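(* Let $\Gamma$ be a countable group and let $G$ be a subgroup of the automorphism group of $\Gamma$ which contains all inner automorphisms of $\Gamma$. Let $\{B_i\}_{i\in I}$ be a family of abelian finite $G$-feet of $\Gamma$ such that $MA^G(\Gamma)=\bigoplus_{i\in I}B_i$ (such a family exists). The following properties are equivalent: (i) $\Gamma$ has a unitary representation which is irreducible and $G$-faithful; (ii) $MA(\Gamma)$ has a $G$-faithful unitary character; (ii') $MA^G(\Gamma)$ has a $G$-faithful unitary character; (iii) $MS(\Gamma)$ has a $G$-faithful irreducible unitary representation; (iii') $MS^G(\Gamma)$ has a $G$-faithful irreducible unitary representation; (iv) for every finite subset $E$ of $I$, there exists an element $x_E$ in $MA^G_E(\Gamma):=\bigoplus_{i\in E}B_i$ such that the $G$-orbit of $x_E$ generates $MA^G_E(\Gamma)$. In particular, a countable group $\Gamma$ has a $G$-faithful irreducible unitary representation as soon as $MA^G(\Gamma)=\{e\}$, a fortiori as soon as $MS^G(\Gamma)=\{e\}$.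
   Context: A foot of $\Gamma$ is a minimal normal subgroup of $\Gamma$ (a normal subgroup $M\ne\{e\}$ such that every normal subgroup of $\Gamma$ contained in $M$ is $M$ or $\{e\}$). $MS(\Gamma)$, respectively $MA(\Gamma)$, is the subgroup of $\Gamma$ generated by the union of all finite feet, respectively all finite abelian feet, of $\Gamma$ (and is $\{e\}$ if there are none). A $G$-foot of $\Gamma$ is a minimal $G$-invariant subgroup of $\Gamma$: a $G$-invariant subgroup $M\ne\{e\}$ such that every $G$-invariant subgroup of $\Gamma$ contained in $M$ is $M$ or $\{e\}$. $MS^G(\Gamma)$, respectively $MA^G(\Gamma)$, is the subgroup of $\Gamma$ generated by the union of all finite $G$-feet, respectively all abelian finite $G$-feet, of $\Gamma$ (and is $\{e\}$ if there are none). Direct sums are internal (restricted) direct sums of subgroups. For a $G$-invariant subgroup $N$ of $\Gamma$ and a unitary representation $\sigma$ of $N$, $\sigma^g$ denotes the representation $n\mapsto\sigma(g(n))$, $g\in G$; $\sigma$ is $G$-faithful if $\bigcap_{g\in G}\ker(\sigma^g)=\{e\}$. *)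

theory Defs
  imports
    "HOL-Analysis.Abstract_Metric_Spaces"
    "HOL-Algebra.Bij"
    "HOL-Algebra.Generated_Groups"
    "HOL-Algebra.Module"
    "HOL-Algebra.Algebraic_Closure_Type"
    "HOL-Library.Countable_Set"
begin

section \<open>Complex Hilbert spaces and unitary representations\<close>

text \<open>
  Hilbert spaces are records with an explicit carrier, so that one can quantify over all Hilbert
  spaces whose carrier is a set of elements of a given type. The complex field acts through its
  type-class ring record. The inner product is linear in its first argument.
\<close>

record 'h hilbert = "(complex, 'h) module" +
  cinner :: "'h \<Rightarrow> 'h \<Rightarrow> complex"

text \<open>
  The distance is set to zero off the carrier because the library's locale for metric spaces
  requires symmetry and nonnegativity on the whole type.
\<close>

definition hdist :: "('h, 'b) hilbert_scheme \<Rightarrow> 'h \<Rightarrow> 'h \<Rightarrow> real"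
  where "hdist H x y =
    (if x \<in> carrier H \<and> y \<in> carrier H
     then sqrt (Re (cinner H (x \<ominus>\<^bsub>H\<^esub> y) (x \<ominus>\<^bsub>H\<^esub> y))) else 0)"

locale complex_inner_product_space =
  module "ring_of_type_algebra :: complex ring" H
  for H :: "('h, 'b) hilbert_scheme" (structure) +
  assumes cinner_add_left:
      "\<lbrakk>x \<in> carrier H; y \<in> carrier H; z \<in> carrier H\<rbrakk>
        \<Longrightarrow> cinner H (x \<oplus>\<^bsub>H\<^esub> y) z = cinner H x z + cinner H y z"
    and cinner_smult_left:
      "\<lbrakk>x \<in> carrier H; y \<in> carrier H\<rbrakk> \<Longrightarrow> cinner H (c \<odot>\<^bsub>H\<^esub> x) y = c * cinner H x y"
    and cinner_commute:
      "\<lbrakk>x \<in> carrier H; y \<in> carrier H\<rbrakk> \<Longrightarrow> cinner H y x = cnj (cinner H x y)"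
    and cinner_pos:
      "\<lbrakk>x \<in> carrier H; x \<noteq> \<zero>\<^bsub>H\<^esub>\<rbrakk> \<Longrightarrow> 0 < Re (cinner H x x)"

locale complex_hilbert_space = complex_inner_product_space +
  assumes complete: "Metric_space.mcomplete (carrier H) (hdist H)"

definition unitaries :: "('h, 'b) hilbert_scheme \<Rightarrow> ('h \<Rightarrow> 'h) set"
  where "unitaries H =
    {U \<in> Bij (carrier H).
      (\<forall>x\<in>carrier H. \<forall>y\<in>carrier H. U (x \<oplus>\<^bsub>H\<^esub> y) = U x \<oplus>\<^bsub>H\<^esub> U y) \<and>
      (\<forall>c. \<forall>x\<in>carrier H. U (c \<odot>\<^bsub>H\<^esub> x) = c \<odot>\<^bsub>H\<^esub> U x) \<and>
      (\<forall>x\<in>carrier H. \<forall>y\<in>carrier H. cinner H (U x) (U y) = cinner H x y)}"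

definition unitary_group :: "('h, 'b) hilbert_scheme \<Rightarrow> ('h \<Rightarrow> 'h) monoid"
  where "unitary_group H = BijGroup (carrier H) \<lparr>carrier := unitaries H\<rparr>"

definition unitary_rep ::
    "('a, 'c) monoid_scheme \<Rightarrow> ('h, 'b) hilbert_scheme \<Rightarrow> ('a \<Rightarrow> 'h \<Rightarrow> 'h) \<Rightarrow> bool"
  where "unitary_rep K H \<sigma> \<longleftrightarrow> complex_hilbert_space H \<and> \<sigma> \<in> hom K (unitary_group H)"

definition irreducible_unitary_rep ::
    "('a, 'c) monoid_scheme \<Rightarrow> ('h, 'b) hilbert_scheme \<Rightarrow> ('a \<Rightarrow> 'h \<Rightarrow> 'h) \<Rightarrow> bool"
  where "irreducible_unitary_rep K H \<sigma> \<longleftrightarrow>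
    unitary_rep K H \<sigma> \<and> carrier H \<noteq> {\<zero>\<^bsub>H\<^esub>} \<and>
    (\<forall>W. submodule W (ring_of_type_algebra :: complex ring) H \<and>
         closedin (Metric_space.mtopology (carrier H) (hdist H)) W \<and>
         (\<forall>k\<in>carrier K. \<sigma> k ` W \<subseteq> W)
       \<longrightarrow> W = {\<zero>\<^bsub>H\<^esub>} \<or> W = carrier H)"

definition circle_group :: "complex monoid"
  where "circle_group = \<lparr>carrier = {z. cmod z = 1}, monoid.mult = (*), one = 1\<rparr>"

definition unitary_character :: "('a, 'c) monoid_scheme \<Rightarrow> ('a \<Rightarrow> complex) \<Rightarrow> bool"
  where "unitary_character K \<phi> \<longleftrightarrow> \<phi> \<in> hom K circle_group"

text \<open>
  \<open>L\<close> is the target of the representation \<open>\<sigma>\<close> of \<open>K\<close>: a unitary group or the circle group.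
\<close>

definition G_faithful ::
    "('a \<Rightarrow> 'a) set \<Rightarrow> ('a, 'c) monoid_scheme \<Rightarrow> ('u, 'd) monoid_scheme \<Rightarrow> ('a \<Rightarrow> 'u) \<Rightarrow> bool"
  where "G_faithful G K L \<sigma> \<longleftrightarrow> (\<Inter>g\<in>G. kernel K L (\<lambda>n. \<sigma> (g n))) = {\<one>\<^bsub>K\<^esub>}"

definition has_G_faithful_irrep ::
    "'h itself \<Rightarrow> ('a \<Rightarrow> 'a) set \<Rightarrow> ('a, 'c) monoid_scheme \<Rightarrow> bool"
  where "has_G_faithful_irrep _ G K \<longleftrightarrow>
    (\<exists>(H :: 'h hilbert) \<sigma>. irreducible_unitary_rep K H \<sigma> \<and> G_faithful G K (unitary_group H) \<sigma>)"

definition has_G_faithful_character ::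
    "('a \<Rightarrow> 'a) set \<Rightarrow> ('a, 'c) monoid_scheme \<Rightarrow> bool"
  where "has_G_faithful_character G K \<longleftrightarrow>
    (\<exists>\<phi>. unitary_character K \<phi> \<and> G_faithful G K circle_group \<phi>)"


section \<open>Feet and the subgroups they generate\<close>

definition inner_automorphisms :: "('a, 'c) monoid_scheme \<Rightarrow> ('a \<Rightarrow> 'a) set"
  where "inner_automorphisms \<Gamma> =
    (\<lambda>a. \<lambda>x\<in>carrier \<Gamma>. a \<otimes>\<^bsub>\<Gamma>\<^esub> x \<otimes>\<^bsub>\<Gamma>\<^esub> inv\<^bsub>\<Gamma>\<^esub> a) ` carrier \<Gamma>"

definition foot :: "('a, 'c) monoid_scheme \<Rightarrow> 'a set \<Rightarrow> bool"
  where "foot \<Gamma> M \<longleftrightarrow> M \<lhd> \<Gamma> \<and> M \<noteq> {\<one>\<^bsub>\<Gamma>\<^esub>} \<and>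
    (\<forall>N. N \<lhd> \<Gamma> \<and> N \<subseteq> M \<longrightarrow> N = M \<or> N = {\<one>\<^bsub>\<Gamma>\<^esub>})"

definition G_invariant_subgroup :: "('a, 'c) monoid_scheme \<Rightarrow> ('a \<Rightarrow> 'a) set \<Rightarrow> 'a set \<Rightarrow> bool"
  where "G_invariant_subgroup \<Gamma> G M \<longleftrightarrow> subgroup M \<Gamma> \<and> (\<forall>g\<in>G. g ` M = M)"

definition G_foot :: "('a, 'c) monoid_scheme \<Rightarrow> ('a \<Rightarrow> 'a) set \<Rightarrow> 'a set \<Rightarrow> bool"
  where "G_foot \<Gamma> G M \<longleftrightarrow> G_invariant_subgroup \<Gamma> G M \<and> M \<noteq> {\<one>\<^bsub>\<Gamma>\<^esub>} \<and>
    (\<forall>N. G_invariant_subgroup \<Gamma> G N \<and> N \<subseteq> M \<longrightarrow> N = M \<or> N = {\<one>\<^bsub>\<Gamma>\<^esub>})"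

definition abelian_finite_G_foot :: "('a, 'c) monoid_scheme \<Rightarrow> ('a \<Rightarrow> 'a) set \<Rightarrow> 'a set \<Rightarrow> bool"
  where "abelian_finite_G_foot \<Gamma> G M \<longleftrightarrow>
    G_foot \<Gamma> G M \<and> finite M \<and> comm_group (\<Gamma>\<lparr>carrier := M\<rparr>)"

definition MS :: "('a, 'c) monoid_scheme \<Rightarrow> 'a set"
  where "MS \<Gamma> = generate \<Gamma> (\<Union>{M. foot \<Gamma> M \<and> finite M})"

definition MA :: "('a, 'c) monoid_scheme \<Rightarrow> 'a set"
  where "MA \<Gamma> = generate \<Gamma> (\<Union>{M. foot \<Gamma> M \<and> finite M \<and> comm_group (\<Gamma>\<lparr>carrier := M\<rparr>)})"

definition MSG :: "('a, 'c) monoid_scheme \<Rightarrow> ('a \<Rightarrow> 'a) set \<Rightarrow> 'a set"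
  where "MSG \<Gamma> G = generate \<Gamma> (\<Union>{M. G_foot \<Gamma> G M \<and> finite M})"

definition MAG :: "('a, 'c) monoid_scheme \<Rightarrow> ('a \<Rightarrow> 'a) set \<Rightarrow> 'a set"
  where "MAG \<Gamma> G = generate \<Gamma> (\<Union>{M. abelian_finite_G_foot \<Gamma> G M})"

text \<open>
  \<open>N\<close> is the internal restricted direct sum of the family \<open>(B i)\<^sub>i\<^sub>\<in>\<^sub>I\<close> of subgroups of \<open>\<Gamma>\<close>.
\<close>

definition internal_direct_sum ::
    "('a, 'c) monoid_scheme \<Rightarrow> 'i set \<Rightarrow> ('i \<Rightarrow> 'a set) \<Rightarrow> 'a set \<Rightarrow> bool"
  where "internal_direct_sum \<Gamma> I B N \<longleftrightarrow>
    (\<forall>i\<in>I. subgroup (B i) \<Gamma>) \<and>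
    (\<forall>i\<in>I. \<forall>j\<in>I. i \<noteq> j \<longrightarrow> (\<forall>x\<in>B i. \<forall>y\<in>B j. x \<otimes>\<^bsub>\<Gamma>\<^esub> y = y \<otimes>\<^bsub>\<Gamma>\<^esub> x)) \<and>
    (\<forall>i\<in>I. B i \<inter> generate \<Gamma> (\<Union>j\<in>I - {i}. B j) = {\<one>\<^bsub>\<Gamma>\<^esub>}) \<and>
    N = generate \<Gamma> (\<Union>i\<in>I. B i)"

definition MAG_decomposition ::
    "('a, 'c) monoid_scheme \<Rightarrow> ('a \<Rightarrow> 'a) set \<Rightarrow> 'i set \<Rightarrow> ('i \<Rightarrow> 'a set) \<Rightarrow> bool"
  where "MAG_decomposition \<Gamma> G I B \<longleftrightarrow>
    (\<forall>i\<in>I. abelian_finite_G_foot \<Gamma> G (B i)) \<and> internal_direct_sum \<Gamma> I B (MAG \<Gamma> G)"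

text \<open>
  Given a decomposition as above, this is the direct sum of the \<open>B i\<close> with \<open>i\<close> in \<open>E \<subseteq> I\<close>.
\<close>

definition MAG_part :: "('a, 'c) monoid_scheme \<Rightarrow> ('i \<Rightarrow> 'a set) \<Rightarrow> 'i set \<Rightarrow> 'a set"
  where "MAG_part \<Gamma> B E = generate \<Gamma> (\<Union>i\<in>E. B i)"

end

theory Submission
  imports Defs "HOL-Analysis.Function_Topology" "HOL-Algebra.Zassenhaus"
begin

text \<open>
  An irreducible representation comes from a pure state, that is, an extreme point of the compact
  convex set of limits of vector states of a given positive definite function \<open>\<phi>\<close>. Slices of this
  set contain vector states, so a Baire category argument on shrinking slices produces a pure state
  that is nontrivial on each of countably many subgroups \<open>M\<close>, provided that elements of \<open>M\<close> average
  all vectors of \<open>\<phi>\<close> to almost zero. Applying this to the subgroups generated by \<open>G\<close>-orbits or to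
  finite feet inside them gives \<open>G\<close>-faithfulness.

  A faithful representation restricts to \<open>MA\<^sup>G\<close> with no invariant vectors under any nontrivial
  \<open>G\<close>-invariant subgroup; a pure state subordinate to one of its matrix coefficients is a
  \<open>G\<close>-faithful character. Conversely, a \<open>G\<close>-faithful character of \<open>MA\<^sup>G\<close> extends to the abelian
  subgroup generated by \<open>MA\<^sup>G\<close> and one element \<open>\<noteq> 1\<close> of each nonabelian finite \<open>G\<close>-foot, with
  values \<open>\<noteq> 1\<close> at these elements; extended by \<open>0\<close> it becomes the function \<open>\<phi>\<close> above. Since \<open>MA\<^sup>G\<close> is
  the same for \<open>\<Gamma>\<close>, \<open>MA\<close>, \<open>MS\<close> and \<open>MS\<^sup>G\<close>, this settles everything but (iv).

  For (iv), add one foot \<open>B\<close> to a finite partial sum \<open>S\<close>. Given a generator \<open>x\<close> of \<open>S\<close>, the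
  \<open>b \<in> B\<close> for which \<open>x b\<close> does not generate \<open>S \<oplus> B\<close> correspond to equivariant homomorphisms
  \<open>S \<rightarrow> B\<close>; given a faithful character of \<open>S\<close>, the characters of \<open>B\<close> that give an unfaithful
  product correspond to equivariant homomorphisms \<open>B \<rightarrow> S\<close>. Both kinds of homomorphisms are equally
  many, and so are elements and characters of \<open>B\<close>, hence both extensions exist simultaneously.
\<close>

subsection \<open>Positive definite functions\<close>

text \<open>One irreducible representation has to escape countably many kernels at once, while the
  representations at hand (induced, or restricted to a subgroup) are reducible and have irreducible
  pieces only in the sense of direct integrals. Density replaces integration. Not being constantly 1
  on \<open>M\<close> is an open condition on states, but it must be reachable inside every slice,
  because pure states do not form a closed set and cannot be prescribed directly. Every slice
  contains some vector state \<open>sandwich \<phi>0 a\<close>, and therefore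
  \<open>dispersed\<close> quantifies over all \<open>a\<close> and bounds the average relative to
  \<open>form \<phi>0 a a\<close>. The existence theorem for pure states is then used in three ways:
  a pure state has an irreducible GNS representation, on an abelian group it is a character, and
  started from an induced character it extends that character.

  The second obstacle is that "different from 1" is not a closed condition, so compactness does not
  apply to it at first sight. On finite subgroups the values of characters are roots of unity, and
  there the condition becomes closed.\<close>

text \<open>A list of pairs encodes the element \<open>\<Sum> c x\<close> of the complex group algebra; \<open>lf a\<close> extends a
  function on the group linearly to it.\<close>


lemma quadratic_bound:
  fixes A B s :: real
  assumes "\<And>t. 0 \<le> A - 2 * t * s + t\<^sup>2 * s * B" "0 \<le> s" "0 \<le> B"
  shows "s \<le> A * B"
proof (cases "s = 0")
  case True
  then show ?thesis using assms(1)[of 0] assms(3) by simp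
next
  case False
  then have s: "s > 0" using assms by simp
  have "B \<noteq> 0"
  proof
    assume "B = 0"
    \<comment> \<open>With \<open>B = 0\<close> the polynomial is affine in \<open>t\<close>; at
      this \<open>t\<close> it equals \<open>- A - 2\<close>, whereas \<open>t = 0\<close> gives
      \<open>0 \<le> A\<close>.\<close>
    then show False using assms(1)[of "(A + 1) / s"] assms(1)[of 0] s by (simp add: field_simps)
  qed
  then have B: "B > 0" using assms by simp
  \<comment> \<open>\<open>t = 1 / B\<close> minimizes the polynomial.\<close>
  have "0 \<le> A - s / B"
    using assms(1)[of "1 / B"] B by (simp add: field_simps power2_eq_square)
  then show ?thesis using B by (simp add: field_simps)
qed

definition lf :: "(complex \<times> 'a) list \<Rightarrow> ('a \<Rightarrow> complex) \<Rightarrow> complex"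
  where "lf a f = (\<Sum>p\<leftarrow>a. fst p * f (snd p))"

definition lscale :: "complex \<Rightarrow> (complex \<times> 'a) list \<Rightarrow> (complex \<times> 'a) list"
  where "lscale c a = map (\<lambda>p. (c * fst p, snd p)) a"

lemma cnj_sum_list: "cnj (sum_list xs) = (\<Sum>x\<leftarrow>xs. cnj x)"
  by (induction xs) auto

lemma sum_list_swap':
  fixes f :: "'x \<Rightarrow> 'y \<Rightarrow> 'z::comm_monoid_add"
  shows "(\<Sum>x\<leftarrow>xs. \<Sum>y\<leftarrow>ys. f x y) = (\<Sum>y\<leftarrow>ys. \<Sum>x\<leftarrow>xs. f x y)"
  by (induction xs) (auto simp: sum_list_addf)

lemma lf_Nil [simp]: "lf [] f = 0"
  by (simp add: lf_def)

lemma lf_Cons [simp]: "lf (p # a) f = fst p * f (snd p) + lf a f"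
  by (simp add: lf_def)

lemma lf_append [simp]: "lf (a @ b) f = lf a f + lf b f"
  by (simp add: lf_def)

lemma lf_scale [simp]: "lf (lscale c a) f = c * lf a f"
  by (induction a) (auto simp: lf_def lscale_def algebra_simps)

lemma lf_add: "lf a (\<lambda>x. f x + g x) = lf a f + lf a g"
  by (induction a) (auto simp: algebra_simps)

lemma lf_cmult: "lf a (\<lambda>x. k * f x) = k * lf a f"
  by (induction a) (auto simp: algebra_simps)

lemma lf_concat: "lf (concat (map F xs)) f = (\<Sum>x\<leftarrow>xs. lf (F x) f)"
  by (induction xs) auto

lemma continuous_lf: "continuous_on S (\<lambda>f. lf a f)"
proof (induction a)
  case (Cons p a)
  have "continuous_on S (\<lambda>f. f (snd p))"
    by (rule continuous_on_subset[OF continuous_on_product_coordinates]) simp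
  with Cons show ?case by (auto intro!: continuous_intros)
qed simp

context group
begin

definition combs :: "(complex \<times> 'a) list set"
  where "combs = {a. snd ` set a \<subseteq> carrier G}"

definition shift :: "'a \<Rightarrow> (complex \<times> 'a) list \<Rightarrow> (complex \<times> 'a) list"
  where "shift x a = map (\<lambda>p. (fst p, x \<otimes> snd p)) a"

text \<open>In the group algebra this is the value of \<open>\<phi>\<close> at the product of the
  adjoint of \<open>b\<close> with \<open>a\<close>: the GNS inner product, conjugate linear in
  \<open>b\<close> as \<open>cinner\<close> is in its second argument.\<close>

definition form :: "('a \<Rightarrow> complex) \<Rightarrow> (complex \<times> 'a) list \<Rightarrow> (complex \<times> 'a) list \<Rightarrow> complex"
  where "form \<phi> a b =
    (\<Sum>p\<leftarrow>a. \<Sum>q\<leftarrow>b. fst p * cnj (fst q) * \<phi> (inv (snd q) \<otimes> snd p))"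

text \<open>The matrix coefficient of the vector \<open>a\<close> in the GNS representation of
  \<open>\<phi>\<close>, not normalized. The value 0 off the carrier makes such functions comparable
  on the whole type.\<close>

definition sandwich :: "('a \<Rightarrow> complex) \<Rightarrow> (complex \<times> 'a) list \<Rightarrow> 'a \<Rightarrow> complex"
  where "sandwich \<phi> a x = (if x \<in> carrier G then form \<phi> (shift x a) a else 0)"

text \<open>The product \<open>b a\<close> of the group algebra.\<close>

definition conv :: "(complex \<times> 'a) list \<Rightarrow> (complex \<times> 'a) list \<Rightarrow> (complex \<times> 'a) list"
  where "conv b a = concat (map (\<lambda>p. lscale (fst p) (shift (snd p) a)) b)"

text \<open>The group algebra element whose pairing with \<open>\<phi>\<close> is
  \<open>form \<phi> a b\<close>. It turns an expression quadratic in vectors into a linear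
  functional of the state, which is what cones and slices are tested with.\<close>

definition form_list :: "(complex \<times> 'a) list \<Rightarrow> (complex \<times> 'a) list \<Rightarrow> (complex \<times> 'a) list"
  where "form_list a b =
    concat (map (\<lambda>p. map (\<lambda>q. (fst p * cnj (fst q), inv (snd q) \<otimes> snd p)) b) a)"

text \<open>Transpose of the map \<open>\<phi> \<mapsto> sandwich \<phi> a\<close>: the two-sided
  multiplication by \<open>a\<close> is moved from the state to the functional.\<close>

definition sandwich_list :: "(complex \<times> 'a) list \<Rightarrow> (complex \<times> 'a) list \<Rightarrow> (complex \<times> 'a) list"
  where "sandwich_list a l =
    concat (map (\<lambda>p. lscale (fst p) (form_list (shift (snd p) a) a)) l)"

definition posdef :: "('a \<Rightarrow> complex) \<Rightarrow> bool"
  where "posdef \<phi> \<longleftrightarrow> (\<forall>x. x \<notin> carrier G \<longrightarrow> \<phi> x = 0) \<and>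
    (\<forall>a\<in>combs. Im (form \<phi> a a) = 0 \<and> 0 \<le> Re (form \<phi> a a))"

lemma combs_simps [simp]:
  "[] \<in> combs"
  "p # a \<in> combs \<longleftrightarrow> snd p \<in> carrier G \<and> a \<in> combs"
  "a @ b \<in> combs \<longleftrightarrow> a \<in> combs \<and> b \<in> combs"
  "lscale c a \<in> combs \<longleftrightarrow> a \<in> combs"
  by (auto simp: combs_def lscale_def image_image)

lemma combsD: "a \<in> combs \<Longrightarrow> p \<in> set a \<Longrightarrow> snd p \<in> carrier G"
  by (auto simp: combs_def)

lemma shift_combs [simp]: "x \<in> carrier G \<Longrightarrow> a \<in> combs \<Longrightarrow> shift x a \<in> combs"
  by (auto simp: combs_def shift_def)

lemma shift_simps [simp]:
  "shift x [] = []" "shift x (p # a) = (fst p, x \<otimes> snd p) # shift x a"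
  "shift x (a @ b) = shift x a @ shift x b"
  "shift x (lscale c a) = lscale c (shift x a)"
  by (auto simp: shift_def lscale_def)

lemma shift_shift:
  "x \<in> carrier G \<Longrightarrow> y \<in> carrier G \<Longrightarrow> a \<in> combs \<Longrightarrow> shift x (shift y a) = shift (x \<otimes> y) a"
  by (induction a) (auto simp: m_assoc)

lemma shift_one: "a \<in> combs \<Longrightarrow> shift \<one> a = a"
  by (induction a) auto

lemma form_Nil [simp]: "form \<phi> [] b = 0" "form \<phi> a [] = 0"
  by (auto simp: form_def)

lemma form_append_left [simp]: "form \<phi> (a @ a') b = form \<phi> a b + form \<phi> a' b"
  by (simp add: form_def)

lemma form_append_right [simp]: "form \<phi> a (b @ b') = form \<phi> a b + form \<phi> a b'"
  by (simp add: form_def sum_list_addf)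

lemma form_scale_left [simp]: "form \<phi> (lscale c a) b = c * form \<phi> a b"
  by (simp add: form_def lscale_def o_def sum_list_const_mult mult.assoc)

lemma form_scale_right [simp]: "form \<phi> a (lscale c b) = cnj c * form \<phi> a b"
  unfolding form_def lscale_def o_def map_map sum_list_const_mult[symmetric]
  by (simp add: mult_ac)

lemma form_singleton:
  "form \<phi> [(c, x)] [(d, y)] = c * cnj d * \<phi> (inv y \<otimes> x)"
  by (simp add: form_def)

lemma form_shift:
  assumes "x \<in> carrier G" "a \<in> combs" "b \<in> combs"
  shows "form \<phi> (shift x a) (shift x b) = form \<phi> a b"
proof -
  have "inv (x \<otimes> z) \<otimes> (x \<otimes> y) = inv z \<otimes> y" if "y \<in> carrier G" "z \<in> carrier G" for y z
    using that assms(1) by (simp add: inv_mult_group m_assoc) (simp add: m_assoc[symmetric])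
  then show ?thesis using assms combsD
    unfolding form_def shift_def by (auto simp: o_def intro!: arg_cong[where f=sum_list] map_cong)
qed

lemma form_shift_left:
  assumes "x \<in> carrier G" "a \<in> combs" "b \<in> combs"
  shows "form \<phi> (shift x a) b = form \<phi> a (shift (inv x) b)"
  using form_shift[of "inv x" "shift x a" b \<phi>] assms by (simp add: shift_shift shift_one)

lemma lf_form_list: "lf (form_list a b) \<phi> = form \<phi> a b"
  unfolding form_list_def lf_concat form_def
  by (simp add: lf_def o_def)

lemma form_list_combs [simp]: "a \<in> combs \<Longrightarrow> b \<in> combs \<Longrightarrow> form_list a b \<in> combs"
  by (auto simp: combs_def form_list_def image_subset_iff)

lemma lf_sandwich_list:
  assumes "l \<in> combs"
  shows "lf (sandwich_list a l) \<phi> = lf l (sandwich \<phi> a)"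
proof -
  have "lf (sandwich_list a l) \<phi> = (\<Sum>p\<leftarrow>l. fst p * form \<phi> (shift (snd p) a) a)"
    by (simp add: sandwich_list_def lf_concat lf_form_list)
  also have "\<dots> = lf l (sandwich \<phi> a)"
    using assms by (auto simp: lf_def sandwich_def combs_def intro!: arg_cong[where f=sum_list] map_cong)
  finally show ?thesis .
qed

lemma sandwich_list_combs [simp]: "a \<in> combs \<Longrightarrow> l \<in> combs \<Longrightarrow> sandwich_list a l \<in> combs"
  unfolding sandwich_list_def by (induction l) auto

lemma conv_simps [simp]:
  "conv [] a = []" "conv (p # b) a = lscale (fst p) (shift (snd p) a) @ conv b a"
  by (auto simp: conv_def)

lemma conv_combs [simp]: "a \<in> combs \<Longrightarrow> b \<in> combs \<Longrightarrow> conv b a \<in> combs"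
  by (induction b) auto

lemma shift_conv:
  "x \<in> carrier G \<Longrightarrow> a \<in> combs \<Longrightarrow> b \<in> combs \<Longrightarrow> shift x (conv b a) = conv (shift x b) a"
  by (induction b) (auto simp: shift_shift)

text \<open>The vector \<open>b\<close> for the state of \<open>a\<close> corresponds to the vector
  \<open>b a\<close> for \<open>\<phi>\<close>, so the GNS space of a vector state embeds
  isometrically into that of \<open>\<phi>\<close>.\<close>

lemma form_sandwich:
  assumes "a \<in> combs" "b \<in> combs" "b' \<in> combs"
  shows "form (sandwich \<phi> a) b b' = form \<phi> (conv b a) (conv b' a)"
proof -
  have r: "form \<phi> c (conv b' a) = (\<Sum>q\<leftarrow>b'. cnj (fst q) * form \<phi> c (shift (snd q) a))"
    if "b' \<in> combs" for c b'
    using that by (induction b') auto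
  have l: "form \<phi> (conv b a) c = (\<Sum>p\<leftarrow>b. fst p * form \<phi> (shift (snd p) a) c)"
    if "b \<in> combs" for c b
    using that by (induction b) auto
  have e: "sandwich \<phi> a (inv z \<otimes> y) = form \<phi> (shift y a) (shift z a)"
    if "y \<in> carrier G" "z \<in> carrier G" for y z
  proof -
    have "form \<phi> (shift y a) (shift z a) = form \<phi> (shift z (shift (inv z \<otimes> y) a)) (shift z a)"
      using that assms by (simp add: shift_shift m_assoc[symmetric])
    then show ?thesis using that assms by (simp add: sandwich_def form_shift)
  qed
  show ?thesis
    unfolding l[OF assms(2)]
    unfolding r[OF assms(3)] form_def[of "sandwich \<phi> a"] sum_list_const_mult[symmetric]
    using assms combsD e by (auto simp: mult.assoc intro!: arg_cong[where f=sum_list] map_cong)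
qed

lemma sandwich_sandwich:
  assumes "a \<in> combs" "b \<in> combs"
  shows "sandwich (sandwich \<phi> a) b = sandwich \<phi> (conv b a)"
  using assms by (auto simp: fun_eq_iff sandwich_def form_sandwich shift_conv)

lemma sandwich_at_one: "a \<in> combs \<Longrightarrow> sandwich \<phi> a \<one> = form \<phi> a a"
  by (simp add: sandwich_def shift_one)

lemma sandwich_unit:
  assumes "\<And>x. x \<notin> carrier G \<Longrightarrow> \<phi> x = 0"
  shows "sandwich \<phi> [(1, \<one>)] = \<phi>"
  using assms by (auto simp: sandwich_def fun_eq_iff form_singleton)

lemma form_cmult_fun: "form (\<lambda>x. k * \<phi> x) a b = k * form \<phi> a b"
  by (simp add: lf_form_list[symmetric] lf_cmult)

context
  fixes \<phi> assumes pd: "posdef \<phi>"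
begin

lemma posdef_off: "x \<notin> carrier G \<Longrightarrow> \<phi> x = 0"
  using pd by (auto simp: posdef_def)

lemma posdef_form: "a \<in> combs \<Longrightarrow> 0 \<le> Re (form \<phi> a a)" "a \<in> combs \<Longrightarrow> Im (form \<phi> a a) = 0"
  using pd by (auto simp: posdef_def)

lemma posdef_one: "Im (\<phi> \<one>) = 0" "0 \<le> Re (\<phi> \<one>)"
  using posdef_form[of "[(1, \<one>)]"] by (auto simp: form_singleton)

text \<open>Polarization: the form is real at \<open>1 + x\<close>, which compares the imaginary
  parts, and at \<open>1 + \<i> x\<close>, which compares the real parts.\<close>

lemma posdef_cnj:
  assumes "x \<in> carrier G" shows "\<phi> (inv x) = cnj (\<phi> x)"
proof -
  have "Im (\<phi> \<one> + \<phi> x + (\<phi> (inv x) + \<phi> \<one>)) = 0"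
    using posdef_form(2)[of "[(1, \<one>), (1, x)]"] assms by (simp add: form_def algebra_simps)
  moreover have "Im (\<phi> \<one> + \<i> * \<phi> x + (- \<i> * \<phi> (inv x) + \<phi> \<one>)) = 0"
    using posdef_form(2)[of "[(1, \<one>), (\<i>, x)]"] assms by (simp add: form_def algebra_simps)
  ultimately show ?thesis using posdef_one
    by (auto simp: complex_eq_iff)
qed

lemma form_cnj:
  assumes "a \<in> combs" "b \<in> combs"
  shows "form \<phi> b a = cnj (form \<phi> a b)"
proof -
  have "cnj (\<phi> (inv z \<otimes> y)) = \<phi> (inv y \<otimes> z)" if "y \<in> carrier G" "z \<in> carrier G" for y z
    using posdef_cnj[of "inv z \<otimes> y"] that by (simp add: inv_mult_group)
  then show ?thesis using assms combsD
    unfolding form_def sum_list_swap'[of _ b a] cnj_sum_list map_map o_def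
    by (auto simp: mult_ac cnj_sum_list o_def intro!: arg_cong[where f=sum_list] map_cong)
qed

lemma form_CS:
  assumes "a \<in> combs" "b \<in> combs"
  shows "(cmod (form \<phi> a b))\<^sup>2 \<le> Re (form \<phi> a a) * Re (form \<phi> b b)"
proof (rule quadratic_bound)
  fix t :: real
  \<comment> \<open>With this phase, positivity at \<open>a + c b\<close> becomes a real polynomial
    in \<open>t\<close> of the shape treated by \<open>quadratic_bound\<close>, which also covers
    the case that \<open>b\<close> has norm 0.\<close>
  define c where "c = - of_real t * form \<phi> a b"
  have "0 \<le> Re (form \<phi> (a @ lscale c b) (a @ lscale c b))"
    by (rule posdef_form(1)) (use assms in auto)
  also have "\<dots> = Re (form \<phi> a a) + 2 * Re (cnj c * form \<phi> a b) + Re (c * cnj c * form \<phi> b b)"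
    using form_cnj[OF assms] by (simp add: algebra_simps)
  also have "Re (cnj c * form \<phi> a b) = - t * (cmod (form \<phi> a b))\<^sup>2"
    by (simp add: c_def cmod_power2) (simp add: power2_eq_square algebra_simps)
  also have "c * cnj c * form \<phi> b b = of_real (t\<^sup>2 * (cmod (form \<phi> a b))\<^sup>2) * form \<phi> b b"
    using complex_norm_square[of "form \<phi> a b"]
    by (simp add: c_def power2_eq_square algebra_simps)
  finally show "0 \<le> Re (form \<phi> a a) - 2 * t * (cmod (form \<phi> a b))\<^sup>2 + t\<^sup>2 * (cmod (form \<phi> a b))\<^sup>2 * Re (form \<phi> b b)"
    by simp
qed (use posdef_form assms in auto)

text \<open>Cauchy-Schwarz for two translates of one vector, which have equal norms.\<close>

lemma posdef_bound: "cmod (\<phi> x) \<le> Re (\<phi> \<one>)"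
proof (cases "x \<in> carrier G")
  case True
  then have "(cmod (\<phi> x))\<^sup>2 \<le> (Re (\<phi> \<one>))\<^sup>2"
    using form_CS[of "[(1, x)]" "[(1, \<one>)]"] by (simp add: form_singleton power2_eq_square)
  then show ?thesis using posdef_one(2) by (rule power2_le_imp_le)
qed (use posdef_off posdef_one in auto)

end

subsection \<open>The cone of limits of vector states\<close>

text \<open>By the bipolar theorem this is the closed convex cone spanned by the functions
  \<open>sandwich \<phi>0 a\<close>; testing against functionals makes that theorem unnecessary.\<close>

definition state_cone :: "('a \<Rightarrow> complex) \<Rightarrow> ('a \<Rightarrow> complex) set"
  where "state_cone \<phi>0 = {\<phi>. (\<forall>x. x \<notin> carrier G \<longrightarrow> \<phi> x = 0) \<and>
    (\<forall>l\<in>combs. (\<forall>a\<in>combs. 0 \<le> Re (lf l (sandwich \<phi>0 a))) \<longrightarrow> 0 \<le> Re (lf l \<phi>))}"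

lemma state_coneD:
  "\<phi> \<in> state_cone \<phi>0 \<Longrightarrow> l \<in> combs \<Longrightarrow> (\<And>a. a \<in> combs \<Longrightarrow> 0 \<le> Re (lf l (sandwich \<phi>0 a))) \<Longrightarrow> 0 \<le> Re (lf l \<phi>)"
  by (auto simp: state_cone_def)

lemma state_cone_off: "\<phi> \<in> state_cone \<phi>0 \<Longrightarrow> x \<notin> carrier G \<Longrightarrow> \<phi> x = 0"
  by (auto simp: state_cone_def)

lemma sandwich_in_state_cone: "a \<in> combs \<Longrightarrow> sandwich \<phi>0 a \<in> state_cone \<phi>0"
  by (auto simp: state_cone_def sandwich_def)

lemma state_cone_scale: "\<phi> \<in> state_cone \<phi>0 \<Longrightarrow> 0 \<le> r \<Longrightarrow> (\<lambda>x. of_real r * \<phi> x) \<in> state_cone \<phi>0"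
  by (auto simp: state_cone_def lf_cmult)

text \<open>An equation is the conjunction of the inequalities
  \<open>0 \<le> Re (c * lf l \<phi>)\<close> for \<open>c\<close> equal to 1, -1, \<i> and -\<i>,
  and each of these is an admissible test. In this way identities common to all vector states pass
  to limits.\<close>

lemma state_cone_eq:
  assumes "\<phi> \<in> state_cone \<phi>0" "l \<in> combs" "\<And>a. a \<in> combs \<Longrightarrow> lf l (sandwich \<phi>0 a) = 0"
  shows "lf l \<phi> = 0"
proof -
  have "0 \<le> Re (lf (lscale c l) \<phi>)" for c
    by (rule state_coneD[OF assms(1)]) (use assms in auto)
  then have "0 \<le> Re (c * lf l \<phi>)" for c by simp
  from this[of 1] this[of "-1"] this[of \<i>] this[of "-\<i>"] show ?thesis
    by (simp add: complex_eq_iff)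
qed

text \<open>Vector states of a vector state are again vector states of \<open>\<phi>0\<close>, so
  \<open>sandwich_list b\<close> maps functionals that are nonnegative on all vector states to
  functionals of the same kind.\<close>

lemma sandwich_state_cone:
  assumes "\<phi> \<in> state_cone \<phi>0" "b \<in> combs"
  shows "sandwich \<phi> b \<in> state_cone \<phi>0"
  unfolding state_cone_def
proof (intro CollectI conjI allI impI ballI)
  fix l assume l: "l \<in> combs" "\<forall>a\<in>combs. 0 \<le> Re (lf l (sandwich \<phi>0 a))"
  have "0 \<le> Re (lf (sandwich_list b l) \<phi>)"
    by (rule state_coneD[OF assms(1)]) (use assms l in \<open>auto simp: lf_sandwich_list sandwich_sandwich\<close>)
  then show "0 \<le> Re (lf l (sandwich \<phi> b))" using l by (simp add: lf_sandwich_list)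
qed (auto simp: sandwich_def)

text \<open>\<open>form \<phi> b b\<close> is a linear functional of \<open>\<phi>\<close> which is
  real and nonnegative on vector states. Its multiples by \<i> and -\<i> have real part 0 there, and
  testing with both makes the imaginary part vanish on the cone.\<close>

lemma state_cone_posdef:
  assumes "posdef \<phi>0" "\<phi> \<in> state_cone \<phi>0"
  shows "posdef \<phi>"
  unfolding posdef_def
proof (intro conjI ballI allI impI)
  fix b assume b: "b \<in> combs"
  have f: "form \<psi> b b = lf (sandwich_list b [(1, \<one>)]) \<psi>" for \<psi>
    using b by (simp add: lf_sandwich_list sandwich_at_one)
  have pos: "Im (form (sandwich \<phi>0 a) b b) = 0" "0 \<le> Re (form (sandwich \<phi>0 a) b b)" if "a \<in> combs" for a
    using posdef_form[OF assms(1), of "conv b a"] that b by (auto simp: form_sandwich)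
  show "0 \<le> Re (form \<phi> b b)"
    unfolding f by (rule state_coneD[OF assms(2)]) (use b pos f in auto)
  have "0 \<le> Re (lf (lscale \<i> (sandwich_list b [(1, \<one>)])) \<phi>)"
    by (rule state_coneD[OF assms(2)]) (use b pos f in \<open>auto simp del: lf_Cons lf_append\<close>)
  moreover have "0 \<le> Re (lf (lscale (-\<i>) (sandwich_list b [(1, \<one>)])) \<phi>)"
    by (rule state_coneD[OF assms(2)]) (use b pos f in \<open>auto simp del: lf_Cons lf_append\<close>)
  ultimately show "Im (form \<phi> b b) = 0" by (simp add: f)
qed (use assms state_cone_off in auto)

end

subsection \<open>Existence of pure states\<close>

lemma compact_unit_bounded_functions: "compact {f :: 'a \<Rightarrow> complex. \<forall>x. cmod (f x) \<le> 1}"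
proof -
  have "compactin (product_topology (\<lambda>_. euclidean) UNIV) (PiE UNIV (\<lambda>_::'a. cball (0::complex) 1))"
    by (simp add: compactin_PiE)
  moreover have "PiE UNIV (\<lambda>_::'a. cball (0::complex) 1) = {f. \<forall>x. cmod (f x) \<le> 1}"
    by (auto simp: PiE_def Pi_def)
  ultimately show ?thesis by (simp add: euclidean_product_topology)
qed

lemma closed_nonneg_lf: "closed {f. 0 \<le> Re (lf l f)}"
  by (intro closed_Collect_le continuous_intros continuous_lf)

lemma closed_eval_eq: "closed {f :: 'a \<Rightarrow> complex. f x = c}"
proof -
  have "continuous_on UNIV (\<lambda>f :: 'a \<Rightarrow> complex. f x)"
    by (rule continuous_on_product_coordinates)
  then show ?thesis by (intro closed_Collect_eq continuous_intros)
qed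

lemma lf_bound:
  assumes "\<And>x. cmod (f x) \<le> 1"
  shows "cmod (lf l f) \<le> (\<Sum>p\<leftarrow>l. cmod (fst p))"
proof (induction l)
  case (Cons p l)
  have "cmod (fst p * f (snd p)) \<le> cmod (fst p)"
    using assms[of "snd p"] by (simp add: norm_mult mult_left_le)
  then show ?case using Cons by (simp add: norm_triangle_le)
qed simp

context group
begin

text \<open>Affine combinations of elements of \<open>M\<close> move each vector of the cyclic span of \<open>\<phi>0\<close> arbitrarily
  close to \<open>0\<close>, a quantitative way to exclude vectors fixed by \<open>M\<close>.\<close>

definition dispersed :: "('a \<Rightarrow> complex) \<Rightarrow> 'a set \<Rightarrow> bool"
  where "dispersed \<phi>0 M \<longleftrightarrow> (\<forall>a\<in>combs. \<forall>\<epsilon>>0. \<exists>w\<in>combs. snd ` set w \<subseteq> M \<and> lf w (\<lambda>_. 1) = 1 \<and>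
      Re (form (sandwich \<phi>0 a) w w) \<le> \<epsilon> * Re (form \<phi>0 a a))"

text \<open>Extremality of the ray rather than of the normalized point: summands may be inserted as
  they come, for instance the states of the two components of a cyclic vector.\<close>

definition pure :: "('a \<Rightarrow> complex) \<Rightarrow> ('a \<Rightarrow> complex) \<Rightarrow> bool"
  where "pure \<phi>0 q \<longleftrightarrow> (\<forall>\<phi>1\<in>state_cone \<phi>0. \<forall>\<phi>2\<in>state_cone \<phi>0.
      (\<forall>x. q x = \<phi>1 x + \<phi>2 x) \<longrightarrow> (\<forall>x. \<phi>1 x = \<phi>1 \<one> * q x))"

context
  fixes \<phi>0 assumes pd0: "posdef \<phi>0" and norm0: "\<phi>0 \<one> = 1"
begin

definition states :: "('a \<Rightarrow> complex) set"
  where "states = {\<phi> \<in> state_cone \<phi>0. \<phi> \<one> = 1}"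

lemma phi0_state_cone: "\<phi>0 \<in> state_cone \<phi>0"
  using sandwich_in_state_cone[of "[(1, \<one>)]" \<phi>0] sandwich_unit[OF posdef_off[OF pd0]] by simp

lemma states_bound: "\<phi> \<in> states \<Longrightarrow> cmod (\<phi> x) \<le> 1"
  using posdef_bound[OF state_cone_posdef[OF pd0], of \<phi> x] by (simp add: states_def)

lemma compact_states: "compact states"
proof -
  have c1: "closed {\<phi>. x \<notin> carrier G \<longrightarrow> \<phi> x = (0::complex)}" for x
    by (cases "x \<in> carrier G") (auto intro: closed_eval_eq)
  have c2: "closed {\<phi>. l \<in> combs \<longrightarrow> (\<forall>a\<in>combs. 0 \<le> Re (lf l (sandwich \<phi>0 a))) \<longrightarrow> 0 \<le> Re (lf l \<phi>)}" for l
  proof (cases "l \<in> combs \<and> (\<forall>a\<in>combs. 0 \<le> Re (lf l (sandwich \<phi>0 a)))")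
    case False
    then have "{\<phi>. l \<in> combs \<longrightarrow> (\<forall>a\<in>combs. 0 \<le> Re (lf l (sandwich \<phi>0 a))) \<longrightarrow> 0 \<le> Re (lf l \<phi>)} = UNIV"
      by blast
    then show ?thesis by simp
  qed (auto intro: closed_nonneg_lf)
  have "compact ({f :: 'a \<Rightarrow> complex. \<forall>x. cmod (f x) \<le> 1} \<inter> (((\<Inter>x. {\<phi>. x \<notin> carrier G \<longrightarrow> \<phi> x = (0::complex)}) \<inter>
      (\<Inter>l. {\<phi>. l \<in> combs \<longrightarrow> (\<forall>a\<in>combs. 0 \<le> Re (lf l (sandwich \<phi>0 a))) \<longrightarrow> 0 \<le> Re (lf l \<phi>)})) \<inter>
      {\<phi>. \<phi> \<one> = 1}))"
    by (rule compact_Int_closed[OF compact_unit_bounded_functions], rule closed_Int[OF closed_Int[OF closed_INT closed_INT] closed_eval_eq]; rule ballI)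
      (rule c1, rule c2)
  also have "{f :: 'a \<Rightarrow> complex. \<forall>x. cmod (f x) \<le> 1} \<inter> (((\<Inter>x. {\<phi>. x \<notin> carrier G \<longrightarrow> \<phi> x = (0::complex)}) \<inter>
      (\<Inter>l. {\<phi>. l \<in> combs \<longrightarrow> (\<forall>a\<in>combs. 0 \<le> Re (lf l (sandwich \<phi>0 a))) \<longrightarrow> 0 \<le> Re (lf l \<phi>)})) \<inter>
      {\<phi>. \<phi> \<one> = 1}) = states"
    (is "?B \<inter> (?X \<inter> ?Y \<inter> ?Z) = _")
  proof -
    have "?X \<inter> ?Y \<inter> ?Z = states" unfolding states_def state_cone_def by blast
    then show ?thesis using states_bound by blast
  qed
  finally show ?thesis .
qed

lemma normalize_state:
  assumes "\<phi> \<in> state_cone \<phi>0" "\<phi> \<one> \<noteq> 0"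
  shows "(\<lambda>x. of_real (1 / Re (\<phi> \<one>)) * \<phi> x) \<in> states" "0 < Re (\<phi> \<one>)" "\<phi> \<one> = of_real (Re (\<phi> \<one>))"
proof -
  have p: "Im (\<phi> \<one>) = 0" "0 \<le> Re (\<phi> \<one>)"
    using posdef_one[OF state_cone_posdef[OF pd0 assms(1)]] by auto
  then show *: "\<phi> \<one> = of_real (Re (\<phi> \<one>))" by (simp add: complex_eq_iff)
  then show "0 < Re (\<phi> \<one>)" using p assms(2) by (metis less_eq_real_def of_real_0)
  moreover from this have "of_real (1 / Re (\<phi> \<one>)) * \<phi> \<one> = 1"
    by (subst (2) *) (simp flip: of_real_mult)
  ultimately show "(\<lambda>x. of_real (1 / Re (\<phi> \<one>)) * \<phi> x) \<in> states"
    using state_cone_scale[OF assms(1), of "1 / Re (\<phi> \<one>)"]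
    unfolding states_def by (metis (mono_tags, lifting) mem_Collect_eq less_imp_le zero_less_divide_1_iff)
qed

text \<open>Convexity is used only through slices: every nonempty slice contains a normalized vector
  state (\<open>slice_vector_state\<close>), and slices shrink to a point that is then extreme.\<close>

definition slice :: "(complex \<times> 'a) list \<Rightarrow> real \<Rightarrow> ('a \<Rightarrow> complex) set"
  where "slice l c = {\<phi> \<in> states. c < Re (lf l \<phi>)}"

definition cslice :: "(complex \<times> 'a) list \<Rightarrow> real \<Rightarrow> ('a \<Rightarrow> complex) set"
  where "cslice l c = {\<phi> \<in> states. c \<le> Re (lf l \<phi>)}"

text \<open>Otherwise \<open>Re (lf l (sandwich \<phi>0 a)) \<le> c * Re (form \<phi>0 a a)\<close>
  for every \<open>a\<close>. The right-hand side comes from evaluation at \<open>\<one>\<close>, so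
  this is a linear test; it then holds on the whole cone and the slice is empty.\<close>

lemma slice_vector_state:
  assumes "l \<in> combs" "slice l c \<noteq> {}"
  obtains a where "a \<in> combs" "form \<phi>0 a a \<noteq> 0"
    "(\<lambda>x. of_real (1 / Re (form \<phi>0 a a)) * sandwich \<phi>0 a x) \<in> slice l c"
proof -
  obtain \<phi> where \<phi>: "\<phi> \<in> states" "c < Re (lf l \<phi>)" using assms by (auto simp: slice_def)
  have "\<exists>a\<in>combs. c * Re (form \<phi>0 a a) < Re (lf l (sandwich \<phi>0 a))"
  proof (rule ccontr)
    assume "\<not> ?thesis"
    then have "0 \<le> Re (lf (lscale (-1) l @ [(of_real c, \<one>)]) (sandwich \<phi>0 a))" if "a \<in> combs" for a
      using that by (auto simp: sandwich_at_one not_less)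
    then have "0 \<le> Re (lf (lscale (-1) l @ [(of_real c, \<one>)]) \<phi>)"
      using \<phi> assms(1) by (intro state_coneD[of \<phi> \<phi>0]) (auto simp: states_def simp del: lf_append)
    then show False using \<phi> by (auto simp: states_def)
  qed
  then obtain a where a: "a \<in> combs" "c * Re (form \<phi>0 a a) < Re (lf l (sandwich \<phi>0 a))" by blast
  have s: "sandwich \<phi>0 a \<in> state_cone \<phi>0" using a by (simp add: sandwich_in_state_cone)
  \<comment> \<open>A vector of norm 0 has vector state 0, for which the strict inequality defining
    \<open>a\<close> fails.\<close>
  have nz: "form \<phi>0 a a \<noteq> 0"
  proof
    assume 0: "form \<phi>0 a a = 0"
    then have "cmod (sandwich \<phi>0 a x) \<le> 0" for x
      using posdef_bound[OF state_cone_posdef[OF pd0 s], of x] a by (simp add: sandwich_at_one)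
    then have "sandwich \<phi>0 a = (\<lambda>_. 0)" by auto
    moreover have "lf l (\<lambda>_. 0) = 0" by (induction l) auto
    ultimately show False using a 0 by simp
  qed
  note n = normalize_state[OF s, unfolded sandwich_at_one[OF a(1)], OF nz]
  have "lf l (\<lambda>x. of_real (1 / Re (form \<phi>0 a a)) * sandwich \<phi>0 a x)
      = of_real (1 / Re (form \<phi>0 a a)) * lf l (sandwich \<phi>0 a)" by (rule lf_cmult)
  then have "Re (lf l (\<lambda>x. of_real (1 / Re (form \<phi>0 a a)) * sandwich \<phi>0 a x))
      = Re (lf l (sandwich \<phi>0 a)) / Re (form \<phi>0 a a)" by simp
  then show ?thesis using that[of a] a nz n by (simp add: slice_def pos_less_divide_eq)
qed

text \<open>Replace \<open>l\<close> by \<open>l\<close> minus \<open>lam\<close> times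
  \<open>form w w\<close>, where \<open>w\<close> moves the vector of a state \<open>\<rho>\<close>
  of the slice close to 0. The penalty is small at \<open>\<rho>\<close>. A state that is 1 on
  \<open>M\<close> pays the full \<open>lam\<close>, since its \<open>form w w\<close> is the
  squared modulus of the total weight of \<open>w\<close>, which is 1.\<close>

lemma slice_avoid:
  assumes l: "l \<in> combs" "slice l c \<noteq> {}" and M: "subgroup M G" "dispersed \<phi>0 M"
  obtains l' c' where "l' \<in> combs" "slice l' c' \<noteq> {}" "cslice l' c' \<subseteq> slice l c"
    "\<And>\<psi>. \<psi> \<in> cslice l' c' \<Longrightarrow> \<exists>x\<in>M. \<psi> x \<noteq> 1"
proof -
  obtain a where a: "a \<in> combs" "form \<phi>0 a a \<noteq> 0"
    and sl: "(\<lambda>x. of_real (1 / Re (form \<phi>0 a a)) * sandwich \<phi>0 a x) \<in> slice l c"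
    using slice_vector_state[OF l] by blast
  define \<rho> where "\<rho> = (\<lambda>x. of_real (1 / Re (form \<phi>0 a a)) * sandwich \<phi>0 a x)"
  have \<rho>: "\<rho> \<in> states" "c < Re (lf l \<rho>)" using sl by (auto simp: \<rho>_def slice_def)
  have fpos: "0 < Re (form \<phi>0 a a)"
    using normalize_state(2)[OF sandwich_in_state_cone[OF a(1)]] a by (simp add: sandwich_at_one)
  define m where "m = (\<Sum>p\<leftarrow>l. cmod (fst p))"
  have m: "Re (lf l \<psi>) \<le> m" if "\<psi> \<in> states" for \<psi>
    using lf_bound[of \<psi> l] states_bound[OF that] complex_Re_le_cmod[of "lf l \<psi>"] by (simp add: m_def)
  \<comment> \<open>\<open>m\<close> bounds \<open>l\<close> on all states, so a penalty of this
    size pushes every state down to \<open>c\<close> or below.\<close>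
  define lam where "lam = m - c"
  have lam: "0 < lam" using m[OF \<rho>(1)] \<rho> by (simp add: lam_def)
  define \<delta> where "\<delta> = Re (lf l \<rho>) - c"
  have \<delta>: "0 < \<delta>" using \<rho> by (simp add: \<delta>_def)
  \<comment> \<open>The penalty at \<open>\<rho>\<close> is at most half of \<open>\<delta>\<close>,
    so the new functional exceeds the level \<open>c + \<delta> / 4\<close> there.\<close>
  obtain w where w: "w \<in> combs" "snd ` set w \<subseteq> M" "lf w (\<lambda>_. 1) = 1"
    "Re (form (sandwich \<phi>0 a) w w) \<le> (\<delta> / (2 * lam)) * Re (form \<phi>0 a a)"
    using M(2) a(1) \<delta> lam unfolding dispersed_def by (metis divide_pos_pos mult_pos_pos zero_less_numeral)
  define l' where "l' = l @ lscale (of_real (- lam)) (form_list w w)"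
  have l': "Re (lf l' \<psi>) = Re (lf l \<psi>) - lam * Re (form \<psi> w w)" for \<psi>
    by (simp add: l'_def lf_form_list)
  have "Re (form \<rho> w w) = Re (form (sandwich \<phi>0 a) w w) / Re (form \<phi>0 a a)"
    unfolding \<rho>_def form_cmult_fun by simp
  then have "Re (form \<rho> w w) \<le> \<delta> / (2 * lam)"
    using w(4) fpos by (simp add: pos_divide_le_eq)
  then have "lam * Re (form \<rho> w w) \<le> \<delta> / 2" using lam by (simp add: field_simps)
  then have in': "\<rho> \<in> slice l' (c + \<delta> / 4)"
    using \<rho> \<delta> by (simp add: slice_def l') (simp add: \<delta>_def field_simps)
  have sub: "\<psi> \<in> slice l c" "\<exists>x\<in>M. \<psi> x \<noteq> 1" if "\<psi> \<in> cslice l' (c + \<delta> / 4)" for \<psi>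
  proof -
    have \<psi>: "\<psi> \<in> states" "c + \<delta> / 4 \<le> Re (lf l \<psi>) - lam * Re (form \<psi> w w)"
      using that by (auto simp: cslice_def l')
    have "posdef \<psi>" using \<psi> state_cone_posdef[OF pd0] by (simp add: states_def)
    then have "0 \<le> Re (form \<psi> w w)" using posdef_form w by blast
    then have "0 \<le> lam * Re (form \<psi> w w)" using lam by simp
    then show "\<psi> \<in> slice l c" using \<psi> \<delta> by (simp add: slice_def)
    show "\<exists>x\<in>M. \<psi> x \<noteq> 1"
    proof (rule ccontr)
      assume "\<not> ?thesis"
      then have 1: "\<psi> x = 1" if "x \<in> M" for x using that by blast
      have "\<psi> (inv (snd q) \<otimes> snd p) = 1" if "p \<in> set w" "q \<in> set w" for p q
        using that w(2) M(1) by (intro 1) (auto intro!: subgroup.m_closed subgroup.m_inv_closed)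
      then have "form \<psi> w w = (\<Sum>p\<leftarrow>w. \<Sum>q\<leftarrow>w. fst p * cnj (fst q))"
        unfolding form_def by (auto intro!: arg_cong[where f=sum_list] map_cong)
      also have "\<dots> = lf w (\<lambda>_. 1) * cnj (lf w (\<lambda>_. 1))"
        unfolding lf_def by (simp add: sum_list_const_mult sum_list_mult_const cnj_sum_list o_def)
      finally have "form \<psi> w w = 1" using w by simp
      then show False using \<psi> m[OF \<psi>(1)] \<delta> by (simp add: lam_def)
    qed
  qed
  have "l' \<in> combs" using l w by (simp add: l'_def)
  then show ?thesis using that[of l' "c + \<delta> / 4"] in' sub by blast
qed

text \<open>Maximize \<open>l\<close> on the states, then \<open>Re (k * \<psi> x)\<close> on the
  face where \<open>l\<close> is maximal, and tilt \<open>l\<close> slightly towards the second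
  functional. Near a maximum of the tilted functional the second one is close to its maximum
  \<open>b\<close> on the face: a smaller value costs at first order in the tilt, and a larger one
  keeps \<open>l\<close> away from its maximum by compactness.\<close>

lemma slice_pin:
  assumes l: "l \<in> combs" "slice l c \<noteq> {}" and x: "x \<in> carrier G" and k: "cmod k = 1" and "0 < \<epsilon>"
  obtains l' c' where "l' \<in> combs" "slice l' c' \<noteq> {}" "cslice l' c' \<subseteq> slice l c"
    "\<And>\<psi> \<psi>'. \<psi> \<in> cslice l' c' \<Longrightarrow> \<psi>' \<in> cslice l' c' \<Longrightarrow> \<bar>Re (k * \<psi> x) - Re (k * \<psi>' x)\<bar> \<le> \<epsilon>"
proof -
  define f where "f = (\<lambda>\<psi>. Re (lf [(k, x)] \<psi>))"
  define g where "g = (\<lambda>\<psi>. Re (lf l \<psi>))"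
  have cont: "continuous_on S f" "continuous_on S g" for S
    unfolding f_def g_def by (intro continuous_intros continuous_lf)+
  obtain \<phi> where \<phi>: "\<phi> \<in> states" "c < g \<phi>" using l by (auto simp: slice_def g_def)
  obtain \<mu> where \<mu>: "\<mu> \<in> states" "\<And>\<psi>. \<psi> \<in> states \<Longrightarrow> g \<psi> \<le> g \<mu>"
    using continuous_attains_sup[OF compact_states _ cont(2)[of states]] \<phi> by blast
  define m where "m = g \<mu>"
  have mc: "c < m" using \<mu>(2)[OF \<phi>(1)] \<phi>(2) by (simp add: m_def)
  define K1 where "K1 = states \<inter> {\<psi>. g \<psi> = m}"
  have "compact K1"
    unfolding K1_def by (intro compact_Int_closed compact_states closed_Collect_eq cont continuous_on_const)
  moreover have "K1 \<noteq> {}" using \<mu> by (auto simp: K1_def m_def)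
  ultimately have "\<exists>\<nu>\<in>K1. \<forall>\<psi>\<in>K1. f \<psi> \<le> f \<nu>"
    by (rule continuous_attains_sup[OF _ _ cont(1)])
  then obtain \<nu> where \<nu>: "\<nu> \<in> K1" "\<And>\<psi>. \<psi> \<in> K1 \<Longrightarrow> f \<psi> \<le> f \<nu>" by blast
  have \<nu>': "\<nu> \<in> states" "g \<nu> = m" using \<nu> by (auto simp: K1_def)
  define b where "b = f \<nu>"
  have fb: "\<bar>f \<psi>\<bar> \<le> 1" if "\<psi> \<in> states" for \<psi>
  proof -
    have "\<bar>f \<psi>\<bar> \<le> cmod (k * \<psi> x)" unfolding f_def by (simp add: abs_Re_le_cmod del: times_complex.sel)
    also have "\<dots> \<le> 1" using k states_bound[OF that] by (simp add: norm_mult)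
    finally show ?thesis .
  qed
  \<comment> \<open>On \<open>Z\<close> the second functional exceeds its maximum on the face, so
    \<open>Z\<close> avoids the face, and compactness leaves a gap \<open>\<kappa>\<close> between
    \<open>l\<close> and its maximum \<open>m\<close>.\<close>
  define Z where "Z = states \<inter> {\<psi>. b + \<epsilon> / 2 \<le> f \<psi>}"
  have "\<exists>\<kappa>>0. \<forall>\<psi>\<in>Z. g \<psi> \<le> m - \<kappa>"
  proof (cases "Z = {}")
    case True then show ?thesis by (auto intro: exI[of _ 1])
  next
    case False
    have "compact Z"
      unfolding Z_def by (intro compact_Int_closed compact_states closed_Collect_le cont continuous_on_const)
    then have "\<exists>z\<in>Z. \<forall>\<psi>\<in>Z. g \<psi> \<le> g z"
      by (rule continuous_attains_sup[OF _ False cont(2)])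
    then obtain z where z: "z \<in> Z" "\<And>\<psi>. \<psi> \<in> Z \<Longrightarrow> g \<psi> \<le> g z" by blast
    have "g z \<noteq> m"
    proof
      assume "g z = m"
      then have "z \<in> K1" using z by (auto simp: K1_def Z_def)
      then show False using \<nu>(2) z(1) assms(5) by (force simp: Z_def b_def)
    qed
    moreover have "g z \<le> m" using z \<mu> by (auto simp: Z_def m_def)
    ultimately show ?thesis using z by (intro exI[of _ "m - g z"]) auto
  qed
  then obtain \<kappa> where \<kappa>: "\<kappa> > 0" "\<And>\<psi>. \<psi> \<in> Z \<Longrightarrow> g \<psi> \<le> m - \<kappa>" by blast
  \<comment> \<open>The deficit of \<open>l\<close> will be at most \<open>3 * \<eta>\<close>. This
    is less than \<open>\<kappa>\<close>, which excludes \<open>Z\<close>, and less than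
    \<open>m - c\<close>, which keeps the new slice inside the old one.\<close>
  define \<eta> where "\<eta> = min (min 1 (\<epsilon> / 2)) (min (\<kappa> / 4) ((m - c) / 4))"
  have \<eta>: "0 < \<eta>" "\<eta> \<le> 1" "\<eta> \<le> \<epsilon> / 2" "4 * \<eta> \<le> \<kappa>" "4 * \<eta> \<le> m - c"
    using \<kappa> mc assms(5) by (auto simp: \<eta>_def min_def)
  have \<eta>2: "\<eta>\<^sup>2 \<le> \<eta>" using \<eta> by (simp add: power2_eq_square mult_left_le)
  define l' where "l' = l @ [(of_real \<eta> * k, x)]"
  \<comment> \<open>The value of the tilted functional at \<open>\<nu>\<close>, lowered by a
    second-order term. After division by \<open>\<eta>\<close> this slack is \<open>\<eta>\<close>,
    hence at most \<open>\<epsilon> / 2\<close>.\<close>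
  define c' where "c' = m + \<eta> * b - \<eta>\<^sup>2"
  have l': "Re (lf l' \<psi>) = g \<psi> + \<eta> * f \<psi>" for \<psi>
    by (simp add: l'_def g_def f_def algebra_simps)
  have key: "g \<psi> > c" "b - \<epsilon> / 2 \<le> f \<psi>" "f \<psi> \<le> b + \<epsilon> / 2" if "\<psi> \<in> cslice l' c'" for \<psi>
  proof -
    have \<psi>: "\<psi> \<in> states" "m + \<eta> * b - \<eta>\<^sup>2 \<le> g \<psi> + \<eta> * f \<psi>"
      using that by (auto simp: cslice_def l' c'_def)
    have gm: "g \<psi> \<le> m" using \<mu> \<psi> by (simp add: m_def)
    have "\<eta> * (b - \<eta>) \<le> \<eta> * f \<psi>" using \<psi>(2) gm by (simp add: algebra_simps power2_eq_square)
    then have "b - \<eta> \<le> f \<psi>" using \<eta>(1) by (simp only: mult_le_cancel_left_pos)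
    then show "b - \<epsilon> / 2 \<le> f \<psi>" using \<eta> by simp
    have "\<eta> * f \<psi> \<le> \<eta>" "- \<eta> \<le> \<eta> * b"
      using fb[OF \<psi>(1)] fb[OF \<nu>'(1)] \<eta>(1) mult_left_mono[of "-1" b \<eta>] by (auto simp: b_def mult_left_le)
    then have g: "m - 3 * \<eta> \<le> g \<psi>" using \<psi>(2) \<eta>2 by linarith
    then show "g \<psi> > c" using \<eta> by linarith
    show "f \<psi> \<le> b + \<epsilon> / 2"
    proof (rule ccontr)
      assume "\<not> ?thesis"
      then have "\<psi> \<in> Z" using \<psi> by (auto simp: Z_def)
      then show False using \<kappa> g \<eta> by fastforce
    qed
  qed
  have "\<nu> \<in> slice l' c'" using \<nu>' \<eta>(1) by (simp add: slice_def l' c'_def b_def)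
  moreover have "cslice l' c' \<subseteq> slice l c" using key(1) by (auto simp: slice_def cslice_def g_def)
  moreover have "l' \<in> combs" using l x by (simp add: l'_def)
  moreover have "\<bar>Re (k * \<psi> x) - Re (k * \<psi>' x)\<bar> \<le> \<epsilon>"
    if "\<psi> \<in> cslice l' c'" "\<psi>' \<in> cslice l' c'" for \<psi> \<psi>'
    using key(2,3)[OF that(1)] key(2,3)[OF that(2)] by (simp add: f_def)
  ultimately show ?thesis using that[of l' c'] by blast
qed

lemma slice_refine:
  assumes l: "l \<in> combs" "slice l c \<noteq> {}" and x: "x \<in> carrier G" and \<epsilon>: "0 < \<epsilon>"
  obtains l' c' where "l' \<in> combs" "slice l' c' \<noteq> {}" "cslice l' c' \<subseteq> slice l c"
    "\<And>\<psi> \<psi>'. \<psi> \<in> cslice l' c' \<Longrightarrow> \<psi>' \<in> cslice l' c' \<Longrightarrow> cmod (\<psi> x - \<psi>' x) \<le> \<epsilon>"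
proof -
  have sc: "slice l c \<subseteq> cslice l c" for l c by (auto simp: slice_def cslice_def)
  obtain l2 c2 where 2: "l2 \<in> combs" "slice l2 c2 \<noteq> {}" "cslice l2 c2 \<subseteq> slice l c"
    "\<And>\<psi> \<psi>'. \<psi> \<in> cslice l2 c2 \<Longrightarrow> \<psi>' \<in> cslice l2 c2 \<Longrightarrow> \<bar>Re (1 * \<psi> x) - Re (1 * \<psi>' x)\<bar> \<le> \<epsilon> / 2"
    using slice_pin[OF l x, of 1 "\<epsilon> / 2"] \<epsilon> by auto
  obtain l3 c3 where 3: "l3 \<in> combs" "slice l3 c3 \<noteq> {}" "cslice l3 c3 \<subseteq> slice l2 c2"
    "\<And>\<psi> \<psi>'. \<psi> \<in> cslice l3 c3 \<Longrightarrow> \<psi>' \<in> cslice l3 c3 \<Longrightarrow> \<bar>Re (\<i> * \<psi> x) - Re (\<i> * \<psi>' x)\<bar> \<le> \<epsilon> / 2"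
    using slice_pin[OF 2(1,2) x, of \<i> "\<epsilon> / 2"] \<epsilon> by auto
  have s: "cslice l3 c3 \<subseteq> cslice l2 c2" "cslice l3 c3 \<subseteq> slice l c"
    using 2 3 sc by blast+
  have "cmod (\<psi> x - \<psi>' x) \<le> \<epsilon>" if "\<psi> \<in> cslice l3 c3" "\<psi>' \<in> cslice l3 c3" for \<psi> \<psi>'
  proof -
    have "\<bar>Re (1 * \<psi> x) - Re (1 * \<psi>' x)\<bar> \<le> \<epsilon> / 2" using 2(4) s that by blast
    moreover have "\<bar>Re (\<i> * \<psi> x) - Re (\<i> * \<psi>' x)\<bar> \<le> \<epsilon> / 2" using 3(4) that by blast
    ultimately show ?thesis using cmod_le[of "\<psi> x - \<psi>' x"] by (simp add: abs_minus_commute)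
  qed
  then show ?thesis using that[of l3 c3] 3(1,2) s by blast
qed

text \<open>Purity of the limit comes from the shape of the slices. They are cut from the states by
  half-spaces, so if their only common point is a convex combination of \<open>u\<close> and
  \<open>v\<close>, each of them contains \<open>u\<close> or \<open>v\<close>. As they decrease,
  one of the two lies in all of them and equals \<open>q\<close>.\<close>

theorem pure_state_exists:
  assumes count: "countable (carrier G)"
    and l0: "l0 \<in> combs" "c0 < Re (lf l0 \<phi>0)"
    and F: "countable F" "\<And>M. M \<in> F \<Longrightarrow> subgroup M G" "\<And>M. M \<in> F \<Longrightarrow> dispersed \<phi>0 M"
  obtains q where "q \<in> state_cone \<phi>0" "q \<one> = 1" "pure \<phi>0 q" "c0 < Re (lf l0 q)"
    "\<And>M. M \<in> F \<Longrightarrow> \<exists>x\<in>M. q x \<noteq> 1"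
proof -
  define M where "M = (\<lambda>n. from_nat_into F n)"
  have M: "subgroup (M n) G" "dispersed \<phi>0 (M n)" if "F \<noteq> {}" for n
    using F(2,3) from_nat_into[OF that] by (auto simp: M_def)
  \<comment> \<open>Step \<open>n\<close> treats the element with index
    \<open>fst (prod_decode n)\<close>. Thus each element is treated infinitely often, with
    precisions tending to 0.\<close>
  define xs where "xs = (\<lambda>n. from_nat_into (carrier G) (fst (prod_decode n)))"
  have xs: "xs n \<in> carrier G" for n unfolding xs_def by (rule from_nat_into) auto
  define good where "good = (\<lambda>n T. (F \<noteq> {} \<longrightarrow> (\<forall>\<psi>\<in>T. \<exists>x\<in>M n. \<psi> x \<noteq> 1)) \<and>
    (\<forall>\<psi>\<in>T. \<forall>\<psi>'\<in>T. cmod (\<psi> (xs n) - \<psi>' (xs n)) \<le> 1 / (1 + real n)))"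
  define P where "P = (\<lambda>(n::nat) (p :: (complex \<times> 'a) list \<times> real). fst p \<in> combs \<and> slice (fst p) (snd p) \<noteq> {}
     \<and> cslice (fst p) (snd p) \<subseteq> slice l0 c0)"
  define Q where "Q = (\<lambda>n (p :: (complex \<times> 'a) list \<times> real) p'. cslice (fst p') (snd p') \<subseteq> cslice (fst p) (snd p)
     \<and> good n (cslice (fst p') (snd p')))"
  have step: "\<exists>p'. fst p' \<in> combs \<and> slice (fst p') (snd p') \<noteq> {} \<and> cslice (fst p') (snd p') \<subseteq> slice l c
      \<and> good n (cslice (fst p') (snd p'))" if sl: "l \<in> combs" "slice l c \<noteq> {}" for l c n
  proof -
    have "\<exists>l1 c1. l1 \<in> combs \<and> slice l1 c1 \<noteq> {} \<and> slice l1 c1 \<subseteq> slice l c \<and>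
        (F \<noteq> {} \<longrightarrow> (\<forall>\<psi>\<in>slice l1 c1. \<exists>x\<in>M n. \<psi> x \<noteq> 1))"
    proof (cases "F = {}")
      case False
      obtain l1 c1 where 1: "l1 \<in> combs" "slice l1 c1 \<noteq> {}" "cslice l1 c1 \<subseteq> slice l c"
        "\<And>\<psi>. \<psi> \<in> cslice l1 c1 \<Longrightarrow> \<exists>x\<in>M n. \<psi> x \<noteq> 1"
        using slice_avoid[OF sl M[OF False, of n]] by blast
      moreover have "slice l1 c1 \<subseteq> cslice l1 c1" by (auto simp: slice_def cslice_def)
      ultimately show ?thesis by blast
    qed (use sl in blast)
    then obtain l1 c1 where 1: "l1 \<in> combs" "slice l1 c1 \<noteq> {}" "slice l1 c1 \<subseteq> slice l c"
      "F \<noteq> {} \<longrightarrow> (\<forall>\<psi>\<in>slice l1 c1. \<exists>x\<in>M n. \<psi> x \<noteq> 1)" by blast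
    obtain l' c' where 2: "l' \<in> combs" "slice l' c' \<noteq> {}" "cslice l' c' \<subseteq> slice l1 c1"
      "\<And>\<psi> \<psi>'. \<psi> \<in> cslice l' c' \<Longrightarrow> \<psi>' \<in> cslice l' c' \<Longrightarrow> cmod (\<psi> (xs n) - \<psi>' (xs n)) \<le> 1 / (1 + real n)"
      using slice_refine[OF 1(1,2) xs[of n], of "1 / (1 + real n)"] by auto
    have *: "cslice l' c' \<subseteq> slice l c" "good n (cslice l' c')"
      using 1 2 unfolding good_def by blast+
    show ?thesis by (rule exI[of _ "(l', c')"]) (use 2 * in auto)
  qed
  have sc: "slice l c \<subseteq> cslice l c" for l c by (auto simp: slice_def cslice_def)
  have "\<exists>p. P 0 p"
  proof -
    have "slice l0 c0 \<noteq> {}" using l0 phi0_state_cone norm0 by (auto simp: slice_def states_def)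
    from step[OF l0(1) this, of 0] show ?thesis by (auto simp: P_def)
  qed
  moreover have "\<exists>p'. P (Suc n) p' \<and> Q n p p'" if "P n p" for p n
    using step[of "fst p" "snd p" n] that sc unfolding P_def Q_def by (meson order_trans)
  ultimately obtain p where p: "\<And>n. P n (p n)" "\<And>n. Q n (p n) (p (Suc n))"
    using dependent_nat_choice[of P Q] by blast
  define T where "T = (\<lambda>n. cslice (fst (p n)) (snd (p n)))"
  have Tdec: "T (Suc n) \<subseteq> T n" for n using p(2)[of n] by (simp add: Q_def T_def)
  have Tmono: "m \<le> n \<Longrightarrow> T n \<subseteq> T m" for m n by (rule lift_Suc_antimono_le[of T]) (use Tdec in auto)
  have Tgood: "good n (T (Suc n))" for n using p(2)[of n] by (simp add: Q_def T_def)
  define C where "C = (\<lambda>n. {\<psi>. snd (p n) \<le> Re (lf (fst (p n)) \<psi>)})"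
  have TC: "T n = states \<inter> C n" for n
    by (auto simp: T_def cslice_def C_def)
  have Tne: "T n \<noteq> {}" for n using p(1)[of n] sc[of "fst (p n)" "snd (p n)"] by (auto simp: P_def T_def)
  have "states \<inter> (\<Inter>n\<in>UNIV. C n) \<noteq> {}"
  proof (rule compact_imp_fip_image[OF compact_states])
    show "closed (C n)" for n unfolding C_def by (intro closed_Collect_le continuous_intros continuous_lf)
    fix I' :: "nat set" assume "finite I'"
    then obtain N where "\<forall>i\<in>I'. i \<le> N" using finite_nat_set_iff_bounded_le by blast
    then have "T N \<subseteq> states \<inter> (\<Inter>i\<in>I'. C i)" using Tmono[of _ N] TC by blast
    then show "states \<inter> (\<Inter>i\<in>I'. C i) \<noteq> {}" using Tne[of N] by blast
  qed
  then have "\<Inter> (range T) \<noteq> {}" unfolding TC by blast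
  then obtain q where q: "\<And>n. q \<in> T n" by blast
  have qs: "q \<in> states" using q[of 0] by (simp add: T_def cslice_def)
  have uniq: "\<psi> = q" if "\<And>n. \<psi> \<in> T n" for \<psi>
  proof
    fix x
    have \<psi>s: "\<psi> \<in> states" using that[of 0] by (simp add: T_def cslice_def)
    show "\<psi> x = q x"
    proof (cases "x \<in> carrier G")
      case True
      then obtain i where i: "x = from_nat_into (carrier G) i"
        using from_nat_into_surj[OF count True] by blast
      have "cmod (\<psi> x - q x) \<le> inverse (real (Suc j))" for j
      proof -
        define n where "n = prod_encode (i, j)"
        have "xs n = x" by (simp add: xs_def n_def i)
        then have "cmod (\<psi> x - q x) \<le> 1 / (1 + real n)"
          using Tgood[of n] that[of "Suc n"] q[of "Suc n"] by (auto simp: good_def)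
        also have "\<dots> \<le> 1 / (1 + real j)"
          using le_prod_encode_2[of j i] by (intro divide_left_mono) (auto simp: n_def intro: add_pos_nonneg)
        finally show ?thesis by (simp add: inverse_eq_divide)
      qed
      then have "cmod (\<psi> x - q x) \<le> 0"
        using LIMSEQ_le_const[OF LIMSEQ_inverse_real_of_nat, of "cmod (\<psi> x - q x)"] by blast
      then show ?thesis by simp
    next
      case False
      then show ?thesis using \<psi>s qs state_cone_off[of \<psi> \<phi>0 x] state_cone_off[of q \<phi>0 x] by (simp add: states_def)
    qed
  qed
  have "pure \<phi>0 q" unfolding pure_def
  proof (intro ballI impI allI)
    fix \<phi>1 \<phi>2 x
    assume h: "\<phi>1 \<in> state_cone \<phi>0" "\<phi>2 \<in> state_cone \<phi>0" "\<forall>x. q x = \<phi>1 x + \<phi>2 x"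
    have b: "cmod (\<phi>1 x) \<le> Re (\<phi>1 \<one>)" "cmod (\<phi>2 x) \<le> Re (\<phi>2 \<one>)" for x
      using posdef_bound[OF state_cone_posdef[OF pd0]] h by auto
    have sum1: "\<phi>1 \<one> + \<phi>2 \<one> = 1" using h(3) qs by (simp add: states_def)
    \<comment> \<open>A summand that vanishes at \<open>\<one>\<close> vanishes everywhere by
      \<open>posdef_bound\<close>; the remaining case can be normalized.\<close>
    consider "\<phi>1 \<one> = 0" | "\<phi>2 \<one> = 0" | "\<phi>1 \<one> \<noteq> 0" "\<phi>2 \<one> \<noteq> 0" by blast
    then show "\<phi>1 x = \<phi>1 \<one> * q x"
    proof cases
      case 1 then show ?thesis using b(1)[of x] by simp
    next
      case 2 then show ?thesis using b(2)[of x] h(3) sum1 by simp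
    next
      case 3
      define t where "t = Re (\<phi>1 \<one>)"
      define s where "s = Re (\<phi>2 \<one>)"
      define u where "u = (\<lambda>x. of_real (1 / t) * \<phi>1 x)"
      define v where "v = (\<lambda>x. of_real (1 / s) * \<phi>2 x)"
      have u: "u \<in> states" "0 < t" "\<phi>1 \<one> = of_real t"
        using normalize_state[OF h(1) 3(1)] by (auto simp: u_def t_def)
      have v: "v \<in> states" "0 < s" "\<phi>2 \<one> = of_real s"
        using normalize_state[OF h(2) 3(2)] by (auto simp: v_def s_def)
      have ts: "t + s = 1" using sum1 u v by (metis of_real_add of_real_eq_1_iff)
      have \<phi>: "\<phi>1 x = of_real t * u x" "\<phi>2 x = of_real s * v x" for x
        using u v by (auto simp: u_def v_def)
      have qf: "q = (\<lambda>x. of_real t * u x + of_real s * v x)" using h(3) \<phi> by auto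
      \<comment> \<open>The complement of a half-space is convex: if it contained both
        \<open>u\<close> and \<open>v\<close>, it would contain \<open>q\<close>.\<close>
      have uv: "u \<in> T n \<or> v \<in> T n" for n
      proof (rule ccontr)
        let ?l = "\<lambda>f. Re (lf (fst (p n)) f)"
        let ?c = "snd (p n)"
        assume "\<not> ?thesis"
        then have "?l u < ?c" "?l v < ?c" using u v by (auto simp: T_def cslice_def)
        then have "t * ?l u + s * ?l v < t * ?c + s * ?c"
          using u(2) v(2) by (intro add_strict_mono mult_strict_left_mono) auto
        also have "\<dots> = ?c" using ts by (simp add: distrib_right[symmetric])
        also have "\<dots> \<le> ?l q" using q[of n] by (simp add: T_def cslice_def)
        also have "?l q = t * ?l u + s * ?l v"
          unfolding qf lf_add lf_cmult by simp
        finally show False by simp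
      qed
      have "(\<forall>n. u \<in> T n) \<or> (\<forall>n. v \<in> T n)"
      proof (rule ccontr)
        assume "\<not> ?thesis"
        then obtain m n where "u \<notin> T m" "v \<notin> T n" by blast
        then have "u \<notin> T (max m n)" "v \<notin> T (max m n)"
          using Tmono[of m "max m n"] Tmono[of n "max m n"] by auto
        then show False using uv by blast
      qed
      then have "u = q \<or> v = q" using uniq by blast
      moreover have "u x = q x" if "v = q"
      proof -
        have "q x = of_real t * u x + of_real s * q x" using h(3) \<phi> that by simp
        then have "of_real (1 - s) * q x = of_real t * u x" by (simp add: algebra_simps)
        moreover have "1 - s = t" using ts by simp
        ultimately show ?thesis using u(2) by simp
      qed
      ultimately have "u x = q x" by auto
      then show ?thesis using \<phi>(1)[of x] u(3) by simp
    qed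
  qed
  moreover have "c0 < Re (lf l0 q)" using q[of 0] p(1)[of 0] by (auto simp: P_def T_def slice_def)
  moreover have "\<exists>x\<in>M. q x \<noteq> 1" if MF: "M \<in> F" for M
  proof -
    obtain n where "M = from_nat_into F n" using from_nat_into_surj[OF F(1) MF] by metis
    then show ?thesis using Tgood[of n] q[of "Suc n"] MF unfolding good_def M_def by blast
  qed
  ultimately show ?thesis using that[of q] qs by (simp add: states_def)
qed

end

end

subsection \<open>Complex Hilbert spaces\<close>

lemma ring_of_type_algebra_simps [simp]:
  "carrier (ring_of_type_algebra :: complex ring) = UNIV"
  "x \<otimes>\<^bsub>(ring_of_type_algebra :: complex ring)\<^esub> y = x * y"
  "x \<oplus>\<^bsub>(ring_of_type_algebra :: complex ring)\<^esub> y = x + y"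
  "\<one>\<^bsub>(ring_of_type_algebra :: complex ring)\<^esub> = 1"
  "\<zero>\<^bsub>(ring_of_type_algebra :: complex ring)\<^esub> = 0"
  by (auto simp: ring_of_type_algebra_def)

context complex_inner_product_space
begin

definition sq :: "'h \<Rightarrow> real"
  where "sq x = Re (cinner H x x)"

lemma cinner_zero_left [simp]: "y \<in> carrier H \<Longrightarrow> cinner H \<zero> y = 0"
  using cinner_add_left[of \<zero> \<zero> y] by simp

lemma cinner_zero_right [simp]: "y \<in> carrier H \<Longrightarrow> cinner H y \<zero> = 0"
  using cinner_commute[of \<zero> y] by simp

lemma cinner_add_right:
  "\<lbrakk>x \<in> carrier H; y \<in> carrier H; z \<in> carrier H\<rbrakk> \<Longrightarrow> cinner H z (x \<oplus> y) = cinner H z x + cinner H z y"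
  using cinner_commute[of "x \<oplus> y" z] cinner_commute[of x z] cinner_commute[of y z]
  by (simp add: cinner_add_left)

lemma cinner_smult_right:
  "\<lbrakk>x \<in> carrier H; y \<in> carrier H\<rbrakk> \<Longrightarrow> cinner H y (c \<odot> x) = cnj c * cinner H y x"
  using cinner_commute[of "c \<odot> x" y] cinner_commute[of x y] by (simp add: cinner_smult_left)

lemma cinner_neg_left: "\<lbrakk>x \<in> carrier H; y \<in> carrier H\<rbrakk> \<Longrightarrow> cinner H (\<ominus> x) y = - cinner H x y"
  using cinner_add_left[of x "\<ominus> x" y] by (simp add: r_neg add_eq_0_iff2 add.commute)

lemma cinner_neg_right: "\<lbrakk>x \<in> carrier H; y \<in> carrier H\<rbrakk> \<Longrightarrow> cinner H y (\<ominus> x) = - cinner H y x"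
  using cinner_commute[of "\<ominus> x" y] cinner_commute[of x y] by (simp add: cinner_neg_left)

lemma cinner_minus_left:
  "\<lbrakk>x \<in> carrier H; y \<in> carrier H; z \<in> carrier H\<rbrakk> \<Longrightarrow> cinner H (x \<ominus> y) z = cinner H x z - cinner H y z"
  by (simp add: a_minus_def cinner_add_left cinner_neg_left)

lemma cinner_minus_right:
  "\<lbrakk>x \<in> carrier H; y \<in> carrier H; z \<in> carrier H\<rbrakk> \<Longrightarrow> cinner H z (x \<ominus> y) = cinner H z x - cinner H z y"
  by (simp add: a_minus_def cinner_add_right cinner_neg_right)

lemmas cinner_simps = cinner_add_left cinner_add_right cinner_smult_left cinner_smult_right
  cinner_neg_left cinner_neg_right cinner_minus_left cinner_minus_right

lemma Im_cinner_self [simp]: "x \<in> carrier H \<Longrightarrow> Im (cinner H x x) = 0"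
  using cinner_commute[of x x] by (simp add: complex_eq_iff)

lemma cinner_self: "x \<in> carrier H \<Longrightarrow> cinner H x x = of_real (sq x)"
  by (simp add: sq_def complex_eq_iff)

lemma sq_nonneg [simp]: "x \<in> carrier H \<Longrightarrow> 0 \<le> sq x"
  using cinner_pos[of x] by (cases "x = \<zero>") (auto simp: sq_def)

lemma sq_eq_0 [simp]: "x \<in> carrier H \<Longrightarrow> sq x = 0 \<longleftrightarrow> x = \<zero>"
  using cinner_pos[of x] by (cases "x = \<zero>") (auto simp: sq_def)

text \<open>The polynomial of \<open>quadratic_bound\<close> again: it yields Cauchy-Schwarz, and
  for a vector of minimal length it yields orthogonality.\<close>

lemma sq_minus_smult:
  fixes t :: real
  assumes [simp]: "x \<in> carrier H" "y \<in> carrier H"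
  shows "sq (x \<ominus> (of_real t * cinner H x y) \<odot> y)
    = sq x - 2 * t * (cmod (cinner H x y))\<^sup>2 + t\<^sup>2 * (cmod (cinner H x y))\<^sup>2 * sq y"
proof -
  let ?i = "cinner H x y"
  have yx: "cinner H y x = cnj ?i" by (rule cinner_commute) simp_all
  have n: "?i * cnj ?i = of_real ((cmod ?i)\<^sup>2)" by (rule complex_norm_square[symmetric])
  have "cinner H (x \<ominus> c \<odot> y) (x \<ominus> c \<odot> y)
    = cinner H x x - cnj c * ?i - c * cinner H y x + c * cnj c * cinner H y y" for c
    by (simp add: cinner_simps right_diff_distrib)
  then have "cinner H (x \<ominus> (of_real t * ?i) \<odot> y) (x \<ominus> (of_real t * ?i) \<odot> y)
    = of_real (sq x) - of_real t * (?i * cnj ?i) - of_real t * (?i * cnj ?i)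
      + of_real t * of_real t * (?i * cnj ?i) * of_real (sq y)"
    by (simp add: yx cinner_self)
  then show ?thesis unfolding n sq_def[of "x \<ominus> (of_real t * ?i) \<odot> y"]
    by (simp add: power2_eq_square)
qed

lemma cauchy_schwarz:
  assumes "x \<in> carrier H" "y \<in> carrier H"
  shows "(cmod (cinner H x y))\<^sup>2 \<le> sq x * sq y"
proof (rule quadratic_bound)
  fix t :: real
  have "0 \<le> sq (x \<ominus> (of_real t * cinner H x y) \<odot> y)" using assms by simp
  then show "0 \<le> sq x - 2 * t * (cmod (cinner H x y))\<^sup>2 + t\<^sup>2 * (cmod (cinner H x y))\<^sup>2 * sq y"
    by (simp add: sq_minus_smult assms)
qed (use assms in auto)

lemma cauchy_schwarz_sqrt:
  assumes "x \<in> carrier H" "y \<in> carrier H"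
  shows "cmod (cinner H x y) \<le> sqrt (sq x) * sqrt (sq y)"
  using real_sqrt_le_mono[OF cauchy_schwarz[OF assms]] by (simp add: real_sqrt_mult)

lemma norm_triangle:
  assumes [simp]: "x \<in> carrier H" "y \<in> carrier H"
  shows "sqrt (sq (x \<oplus> y)) \<le> sqrt (sq x) + sqrt (sq y)"
proof (rule real_le_lsqrt)
  have yx: "cinner H y x = cnj (cinner H x y)" by (rule cinner_commute) simp_all
  have "sq (x \<oplus> y) = sq x + 2 * Re (cinner H x y) + sq y"
    by (simp add: sq_def cinner_simps yx)
  also have "\<dots> \<le> sq x + 2 * (sqrt (sq x) * sqrt (sq y)) + sq y"
    using cauchy_schwarz_sqrt[of x y] complex_Re_le_cmod[of "cinner H x y"] by simp
  also have "\<dots> = (sqrt (sq x) + sqrt (sq y))\<^sup>2" by (simp add: power2_sum)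
  finally show "sq (x \<oplus> y) \<le> (sqrt (sq x) + sqrt (sq y))\<^sup>2" .
qed auto

lemma hdist_eq: "x \<in> carrier H \<Longrightarrow> y \<in> carrier H \<Longrightarrow> hdist H x y = sqrt (sq (x \<ominus> y))"
  by (simp add: hdist_def sq_def)

lemma Metric_space_hdist: "Metric_space (carrier H) (hdist H)"
proof
  fix x y z
  show "0 \<le> hdist H x y"
  proof (cases "x \<in> carrier H \<and> y \<in> carrier H")
    case True
    then show ?thesis by (simp add: hdist_eq)
  qed (auto simp: hdist_def)
  show "hdist H x y = hdist H y x"
  proof (cases "x \<in> carrier H \<and> y \<in> carrier H")
    case True
    then have "sq (x \<ominus> y) = sq (y \<ominus> x)" by (simp add: sq_def cinner_simps)
    then show ?thesis using True by (simp add: hdist_eq)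
  qed (auto simp: hdist_def)
  assume x[simp]: "x \<in> carrier H" and y[simp]: "y \<in> carrier H"
  show "hdist H x y = 0 \<longleftrightarrow> x = y" by (simp add: hdist_eq) (metis a_minus_def a_inv_closed minus_equality minus_minus r_neg x y)
  assume z[simp]: "z \<in> carrier H"
  have "x \<ominus> z = (x \<ominus> y) \<oplus> (y \<ominus> z)"
    by (simp add: a_minus_def) (simp add: a_assoc r_neg1 r_neg2)
  then show "hdist H x z \<le> hdist H x y + hdist H y z"
    using norm_triangle[of "x \<ominus> y" "y \<ominus> z"] by (simp add: hdist_eq)
qed

lemma cinner_tendsto:
  assumes "limitin (Metric_space.mtopology (carrier H) (hdist H)) s l sequentially"
    and "\<And>n. s n \<in> carrier H" and y: "y \<in> carrier H"
  shows "(\<lambda>n. cinner H (s n) y) \<longlonglongrightarrow> cinner H l y"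
proof -
  interpret M: Metric_space "carrier H" "hdist H" by (rule Metric_space_hdist)
  have l: "l \<in> carrier H" "(\<lambda>n. hdist H (s n) l) \<longlonglongrightarrow> 0"
    using assms(1) unfolding M.limitin_metric_dist_null by auto
  have "(\<lambda>n. hdist H (s n) l * sqrt (sq y)) \<longlonglongrightarrow> 0"
    using tendsto_mult_left_zero[OF l(2)] by simp
  then have "(\<lambda>n. cinner H (s n) y - cinner H l y) \<longlonglongrightarrow> 0"
  proof (rule Lim_null_comparison[rotated], intro always_eventually allI)
    fix n
    have "cinner H (s n) y - cinner H l y = cinner H (s n \<ominus> l) y"
      using assms l by (simp add: cinner_simps)
    then show "cmod (cinner H (s n) y - cinner H l y) \<le> hdist H (s n) l * sqrt (sq y)"
      using cauchy_schwarz_sqrt[of "s n \<ominus> l" y] assms l by (simp add: hdist_eq)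
  qed
  then show ?thesis by (simp add: LIM_zero_iff)
qed

lemma sq_minus:
  assumes [simp]: "x \<in> carrier H" "y \<in> carrier H"
  shows "sq (x \<ominus> y) = sq x - 2 * Re (cinner H x y) + sq y"
proof -
  have yx: "cinner H y x = cnj (cinner H x y)" by (rule cinner_commute) simp_all
  show ?thesis by (simp add: sq_def cinner_simps yx)
qed

lemma sq_add:
  assumes [simp]: "x \<in> carrier H" "y \<in> carrier H"
  shows "sq (x \<oplus> y) = sq x + 2 * Re (cinner H x y) + sq y"
proof -
  have yx: "cinner H y x = cnj (cinner H x y)" by (rule cinner_commute) simp_all
  show ?thesis by (simp add: sq_def cinner_simps yx)
qed

lemma sq_smult: "x \<in> carrier H \<Longrightarrow> sq (c \<odot> x) = (cmod c)\<^sup>2 * sq x"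
  unfolding sq_def unfolding cmod_power2
  by (simp add: cinner_simps mult.assoc[symmetric]) (simp add: power2_eq_square)

text \<open>The midpoint form is the one needed for projections: two points of a subspace that are
  almost nearest to \<open>x\<close> are close to each other, because their midpoint is no nearer
  than the infimum.\<close>

lemma parallelogram:
  assumes [simp]: "x \<in> carrier H" "y \<in> carrier H" "z \<in> carrier H"
  shows "sq (y \<ominus> z) = 2 * sq (x \<ominus> y) + 2 * sq (x \<ominus> z) - 4 * sq (x \<ominus> (1/2) \<odot> (y \<oplus> z))"
proof -
  have "sq ((1/2) \<odot> (y \<oplus> z)) = sq (y \<oplus> z) / 4"
    by (simp add: sq_smult norm_divide power2_eq_square)
  moreover have "Re (cinner H x ((1/2) \<odot> (y \<oplus> z))) = (Re (cinner H x y) + Re (cinner H x z)) / 2"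
    by (simp add: cinner_smult_right cinner_add_right)
  ultimately show ?thesis by (simp add: sq_minus sq_add)
qed

end

lemma (in complex_hilbert_space) orthogonal_projection:
  assumes W: "submodule W (ring_of_type_algebra :: complex ring) H"
    and cl: "closedin (Metric_space.mtopology (carrier H) (hdist H)) W"
    and x: "x \<in> carrier H"
  obtains u where "u \<in> W" "\<And>w. w \<in> W \<Longrightarrow> cinner H (x \<ominus> u) w = 0"
proof -
  interpret M: Metric_space "carrier H" "hdist H" by (rule Metric_space_hdist)
  have Wc: "w \<in> W \<Longrightarrow> w \<in> carrier H" for w using submoduleE(1)[OF W] by blast
  note Wadd = submoduleE(5)[OF W] and Wne = submoduleE(2)[OF W]
  have Wsm: "w \<in> W \<Longrightarrow> c \<odot> w \<in> W" for c w by (rule submoduleE(4)[OF W]) simp_all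
  define d where "d = (INF w\<in>W. sq (x \<ominus> w))"
  have bdd: "bdd_below ((\<lambda>w. sq (x \<ominus> w)) ` W)"
    by (rule bdd_belowI[of _ 0]) (use x Wc in auto)
  have dle: "d \<le> sq (x \<ominus> w)" if "w \<in> W" for w
    unfolding d_def using bdd that by (rule cINF_lower)
  have "\<exists>w\<in>W. sq (x \<ominus> w) < d + 1 / (1 + real n)" for n
  proof -
    have "(INF w\<in>W. sq (x \<ominus> w)) < d + 1 / (1 + real n)" by (simp add: d_def add_pos_nonneg)
    then show ?thesis using cINF_less_iff[OF Wne bdd] by blast
  qed
  then obtain s where s: "\<And>n. s n \<in> W" "\<And>n. sq (x \<ominus> s n) < d + 1 / (1 + real n)" by metis
  have sc: "s n \<in> carrier H" for n using s Wc by auto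
  have close: "sq (s m \<ominus> s n) \<le> 4 / (1 + real N)" if "m \<ge> N" "n \<ge> N" for m n N
  proof -
    have "sq (s m \<ominus> s n) \<le> 2 * sq (x \<ominus> s m) + 2 * sq (x \<ominus> s n) - 4 * d"
      using parallelogram[OF x sc sc, of m n] dle[of "(1/2) \<odot> (s m \<oplus> s n)"] s Wadd Wsm by simp
    also have "\<dots> \<le> 2 / (1 + real m) + 2 / (1 + real n)" using s(2)[of m] s(2)[of n] by simp
    also have "\<dots> \<le> 2 / (1 + real N) + 2 / (1 + real N)"
      using that by (intro add_mono divide_left_mono) (auto intro: add_pos_nonneg)
    finally show ?thesis by simp
  qed
  have "M.MCauchy s" unfolding M.MCauchy_def
  proof (intro conjI allI impI)
    fix \<epsilon> :: real assume \<epsilon>: "\<epsilon> > 0"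
    obtain N where N: "4 / \<epsilon>\<^sup>2 < real N" using reals_Archimedean2 by blast
    moreover have "0 < \<epsilon>\<^sup>2" using \<epsilon> by simp
    ultimately have "4 < real N * \<epsilon>\<^sup>2 + \<epsilon>\<^sup>2" unfolding pos_divide_less_eq[OF \<open>0 < \<epsilon>\<^sup>2\<close>] by linarith
    then have "4 / (1 + real N) < \<epsilon>\<^sup>2" by (simp add: pos_divide_less_eq algebra_simps)
    then have "sqrt (sq (s m \<ominus> s n)) < \<epsilon>" if "m \<ge> N" "n \<ge> N" for m n
      using close[OF that] \<epsilon> by (intro real_less_lsqrt) auto
    then show "\<exists>N. \<forall>n n'. N \<le> n \<longrightarrow> N \<le> n' \<longrightarrow> hdist H (s n) (s n') < \<epsilon>"
      using sc by (auto simp: hdist_eq)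
  qed (use sc in auto)
  then obtain u where u: "limitin M.mtopology s u sequentially"
    using complete unfolding M.mcomplete_def by blast
  have uW: "u \<in> W" using cl u s unfolding M.metric_closedin_iff_sequentially_closed by blast
  have uc: "u \<in> carrier H" using uW Wc by auto
  have "(\<lambda>n. hdist H (s n) u) \<longlonglongrightarrow> 0" using u unfolding M.limitin_metric_dist_null by auto
  moreover have "(\<lambda>n. sqrt (d + 1 / (1 + real n))) \<longlonglongrightarrow> sqrt (d + 0)"
    by (intro tendsto_intros LIMSEQ_inverse_real_of_nat[unfolded inverse_eq_divide, simplified])
  ultimately have "(\<lambda>n. sqrt (d + 1 / (1 + real n)) + hdist H (s n) u) \<longlonglongrightarrow> sqrt (d + 0) + 0"
    by (rule tendsto_add[rotated])
  moreover have "sqrt (sq (x \<ominus> u)) \<le> sqrt (d + 1 / (1 + real n)) + hdist H (s n) u" for n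
  proof -
    have "hdist H x u \<le> hdist H x (s n) + hdist H (s n) u" using M.triangle x uc sc by blast
    moreover have "hdist H x (s n) \<le> sqrt (d + 1 / (1 + real n))"
      using s(2)[of n] x sc by (simp add: hdist_eq)
    ultimately show ?thesis using x uc by (simp add: hdist_eq)
  qed
  ultimately have "sqrt (sq (x \<ominus> u)) \<le> sqrt (d + 0) + 0" using LIMSEQ_le_const by blast
  then have ud: "sq (x \<ominus> u) \<le> d" by simp
  have "cinner H (x \<ominus> u) w = 0" if w: "w \<in> W" for w
  proof -
    let ?y = "x \<ominus> u"
    have wc: "w \<in> carrier H" using w Wc by auto
    \<comment> \<open>Minimality of \<open>u\<close> against all points
      \<open>u \<oplus> c \<odot> w\<close> leaves a quadratic polynomial with constant term 0, so
      the bound is 0.\<close>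
    have "(cmod (cinner H ?y w))\<^sup>2 \<le> 0 * sq w"
    proof (rule quadratic_bound)
      fix t :: real
      let ?c = "of_real t * cinner H ?y w"
      have "x \<ominus> (u \<oplus> ?c \<odot> w) = ?y \<ominus> ?c \<odot> w"
        using x uc wc by (simp add: a_minus_def minus_add a_assoc)
      moreover have "d \<le> sq (x \<ominus> (u \<oplus> ?c \<odot> w))" using dle uW w Wadd Wsm by simp
      ultimately have "sq ?y \<le> sq (?y \<ominus> ?c \<odot> w)" using ud by simp
      then show "0 \<le> 0 - 2 * t * (cmod (cinner H ?y w))\<^sup>2 + t\<^sup>2 * (cmod (cinner H ?y w))\<^sup>2 * sq w"
        using sq_minus_smult[of ?y w t] x uc wc by simp
    qed (use wc in auto)
    then show ?thesis by simp
  qed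
  then show ?thesis using that uW by blast
qed

subsection \<open>The GNS representation of a pure state\<close>

context group
begin

context
  fixes \<phi> assumes pd: "posdef \<phi>"
begin

definition nr :: "(complex \<times> 'a) list \<Rightarrow> real"
  where "nr a = sqrt (Re (form \<phi> a a))"

definition dif :: "(complex \<times> 'a) list \<Rightarrow> (complex \<times> 'a) list \<Rightarrow> (complex \<times> 'a) list"
  where "dif a b = a @ lscale (-1) b"

lemma dif_combs [simp]: "a \<in> combs \<Longrightarrow> b \<in> combs \<Longrightarrow> dif a b \<in> combs"
  by (simp add: dif_def)

lemma form_dif_left: "form \<phi> (dif a b) c = form \<phi> a c - form \<phi> b c"
  by (simp add: dif_def)

lemma form_dif_right: "form \<phi> c (dif a b) = form \<phi> c a - form \<phi> c b"
  by (simp add: dif_def)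

lemma nr_nonneg [simp]: "a \<in> combs \<Longrightarrow> 0 \<le> nr a"
  using posdef_form[OF pd] by (simp add: nr_def)

lemma form_self: "a \<in> combs \<Longrightarrow> form \<phi> a a = of_real ((nr a)\<^sup>2)"
  using posdef_form[OF pd, of a] by (simp add: nr_def complex_eq_iff)

lemma form_le_nr:
  assumes "a \<in> combs" "b \<in> combs"
  shows "cmod (form \<phi> a b) \<le> nr a * nr b"
  using real_sqrt_le_mono[OF form_CS[OF pd assms]] by (simp add: real_sqrt_mult nr_def)

lemma nr_triangle:
  assumes "a \<in> combs" "b \<in> combs"
  shows "nr (a @ b) \<le> nr a + nr b"
proof -
  have "Re (form \<phi> (a @ b) (a @ b)) = (nr a)\<^sup>2 + 2 * Re (form \<phi> a b) + (nr b)\<^sup>2"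
    using form_cnj[OF pd assms] assms by (simp add: form_self)
  also have "\<dots> \<le> (nr a)\<^sup>2 + 2 * (nr a * nr b) + (nr b)\<^sup>2"
    using form_le_nr[OF assms] complex_Re_le_cmod[of "form \<phi> a b"] by simp
  also have "\<dots> = (nr a + nr b)\<^sup>2" by (simp add: power2_sum)
  finally show ?thesis
    unfolding nr_def[of "a @ b"] using assms by (intro real_le_lsqrt) auto
qed

lemma nr_lscale: "a \<in> combs \<Longrightarrow> nr (lscale c a) = cmod c * nr a"
proof -
  assume a: "a \<in> combs"
  have "form \<phi> (lscale c a) (lscale c a) = of_real ((cmod c)\<^sup>2) * form \<phi> a a"
    by (subst complex_norm_square) simp
  from arg_cong[OF this, of Re]
  have "Re (form \<phi> (lscale c a) (lscale c a)) = (cmod c)\<^sup>2 * Re (form \<phi> a a)"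
    by (simp del: form_scale_left form_scale_right of_real_power)
  then show ?thesis unfolding nr_def by (simp add: real_sqrt_mult)
qed

text \<open>The GNS space is realized as the reproducing kernel space of functions on the group: its
  elements are the pointwise limits of Cauchy sequences of the functions \<open>vec a\<close>.\<close>

definition lcauchy :: "(nat \<Rightarrow> (complex \<times> 'a) list) \<Rightarrow> bool"
  where "lcauchy s \<longleftrightarrow> (\<forall>n. s n \<in> combs) \<and> (\<forall>\<epsilon>>0. \<exists>N. \<forall>m\<ge>N. \<forall>n\<ge>N. nr (dif (s m) (s n)) < \<epsilon>)"

text \<open>The coefficients of \<open>a\<close> against point masses. Evaluation at
  \<open>z\<close> is then the inner product with \<open>vec [(1, z)]\<close>, so vectors are
  genuine functions and null vectors disappear without a quotient.\<close>

definition vec :: "(complex \<times> 'a) list \<Rightarrow> 'a \<Rightarrow> complex"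
  where "vec a z = (if z \<in> carrier G then form \<phi> a [(1, z)] else 0)"

definition represents :: "(nat \<Rightarrow> (complex \<times> 'a) list) \<Rightarrow> ('a \<Rightarrow> complex) \<Rightarrow> bool"
  where "represents s f \<longleftrightarrow> lcauchy s \<and> (\<forall>z. (\<lambda>n. vec (s n) z) \<longlonglongrightarrow> f z)"

definition RK :: "('a \<Rightarrow> complex) set"
  where "RK = {f. \<exists>s. represents s f}"

definition rep :: "('a \<Rightarrow> complex) \<Rightarrow> nat \<Rightarrow> (complex \<times> 'a) list"
  where "rep f = (SOME s. represents s f)"

text \<open>Defined through chosen approximating sequences; \<open>ip_lim\<close> shows that every
  choice gives the same limit.\<close>

definition ip :: "('a \<Rightarrow> complex) \<Rightarrow> ('a \<Rightarrow> complex) \<Rightarrow> complex"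
  where "ip f g = lim (\<lambda>n. form \<phi> (rep f n) (rep g n))"

lemma lcauchy_combs: "lcauchy s \<Longrightarrow> s n \<in> combs"
  by (simp add: lcauchy_def)

lemma represents_combs: "represents s f \<Longrightarrow> s n \<in> combs"
  by (simp add: lcauchy_def represents_def)

lemma represents_rep: "f \<in> RK \<Longrightarrow> represents (rep f) f"
  unfolding RK_def rep_def mem_Collect_eq by (rule someI_ex[of "\<lambda>s. represents s f"])

lemma rep_combs: "f \<in> RK \<Longrightarrow> rep f n \<in> combs"
  using represents_combs represents_rep by blast

lemma nr_le_dif: "a \<in> combs \<Longrightarrow> b \<in> combs \<Longrightarrow> nr a \<le> nr (dif a b) + nr b"
proof -
  assume ab: "a \<in> combs" "b \<in> combs"
  have "nr a = nr (dif a b @ b)"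
    unfolding nr_def by (simp add: form_dif_left form_dif_right)
  then show ?thesis using nr_triangle ab by simp
qed

lemma lcauchy_bounded:
  assumes "lcauchy s" obtains B where "\<And>n. nr (s n) \<le> B" "0 < B"
proof -
  obtain N where N: "\<And>m n. m \<ge> N \<Longrightarrow> n \<ge> N \<Longrightarrow> nr (dif (s m) (s n)) < 1"
    using assms unfolding lcauchy_def by (meson zero_less_one)
  define B where "B = 1 + (\<Sum>i\<le>N. nr (s i))"
  note c = lcauchy_combs[OF assms]
  have le: "nr (s i) \<le> (\<Sum>i\<le>N. nr (s i))" if "i \<le> N" for i
    by (rule member_le_sum) (use that c in auto)
  have "nr (s n) \<le> B" for n
  proof (cases "n \<le> N")
    case False
    then have "nr (s n) \<le> nr (dif (s n) (s N)) + nr (s N)" using nr_le_dif c by blast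
    then show ?thesis using N[of n N] False le[of N] by (simp add: B_def)
  qed (use le[of n] in \<open>simp add: B_def\<close>)
  moreover have "0 < B" unfolding B_def using c by (intro add_pos_nonneg sum_nonneg) auto
  ultimately show ?thesis using that by blast
qed

lemma form_dif_bound:
  assumes "a \<in> combs" "a' \<in> combs" "b \<in> combs" "b' \<in> combs"
  shows "cmod (form \<phi> a b - form \<phi> a' b') \<le> nr (dif a a') * nr b + nr a' * nr (dif b b')"
proof -
  have "form \<phi> a b - form \<phi> a' b' = form \<phi> (dif a a') b + form \<phi> a' (dif b b')"
    by (simp add: form_dif_left form_dif_right)
  also have "cmod \<dots> \<le> nr (dif a a') * nr b + nr a' * nr (dif b b')"
    using assms by (intro norm_triangle_le add_mono form_le_nr) auto
  finally show ?thesis .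
qed

lemma form_convergent:
  assumes s: "lcauchy s" and t: "lcauchy t"
  shows "convergent (\<lambda>n. form \<phi> (s n) (t n))"
proof -
  obtain B where B: "\<And>n. nr (s n) \<le> B" "0 < B" using lcauchy_bounded[OF s] by blast
  obtain C where C: "\<And>n. nr (t n) \<le> C" "0 < C" using lcauchy_bounded[OF t] by blast
  note c = lcauchy_combs[OF s] lcauchy_combs[OF t]
  have "Cauchy (\<lambda>n. form \<phi> (s n) (t n))"
    unfolding Cauchy_def dist_norm
  proof (intro allI impI)
    fix e :: real assume e: "0 < e"
    obtain M where M: "\<And>m n. m \<ge> M \<Longrightarrow> n \<ge> M \<Longrightarrow> nr (dif (s m) (s n)) < e / (2 * C)"
      using s e C(2) unfolding lcauchy_def by (meson divide_pos_pos mult_pos_pos zero_less_numeral)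
    obtain N where N: "\<And>m n. m \<ge> N \<Longrightarrow> n \<ge> N \<Longrightarrow> nr (dif (t m) (t n)) < e / (2 * B)"
      using t e B(2) unfolding lcauchy_def by (meson divide_pos_pos mult_pos_pos zero_less_numeral)
    have "cmod (form \<phi> (s m) (t m) - form \<phi> (s n) (t n)) < e" if mn: "m \<ge> max M N" "n \<ge> max M N" for m n
    proof -
      have "cmod (form \<phi> (s m) (t m) - form \<phi> (s n) (t n))
          \<le> nr (dif (s m) (s n)) * nr (t m) + nr (s n) * nr (dif (t m) (t n))"
        using form_dif_bound c by blast
      also have "\<dots> \<le> nr (dif (s m) (s n)) * C + B * nr (dif (t m) (t n))"
        using B C c by (intro add_mono mult_mono) (auto intro: less_imp_le)
      also have "\<dots> < e / (2 * C) * C + B * (e / (2 * B))"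
        using M N mn B C by (intro add_strict_mono mult_strict_right_mono mult_strict_left_mono) auto
      also have "\<dots> = e" using B C by simp
      finally show ?thesis .
    qed
    then show "\<exists>M. \<forall>m\<ge>M. \<forall>n\<ge>M. cmod (form \<phi> (s m) (t m) - form \<phi> (s n) (t n)) < e" by blast
  qed
  then show ?thesis by (rule Cauchy_convergent)
qed

lemma form_vec:
  assumes "b \<in> combs"
  shows "form \<phi> a b = (\<Sum>q\<leftarrow>b. cnj (fst q) * vec a (snd q))"
proof -
  have "form \<phi> a b = (\<Sum>q\<leftarrow>b. cnj (fst q) * form \<phi> a [(1, snd q)])"
  proof (induction b)
    case (Cons q b)
    have "q # b = lscale (fst q) [(1, snd q)] @ b" by (simp add: lscale_def)
    then have "form \<phi> a (q # b) = form \<phi> a (lscale (fst q) [(1, snd q)] @ b)" by metis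
    then show ?case using Cons by simp
  qed simp
  also have "\<dots> = (\<Sum>q\<leftarrow>b. cnj (fst q) * vec a (snd q))"
    using combsD[OF assms] by (auto simp: vec_def intro!: arg_cong[where f=sum_list] map_cong)
  finally show ?thesis .
qed

lemma form_represents:
  assumes "represents s f" "b \<in> combs"
  shows "(\<lambda>n. form \<phi> (s n) b) \<longlonglongrightarrow> (\<Sum>q\<leftarrow>b. cnj (fst q) * f (snd q))"
  unfolding form_vec[OF assms(2)]
proof (induction b)
  case (Cons q b)
  then show ?case using assms(1) unfolding represents_def by (auto intro!: tendsto_intros)
qed simp

text \<open>For fixed \<open>N\<close>, pointwise convergence to 0 makes
  \<open>form \<phi> (s n) (s N)\<close> tend to 0, and for large \<open>N\<close> the Cauchy
  property keeps \<open>form \<phi> (s n) (s n)\<close> close to it. Hence no vector of positive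
  norm is lost when vectors are replaced by functions.\<close>

lemma represents_zero:
  assumes "represents s (\<lambda>_. 0)"
  shows "(\<lambda>n. nr (s n)) \<longlonglongrightarrow> 0"
proof -
  have s: "lcauchy s" using assms by (simp add: represents_def)
  note c = lcauchy_combs[OF s]
  obtain B where B: "\<And>n. nr (s n) \<le> B" "0 < B" using lcauchy_bounded[OF s] by blast
  obtain L where L: "(\<lambda>n. form \<phi> (s n) (s n)) \<longlonglongrightarrow> L"
    using form_convergent[OF s s] by (auto simp: convergent_def)
  have "cmod L \<le> e" if e: "e > 0" for e
  proof -
    obtain N where N: "\<And>m n. m \<ge> N \<Longrightarrow> n \<ge> N \<Longrightarrow> nr (dif (s m) (s n)) < e / B"
      using s B(2) e unfolding lcauchy_def by (meson divide_pos_pos)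
    have "(\<lambda>n. form \<phi> (s n) (s N)) \<longlonglongrightarrow> (\<Sum>q\<leftarrow>s N. cnj (fst q) * (\<lambda>_. 0) (snd q))"
      by (rule form_represents[OF assms c])
    then have "(\<lambda>n. form \<phi> (s n) (s n) - form \<phi> (s n) (s N)) \<longlonglongrightarrow> L - 0"
      using L by (intro tendsto_diff) auto
    then have "(\<lambda>n. cmod (form \<phi> (s n) (s n) - form \<phi> (s n) (s N))) \<longlonglongrightarrow> cmod L"
      by (intro tendsto_norm) simp
    moreover have "cmod (form \<phi> (s n) (s n) - form \<phi> (s n) (s N)) \<le> e" if "n \<ge> N" for n
    proof -
      have "cmod (form \<phi> (s n) (s n) - form \<phi> (s n) (s N)) \<le> nr (s n) * nr (dif (s n) (s N))"
        using form_le_nr[of "s n" "dif (s n) (s N)"] c by (simp add: form_dif_right)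
      also have "\<dots> \<le> B * (e / B)" using B N[of n N] that c
        by (intro mult_mono) (auto intro: less_imp_le)
      finally show ?thesis using B by simp
    qed
    ultimately show ?thesis by (intro LIMSEQ_le_const2) auto
  qed
  then have "cmod L \<le> 0" by (rule dense_ge)
  then have "L = 0" by simp
  then have "(\<lambda>n. sqrt (Re (form \<phi> (s n) (s n)))) \<longlonglongrightarrow> sqrt (Re 0)" using L by (intro tendsto_intros) auto
  then show ?thesis by (simp add: nr_def)
qed

lemma lcauchy_append: 
  assumes "lcauchy s" "lcauchy t" shows "lcauchy (\<lambda>n. s n @ t n)"
  unfolding lcauchy_def
proof (intro conjI allI impI)
  note c = lcauchy_combs[OF assms(1)] lcauchy_combs[OF assms(2)]
  fix \<epsilon> :: real assume \<epsilon>: "\<epsilon> > 0"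
  obtain M where M: "\<And>m n. m \<ge> M \<Longrightarrow> n \<ge> M \<Longrightarrow> nr (dif (s m) (s n)) < \<epsilon> / 2"
    using assms(1) \<epsilon> unfolding lcauchy_def by (meson half_gt_zero)
  obtain N where N: "\<And>m n. m \<ge> N \<Longrightarrow> n \<ge> N \<Longrightarrow> nr (dif (t m) (t n)) < \<epsilon> / 2"
    using assms(2) \<epsilon> unfolding lcauchy_def by (meson half_gt_zero)
  have "nr (dif (s m @ t m) (s n @ t n)) < \<epsilon>" if "m \<ge> max M N" "n \<ge> max M N" for m n
  proof -
    have "nr (dif (s m @ t m) (s n @ t n)) = nr (dif (s m) (s n) @ dif (t m) (t n))"
      unfolding nr_def by (simp add: form_dif_left form_dif_right algebra_simps)
    also have "\<dots> \<le> nr (dif (s m) (s n)) + nr (dif (t m) (t n))" using c by (intro nr_triangle) auto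
    also have "\<dots> < \<epsilon>" using M[of m n] N[of m n] that by simp
    finally show ?thesis .
  qed
  then show "\<exists>N. \<forall>m\<ge>N. \<forall>n\<ge>N. nr (dif (s m @ t m) (s n @ t n)) < \<epsilon>" by blast
qed (use assms lcauchy_combs in auto)

lemma lcauchy_lscale:
  assumes "lcauchy s" shows "lcauchy (\<lambda>n. lscale k (s n))"
  unfolding lcauchy_def
proof (intro conjI allI impI)
  note c = lcauchy_combs[OF assms]
  fix \<epsilon> :: real assume \<epsilon>: "\<epsilon> > 0"
  have pos: "0 < cmod k + 1" by (simp add: add_nonneg_pos)
  obtain M where M: "\<And>m n. m \<ge> M \<Longrightarrow> n \<ge> M \<Longrightarrow> nr (dif (s m) (s n)) < \<epsilon> / (cmod k + 1)"
    using assms \<epsilon> pos unfolding lcauchy_def by (meson divide_pos_pos)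
  have "nr (dif (lscale k (s m)) (lscale k (s n))) < \<epsilon>" if "m \<ge> M" "n \<ge> M" for m n
  proof -
    have "nr (dif (lscale k (s m)) (lscale k (s n))) = nr (lscale k (dif (s m) (s n)))"
      unfolding nr_def by (simp add: form_dif_left form_dif_right algebra_simps)
    also have "\<dots> = cmod k * nr (dif (s m) (s n))" using c by (simp add: nr_lscale)
    also have "\<dots> \<le> (cmod k + 1) * nr (dif (s m) (s n))" using c by (intro mult_right_mono) auto
    also have "\<dots> < \<epsilon>" using M[OF that] pos by (simp add: pos_less_divide_eq mult.commute)
    finally show ?thesis .
  qed
  then show "\<exists>N. \<forall>m\<ge>N. \<forall>n\<ge>N. nr (dif (lscale k (s m)) (lscale k (s n))) < \<epsilon>" by blast
qed (use assms lcauchy_combs in auto)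

lemma vec_append: "vec (a @ b) z = vec a z + vec b z"
  by (simp add: vec_def)

lemma vec_lscale: "vec (lscale k a) z = k * vec a z"
  by (simp add: vec_def)

lemma represents_add:
  "represents s f \<Longrightarrow> represents t g \<Longrightarrow> represents (\<lambda>n. s n @ t n) (\<lambda>z. f z + g z)"
  unfolding represents_def vec_append by (auto intro: lcauchy_append tendsto_add)

lemma represents_cmult:
  "represents s f \<Longrightarrow> represents (\<lambda>n. lscale k (s n)) (\<lambda>z. k * f z)"
  unfolding represents_def vec_lscale by (auto intro: lcauchy_lscale tendsto_mult)

lemma represents_vec: "a \<in> combs \<Longrightarrow> represents (\<lambda>_. a) (vec a)"
proof -
  assume a: "a \<in> combs"
  have "nr (dif a a) = 0" unfolding nr_def by (simp add: form_dif_left)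
  then show ?thesis using a by (simp add: represents_def lcauchy_def)
qed

lemma represents_unique_lim:
  assumes "represents s f" "represents t f"
  shows "(\<lambda>n. nr (dif (s n) (t n))) \<longlonglongrightarrow> 0"
proof -
  have "represents (\<lambda>n. dif (s n) (t n)) (\<lambda>z. f z + (-1) * f z)"
    unfolding dif_def by (intro represents_add represents_cmult assms)
  then show ?thesis by (intro represents_zero) simp
qed

lemma ip_lim:
  assumes s: "represents s f" and t: "represents t g"
  shows "(\<lambda>n. form \<phi> (s n) (t n)) \<longlonglongrightarrow> ip f g"
proof -
  have r: "represents (rep f) f" "represents (rep g) g"
    using s t represents_rep by (auto simp: RK_def)
  then have L: "(\<lambda>n. form \<phi> (rep f n) (rep g n)) \<longlonglongrightarrow> ip f g"
    unfolding ip_def by (intro convergent_LIMSEQ_iff[THEN iffD1] form_convergent) (auto simp: represents_def)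
  note c = represents_combs[OF s] represents_combs[OF t] represents_combs[OF r(1)] represents_combs[OF r(2)]
  obtain B where B: "\<And>n. nr (t n) \<le> B" "0 < B" using lcauchy_bounded t by (auto simp: represents_def)
  obtain C where C: "\<And>n. nr (rep f n) \<le> C" "0 < C" using lcauchy_bounded r by (auto simp: represents_def)
  have "(\<lambda>n. nr (dif (s n) (rep f n)) * B + C * nr (dif (t n) (rep g n))) \<longlonglongrightarrow> 0 * B + C * 0"
    by (intro tendsto_intros represents_unique_lim[OF s r(1)] represents_unique_lim[OF t r(2)])
  then have "(\<lambda>n. nr (dif (s n) (rep f n)) * B + C * nr (dif (t n) (rep g n))) \<longlonglongrightarrow> 0" by simp
  then have "(\<lambda>n. form \<phi> (s n) (t n) - form \<phi> (rep f n) (rep g n)) \<longlonglongrightarrow> 0"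
  proof (rule Lim_null_comparison[rotated], intro always_eventually allI)
    fix n
    have "cmod (form \<phi> (s n) (t n) - form \<phi> (rep f n) (rep g n))
       \<le> nr (dif (s n) (rep f n)) * nr (t n) + nr (rep f n) * nr (dif (t n) (rep g n))"
      using form_dif_bound c by blast
    also have "\<dots> \<le> nr (dif (s n) (rep f n)) * B + C * nr (dif (t n) (rep g n))"
      using B C c by (intro add_mono mult_mono) (auto intro: less_imp_le)
    finally show "cmod (form \<phi> (s n) (t n) - form \<phi> (rep f n) (rep g n))
      \<le> nr (dif (s n) (rep f n)) * B + C * nr (dif (t n) (rep g n))" .
  qed
  from tendsto_add[OF this L] show ?thesis by simp
qed

lemma RK_add: "f \<in> RK \<Longrightarrow> g \<in> RK \<Longrightarrow> (\<lambda>z. f z + g z) \<in> RK"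
  unfolding RK_def using represents_add by blast

lemma RK_cmult: "f \<in> RK \<Longrightarrow> (\<lambda>z. k * f z) \<in> RK"
  unfolding RK_def using represents_cmult by blast

lemma RK_vec: "a \<in> combs \<Longrightarrow> vec a \<in> RK"
  unfolding RK_def using represents_vec by blast

lemma RK_zero: "(\<lambda>_. 0) \<in> RK"
proof -
  have "vec [] = (\<lambda>_. 0)" by (auto simp: vec_def)
  then show ?thesis using RK_vec[of "[]"] by simp
qed

lemma RK_off:
  assumes "f \<in> RK" "z \<notin> carrier G" shows "f z = 0"
proof -
  have "(\<lambda>n. vec (rep f n) z) \<longlonglongrightarrow> f z"
    using represents_rep[OF assms(1)] by (simp add: represents_def)
  moreover have "vec (rep f n) z = 0" for n using assms by (simp add: vec_def)
  ultimately show ?thesis by (simp add: LIMSEQ_const_iff)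
qed

lemma ip_add:
  assumes "f \<in> RK" "g \<in> RK" "h \<in> RK"
  shows "ip (\<lambda>z. f z + g z) h = ip f h + ip g h"
proof -
  have "(\<lambda>n. form \<phi> (rep f n @ rep g n) (rep h n)) \<longlonglongrightarrow> ip (\<lambda>z. f z + g z) h"
    by (intro ip_lim represents_add represents_rep assms)
  moreover have "(\<lambda>n. form \<phi> (rep f n @ rep g n) (rep h n)) \<longlonglongrightarrow> ip f h + ip g h"
    by (simp, intro tendsto_add ip_lim represents_rep assms)
  ultimately show ?thesis by (rule LIMSEQ_unique)
qed

lemma ip_cmult:
  assumes "f \<in> RK" "h \<in> RK"
  shows "ip (\<lambda>z. k * f z) h = k * ip f h"
proof -
  have "(\<lambda>n. form \<phi> (lscale k (rep f n)) (rep h n)) \<longlonglongrightarrow> ip (\<lambda>z. k * f z) h"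
    by (intro ip_lim represents_cmult represents_rep assms)
  moreover have "(\<lambda>n. form \<phi> (lscale k (rep f n)) (rep h n)) \<longlonglongrightarrow> k * ip f h"
    by (simp, intro tendsto_mult tendsto_const ip_lim represents_rep assms)
  ultimately show ?thesis by (rule LIMSEQ_unique)
qed

lemma ip_cnj:
  assumes "f \<in> RK" "g \<in> RK"
  shows "ip g f = cnj (ip f g)"
proof -
  have "(\<lambda>n. cnj (form \<phi> (rep f n) (rep g n))) \<longlonglongrightarrow> cnj (ip f g)"
    by (intro tendsto_cnj ip_lim represents_rep assms)
  moreover have "cnj (form \<phi> (rep f n) (rep g n)) = form \<phi> (rep g n) (rep f n)" for n
    using form_cnj[OF pd, of "rep f n" "rep g n"] rep_combs assms by simp
  ultimately have "(\<lambda>n. form \<phi> (rep g n) (rep f n)) \<longlonglongrightarrow> cnj (ip f g)" by simp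
  moreover have "(\<lambda>n. form \<phi> (rep g n) (rep f n)) \<longlonglongrightarrow> ip g f"
    by (intro ip_lim represents_rep assms)
  ultimately show ?thesis by (rule LIMSEQ_unique[rotated])
qed

lemma ip_vec:
  assumes "f \<in> RK" "b \<in> combs"
  shows "ip f (vec b) = (\<Sum>q\<leftarrow>b. cnj (fst q) * f (snd q))"
proof -
  have "(\<lambda>n. form \<phi> (rep f n) b) \<longlonglongrightarrow> ip f (vec b)"
    by (intro ip_lim represents_rep represents_vec assms)
  then show ?thesis
    using form_represents[OF represents_rep[OF assms(1)] assms(2)] LIMSEQ_unique by blast
qed

lemma ip_vec_vec: "a \<in> combs \<Longrightarrow> b \<in> combs \<Longrightarrow> ip (vec a) (vec b) = form \<phi> a b"
  by (simp add: ip_vec RK_vec form_vec)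

lemma ip_lim_self:
  assumes "represents s f" shows "(\<lambda>n. (nr (s n))\<^sup>2) \<longlonglongrightarrow> Re (ip f f)"
proof -
  have "(\<lambda>n. Re (form \<phi> (s n) (s n))) \<longlonglongrightarrow> Re (ip f f)"
    by (intro tendsto_Re ip_lim assms)
  then show ?thesis using represents_combs[OF assms] by (simp add: form_self)
qed

text \<open>Cauchy-Schwarz against point masses: a vector of norm 0 has all values 0.\<close>

lemma ip_self_zero:
  assumes "f \<in> RK" "Re (ip f f) = 0" shows "f = (\<lambda>_. 0)"
proof
  fix z
  have r: "represents (rep f) f" using assms represents_rep by blast
  note c = represents_combs[OF r]
  show "f z = 0"
  proof (cases "z \<in> carrier G")
    case True
    have "(\<lambda>n. sqrt ((nr (rep f n))\<^sup>2)) \<longlonglongrightarrow> sqrt (Re (ip f f))"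
      by (intro tendsto_real_sqrt ip_lim_self r)
    then have "(\<lambda>n. nr (rep f n)) \<longlonglongrightarrow> 0" using c assms by simp
    then have "(\<lambda>n. nr (rep f n) * nr [(1, z)]) \<longlonglongrightarrow> 0" by (rule tendsto_mult_left_zero)
    then have "(\<lambda>n. vec (rep f n) z) \<longlonglongrightarrow> 0"
      by (rule Lim_null_comparison[rotated])
        (use c True form_le_nr in \<open>auto simp: vec_def intro!: always_eventually\<close>)
    then show ?thesis using r LIMSEQ_unique unfolding represents_def by blast
  qed (use assms RK_off in auto)
qed

lemma ip_self_nonneg: "f \<in> RK \<Longrightarrow> 0 \<le> Re (ip f f)"
  by (rule LIMSEQ_le_const[OF ip_lim_self[OF represents_rep]]) auto

lemma represents_approx:
  assumes "represents s f" "0 < \<epsilon>"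
  shows "\<exists>N. \<forall>m\<ge>N. Re (ip (\<lambda>z. f z + (-1) * vec (s m) z) (\<lambda>z. f z + (-1) * vec (s m) z)) \<le> \<epsilon>\<^sup>2"
proof -
  have s: "lcauchy s" using assms by (simp add: represents_def)
  obtain N where N: "\<And>m n. m \<ge> N \<Longrightarrow> n \<ge> N \<Longrightarrow> nr (dif (s m) (s n)) < \<epsilon>"
    using s assms(2) unfolding lcauchy_def by meson
  have "Re (ip (\<lambda>z. f z + (-1) * vec (s m) z) (\<lambda>z. f z + (-1) * vec (s m) z)) \<le> \<epsilon>\<^sup>2" if m: "m \<ge> N" for m
  proof -
    have "represents (\<lambda>n. dif (s n) (s m)) (\<lambda>z. f z + (-1) * vec (s m) z)"
      unfolding dif_def using lcauchy_combs[OF s]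
      by (intro represents_add represents_cmult assms represents_vec)
    from ip_lim_self[OF this] show ?thesis
    proof (rule LIMSEQ_le_const2, intro exI allI impI)
      fix n assume "N \<le> n"
      then show "(nr (dif (s n) (s m)))\<^sup>2 \<le> \<epsilon>\<^sup>2"
        using N[of n m] m lcauchy_combs[OF s] by (intro power_mono) (auto intro: less_imp_le)
    qed
  qed
  then show ?thesis by blast
qed

lemma lcauchy_represents:
  assumes b: "lcauchy b"
  obtains f where "represents b f"
proof -
  have "convergent (\<lambda>n. vec (b n) z)" for z
  proof (cases "z \<in> carrier G")
    case True
    then have "lcauchy (\<lambda>_. [(1, z)])" using represents_vec[of "[(1, z)]"] by (simp add: represents_def)
    then show ?thesis using form_convergent[OF b] True by (simp add: vec_def)
  qed (simp add: vec_def convergent_const)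
  then have "represents b (\<lambda>z. lim (\<lambda>n. vec (b n) z))"
    using b by (simp add: represents_def convergent_LIMSEQ_iff)
  then show ?thesis using that by blast
qed

definition translate :: "'a \<Rightarrow> ('a \<Rightarrow> complex) \<Rightarrow> 'a \<Rightarrow> complex"
  where "translate x f z = (if z \<in> carrier G then f (inv x \<otimes> z) else 0)"

lemma vec_shift: "x \<in> carrier G \<Longrightarrow> a \<in> combs \<Longrightarrow> vec (shift x a) z = translate x (vec a) z"
  using form_shift_left[of x a "[(1, z)]" \<phi>] by (simp add: vec_def translate_def)

lemma represents_translate:
  assumes "represents s f" "x \<in> carrier G"
  shows "represents (\<lambda>n. shift x (s n)) (translate x f)"
proof -
  note c = represents_combs[OF assms(1)]
  have "dif (shift x (s m)) (shift x (s n)) = shift x (dif (s m) (s n))" for m n by (simp add: dif_def)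
  then have "nr (dif (shift x (s m)) (shift x (s n))) = nr (dif (s m) (s n))" for m n
    unfolding nr_def using c assms(2) by (simp add: form_shift)
  then show ?thesis using assms c unfolding represents_def lcauchy_def
    by (auto simp: vec_shift translate_def)
qed

lemma RK_translate: "f \<in> RK \<Longrightarrow> x \<in> carrier G \<Longrightarrow> translate x f \<in> RK"
  unfolding RK_def using represents_translate by blast

lemma ip_translate:
  assumes "f \<in> RK" "g \<in> RK" "x \<in> carrier G"
  shows "ip (translate x f) (translate x g) = ip f g"
proof -
  have "(\<lambda>n. form \<phi> (shift x (rep f n)) (shift x (rep g n))) \<longlonglongrightarrow> ip (translate x f) (translate x g)"
    by (intro ip_lim represents_translate represents_rep assms)
  then have "(\<lambda>n. form \<phi> (rep f n) (rep g n)) \<longlonglongrightarrow> ip (translate x f) (translate x g)"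
    using rep_combs assms by (simp add: form_shift)
  moreover have "(\<lambda>n. form \<phi> (rep f n) (rep g n)) \<longlonglongrightarrow> ip f g"
    by (intro ip_lim represents_rep assms)
  ultimately show ?thesis by (rule LIMSEQ_unique)
qed

lemma translate_translate:
  "x \<in> carrier G \<Longrightarrow> y \<in> carrier G \<Longrightarrow> translate x (translate y f) = translate (x \<otimes> y) f"
  by (auto simp: translate_def fun_eq_iff inv_mult_group m_assoc)

lemma translate_one: "f \<in> RK \<Longrightarrow> translate \<one> f = f"
  by (auto simp: translate_def fun_eq_iff RK_off)

end

end

section \<open>The GNS representation on a prescribed type of vectors\<close>

lemma unitary_group_simps:
  "carrier (unitary_group H) = unitaries H"
  "\<one>\<^bsub>unitary_group H\<^esub> = (\<lambda>x\<in>carrier H. x)"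
  "U \<in> unitaries H \<Longrightarrow> V \<in> unitaries H \<Longrightarrow> U \<otimes>\<^bsub>unitary_group H\<^esub> V = compose (carrier H) U V"
  by (auto simp: unitary_group_def BijGroup_def unitaries_def)

text \<open>There are at most continuum many such functions: the real and imaginary parts of the
  values become sets of naturals, and countably many of these are packed into one set by
  \<open>to_nat\<close>. Therefore the GNS spaces of a countable group fit into any type that
  contains a copy of the reals.\<close>

lemma inj_on_countable_support:
  assumes A: "countable A" and u: "inj (u :: real \<Rightarrow> 'h)"
  obtains j :: "('a \<Rightarrow> complex) \<Rightarrow> 'h" where "inj_on j {f. \<forall>x. x \<notin> A \<longrightarrow> f x = 0}"
proof -
  obtain e :: "nat set \<Rightarrow> real" where e: "bij e"
    using nat_sets_eqpoll_reals by (auto simp: eqpoll_def)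
  have inv_e: "inj (inv_into UNIV e)" using e by (simp add: bij_imp_bij_inv bij_is_inj)
  define part where "part = (\<lambda>(b :: bool) (c :: complex). if b then Re c else Im c)"
  define code where "code = (\<lambda>f :: 'a \<Rightarrow> complex.
    {m. \<exists>n b k. m = to_nat (n :: nat, b, k :: nat) \<and> k \<in> inv_into UNIV e (part b (f (from_nat_into A n)))})"
  have mem: "k \<in> inv_into UNIV e (part b (f (from_nat_into A n))) \<longleftrightarrow> to_nat (n, b, k) \<in> code f" for f n b k
    unfolding code_def by auto
  have "inj_on code {f. \<forall>x. x \<notin> A \<longrightarrow> f x = 0}"
  proof (rule inj_onI)
    fix f g :: "'a \<Rightarrow> complex"
    assume f: "f \<in> {f. \<forall>x. x \<notin> A \<longrightarrow> f x = 0}" and g: "g \<in> {f. \<forall>x. x \<notin> A \<longrightarrow> f x = 0}"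
      and eq: "code f = code g"
    have "part b (f (from_nat_into A n)) = part b (g (from_nat_into A n))" for b n
      by (rule injD[OF inv_e]) (use mem eq in blast)
    then have "f (from_nat_into A n) = g (from_nat_into A n)" for n
      unfolding part_def complex_eq_iff by (metis (full_types))
    then have "f x = g x" if "x \<in> A" for x using from_nat_into_surj[OF A that] by metis
    then have "f x = g x" for x using f g by (cases "x \<in> A") auto
    then show "f = g" by auto
  qed
  moreover have "inj (\<lambda>S. u (e S))" using u e by (auto simp: inj_def bij_def)
  ultimately have "inj_on (\<lambda>f. u (e (code f))) {f. \<forall>x. x \<notin> A \<longrightarrow> f x = 0}"
    by (auto simp: inj_on_def inj_def)
  then show ?thesis using that by blast
qed

context group
begin

context
  fixes \<phi> and j :: "('a \<Rightarrow> complex) \<Rightarrow> 'h"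
  assumes pd: "posdef \<phi>" and inj: "inj_on j (RK \<phi>)"
begin

definition dec :: "'h \<Rightarrow> 'a \<Rightarrow> complex"
  where "dec = inv_into (RK \<phi>) j"

text \<open>The functions are renamed along \<open>j\<close>, since the representation has to act on
  elements of the prescribed type; \<open>dec\<close> undoes the renaming.\<close>

definition gns_space :: "'h hilbert"
  where "gns_space = \<lparr>carrier = j ` RK \<phi>, monoid.mult = (\<lambda>u v. u), one = j (\<lambda>_. 0),
    zero = j (\<lambda>_. 0), add = (\<lambda>u v. j (\<lambda>z. dec u z + dec v z)),
    module.smult = (\<lambda>c u. j (\<lambda>z. c * dec u z)), cinner = (\<lambda>u v. ip \<phi> (dec u) (dec v))\<rparr>"

definition gns_rep :: "'a \<Rightarrow> 'h \<Rightarrow> 'h"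
  where "gns_rep x = (\<lambda>u\<in>j ` RK \<phi>. j (translate x (dec u)))"

lemma dec_j [simp]: "f \<in> RK \<phi> \<Longrightarrow> dec (j f) = f"
  unfolding dec_def using inj by (rule inv_into_f_f)

lemma gns_simps [simp]:
  "carrier gns_space = j ` RK \<phi>"
  "\<zero>\<^bsub>gns_space\<^esub> = j (\<lambda>_. 0)"
  "f \<in> RK \<phi> \<Longrightarrow> g \<in> RK \<phi> \<Longrightarrow> j f \<oplus>\<^bsub>gns_space\<^esub> j g = j (\<lambda>z. f z + g z)"
  "f \<in> RK \<phi> \<Longrightarrow> c \<odot>\<^bsub>gns_space\<^esub> j f = j (\<lambda>z. c * f z)"
  "f \<in> RK \<phi> \<Longrightarrow> g \<in> RK \<phi> \<Longrightarrow> cinner gns_space (j f) (j g) = ip \<phi> f g"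
  by (auto simp: gns_space_def)

lemmas RK_intros = RK_add[OF pd] RK_cmult[OF pd] RK_zero[OF pd] RK_translate[OF pd] RK_vec[OF pd]

lemma j_eq_iff: "f \<in> RK \<phi> \<Longrightarrow> g \<in> RK \<phi> \<Longrightarrow> j f = j g \<longleftrightarrow> f = g"
  using inj by (auto simp: inj_on_def)

lemma gns_inner_product_space: "complex_inner_product_space gns_space"
proof (intro complex_inner_product_space.intro complex_inner_product_space_axioms.intro)
  show "module ring_of_type_algebra gns_space"
  proof (rule moduleI)
    show "abelian_group gns_space"
    proof (rule abelian_groupI)
      fix x assume "x \<in> carrier gns_space"
      then obtain f where f: "f \<in> RK \<phi>" "x = j f" by auto
      have "j (\<lambda>z. -1 * f z) \<oplus>\<^bsub>gns_space\<^esub> x = \<zero>\<^bsub>gns_space\<^esub>"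
        using f RK_cmult[OF pd f(1), of "-1"] by simp
      then show "\<exists>y\<in>carrier gns_space. y \<oplus>\<^bsub>gns_space\<^esub> x = \<zero>\<^bsub>gns_space\<^esub>"
        using RK_cmult[OF pd f(1), of "-1"] by auto
    qed (auto simp: RK_intros algebra_simps)
  qed (auto simp: RK_intros algebra_simps comm_ring_1_class.cring_from_type_algebra)
next
  fix x assume "x \<in> carrier gns_space" "x \<noteq> \<zero>\<^bsub>gns_space\<^esub>"
  then obtain f where f: "f \<in> RK \<phi>" "x = j f" "f \<noteq> (\<lambda>_. 0)" by auto
  then show "0 < Re (cinner gns_space x x)"
    using ip_self_zero[OF pd f(1)] ip_self_nonneg[OF pd f(1)] by fastforce
next
  fix x y assume "x \<in> carrier gns_space" "y \<in> carrier gns_space"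
  then show "cinner gns_space y x = cnj (cinner gns_space x y)"
    by (auto intro: ip_cnj[OF pd])
qed (auto simp: RK_intros ip_add[OF pd] ip_cmult[OF pd])

interpretation C: complex_inner_product_space gns_space
  by (rule gns_inner_product_space)

lemma gns_minus:
  assumes "f \<in> RK \<phi>" "g \<in> RK \<phi>"
  shows "j f \<ominus>\<^bsub>gns_space\<^esub> j g = j (\<lambda>z. f z + -1 * g z)"
proof -
  have "\<ominus>\<^bsub>gns_space\<^esub> j g = j (\<lambda>z. -1 * g z)"
    by (rule C.minus_equality) (use assms RK_cmult[OF pd assms(2), of "-1"] in auto)
  then show ?thesis using assms RK_cmult[OF pd assms(2), of "-1"] by (simp add: a_minus_def)
qed

lemma gns_dist:
  assumes "f \<in> RK \<phi>" "g \<in> RK \<phi>"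
  shows "hdist gns_space (j f) (j g) = sqrt (Re (ip \<phi> (\<lambda>z. f z + -1 * g z) (\<lambda>z. f z + -1 * g z)))"
  using assms RK_add[OF pd assms(1) RK_cmult[OF pd assms(2), of "-1"]]
  by (simp add: hdist_def gns_minus)

lemma gns_dist_vec:
  assumes "a \<in> combs" "b \<in> combs"
  shows "hdist gns_space (j (vec \<phi> a)) (j (vec \<phi> b)) = nr \<phi> (dif a b)"
proof -
  have "(\<lambda>z. vec \<phi> a z + -1 * vec \<phi> b z) = vec \<phi> (dif a b)"
    unfolding dif_def[OF pd] vec_append[OF pd] vec_lscale[OF pd] ..
  then show ?thesis using assms
    by (simp add: gns_dist RK_intros ip_vec_vec[OF pd] dif_combs[OF pd] nr_def[OF pd])
qed

lemma gns_approx: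
  assumes "represents \<phi> s f" "0 < \<epsilon>"
  shows "\<exists>N. \<forall>m\<ge>N. hdist gns_space (j f) (j (vec \<phi> (s m))) \<le> \<epsilon>"
proof -
  obtain N where N: "\<And>m. m \<ge> N \<Longrightarrow>
      Re (ip \<phi> (\<lambda>z. f z + (-1) * vec \<phi> (s m) z) (\<lambda>z. f z + (-1) * vec \<phi> (s m) z)) \<le> \<epsilon>\<^sup>2"
    using represents_approx[OF pd assms] by blast
  have "f \<in> RK \<phi>" "\<And>m. vec \<phi> (s m) \<in> RK \<phi>"
    using assms(1) RK_intros represents_combs[OF pd assms(1)] by (auto simp: RK_def[OF pd])
  then have "hdist gns_space (j f) (j (vec \<phi> (s m))) \<le> \<epsilon>" if "m \<ge> N" for m
    unfolding gns_dist[OF \<open>f \<in> RK \<phi>\<close> \<open>\<And>m. vec \<phi> (s m) \<in> RK \<phi>\<close>]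
    using N[OF that] assms(2) by (intro real_le_lsqrt) auto
  then show ?thesis by blast
qed

interpretation M: Metric_space "j ` RK \<phi>" "hdist gns_space"
  using C.Metric_space_hdist by simp

text \<open>Replace the term with index \<open>k\<close> of a Cauchy sequence by a finite
  combination at distance at most \<open>1 / (1 + k)\<close>. The combinations again form a Cauchy
  sequence, and their pointwise limit is the limit of the original terms.\<close>

lemma gns_hilbert_space: "complex_hilbert_space gns_space"
proof (intro complex_hilbert_space.intro gns_inner_product_space complex_hilbert_space_axioms.intro)
  have "M.mcomplete" unfolding M.mcomplete_def
  proof (intro allI impI)
    fix \<sigma> assume \<sigma>: "M.MCauchy \<sigma>"
    then have "\<forall>k. \<exists>f\<in>RK \<phi>. \<sigma> k = j f" by (auto simp: M.MCauchy_def image_subset_iff image_iff)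
    then obtain F where F: "\<And>k. F k \<in> RK \<phi>" "\<And>k. \<sigma> k = j (F k)" by metis
    have "\<exists>b\<in>combs. hdist gns_space (\<sigma> k) (j (vec \<phi> b)) \<le> 1 / (1 + real k)" for k
    proof -
      obtain s where s: "represents \<phi> s (F k)" using F(1) by (auto simp: RK_def[OF pd])
      then show ?thesis using gns_approx[OF s, of "1 / (1 + real k)"] represents_combs[OF pd s] F(2)
        by (metis (no_types, lifting) add_pos_nonneg of_nat_0_le_iff order_refl zero_less_divide_1_iff zero_less_one)
    qed
    then obtain b where b: "\<And>k. b k \<in> combs"
      "\<And>k. hdist gns_space (\<sigma> k) (j (vec \<phi> (b k))) \<le> 1 / (1 + real k)" by metis
    have \<sigma>in: "\<sigma> k \<in> j ` RK \<phi>" for k using F by auto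
    have bin: "j (vec \<phi> (b k)) \<in> j ` RK \<phi>" for k using b(1) RK_intros by auto
    have inv0: "\<exists>N. \<forall>k\<ge>N. 1 / (1 + real k) < \<epsilon>" if \<epsilon>: "\<epsilon> > 0" for \<epsilon>
    proof -
      obtain N where N: "inverse (real (Suc N)) < \<epsilon>" using reals_Archimedean[OF \<epsilon>] by blast
      have "1 / (1 + real k) < \<epsilon>" if "k \<ge> N" for k
      proof -
        have "1 / (1 + real k) \<le> 1 / (1 + real N)"
          using that by (intro divide_left_mono) (auto intro: add_pos_nonneg)
        then show ?thesis using N by (simp add: inverse_eq_divide)
      qed
      then show ?thesis by blast
    qed
    have "lcauchy \<phi> b" unfolding lcauchy_def[OF pd]
    proof (intro conjI allI impI)
      fix \<epsilon> :: real assume \<epsilon>: "\<epsilon> > 0"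
      obtain N1 where N1: "\<And>m n. m \<ge> N1 \<Longrightarrow> n \<ge> N1 \<Longrightarrow> hdist gns_space (\<sigma> m) (\<sigma> n) < \<epsilon> / 3"
        using \<sigma> \<epsilon> unfolding M.MCauchy_def by (metis zero_less_divide_iff zero_less_numeral)
      obtain N2 where N2: "\<And>k. k \<ge> N2 \<Longrightarrow> 1 / (1 + real k) < \<epsilon> / 3"
        using inv0[of "\<epsilon> / 3"] \<epsilon> by auto
      have "nr \<phi> (dif (b m) (b n)) < \<epsilon>" if "m \<ge> max N1 N2" "n \<ge> max N1 N2" for m n
      proof -
        have "hdist gns_space (j (vec \<phi> (b m))) (j (vec \<phi> (b n)))
          \<le> hdist gns_space (j (vec \<phi> (b m))) (\<sigma> m) + hdist gns_space (\<sigma> m) (j (vec \<phi> (b n)))"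
          by (rule M.triangle[OF bin \<sigma>in bin])
        also have "hdist gns_space (\<sigma> m) (j (vec \<phi> (b n)))
          \<le> hdist gns_space (\<sigma> m) (\<sigma> n) + hdist gns_space (\<sigma> n) (j (vec \<phi> (b n)))"
          by (rule M.triangle[OF \<sigma>in \<sigma>in bin])
        finally have "nr \<phi> (dif (b m) (b n)) \<le> hdist gns_space (\<sigma> m) (j (vec \<phi> (b m)))
            + (hdist gns_space (\<sigma> m) (\<sigma> n) + hdist gns_space (\<sigma> n) (j (vec \<phi> (b n))))"
          using M.commute[of "j (vec \<phi> (b m))" "\<sigma> m"] by (simp add: gns_dist_vec b)
        moreover have "hdist gns_space (\<sigma> m) (\<sigma> n) < \<epsilon> / 3" "1 / (1 + real m) < \<epsilon> / 3" "1 / (1 + real n) < \<epsilon> / 3"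
          using N1[of m n] N2[of m] N2[of n] that by auto
        ultimately show ?thesis using b(2)[of m] b(2)[of n] by linarith
      qed
      then show "\<exists>N. \<forall>m\<ge>N. \<forall>n\<ge>N. nr \<phi> (dif (b m) (b n)) < \<epsilon>" by blast
    qed (use b in auto)
    then obtain f where f: "represents \<phi> b f" using lcauchy_represents[OF pd] by blast
    then have fR: "f \<in> RK \<phi>" by (auto simp: RK_def[OF pd])
    have "limitin M.mtopology \<sigma> (j f) sequentially"
      unfolding M.limit_metric_sequentially
    proof (intro conjI allI impI)
      fix \<epsilon> :: real assume \<epsilon>: "\<epsilon> > 0"
      obtain N1 where N1: "\<And>m. m \<ge> N1 \<Longrightarrow> hdist gns_space (j f) (j (vec \<phi> (b m))) \<le> \<epsilon> / 2"
        using gns_approx[OF f, of "\<epsilon> / 2"] \<epsilon> by auto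
      obtain N2 where N2: "\<And>k. k \<ge> N2 \<Longrightarrow> 1 / (1 + real k) < \<epsilon> / 2"
        using inv0[of "\<epsilon> / 2"] \<epsilon> by auto
      have "\<sigma> n \<in> j ` RK \<phi> \<and> hdist gns_space (\<sigma> n) (j f) < \<epsilon>" if "n \<ge> max N1 N2" for n
      proof -
        have "hdist gns_space (\<sigma> n) (j f)
            \<le> hdist gns_space (\<sigma> n) (j (vec \<phi> (b n))) + hdist gns_space (j (vec \<phi> (b n))) (j f)"
          by (rule M.triangle[OF \<sigma>in bin]) (use fR in auto)
        then show ?thesis using b(2)[of n] N1[of n] N2[of n] that \<sigma>in
            M.commute[of "j f" "j (vec \<phi> (b n))"] by simp
      qed
      then show "\<exists>N. \<forall>n\<ge>N. \<sigma> n \<in> j ` RK \<phi> \<and> hdist gns_space (\<sigma> n) (j f) < \<epsilon>" by blast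
    qed (use fR in auto)
    then show "\<exists>x. limitin M.mtopology \<sigma> x sequentially" by blast
  qed
  then show "Metric_space.mcomplete (carrier gns_space) (hdist gns_space)" by simp
qed

lemma gns_rep_j [simp]: "f \<in> RK \<phi> \<Longrightarrow> gns_rep x (j f) = j (translate x f)"
  by (simp add: gns_rep_def)

lemma gns_rep_unitary:
  assumes x: "x \<in> carrier G"
  shows "gns_rep x \<in> unitaries gns_space"
proof -
  have "bij_betw (gns_rep x) (j ` RK \<phi>) (j ` RK \<phi>)"
    by (rule bij_betw_byWitness[where f' = "gns_rep (inv x)"])
      (use x in \<open>auto simp: RK_intros translate_translate[OF pd] translate_one[OF pd]\<close>)
  then show ?thesis using x
    by (auto simp: unitaries_def Bij_def RK_intros ip_translate[OF pd] gns_rep_def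
        translate_def[OF pd] intro!: arg_cong[where f = j])
qed

lemma gns_unitary_rep: "unitary_rep G gns_space gns_rep"
  unfolding unitary_rep_def
proof (intro conjI gns_hilbert_space homI)
  fix x y assume xy: "x \<in> carrier G" "y \<in> carrier G"
  have "gns_rep (x \<otimes> y) = compose (carrier gns_space) (gns_rep x) (gns_rep y)"
  proof
    fix v
    show "gns_rep (x \<otimes> y) v = compose (carrier gns_space) (gns_rep x) (gns_rep y) v"
    proof (cases "v \<in> j ` RK \<phi>")
      case True
      then obtain f where "f \<in> RK \<phi>" "v = j f" by blast
      then show ?thesis using xy RK_translate[OF pd, of f y]
        by (simp add: compose_def translate_translate[OF pd])
    qed (simp add: compose_def gns_rep_def)
  qed
  then show "gns_rep (x \<otimes> y) = gns_rep x \<otimes>\<^bsub>unitary_group gns_space\<^esub> gns_rep y"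
    using xy by (simp add: unitary_group_simps gns_rep_unitary)
qed (simp add: unitary_group_simps gns_rep_unitary)

definition gns_state :: "('a \<Rightarrow> complex) \<Rightarrow> 'a \<Rightarrow> complex"
  where "gns_state f x = (if x \<in> carrier G then ip \<phi> (translate x f) f else 0)"

text \<open>The state of a vector in the completion is a pointwise limit of functions
  \<open>sandwich \<phi> (s n)\<close>, and the conditions defining the cone survive pointwise
  limits. So purity, stated for the cone, can be applied to arbitrary vectors of the GNS
  space.\<close>

lemma gns_state_in_cone:
  assumes "\<phi> \<in> state_cone \<phi>0" "f \<in> RK \<phi>"
  shows "gns_state f \<in> state_cone \<phi>0"
  unfolding state_cone_def
proof (intro CollectI conjI allI impI ballI)
  fix l assume l: "l \<in> combs" "\<forall>a\<in>combs. 0 \<le> Re (lf l (sandwich \<phi>0 a))"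
  obtain s where s: "represents \<phi> s f" using assms(2) by (auto simp: RK_def[OF pd])
  note c = represents_combs[OF pd s]
  have "(\<lambda>n. sandwich \<phi> (s n) x) \<longlonglongrightarrow> gns_state f x" for x
  proof (cases "x \<in> carrier G")
    case True
    then show ?thesis
      unfolding sandwich_def gns_state_def using ip_lim[OF pd represents_translate[OF pd s True] s] by simp
  qed (simp add: sandwich_def gns_state_def)
  then have "(\<lambda>n. lf l (sandwich \<phi> (s n))) \<longlonglongrightarrow> lf l (gns_state f)"
    by (induction l) (auto intro!: tendsto_intros)
  then have "(\<lambda>n. Re (lf l (sandwich \<phi> (s n)))) \<longlonglongrightarrow> Re (lf l (gns_state f))" by (rule tendsto_Re)
  moreover have "0 \<le> Re (lf l (sandwich \<phi> (s n)))" for n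
    using state_coneD[OF sandwich_state_cone[OF assms(1) c] l(1)] l(2) by blast
  ultimately show "0 \<le> Re (lf l (gns_state f))" by (intro LIMSEQ_le_const) auto
qed (simp add: gns_state_def)

lemma translate_add:
  "translate x (\<lambda>z. f z + g z) = (\<lambda>z. translate x f z + translate x g z)"
  by (auto simp: translate_def[OF pd] fun_eq_iff)

lemma ip_add_right:
  assumes "f \<in> RK \<phi>" "g \<in> RK \<phi>" "h \<in> RK \<phi>"
  shows "ip \<phi> h (\<lambda>z. f z + g z) = ip \<phi> h f + ip \<phi> h g"
  using assms ip_cnj[OF pd RK_add[OF pd assms(1,2)] assms(3)] ip_cnj[OF pd assms(1,3)] ip_cnj[OF pd assms(2,3)]
  by (simp add: ip_add[OF pd])

lemma ip_translate_left:
  assumes "f \<in> RK \<phi>" "g \<in> RK \<phi>" "x \<in> carrier G"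
  shows "ip \<phi> (translate x f) g = ip \<phi> f (translate (inv x) g)"
  using ip_translate[OF pd assms(1) RK_translate[OF pd assms(2), of "inv x"] assms(3)] assms
  by (simp add: translate_translate[OF pd] translate_one[OF pd])

text \<open>Write the cyclic vector as \<open>\<xi> = f + g\<close> with \<open>f\<close> in
  \<open>W\<close> and \<open>g\<close> orthogonal to \<open>W\<close>. Since \<open>W\<close> is
  invariant, the state of \<open>\<xi>\<close> is the sum of the states of \<open>f\<close> and
  \<open>g\<close>, and purity makes the state of \<open>f\<close> equal to \<open>a\<close> times
  \<open>\<phi>\<close>. Pairing \<open>f\<close> with the orbit of \<open>\<xi>\<close> gives
  \<open>f = a \<xi>\<close>; hence \<open>\<xi>\<close> is orthogonal to \<open>W\<close> or
  belongs to it.\<close>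

lemma gns_irreducible:
  assumes q: "\<phi> \<in> state_cone \<phi>0" "\<phi> \<one> = 1" "pure \<phi>0 \<phi>"
  shows "irreducible_unitary_rep G gns_space gns_rep"
  unfolding irreducible_unitary_rep_def
proof (intro conjI allI impI gns_unitary_rep)
  define \<xi> where "\<xi> = vec \<phi> [(1, \<one>)]"
  have \<xi>R [simp]: "\<xi> \<in> RK \<phi>" unfolding \<xi>_def by (rule RK_vec[OF pd]) simp
  have t\<xi>: "translate x \<xi> = vec \<phi> [(1, x)]" if "x \<in> carrier G" for x
    using vec_shift[OF pd that, of "[(1, \<one>)]"] that unfolding \<xi>_def by (auto simp: fun_eq_iff)
  have ip\<xi>: "ip \<phi> f (translate x \<xi>) = f x" if "f \<in> RK \<phi>" "x \<in> carrier G" for f x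
    using that by (simp add: t\<xi> ip_vec[OF pd])
  have \<xi>val: "\<xi> x = \<phi> (inv x)" if "x \<in> carrier G" for x
    using that by (simp add: \<xi>_def vec_def[OF pd] form_singleton)
  have "\<xi> \<one> = 1" using q(2) \<xi>val by simp
  then have "\<xi> \<noteq> (\<lambda>_. 0)" by auto
  then have "j \<xi> \<noteq> j (\<lambda>_. 0)" using \<xi>R RK_zero[OF pd] j_eq_iff by blast
  then show "carrier gns_space \<noteq> {\<zero>\<^bsub>gns_space\<^esub>}" using \<xi>R by auto
  fix W assume "submodule W ring_of_type_algebra gns_space \<and>
      closedin (Metric_space.mtopology (carrier gns_space) (hdist gns_space)) W \<and>
      (\<forall>k\<in>carrier G. gns_rep k ` W \<subseteq> W)"
  then have W: "submodule W ring_of_type_algebra gns_space"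
    and cl: "closedin (Metric_space.mtopology (carrier gns_space) (hdist gns_space)) W"
    and inv: "\<And>k w. k \<in> carrier G \<Longrightarrow> w \<in> W \<Longrightarrow> gns_rep k w \<in> W" by auto
  note Wadd = C.submoduleE(5)[OF W] and Wne = C.submoduleE(2)[OF W]
  have Wc: "w \<in> W \<Longrightarrow> w \<in> j ` RK \<phi>" for w using C.submoduleE(1)[OF W] by auto
  have Wsm: "w \<in> W \<Longrightarrow> c \<odot>\<^bsub>gns_space\<^esub> w \<in> W" for c w by (rule C.submoduleE(4)[OF W]) simp_all
  have W0: "j (\<lambda>_. 0) \<in> W"
  proof -
    obtain w where w: "w \<in> W" using Wne by blast
    then obtain f where "f \<in> RK \<phi>" "w = j f" using Wc by blast
    then show ?thesis using Wsm[OF w, of 0] by simp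
  qed
  have seqcl: "l \<in> W" if "\<And>n. s n \<in> W" "limitin M.mtopology s l sequentially" for s l
  proof -
    have "range s \<subseteq> W" using that(1) by blast
    then show ?thesis
      using cl that(2) unfolding gns_simps M.metric_closedin_iff_sequentially_closed by blast
  qed
  obtain u where u: "u \<in> W" "\<And>w. w \<in> W \<Longrightarrow> cinner gns_space (j \<xi> \<ominus>\<^bsub>gns_space\<^esub> u) w = 0"
    using complex_hilbert_space.orthogonal_projection[OF gns_hilbert_space W cl, of "j \<xi>"] \<xi>R by auto
  obtain f where f [simp]: "f \<in> RK \<phi>" and uf: "u = j f" using Wc u by blast
  define g where "g = (\<lambda>z. \<xi> z + -1 * f z)"
  have g [simp]: "g \<in> RK \<phi>" unfolding g_def by (intro RK_add[OF pd] RK_cmult[OF pd]) simp_all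
  have \<xi>fg: "\<xi> = (\<lambda>z. f z + g z)" by (simp add: g_def)
  have orth: "ip \<phi> g h = 0" if "j h \<in> W" "h \<in> RK \<phi>" for h
  proof -
    have "j \<xi> \<ominus>\<^bsub>gns_space\<^esub> u = j g" unfolding uf g_def by (rule gns_minus) simp_all
    then show ?thesis using u(2)[OF that(1)] that(2) by simp
  qed
  have fW: "j (translate x f) \<in> W" if "x \<in> carrier G" for x
    using inv[OF that, of u] u uf by simp
  have orth': "ip \<phi> h g = 0" if "j h \<in> W" "h \<in> RK \<phi>" for h
    using ip_cnj[OF pd g that(2)] orth[OF that] by simp
  have sum: "\<phi> x = gns_state f x + gns_state g x" for x
  proof (cases "x \<in> carrier G")
    case True
    note R = RK_translate[OF pd f True] RK_translate[OF pd g True]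
    have "\<phi> x = \<xi> (inv x)" using True \<xi>val by simp
    also have "\<dots> = ip \<phi> \<xi> (translate (inv x) \<xi>)" using ip\<xi> True by simp
    also have "\<dots> = ip \<phi> (translate x \<xi>) \<xi>" using ip_translate_left True by simp
    also have "\<dots> = ip \<phi> (translate x f) f + ip \<phi> (translate x g) f
        + (ip \<phi> (translate x f) g + ip \<phi> (translate x g) g)"
      unfolding \<xi>fg translate_add
      using R by (simp add: ip_add[OF pd] ip_add_right RK_add[OF pd])
    also have "ip \<phi> (translate x f) g = 0" using orth' fW True R by simp
    also have "ip \<phi> (translate x g) f = 0"
      using ip_translate_left[OF g f True] orth[OF fW] True RK_translate[OF pd f] by simp
    finally show ?thesis using True by (simp add: gns_state_def)
  qed (simp add: gns_state_def posdef_off[OF pd])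
  have pur: "gns_state f x = gns_state f \<one> * \<phi> x" for x
    using q(3) sum gns_state_in_cone[OF q(1) f] gns_state_in_cone[OF q(1) g]
    unfolding pure_def by blast
  define a where "a = gns_state f \<one>"
  have a: "a = ip \<phi> f f" by (simp add: a_def gns_state_def translate_one[OF pd])
  have ra: "cnj a = a" using ip_cnj[OF pd f f] a by simp
  \<comment> \<open>\<open>f x\<close> is the inner product of \<open>f\<close> with
    \<open>translate x \<xi>\<close>. The part coming from \<open>g\<close> vanishes, and the part
    coming from \<open>f\<close> is the conjugate of the state of \<open>f\<close> at
    \<open>x\<close>.\<close>
  have fa: "f = (\<lambda>z. a * \<xi> z)"
  proof
    fix x
    show "f x = a * \<xi> x"
    proof (cases "x \<in> carrier G")
      case True
      note R = RK_translate[OF pd f True] RK_translate[OF pd g True]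
      have "f x = ip \<phi> f (translate x \<xi>)" using ip\<xi> True by simp
      also have "\<dots> = ip \<phi> f (translate x f) + ip \<phi> f (translate x g)"
        unfolding \<xi>fg translate_add using R by (simp add: ip_add_right)
      also have "ip \<phi> f (translate x g) = cnj (ip \<phi> (translate x g) f)"
        by (rule ip_cnj[OF pd]) (use R in auto)
      also have "ip \<phi> (translate x g) f = 0"
        using ip_translate_left[OF g f True] orth[OF fW] True RK_translate[OF pd f] by simp
      also have "ip \<phi> f (translate x f) = cnj (gns_state f x)"
        using ip_cnj[OF pd R(1) f] True by (simp add: gns_state_def)
      also have "\<dots> = a * cnj (\<phi> x)" using pur[of x] ra by (simp add: a_def[symmetric])
      also have "cnj (\<phi> x) = \<xi> x" using posdef_cnj[OF pd True] \<xi>val[OF True] by simp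
      finally show ?thesis by simp
    qed (use RK_off[OF pd f] RK_off[OF pd \<xi>R] in auto)
  qed
  show "W = {\<zero>\<^bsub>gns_space\<^esub>} \<or> W = carrier gns_space"
  proof (cases "a = 0")
    case True
    \<comment> \<open>Now \<open>\<xi>\<close> is orthogonal to \<open>W\<close>, hence so is its
      orbit, and the values of an element of \<open>W\<close> are its inner products with this
      orbit.\<close>
    then have "g = \<xi>" using fa by (auto simp: g_def)
    have "w = j (\<lambda>_. 0)" if w: "w \<in> W" for w
    proof -
      obtain h where h: "h \<in> RK \<phi>" "w = j h" using Wc w by blast
      have "h x = 0" for x
      proof (cases "x \<in> carrier G")
        case True
        have "h x = cnj (ip \<phi> (translate x \<xi>) h)"
          using ip\<xi>[OF h(1) True] ip_cnj[OF pd RK_translate[OF pd \<xi>R True] h(1)] by simp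
        also have "ip \<phi> (translate x \<xi>) h = ip \<phi> g (translate (inv x) h)"
          using ip_translate_left[OF \<xi>R h(1) True] \<open>g = \<xi>\<close> by simp
        also have "\<dots> = 0"
          using orth[of "translate (inv x) h"] inv[of "inv x" w] w h True RK_translate[OF pd h(1)] by simp
        finally show ?thesis by simp
      qed (use RK_off[OF pd h(1)] in auto)
      then have "h = (\<lambda>_. 0)" by auto
      then show ?thesis using h by simp
    qed
    then have "W = {j (\<lambda>_. 0)}" using W0 by blast
    then show ?thesis by simp
  next
    case False
    have "j \<xi> = (1 / a) \<odot>\<^bsub>gns_space\<^esub> u" using False uf by (simp add: fa RK_cmult[OF pd])
    then have \<xi>W: "j \<xi> \<in> W" using Wsm u by simp
    have vecW: "j (vec \<phi> b) \<in> W" if "b \<in> combs" for b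
      using that
    proof (induction b)
      case Nil
      have "vec \<phi> [] = (\<lambda>_. 0)" by (auto simp: vec_def[OF pd])
      then show ?case using W0 by simp
    next
      case (Cons p b)
      have p: "snd p \<in> carrier G" "b \<in> combs" using Cons by auto
      have "vec \<phi> (p # b) z = fst p * translate (snd p) \<xi> z + vec \<phi> b z" for z
        using vec_append[OF pd, of "lscale (fst p) [(1, snd p)]" b z] t\<xi>[OF p(1)]
          vec_lscale[OF pd, of "fst p" "[(1, snd p)]" z] by (simp add: lscale_def)
      then have "vec \<phi> (p # b) = (\<lambda>z. fst p * translate (snd p) \<xi> z + vec \<phi> b z)" by auto
      then have "j (vec \<phi> (p # b)) = fst p \<odot>\<^bsub>gns_space\<^esub> j (translate (snd p) \<xi>) \<oplus>\<^bsub>gns_space\<^esub> j (vec \<phi> b)"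
        using p by (simp add: RK_intros)
      moreover have "j (translate (snd p) \<xi>) \<in> W" using inv[OF p(1) \<xi>W] by simp
      ultimately show ?case using Cons.IH[OF p(2)] Wadd Wsm by simp
    qed
    have "j h \<in> W" if h: "h \<in> RK \<phi>" for h
    proof -
      obtain s where s: "represents \<phi> s h" using h by (auto simp: RK_def[OF pd])
      note c = represents_combs[OF pd s]
      have "limitin M.mtopology (\<lambda>n. j (vec \<phi> (s n))) (j h) sequentially"
        unfolding M.limit_metric_sequentially
      proof (intro conjI allI impI)
        fix \<epsilon> :: real assume "\<epsilon> > 0"
        then obtain N where N: "\<And>m. m \<ge> N \<Longrightarrow> hdist gns_space (j h) (j (vec \<phi> (s m))) \<le> \<epsilon> / 2"
          using gns_approx[OF s, of "\<epsilon> / 2"] by auto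
        have "j (vec \<phi> (s n)) \<in> j ` RK \<phi> \<and> hdist gns_space (j (vec \<phi> (s n))) (j h) < \<epsilon>" if "n \<ge> N" for n
          using N[OF that] \<open>\<epsilon> > 0\<close> M.commute[of "j h" "j (vec \<phi> (s n))"] RK_vec[OF pd c] by simp
        then show "\<exists>N. \<forall>n\<ge>N. j (vec \<phi> (s n)) \<in> j ` RK \<phi> \<and> hdist gns_space (j (vec \<phi> (s n))) (j h) < \<epsilon>"
          by blast
      qed (use h in auto)
      then show ?thesis by (rule seqcl[rotated]) (rule vecW[OF c])
    qed
    then show ?thesis using Wc by auto
  qed
qed

lemma gns_rep_trivial:
  assumes "x \<in> carrier G" "gns_rep x = \<one>\<^bsub>unitary_group gns_space\<^esub>" "\<phi> \<one> = 1"
  shows "\<phi> x = 1"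
proof -
  define \<xi> where "\<xi> = vec \<phi> [(1, \<one>)]"
  have \<xi>R: "\<xi> \<in> RK \<phi>" unfolding \<xi>_def by (rule RK_vec[OF pd]) simp
  have "gns_rep x (j \<xi>) = j \<xi>" using assms(2) \<xi>R by (simp add: unitary_group_simps)
  then have "translate x \<xi> = \<xi>" using \<xi>R j_eq_iff RK_translate[OF pd \<xi>R assms(1)] by simp
  then have "translate x \<xi> \<one> = \<xi> \<one>" by simp
  then show ?thesis using assms
    by (simp add: translate_def[OF pd] \<xi>_def vec_def[OF pd] form_singleton)
qed

end

theorem pure_state_irreducible_rep:
  assumes u: "inj (u :: real \<Rightarrow> 'h)" and count: "countable (carrier G)"
    and pd: "posdef \<phi>0" and q: "\<phi> \<in> state_cone \<phi>0" "\<phi> \<one> = 1" "pure \<phi>0 \<phi>"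
  obtains H :: "'h hilbert" and \<sigma> where "irreducible_unitary_rep G H \<sigma>"
    "\<And>x. x \<in> carrier G \<Longrightarrow> \<sigma> x = \<one>\<^bsub>unitary_group H\<^esub> \<Longrightarrow> \<phi> x = 1"
proof -
  have pq: "posdef \<phi>" by (rule state_cone_posdef[OF pd q(1)])
  obtain j :: "('a \<Rightarrow> complex) \<Rightarrow> 'h" where j: "inj_on j {f. \<forall>x. x \<notin> carrier G \<longrightarrow> f x = 0}"
    using inj_on_countable_support[OF count u] by blast
  have inj: "inj_on j (RK \<phi>)" by (rule inj_on_subset[OF j]) (use RK_off[OF pq] in auto)
  show ?thesis
    using that[OF gns_irreducible[OF pq inj q]] gns_rep_trivial[OF pq inj _ _ q(2)] by blast
qed

end

subsection \<open>Induced characters\<close>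

lemma group_circle_group: "group circle_group"
proof (rule groupI)
  fix x assume "x \<in> carrier circle_group"
  then show "\<exists>y\<in>carrier circle_group. y \<otimes>\<^bsub>circle_group\<^esub> x = \<one>\<^bsub>circle_group\<^esub>"
    by (intro bexI[of _ "inverse x"]) (auto simp: circle_group_def norm_inverse intro!: left_inverse)
qed (auto simp: circle_group_def norm_mult)

lemma circle_simps [simp]:
  "x \<in> carrier circle_group \<longleftrightarrow> cmod x = 1" "x \<otimes>\<^bsub>circle_group\<^esub> y = x * y" "\<one>\<^bsub>circle_group\<^esub> = 1"
  by (auto simp: circle_group_def)

text \<open>Grouped by keys, the double sum is the sum over all keys of the squared modulus of the
  total of \<open>e\<close> over the entries with that key.\<close>

lemma keyed_square_sum:
  fixes e :: "'x \<Rightarrow> complex" and k :: "'x \<Rightarrow> 'k" and a :: "'x list"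
  defines "S \<equiv> (\<Sum>p\<leftarrow>a. \<Sum>q\<leftarrow>a. if k p = k q then e p * cnj (e q) else 0)"
  shows "Im S = 0" "0 \<le> Re S"
proof -
  define K where "K = k ` set a"
  have fin: "finite K" by (simp add: K_def)
  define T where "T = (\<lambda>x. \<Sum>p\<leftarrow>a. if k p = x then e p else 0)"
  have sl: "(\<Sum>p\<leftarrow>xs. \<Sum>x\<in>K. f p x) = (\<Sum>x\<in>K. \<Sum>p\<leftarrow>xs. f p x)" for xs :: "'x list" and f :: "'x \<Rightarrow> 'k \<Rightarrow> complex"
    by (induction xs) (auto simp: sum.distrib)
  have "S = (\<Sum>p\<leftarrow>a. \<Sum>q\<leftarrow>a. \<Sum>x\<in>K. (if k p = x then e p else 0) * cnj (if k q = x then e q else 0))"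
    unfolding S_def
  proof (intro arg_cong[where f = sum_list] map_cong refl)
    fix p q assume pq: "p \<in> set a" "q \<in> set a"
    have "(\<Sum>x\<in>K. (if k p = x then e p else 0) * cnj (if k q = x then e q else 0))
      = (\<Sum>x\<in>K. if k p = x then (if k p = k q then e p * cnj (e q) else 0) else 0)"
      by (rule sum.cong) auto
    also have "\<dots> = (if k p = k q then e p * cnj (e q) else 0)"
      using fin pq by (simp add: K_def)
    finally show "(if k p = k q then e p * cnj (e q) else 0) =
      (\<Sum>x\<in>K. (if k p = x then e p else 0) * cnj (if k q = x then e q else 0))" ..
  qed
  also have "\<dots> = (\<Sum>x\<in>K. T x * cnj (T x))"
    unfolding sl T_def by (simp add: sum_list_const_mult sum_list_mult_const cnj_sum_list o_def)
  also have "\<dots> = of_real (\<Sum>x\<in>K. (cmod (T x))\<^sup>2)"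
    by (simp add: complex_norm_square[symmetric] del: of_real_power)
  finally have S: "S = of_real (\<Sum>x\<in>K. (cmod (T x))\<^sup>2)" .
  show "Im S = 0" "0 \<le> Re S" unfolding S by (auto intro: sum_nonneg)
qed

context group
begin

lemma form_uniform:
  assumes "distinct xs"
  shows "form \<psi> (map (\<lambda>m. (c, m)) xs) (map (\<lambda>m. (c, m)) xs)
    = c * cnj c * (\<Sum>m\<in>set xs. \<Sum>m'\<in>set xs. \<psi> (inv m' \<otimes> m))"
  unfolding form_def using assms
  by (simp add: o_def sum_list_distinct_conv_sum_set sum_distrib_left)

text \<open>The uniform weight on \<open>M\<close> sends every vector to 0 exactly. Expanding
  \<open>sandwich\<close> gives sums of \<open>\<phi>0\<close> over sets \<open>z M y\<close>, and
  by normality these are the cosets \<open>z y M\<close>.\<close>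

lemma dispersed_finite:
  assumes M: "M \<lhd> G" "finite M"
    and 0: "\<And>x. x \<in> carrier G \<Longrightarrow> (\<Sum>m\<in>M. \<phi>0 (x \<otimes> m)) = 0"
    and pd: "posdef \<phi>0"
  shows "dispersed \<phi>0 M"
  unfolding dispersed_def
proof (intro ballI allI impI)
  fix a and \<epsilon> :: real assume a: "a \<in> combs" and \<epsilon>: "\<epsilon> > 0"
  interpret M: normal M G by fact
  have Mc: "m \<in> M \<Longrightarrow> m \<in> carrier G" for m using M.mem_carrier .
  obtain xs where xs: "distinct xs" "set xs = M" using finite_distinct_list[OF M(2)] by blast
  define n where "n = card M"
  have "M \<noteq> {}" using M.one_closed by blast
  then have n: "n > 0" "length xs = n" using M(2) xs(2) distinct_card[OF xs(1)] by (auto simp: n_def card_gt_0_iff)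
  define w where "w = map (\<lambda>m. (1 / of_nat n :: complex, m)) xs"
  have z: "(\<Sum>m\<in>M. \<phi>0 (z \<otimes> m \<otimes> y)) = 0" if "z \<in> carrier G" "y \<in> carrier G" for z y
  proof -
    have "(\<Sum>m\<in>M. \<phi>0 (z \<otimes> m \<otimes> y)) = (\<Sum>m\<in>M. \<phi>0 (z \<otimes> y \<otimes> m))"
    proof (rule sum.reindex_bij_witness[where i = "\<lambda>m. y \<otimes> m \<otimes> inv y" and j = "\<lambda>m. inv y \<otimes> m \<otimes> y"])
      fix m assume m: "m \<in> M"
      show "y \<otimes> (inv y \<otimes> m \<otimes> y) \<otimes> inv y = m" "inv y \<otimes> (y \<otimes> m \<otimes> inv y) \<otimes> y = m"
        using that Mc[OF m] by (simp_all add: m_assoc) (simp_all add: m_assoc[symmetric])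
      show "inv y \<otimes> m \<otimes> y \<in> M" using M.inv_op_closed1 m that by simp
      show "y \<otimes> m \<otimes> inv y \<in> M" using M.inv_op_closed2 m that by simp
      have "z \<otimes> y \<otimes> (inv y \<otimes> m \<otimes> y) = z \<otimes> m \<otimes> y"
        using that Mc[OF m] by (simp add: m_assoc) (simp add: m_assoc[symmetric])
      then show "\<phi>0 (z \<otimes> y \<otimes> (inv y \<otimes> m \<otimes> y)) = \<phi>0 (z \<otimes> m \<otimes> y)" by simp
    qed
    then show ?thesis using 0 that by simp
  qed
  have s: "(\<Sum>m\<in>M. sandwich \<phi>0 a m) = 0"
  proof -
    have sw: "sandwich \<phi>0 a m = (\<Sum>p\<leftarrow>a. \<Sum>q\<leftarrow>a. fst p * cnj (fst q) * \<phi>0 (inv (snd q) \<otimes> m \<otimes> snd p))"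
      if "m \<in> M" for m
      using Mc[OF that] combsD[OF a] unfolding sandwich_def form_def shift_def
      by (auto simp: o_def m_assoc intro!: arg_cong[where f=sum_list] map_cong)
    have sl: "(\<Sum>m\<in>M. \<Sum>p\<leftarrow>ys. f m p) = (\<Sum>p\<leftarrow>ys. \<Sum>m\<in>M. f m p)" for ys :: "(complex \<times> 'a) list" and f :: "'a \<Rightarrow> _ \<Rightarrow> complex"
      by (induction ys) (auto simp: sum.distrib)
    have "(\<Sum>m\<in>M. sandwich \<phi>0 a m) = (\<Sum>p\<leftarrow>a. \<Sum>q\<leftarrow>a. fst p * cnj (fst q) * (\<Sum>m\<in>M. \<phi>0 (inv (snd q) \<otimes> m \<otimes> snd p)))"
      by (simp add: sw sl sum_distrib_left)
    also have "\<dots> = (\<Sum>p\<leftarrow>a. \<Sum>q\<leftarrow>a. 0)"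
      using z combsD[OF a] by (intro arg_cong[where f=sum_list] map_cong refl) auto
    finally show ?thesis by simp
  qed
  have "(\<Sum>m'\<in>M. sandwich \<phi>0 a (inv m \<otimes> m')) = 0" if "m \<in> M" for m
  proof -
    have "(\<Sum>m'\<in>M. sandwich \<phi>0 a (inv m \<otimes> m')) = (\<Sum>m'\<in>M. sandwich \<phi>0 a m')"
      by (rule sum.reindex_bij_witness[where i = "\<lambda>m'. m \<otimes> m'" and j = "\<lambda>m'. inv m \<otimes> m'"])
        (use that Mc in \<open>auto simp: m_assoc[symmetric]\<close>)
    then show ?thesis using s by simp
  qed
  then have f0: "form (sandwich \<phi>0 a) w w = 0"
    unfolding w_def form_uniform[OF xs(1)] xs(2) by (subst sum.swap) simp
  show "\<exists>w\<in>combs. snd ` set w \<subseteq> M \<and> lf w (\<lambda>_. 1) = 1 \<and>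
      Re (form (sandwich \<phi>0 a) w w) \<le> \<epsilon> * Re (form \<phi>0 a a)"
  proof (intro bexI[of _ w] conjI)
    show "w \<in> combs" "snd ` set w \<subseteq> M" using xs Mc by (auto simp: w_def combs_def)
    show "lf w (\<lambda>_. 1) = 1" using n by (simp add: w_def lf_def o_def sum_list_triv)
    show "Re (form (sandwich \<phi>0 a) w w) \<le> \<epsilon> * Re (form \<phi>0 a a)"
      using f0 \<epsilon> posdef_form[OF pd a] by simp
  qed
qed

text \<open>Greedy choice: an element \<open>y\<close> chosen before excludes only finitely many
  candidates, namely itself and its products with elements of \<open>B\<close> and with their
  inverses.\<close>

lemma infinite_subgroup_spread:
  assumes M: "subgroup M G" "infinite M" and B: "finite B" "B \<subseteq> carrier G"
  shows "\<exists>xs. length xs = n \<and> distinct xs \<and> set xs \<subseteq> M \<and>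
    (\<forall>x\<in>set xs. \<forall>y\<in>set xs. x \<noteq> y \<longrightarrow> inv x \<otimes> y \<notin> B)"
proof (induction n)
  case (Suc n)
  then obtain xs where xs: "length xs = n" "distinct xs" "set xs \<subseteq> M"
    "\<forall>x\<in>set xs. \<forall>y\<in>set xs. x \<noteq> y \<longrightarrow> inv x \<otimes> y \<notin> B" by (elim exE conjE) (rule that)
  define Z where "Z = set xs \<union> (\<lambda>(y, b). y \<otimes> b) ` (set xs \<times> B) \<union> (\<lambda>(y, b). y \<otimes> inv b) ` (set xs \<times> B)"
  have "finite Z" using B by (simp add: Z_def)
  then have "infinite (M - Z)" using M by simp
  then have "M - Z \<noteq> {}" by (metis finite.emptyI)
  then obtain x where x: "x \<in> M" "x \<notin> Z" by blast
  have c: "y \<in> carrier G" if "y \<in> M" for y by (rule subgroup.mem_carrier[OF M(1) that])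
  have "inv y \<otimes> x \<notin> B \<and> inv x \<otimes> y \<notin> B" if "y \<in> set xs" for y
  proof -
    have yc: "y \<in> carrier G" "x \<in> carrier G" using xs x c that by auto
    have "y \<otimes> (inv y \<otimes> x) = x" using yc by (simp add: m_assoc[symmetric])
    moreover from this have "y \<otimes> inv (inv x \<otimes> y) = x" using yc by (simp add: inv_mult_group)
    moreover have "y \<otimes> b \<in> Z" "y \<otimes> inv b \<in> Z" if "b \<in> B" for b
      using \<open>y \<in> set xs\<close> that by (force simp: Z_def)+
    ultimately show ?thesis using x(2) by metis
  qed
  note new = this
  have "\<forall>u\<in>set (x # xs). \<forall>v\<in>set (x # xs). u \<noteq> v \<longrightarrow> inv u \<otimes> v \<notin> B"
  proof (intro ballI impI)
    fix u v assume uv: "u \<in> set (x # xs)" "v \<in> set (x # xs)" "u \<noteq> v"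
    consider "u = x" "v \<in> set xs" | "v = x" "u \<in> set xs" | "u \<in> set xs" "v \<in> set xs"
      using uv by auto
    then show "inv u \<otimes> v \<notin> B"
    proof cases
      case 1 then show ?thesis using new[of v] by simp
    next
      case 2 then show ?thesis using new[of u] by simp
    next
      case 3 then show ?thesis using xs(4) uv(3) by metis
    qed
  qed
  moreover have "x \<notin> set xs" using x(2) by (simp add: Z_def)
  ultimately show ?case using xs(1-3) x(1)
    by (intro exI[of _ "x # xs"] conjI) simp_all
qed simp

text \<open>All but finitely many elements of \<open>M\<close> move the vector \<open>a\<close> to a
  vector orthogonal to it. The average of \<open>n\<close> pairwise orthogonal translates has
  \<open>1 / n\<close> times the squared norm of \<open>a\<close>.\<close>

lemma dispersed_infinite:
  assumes M: "M \<lhd> G" "infinite M"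
    and A: "subgroup A G" "\<And>x. x \<notin> A \<Longrightarrow> \<phi>0 x = 0" "M \<inter> A = {\<one>}"
    and pd: "posdef \<phi>0"
  shows "dispersed \<phi>0 M"
  unfolding dispersed_def
proof (intro ballI allI impI)
  fix a and \<epsilon> :: real assume a: "a \<in> combs" and \<epsilon>: "\<epsilon> > 0"
  interpret M: normal M G by fact
  interpret A: subgroup A G by fact
  have Mc: "m \<in> M \<Longrightarrow> m \<in> carrier G" for m using M.mem_carrier .
  define B where "B = {m \<in> M. \<exists>p\<in>set a. \<exists>q\<in>set a. inv (snd q) \<otimes> m \<otimes> snd p \<in> A}"
  \<comment> \<open>Two such elements would put a conjugate of \<open>inv m \<otimes> m'\<close>
    into both \<open>M\<close> and \<open>A\<close>. So each pair of entries of \<open>a\<close>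
    contributes at most one element to \<open>B\<close>, which is therefore finite.\<close>
  have uniq: "m = m'" if m: "m \<in> M" "m' \<in> M" and y: "y \<in> carrier G" "z \<in> carrier G"
    and in_A: "inv z \<otimes> m \<otimes> y \<in> A" "inv z \<otimes> m' \<otimes> y \<in> A" for m m' y z
  proof -
    have "inv (inv z \<otimes> m \<otimes> y) \<otimes> (inv z \<otimes> m' \<otimes> y) = inv y \<otimes> (inv m \<otimes> m') \<otimes> y"
      using y Mc m by (simp add: inv_mult_group m_assoc) (simp add: m_assoc[symmetric])
    moreover have "inv (inv z \<otimes> m \<otimes> y) \<otimes> (inv z \<otimes> m' \<otimes> y) \<in> A" using in_A by blast
    moreover have "inv y \<otimes> (inv m \<otimes> m') \<otimes> y \<in> M" using m y by (intro M.inv_op_closed1) auto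
    ultimately have "inv y \<otimes> (inv m \<otimes> m') \<otimes> y = \<one>" using A(3) by auto
    then have "y \<otimes> (inv y \<otimes> (inv m \<otimes> m') \<otimes> y) \<otimes> inv y = \<one>" using y by simp
    then have "inv m \<otimes> m' = \<one>" using y Mc m by (simp add: m_assoc) (simp add: m_assoc[symmetric])
    then show ?thesis using m Mc by (metis inv_equality inv_inv inv_closed)
  qed
  have "finite {m \<in> M. inv (snd q) \<otimes> m \<otimes> snd p \<in> A}" if pq: "p \<in> set a" "q \<in> set a" for p q
  proof (cases "{m \<in> M. inv (snd q) \<otimes> m \<otimes> snd p \<in> A} = {}")
    case False
    then obtain m where m: "m \<in> M" "inv (snd q) \<otimes> m \<otimes> snd p \<in> A" by blast
    have "m' = m" if "m' \<in> M" "inv (snd q) \<otimes> m' \<otimes> snd p \<in> A" for m'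
      by (rule uniq[OF that(1) m(1) combsD[OF a pq(1)] combsD[OF a pq(2)] that(2) m(2)])
    then have "{m \<in> M. inv (snd q) \<otimes> m \<otimes> snd p \<in> A} \<subseteq> {m}" by blast
    then show ?thesis using finite_subset by blast
  qed (metis finite.emptyI)
  moreover have "B = (\<Union>p\<in>set a. \<Union>q\<in>set a. {m \<in> M. inv (snd q) \<otimes> m \<otimes> snd p \<in> A})"
    by (auto simp: B_def)
  ultimately have fB: "finite B" by simp
  have Bc: "B \<subseteq> carrier G" using Mc by (auto simp: B_def)
  have s0: "sandwich \<phi>0 a m = 0" if "m \<in> M" "m \<notin> B" for m
  proof -
    have "sandwich \<phi>0 a m = (\<Sum>p\<leftarrow>a. \<Sum>q\<leftarrow>a. fst p * cnj (fst q) * \<phi>0 (inv (snd q) \<otimes> m \<otimes> snd p))"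
      using Mc[OF that(1)] combsD[OF a] unfolding sandwich_def form_def shift_def
      by (auto simp: o_def m_assoc intro!: arg_cong[where f=sum_list] map_cong)
    also have "\<dots> = (\<Sum>p\<leftarrow>a. \<Sum>q\<leftarrow>a. 0)"
      using that A(2) by (intro arg_cong[where f=sum_list] map_cong refl) (auto simp: B_def)
    finally show ?thesis by simp
  qed
  obtain n :: nat where n: "1 / \<epsilon> < real n" using reals_Archimedean2 by blast
  have n0: "n > 0" using n \<epsilon> by (metis gr0I less_numeral_extra(3) of_nat_0 order.strict_trans zero_less_divide_1_iff)
  obtain xs where xs: "length xs = n" "distinct xs" "set xs \<subseteq> M"
    "\<forall>x\<in>set xs. \<forall>y\<in>set xs. x \<noteq> y \<longrightarrow> inv x \<otimes> y \<notin> B"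
    using infinite_subgroup_spread[OF M.subgroup_axioms M(2) fB Bc, of n]
    by (elim exE conjE) (rule that)
  define w where "w = map (\<lambda>m. (1 / of_nat n :: complex, m)) xs"
  have "(\<Sum>m'\<in>set xs. sandwich \<phi>0 a (inv m' \<otimes> m)) = form \<phi>0 a a" if m: "m \<in> set xs" for m
  proof -
    have "(\<Sum>m'\<in>set xs. sandwich \<phi>0 a (inv m' \<otimes> m)) = (\<Sum>m'\<in>set xs. if m' = m then form \<phi>0 a a else 0)"
    proof (rule sum.cong[OF refl])
      fix m' assume m': "m' \<in> set xs"
      have mc: "m \<in> M" "m' \<in> M" using m m' xs by auto
      show "sandwich \<phi>0 a (inv m' \<otimes> m) = (if m' = m then form \<phi>0 a a else 0)"
      proof (cases "m' = m")
        case False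
        then show ?thesis using s0[of "inv m' \<otimes> m"] xs(4) m m' mc by auto
      qed (use Mc mc a in \<open>simp add: sandwich_at_one\<close>)
    qed
    then show ?thesis using m by simp
  qed
  then have "form (sandwich \<phi>0 a) w w = (1 / of_nat n) * cnj (1 / of_nat n) * (of_nat n * form \<phi>0 a a)"
    unfolding w_def form_uniform[OF xs(2)] using xs(1,2) distinct_card by fastforce
  also have "\<dots> = of_real (1 / real n) * form \<phi>0 a a" using n0 by simp
  finally have "form (sandwich \<phi>0 a) w w = of_real (1 / real n) * form \<phi>0 a a" .
  then have fw: "Re (form (sandwich \<phi>0 a) w w) = 1 / real n * Re (form \<phi>0 a a)" by simp
  have "1 / real n \<le> \<epsilon>" using n n0 \<epsilon> by (simp add: field_simps)
  show "\<exists>w\<in>combs. snd ` set w \<subseteq> M \<and> lf w (\<lambda>_. 1) = 1 \<and>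
      Re (form (sandwich \<phi>0 a) w w) \<le> \<epsilon> * Re (form \<phi>0 a a)"
  proof (intro bexI[of _ w] conjI)
    show "w \<in> combs" "snd ` set w \<subseteq> M" using xs Mc by (auto simp: w_def combs_def)
    show "lf w (\<lambda>_. 1) = 1" using n0 xs(1) by (simp add: w_def lf_def o_def sum_list_triv)
    show "Re (form (sandwich \<phi>0 a) w w) \<le> \<epsilon> * Re (form \<phi>0 a a)"
      unfolding fw using \<open>1 / real n \<le> \<epsilon>\<close> posdef_form[OF pd a] by (intro mult_right_mono) auto
  qed
qed

definition induced :: "'a set \<Rightarrow> ('a \<Rightarrow> complex) \<Rightarrow> 'a \<Rightarrow> complex"
  where "induced A \<theta> x = (if x \<in> A then \<theta> x else 0)"

lemma character_one:
  assumes "subgroup A G" "\<theta> \<in> hom (G\<lparr>carrier := A\<rparr>) circle_group"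
  shows "\<theta> \<one> = 1"
proof -
  have "\<theta> \<one> * \<theta> \<one> = \<theta> \<one>" "cmod (\<theta> \<one>) = 1"
    using assms subgroup.one_closed[OF assms(1)] hom_mult[OF assms(2), of \<one> \<one>]
    by (auto simp: hom_def Pi_def)
  then show ?thesis by auto
qed

lemma character_mult:
  assumes "\<theta> \<in> hom (G\<lparr>carrier := A\<rparr>) circle_group" "x \<in> A" "y \<in> A"
  shows "\<theta> (x \<otimes> y) = \<theta> x * \<theta> y"
  using hom_mult[OF assms(1), of x y] assms by simp

lemma character_norm:
  assumes "\<theta> \<in> hom (G\<lparr>carrier := A\<rparr>) circle_group" "x \<in> A"
  shows "cmod (\<theta> x) = 1"
  using assms by (auto simp: hom_def Pi_def)

lemma character_inv:
  assumes "subgroup A G" "\<theta> \<in> hom (G\<lparr>carrier := A\<rparr>) circle_group" "x \<in> A"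
  shows "\<theta> (inv x) = cnj (\<theta> x)"
proof -
  have x: "x \<in> carrier G" "inv x \<in> A" using assms subgroup.mem_carrier subgroup.m_inv_closed by metis+
  have "\<theta> (inv x) * \<theta> x = 1"
    using character_mult[OF assms(2) x(2) assms(3)] character_one[OF assms(1,2)] x by simp
  moreover have "cnj (\<theta> x) * \<theta> x = 1"
    using character_norm[OF assms(2,3)] complex_norm_square[of "\<theta> x"] by (simp add: mult.commute)
  moreover have "\<theta> x \<noteq> 0" using character_norm[OF assms(2,3)] by auto
  ultimately show ?thesis by (metis mult_right_cancel)
qed

text \<open>The function below is a matrix coefficient of the representation induced from \<open>\<theta>\<close>; grouping
  the terms of its quadratic form by cosets of \<open>A\<close> gives a sum of squares.\<close>

lemma posdef_induced:
  assumes A: "subgroup A G" and \<theta>: "\<theta> \<in> hom (G\<lparr>carrier := A\<rparr>) circle_group"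
  shows "posdef (induced A \<theta>)"
  unfolding posdef_def
proof (intro conjI ballI allI impI)
  interpret A: subgroup A G by fact
  fix a assume a: "a \<in> combs"
  \<comment> \<open>The choice depends on \<open>y\<close> only through its coset, so equal
    representatives mean equal cosets.\<close>
  define r where "r = (\<lambda>y. SOME t. t \<in> y <# A)"
  define e where "e = (\<lambda>p. fst p * \<theta> (inv (r (snd p)) \<otimes> snd p) :: complex)"
  have rin: "r y \<in> y <# A" if "y \<in> carrier G" for y
  proof -
    have "y \<in> y <# A" using that by (auto simp: l_coset_def intro!: bexI[OF _ A.one_closed])
    then show ?thesis unfolding r_def by (rule someI)
  qed
  have rA: "inv (r y) \<otimes> y \<in> A" "r y \<in> carrier G" if y: "y \<in> carrier G" for y
  proof -
    obtain h where h: "h \<in> A" "r y = y \<otimes> h" using rin[OF y] by (auto simp: l_coset_def)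
    then show "r y \<in> carrier G" using y by simp
    have "inv (r y) \<otimes> y = inv h" using h y by (simp add: inv_mult_group m_assoc)
    then show "inv (r y) \<otimes> y \<in> A" using h by simp
  qed
  have key: "induced A \<theta> (inv z \<otimes> y) =
      (if r y = r z then \<theta> (inv (r y) \<otimes> y) * cnj (\<theta> (inv (r z) \<otimes> z)) else 0)"
    if y: "y \<in> carrier G" and z: "z \<in> carrier G" for y z
  proof (cases "r y = r z")
    case True
    let ?u = "inv (r z) \<otimes> z" and ?v = "inv (r y) \<otimes> y"
    have uv: "?u \<in> A" "?v \<in> A" using rA y z by auto
    have "inv ?u \<otimes> ?v = inv z \<otimes> y"
      using y z rA True by (simp add: inv_mult_group m_assoc) (simp add: m_assoc[symmetric])
    moreover have "inv ?u \<otimes> ?v \<in> A" using uv by simp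
    moreover have "\<theta> (inv ?u \<otimes> ?v) = cnj (\<theta> ?u) * \<theta> ?v"
      using character_mult[OF \<theta>] character_inv[OF A \<theta>] uv by simp
    ultimately show ?thesis using True by (simp add: induced_def mult.commute)
  next
    case False
    have "inv z \<otimes> y \<notin> A"
    proof
      assume h: "inv z \<otimes> y \<in> A"
      have "y = z \<otimes> (inv z \<otimes> y)" using y z by (simp add: m_assoc[symmetric])
      then have "y \<in> z <# A" using h unfolding l_coset_def by blast
      then have "z <# A = y <# A" by (rule l_repr_independence[OF _ z A])
      then show False using False by (simp add: r_def)
    qed
    then show ?thesis using False by (simp add: induced_def)
  qed
  have "form (induced A \<theta>) a a =
      (\<Sum>p\<leftarrow>a. \<Sum>q\<leftarrow>a. if r (snd p) = r (snd q) then e p * cnj (e q) else 0)"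
    unfolding form_def using combsD[OF a]
    by (intro arg_cong[where f = sum_list] map_cong refl) (auto simp: key e_def)
  then show "Im (form (induced A \<theta>) a a) = 0" "0 \<le> Re (form (induced A \<theta>) a a)"
    using keyed_square_sum[where a = a and k = "\<lambda>p. r (snd p)" and e = e] by auto
qed (use subgroup.mem_carrier[OF A] in \<open>auto simp: induced_def\<close>)

text \<open>Replacing \<open>m\<close> by \<open>m \<otimes> c\<close> multiplies the sum by \<open>\<theta> c \<noteq> 1\<close>.\<close>

lemma induced_sum_zero:
  assumes A: "subgroup A G" and \<theta>: "\<theta> \<in> hom (G\<lparr>carrier := A\<rparr>) circle_group"
    and M: "subgroup M G" and c: "c \<in> M" "c \<in> A" "\<theta> c \<noteq> 1" and x: "x \<in> carrier G"
  shows "(\<Sum>m\<in>M. induced A \<theta> (x \<otimes> m)) = 0"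
proof -
  interpret A: subgroup A G by fact
  interpret M: subgroup M G by fact
  have cc: "c \<in> carrier G" using c by simp
  have "induced A \<theta> (y \<otimes> c) = induced A \<theta> y * \<theta> c" if y: "y \<in> carrier G" for y
  proof (cases "y \<in> A")
    case False
    have "y \<otimes> c \<notin> A"
    proof
      assume "y \<otimes> c \<in> A"
      then have "y \<otimes> c \<otimes> inv c \<in> A" using c by blast
      then show False using False y cc by (simp add: m_assoc)
    qed
    then show ?thesis using False by (simp add: induced_def)
  qed (use c character_mult[OF \<theta>] in \<open>simp add: induced_def\<close>)
  then have "(\<Sum>m\<in>M. induced A \<theta> (x \<otimes> (m \<otimes> c))) = (\<Sum>m\<in>M. induced A \<theta> (x \<otimes> m)) * \<theta> c"
    using x cc M.mem_carrier by (simp add: m_assoc[symmetric] sum_distrib_right)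
  moreover have "(\<Sum>m\<in>M. induced A \<theta> (x \<otimes> (m \<otimes> c))) = (\<Sum>m\<in>M. induced A \<theta> (x \<otimes> m))"
    by (rule sum.reindex_bij_witness[where i = "\<lambda>m. m \<otimes> inv c" and j = "\<lambda>m. m \<otimes> c"])
      (use c cc M.mem_carrier in \<open>auto simp: m_assoc\<close>)
  ultimately show ?thesis using c(3) by (metis mult_cancel_left2 mult.commute mult_cancel_left1)
qed

end

section \<open>Pure states and characters of abelian groups\<close>

context comm_group
begin

text \<open>In an abelian group the vector states of \<open>1 \<plusminus> c x\<close> with \<open>\<bar>c\<bar> = 1\<close> average to the
  original state, so purity makes each of them proportional to it.\<close>

lemma pure_state_character:
  assumes pd: "posdef \<phi>0" and q: "q \<in> state_cone \<phi>0" "q \<one> = 1" "pure \<phi>0 q"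
  shows "q \<in> hom G circle_group"
proof -
  have pq: "posdef q" by (rule state_cone_posdef[OF pd q(1)])
  have sw: "sandwich q [(1, \<one>), (c, x)] y = 2 * q y + c * q (y \<otimes> x) + cnj c * q (y \<otimes> inv x)"
    if "x \<in> carrier G" "y \<in> carrier G" "c * cnj c = 1" for c x y
  proof -
    have "inv x \<otimes> (y \<otimes> x) = y" using that by (metis inv_closed m_closed m_comm m_assoc l_inv l_one)
    moreover have "inv x \<otimes> y = y \<otimes> inv x" using that m_comm by simp
    ultimately show ?thesis
      using that by (simp add: sandwich_def form_def algebra_simps)
  qed
  have scale_q: "sandwich q [(1, \<one>), (c, x)] y = sandwich q [(1, \<one>), (c, x)] \<one> * q y"
    if x: "x \<in> carrier G" and y: "y \<in> carrier G" and c: "c * cnj c = 1" for c x y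
  proof -
    \<comment> \<open>The terms with \<open>c\<close> cancel in the sum of the two vector states,
      which leaves four times \<open>q\<close>.\<close>
    define f1 where "f1 = (\<lambda>y. of_real (1/4) * sandwich q [(1, \<one>), (c, x)] y)"
    define f2 where "f2 = (\<lambda>y. of_real (1/4) * sandwich q [(1, \<one>), (- c, x)] y)"
    have "f1 \<in> state_cone \<phi>0" "f2 \<in> state_cone \<phi>0"
      unfolding f1_def f2_def using x q by (intro state_cone_scale sandwich_state_cone; simp)+
    moreover have "q z = f1 z + f2 z" for z
    proof (cases "z \<in> carrier G")
      case True
      then show ?thesis using sw[OF x True, of c] sw[OF x True, of "- c"] c
        by (simp add: f1_def f2_def add_divide_distrib diff_divide_distrib)
    qed (simp add: f1_def f2_def sandwich_def posdef_off[OF pq])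
    ultimately have "f1 y = f1 \<one> * q y" using q(3) unfolding pure_def by blast
    then show ?thesis by (simp add: f1_def)
  qed
  have mult: "q (y \<otimes> x) = q y * q x" if x: "x \<in> carrier G" and y: "y \<in> carrier G" for x y
  proof -
    \<comment> \<open>The case \<open>c = 1\<close> gives the sum of
      \<open>q (y \<otimes> x)\<close> and \<open>q (y \<otimes> inv x)\<close>, the case
      \<open>c = \<i>\<close> their difference.\<close>
    have "2 * q y + q (y \<otimes> x) + q (y \<otimes> inv x) = (2 + q x + q (inv x)) * q y"
      using scale_q[OF x y, of 1] sw[OF x y, of 1] sw[OF x one_closed, of 1] x q(2) by simp
    moreover have "2 * q y + \<i> * q (y \<otimes> x) - \<i> * q (y \<otimes> inv x) = (2 + \<i> * q x - \<i> * q (inv x)) * q y"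
      using scale_q[OF x y, of \<i>] sw[OF x y, of \<i>] sw[OF x one_closed, of \<i>] x q(2) by simp
    ultimately have "q (y \<otimes> x) + q (y \<otimes> inv x) = (q x + q (inv x)) * q y"
      "\<i> * (q (y \<otimes> x) - q (y \<otimes> inv x)) = \<i> * ((q x - q (inv x)) * q y)"
      by (simp_all add: algebra_simps)
    then have "q (y \<otimes> x) + q (y \<otimes> inv x) = (q x + q (inv x)) * q y"
      "q (y \<otimes> x) - q (y \<otimes> inv x) = (q x - q (inv x)) * q y" by auto
    then have "(q (y \<otimes> x) + q (y \<otimes> inv x)) + (q (y \<otimes> x) - q (y \<otimes> inv x))
        = (q x + q (inv x)) * q y + (q x - q (inv x)) * q y" by simp
    then show ?thesis by (simp add: algebra_simps)
  qed
  have "cmod (q x) = 1" if x: "x \<in> carrier G" for x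
  proof -
    have "q x * cnj (q x) = 1" using mult[OF inv_closed[OF x] x] posdef_cnj[OF pq x] x q(2) by simp
    then have "(cmod (q x))\<^sup>2 = 1" using complex_norm_square[of "q x"] by (metis of_real_eq_1_iff)
    then show ?thesis using norm_ge_zero[of "q x"] by (auto simp: power2_eq_1_iff)
  qed
  then show ?thesis using mult by (intro homI) auto
qed

text \<open>As the group is abelian, \<open>\<phi>0 (y \<otimes> x) = \<theta> x * \<phi>0 y\<close>
  for \<open>x\<close> in \<open>A\<close> becomes a linear equation satisfied by all vector states.
  It passes to the pure state \<open>q\<close>, which therefore extends \<open>\<theta>\<close>. The
  slice \<open>Re (q c) < 1\<close> contains \<open>\<phi>0\<close>, which vanishes at
  \<open>c\<close>; starting there keeps \<open>q c\<close> away from 1.\<close>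

theorem extend_character:
  assumes count: "countable (carrier G)" and A: "subgroup A G"
    and \<theta>: "\<theta> \<in> hom (G\<lparr>carrier := A\<rparr>) circle_group" and c: "c \<in> carrier G" "c \<notin> A"
  obtains \<psi> where "\<psi> \<in> hom G circle_group" "\<And>x. x \<in> A \<Longrightarrow> \<psi> x = \<theta> x" "\<psi> c \<noteq> 1"
proof -
  define \<phi>0 where "\<phi>0 = induced A \<theta>"
  have pd: "posdef \<phi>0" unfolding \<phi>0_def by (rule posdef_induced[OF A \<theta>])
  have one: "\<phi>0 \<one> = 1" using character_one[OF A \<theta>] subgroup.one_closed[OF A] by (simp add: \<phi>0_def induced_def)
  have "-1 < Re (lf [(-1, c)] \<phi>0)" using c by (simp add: \<phi>0_def induced_def)
  obtain q where q: "q \<in> state_cone \<phi>0" "q \<one> = 1" "pure \<phi>0 q" "-1 < Re (lf [(-1, c)] q)"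
    by (rule pure_state_exists[OF pd one count, of "[(-1, c)]" "-1" "{}"])
      (use c \<open>-1 < Re (lf [(-1, c)] \<phi>0)\<close> in auto)
  have "q x = \<theta> x" if x: "x \<in> A" for x
  proof -
    have xc: "x \<in> carrier G" by (rule subgroup.mem_carrier[OF A x])
    have ext: "\<phi>0 (y \<otimes> x) = \<theta> x * \<phi>0 y" if y: "y \<in> carrier G" for y
    proof (cases "y \<in> A")
      case False
      have "y \<otimes> x \<notin> A"
      proof
        assume "y \<otimes> x \<in> A"
        then have "y \<otimes> x \<otimes> inv x \<in> A" using A x by (simp add: subgroup.m_closed subgroup.m_inv_closed)
        then show False using False y xc by (simp add: m_assoc)
      qed
      then show ?thesis using False by (simp add: \<phi>0_def induced_def)
    next
      case True
      then show ?thesis using x character_mult[OF \<theta>] subgroup.m_closed[OF A]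
        by (simp add: \<phi>0_def induced_def)
    qed
    have "lf [(1, x), (- \<theta> x, \<one>)] (sandwich \<phi>0 a) = 0" if a: "a \<in> combs" for a
    proof -
      have "\<phi>0 (inv z \<otimes> (x \<otimes> y)) = \<theta> x * \<phi>0 (inv z \<otimes> y)" if "y \<in> carrier G" "z \<in> carrier G" for y z
        using ext[of "inv z \<otimes> y"] that xc by (simp add: m_ac)
      then have "form \<phi>0 (shift x a) a = \<theta> x * form \<phi>0 a a"
        unfolding form_def shift_def sum_list_const_mult[symmetric] map_map o_def using combsD[OF a]
        by (intro arg_cong[where f = sum_list] map_cong refl) auto
      then show ?thesis using a xc by (simp add: sandwich_def shift_one)
    qed
    then have "lf [(1, x), (- \<theta> x, \<one>)] q = 0"
      using xc by (intro state_cone_eq[OF q(1)]) auto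
    then show ?thesis using q(2) by simp
  qed
  moreover have "q c \<noteq> 1" using q(4) by auto
  ultimately show ?thesis using that pure_state_character[OF pd q(1-3)] by blast
qed

end

section \<open>Commuting subgroups\<close>

context group
begin

text \<open>Centralizers are subgroups: this is applied first to the centralizer of \<open>T\<close>
  and then to that of the single element \<open>x\<close>.\<close>

lemma generate_commute:
  assumes S: "S \<subseteq> carrier G" and T: "T \<subseteq> carrier G"
    and comm: "\<And>x y. x \<in> S \<Longrightarrow> y \<in> T \<Longrightarrow> x \<otimes> y = y \<otimes> x"
    and x: "x \<in> generate G S" and y: "y \<in> generate G T"
  shows "x \<otimes> y = y \<otimes> x"
proof -
  define C where "C = (\<lambda>T. {x \<in> carrier G. \<forall>y\<in>T. x \<otimes> y = y \<otimes> x})"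
  have sub: "subgroup (C T) G" if T: "T \<subseteq> carrier G" for T
  proof (rule subgroupI)
    fix a assume a: "a \<in> C T"
    have "inv a \<otimes> y = y \<otimes> inv a" if y: "y \<in> T" for y
    proof -
      have yc: "y \<in> carrier G" "a \<in> carrier G" "a \<otimes> y = y \<otimes> a" using a T y by (auto simp: C_def)
      have "inv a \<otimes> y = inv a \<otimes> (y \<otimes> a) \<otimes> inv a" using yc by (simp add: m_assoc)
      also have "\<dots> = y \<otimes> inv a" using yc by (simp add: yc(3)[symmetric] m_assoc[symmetric])
      finally show ?thesis .
    qed
    then show "inv a \<in> C T" using a by (simp add: C_def)
    fix b assume b: "b \<in> C T"
    have "a \<otimes> b \<otimes> y = y \<otimes> (a \<otimes> b)" if y: "y \<in> T" for y
    proof -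
      have yc: "y \<in> carrier G" "a \<in> carrier G" "b \<in> carrier G" "a \<otimes> y = y \<otimes> a" "b \<otimes> y = y \<otimes> b"
        using a b T y by (auto simp: C_def)
      have "a \<otimes> b \<otimes> y = a \<otimes> (y \<otimes> b)" using yc(1-3) by (simp add: m_assoc yc(5))
      also have "\<dots> = a \<otimes> y \<otimes> b" using yc(1-3) by (simp add: m_assoc)
      also have "\<dots> = y \<otimes> a \<otimes> b" by (simp only: yc(4))
      finally show ?thesis using yc by (simp add: m_assoc)
    qed
    then show "a \<otimes> b \<in> C T" using a b by (simp add: C_def)
  qed (use T in \<open>auto simp: C_def subset_iff\<close>)
  have "generate G S \<subseteq> C T"
    by (rule generate_subgroup_incl[OF _ sub[OF T]]) (use S comm in \<open>auto simp: C_def\<close>)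
  then have "T \<subseteq> C {x}" using x T by (auto simp: C_def)
  moreover have "x \<in> carrier G" using generate_in_carrier[OF S x] .
  ultimately have "generate G T \<subseteq> C {x}" by (intro generate_subgroup_incl sub) auto
  then show ?thesis using y by (auto simp: C_def)
qed

lemma generate_comm_group:
  assumes S: "S \<subseteq> carrier G" and comm: "\<And>x y. x \<in> S \<Longrightarrow> y \<in> S \<Longrightarrow> x \<otimes> y = y \<otimes> x"
  shows "comm_group (G\<lparr>carrier := generate G S\<rparr>)"
proof -
  have "group (G\<lparr>carrier := generate G S\<rparr>)"
    by (rule subgroup.subgroup_is_group[OF generate_is_subgroup[OF S] is_group])
  then show ?thesis
    by (rule group.group_comm_groupI) (use generate_commute[OF S S comm] in auto)
qed

lemma comm_group_iff_commute:
  assumes "subgroup M G"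
  shows "comm_group (G\<lparr>carrier := M\<rparr>) \<longleftrightarrow> (\<forall>x\<in>M. \<forall>y\<in>M. x \<otimes> y = y \<otimes> x)"
proof
  assume "comm_group (G\<lparr>carrier := M\<rparr>)"
  then interpret C: comm_group "G\<lparr>carrier := M\<rparr>" .
  show "\<forall>x\<in>M. \<forall>y\<in>M. x \<otimes> y = y \<otimes> x" using C.m_comm by simp
next
  assume "\<forall>x\<in>M. \<forall>y\<in>M. x \<otimes> y = y \<otimes> x"
  then show "comm_group (G\<lparr>carrier := M\<rparr>)"
    by (intro group.group_comm_groupI subgroup.subgroup_is_group[OF assms is_group]) simp
qed

text \<open>The commutator of \<open>x\<close> and \<open>y\<close> lies in both normal
  subgroups.\<close>

lemma normal_commute:
  assumes M: "M \<lhd> G" and N: "N \<lhd> G" and MN: "M \<inter> N = {\<one>}" and x: "x \<in> M" and y: "y \<in> N"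
  shows "x \<otimes> y = y \<otimes> x"
proof -
  interpret M: normal M G by fact
  interpret N: normal N G by fact
  have c: "x \<in> carrier G" "y \<in> carrier G" using x y by auto
  have "x \<otimes> (y \<otimes> inv x \<otimes> inv y) \<in> M" using x c M.inv_op_closed2 by auto
  moreover have "(x \<otimes> y \<otimes> inv x) \<otimes> inv y \<in> N" using y c N.inv_op_closed2 by auto
  moreover have "x \<otimes> (y \<otimes> inv x \<otimes> inv y) = (x \<otimes> y \<otimes> inv x) \<otimes> inv y" using c by (simp add: m_assoc)
  ultimately have e: "x \<otimes> y \<otimes> inv x \<otimes> inv y = \<one>" using MN by auto
  have "x \<otimes> y = x \<otimes> y \<otimes> inv x \<otimes> inv y \<otimes> (y \<otimes> x)"
    using c by (simp add: m_assoc) (simp add: m_assoc[symmetric])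
  also have "\<dots> = y \<otimes> x" unfolding e using c by simp
  finally show ?thesis .
qed

end

subsection \<open>Invariant subgroups and feet\<close>

text \<open>Only values on the carrier enter. Automorphisms of the whole group are extensional on
  its carrier and thus in general not literally elements of \<open>AutoGroup\<close> of an invariant
  subgroup, yet they satisfy these conditions for it. So every result can be reused for
  \<open>MA\<close>, \<open>MS\<close> and \<open>MSG\<close> (see
  \<open>G_group_subgroup\<close>).\<close>

locale G_group = group G for G :: "('a, 'b) monoid_scheme" (structure) +
  fixes \<A> :: "('a \<Rightarrow> 'a) set"
  assumes countable_carrier: "countable (carrier G)"
    and act_hom: "g \<in> \<A> \<Longrightarrow> g \<in> hom G G"
    and act_inv: "g \<in> \<A> \<Longrightarrow> \<exists>g'\<in>\<A>. \<forall>x\<in>carrier G. g' (g x) = x \<and> g (g' x) = x"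
    and act_comp: "g \<in> \<A> \<Longrightarrow> h \<in> \<A> \<Longrightarrow> \<exists>k\<in>\<A>. \<forall>x\<in>carrier G. k x = g (h x)"
    and act_one: "\<exists>g\<in>\<A>. \<forall>x\<in>carrier G. g x = x"
    and act_inner: "a \<in> carrier G \<Longrightarrow> \<exists>g\<in>\<A>. \<forall>x\<in>carrier G. g x = a \<otimes> x \<otimes> inv a"
begin

abbreviation ginv :: "'a set \<Rightarrow> bool"
  where "ginv M \<equiv> G_invariant_subgroup G \<A> M"

definition span :: "'a \<Rightarrow> 'a set"
  where "span x = generate G ((\<lambda>g. g x) ` \<A>)"

lemma act_closed: "g \<in> \<A> \<Longrightarrow> x \<in> carrier G \<Longrightarrow> g x \<in> carrier G"
  using act_hom by (auto simp: hom_def)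

lemma act_mult: "g \<in> \<A> \<Longrightarrow> x \<in> carrier G \<Longrightarrow> y \<in> carrier G \<Longrightarrow> g (x \<otimes> y) = g x \<otimes> g y"
  using act_hom by (auto simp: hom_def)

lemma act_group_hom: "g \<in> \<A> \<Longrightarrow> group_hom G G g"
  by (simp add: group_hom_def group_hom_axioms_def act_hom is_group)

lemma act_inverse: "g \<in> \<A> \<Longrightarrow> x \<in> carrier G \<Longrightarrow> g (inv x) = inv (g x)"
  by (rule group_hom.hom_inv[OF act_group_hom])

lemma act_unit: "g \<in> \<A> \<Longrightarrow> g \<one> = \<one>"
  by (rule group_hom.hom_one[OF act_group_hom])

text \<open>Inclusion gives the equality in the definition because the inverse of an element of
  \<open>\<A>\<close> acts like an element of \<open>\<A>\<close>.\<close>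

lemma ginvI:
  assumes "subgroup M G" "\<And>g x. g \<in> \<A> \<Longrightarrow> x \<in> M \<Longrightarrow> g x \<in> M"
  shows "ginv M"
  unfolding G_invariant_subgroup_def
proof (intro conjI ballI assms(1) equalityI subsetI)
  fix g x assume g: "g \<in> \<A>" and x: "x \<in> M"
  have xc: "x \<in> carrier G" by (rule subgroup.mem_carrier[OF assms(1) x])
  obtain g' where g': "g' \<in> \<A>" "g (g' x) = x" using act_inv[OF g] xc by blast
  then have "g' x \<in> M" using assms(2) x by blast
  then show "x \<in> g ` M" using g'(2) by (metis image_eqI)
qed (use assms(2) in blast)

lemma ginvD:
  assumes "ginv M"
  shows "subgroup M G" "\<And>g x. g \<in> \<A> \<Longrightarrow> x \<in> M \<Longrightarrow> g x \<in> M" "\<And>x. x \<in> M \<Longrightarrow> x \<in> carrier G" "\<one> \<in> M"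
    "\<And>x y. x \<in> M \<Longrightarrow> y \<in> M \<Longrightarrow> x \<otimes> y \<in> M" "\<And>x. x \<in> M \<Longrightarrow> inv x \<in> M"
proof -
  show s: "subgroup M G" using assms by (simp add: G_invariant_subgroup_def)
  show "g x \<in> M" if "g \<in> \<A>" "x \<in> M" for g x
    using assms that unfolding G_invariant_subgroup_def by blast
  show "x \<in> carrier G" if "x \<in> M" for x by (rule subgroup.mem_carrier[OF s that])
  show "\<one> \<in> M" by (rule subgroup.one_closed[OF s])
  show "x \<otimes> y \<in> M" if "x \<in> M" "y \<in> M" for x y by (rule subgroup.m_closed[OF s that])
  show "inv x \<in> M" if "x \<in> M" for x by (rule subgroup.m_inv_closed[OF s that])
qed

lemma ginv_normal:
  assumes "ginv M" shows "M \<lhd> G"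
  unfolding normal_inv_iff
proof (intro conjI ballI ginvD(1)[OF assms])
  fix a x assume a: "a \<in> carrier G" and x: "x \<in> M"
  obtain g where "g \<in> \<A>" "g x = a \<otimes> x \<otimes> inv a" using act_inner[OF a] ginvD(3)[OF assms x] by blast
  then show "a \<otimes> x \<otimes> inv a \<in> M" using ginvD(2)[OF assms _ x] by metis
qed

lemma ginv_trivial: "ginv {\<one>}"
  by (rule ginvI) (auto simp: triv_subgroup act_unit)

lemma ginv_Int: "ginv M \<Longrightarrow> ginv N \<Longrightarrow> ginv (M \<inter> N)"
  by (rule ginvI) (auto intro: subgroups_Inter_pair dest: ginvD)

lemma ginv_generate:
  assumes "S \<subseteq> carrier G" "\<And>g x. g \<in> \<A> \<Longrightarrow> x \<in> S \<Longrightarrow> g x \<in> S"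
  shows "ginv (generate G S)"
proof (rule ginvI[OF generate_is_subgroup[OF assms(1)]])
  fix g x assume g: "g \<in> \<A>" and x: "x \<in> generate G S"
  have "g ` generate G S = generate G (g ` S)"
    by (rule group_hom.generate_img[OF act_group_hom[OF g] assms(1), symmetric])
  also have "\<dots> \<subseteq> generate G S" by (rule mono_generate) (use assms(2) g in blast)
  finally show "g x \<in> generate G S" using x by blast
qed

lemma ginv_generate_Union:
  assumes "\<And>M. M \<in> F \<Longrightarrow> ginv M"
  shows "ginv (generate G (\<Union>F))"
  using assms ginvD(2,3) by (intro ginv_generate) blast+

lemma orbit_closed: "x \<in> carrier G \<Longrightarrow> (\<lambda>g. g x) ` \<A> \<subseteq> carrier G"
  using act_closed by blast

lemma ginv_span: "x \<in> carrier G \<Longrightarrow> ginv (span x)"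
  unfolding span_def
proof (rule ginv_generate[OF orbit_closed])
  fix g y assume x: "x \<in> carrier G" and g: "g \<in> \<A>" "y \<in> (\<lambda>g. g x) ` \<A>"
  then obtain h where h: "h \<in> \<A>" "y = h x" by blast
  obtain k where "k \<in> \<A>" "k x = g (h x)" using act_comp[OF g(1) h(1)] x by blast
  then show "g y \<in> (\<lambda>g. g x) ` \<A>" using h by (metis image_eqI)
qed

lemma span_self: "x \<in> carrier G \<Longrightarrow> x \<in> span x"
proof -
  assume "x \<in> carrier G"
  then obtain g where "g \<in> \<A>" "g x = x" using act_one by blast
  then have "x \<in> (\<lambda>g. g x) ` \<A>" by (metis image_eqI)
  then show ?thesis unfolding span_def by (rule generate.incl)
qed

lemma span_least: "ginv M \<Longrightarrow> x \<in> M \<Longrightarrow> span x \<subseteq> M"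
  unfolding span_def using ginvD(1,2) by (intro generate_subgroup_incl) blast+

text \<open>The intersection of the twisted kernels is the largest invariant subgroup inside the
  kernel of \<open>\<sigma>\<close>. In this form faithfulness consists of conditions on single
  subgroups, which can be met one at a time.\<close>

lemma G_faithful_iff:
  assumes "group_hom G L \<sigma>"
  shows "G_faithful \<A> G L \<sigma> \<longleftrightarrow> (\<forall>M. ginv M \<and> M \<noteq> {\<one>} \<longrightarrow> (\<exists>x\<in>M. \<sigma> x \<noteq> \<one>\<^bsub>L\<^esub>))"
proof -
  interpret \<sigma>: group_hom G L \<sigma> by fact
  have ne: "\<A> \<noteq> {}" using act_one by blast
  have ker: "(\<Inter>g\<in>\<A>. kernel G L (\<lambda>n. \<sigma> (g n))) = {x \<in> carrier G. \<forall>g\<in>\<A>. \<sigma> (g x) = \<one>\<^bsub>L\<^esub>}"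
    using ne by (auto simp: kernel_def)
  show ?thesis unfolding G_faithful_def ker
  proof (intro iffI allI impI)
    fix M assume h: "{x \<in> carrier G. \<forall>g\<in>\<A>. \<sigma> (g x) = \<one>\<^bsub>L\<^esub>} = {\<one>}" and M: "ginv M \<and> M \<noteq> {\<one>}"
    obtain x where x: "x \<in> M" "x \<noteq> \<one>" using M ginvD(4) by blast
    then have "x \<in> carrier G" using M ginvD(3) by blast
    then obtain g where "g \<in> \<A>" "\<sigma> (g x) \<noteq> \<one>\<^bsub>L\<^esub>" using h x(2) by blast
    then show "\<exists>x\<in>M. \<sigma> x \<noteq> \<one>\<^bsub>L\<^esub>" using M x ginvD(2) by blast
  next
    assume h: "\<forall>M. ginv M \<and> M \<noteq> {\<one>} \<longrightarrow> (\<exists>x\<in>M. \<sigma> x \<noteq> \<one>\<^bsub>L\<^esub>)"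
    have "x = \<one>" if x: "x \<in> carrier G" "\<forall>g\<in>\<A>. \<sigma> (g x) = \<one>\<^bsub>L\<^esub>" for x
    proof (rule ccontr)
      assume "x \<noteq> \<one>"
      then have "span x \<noteq> {\<one>}" using span_self[OF x(1)] by auto
      then obtain y where y: "y \<in> span x" "\<sigma> y \<noteq> \<one>\<^bsub>L\<^esub>" using h ginv_span[OF x(1)] by blast
      have "span x \<subseteq> kernel G L \<sigma>" unfolding span_def
        by (rule generate_subgroup_incl[OF _ \<sigma>.subgroup_kernel])
          (use x act_closed in \<open>auto simp: kernel_def\<close>)
      then show False using y by (auto simp: kernel_def)
    qed
    then show "{x \<in> carrier G. \<forall>g\<in>\<A>. \<sigma> (g x) = \<one>\<^bsub>L\<^esub>} = {\<one>}"
      by (auto simp: act_unit)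
  qed
qed

lemma finite_ginv_contains_foot:
  assumes "finite M" "ginv M" "M \<noteq> {\<one>}"
  obtains F where "G_foot G \<A> F" "finite F" "F \<subseteq> M"
proof -
  have "\<exists>F. G_foot G \<A> F \<and> F \<subseteq> M" using assms
  proof (induction "card M" arbitrary: M rule: less_induct)
    case less
    show ?case
    proof (cases "\<exists>N. ginv N \<and> N \<subseteq> M \<and> N \<noteq> M \<and> N \<noteq> {\<one>}")
      case True
      then obtain N where N: "ginv N" "N \<subset> M" "N \<noteq> {\<one>}" by blast
      then show ?thesis
        using less.hyps[of N] psubset_card_mono[OF less.prems(1) N(2)] finite_subset[of N M] less.prems(1)
        by blast
    next
      case False
      then have "G_foot G \<A> M" using less.prems by (auto simp: G_foot_def)
      then show ?thesis by blast
    qed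
  qed
  then show ?thesis using that finite_subset assms(1) by blast
qed

lemma footD:
  assumes "G_foot G \<A> F"
  shows "ginv F" "F \<noteq> {\<one>}" "\<And>N. ginv N \<Longrightarrow> N \<subseteq> F \<Longrightarrow> N = F \<or> N = {\<one>}"
  using assms by (auto simp: G_foot_def)

lemma foot_Int:
  assumes "G_foot G \<A> F" "ginv M"
  shows "F \<subseteq> M \<or> F \<inter> M = {\<one>}"
  using footD(3)[OF assms(1) ginv_Int[OF footD(1)[OF assms(1)] assms(2)]] by blast

lemma feet_disjoint:
  assumes "G_foot G \<A> F" "G_foot G \<A> F'" "F \<noteq> F'"
  shows "F \<inter> F' = {\<one>}"
  using foot_Int[OF assms(1) footD(1)[OF assms(2)]] footD(3)[OF assms(2) footD(1)[OF assms(1)]]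
    footD(2)[OF assms(1)] assms(3) by blast

lemma feet_commute:
  assumes "G_foot G \<A> F" "G_foot G \<A> F'" "F \<noteq> F'" "x \<in> F" "y \<in> F'"
  shows "x \<otimes> y = y \<otimes> x"
  using normal_commute ginv_normal footD(1) feet_disjoint assms by metis

lemma ginv_carrier_subset: "ginv M \<Longrightarrow> M \<subseteq> carrier G"
  using ginvD(3) by blast

lemma feet_union_carrier: "(\<And>M. M \<in> F \<Longrightarrow> G_foot G \<A> M) \<Longrightarrow> \<Union>F \<subseteq> carrier G"
  using footD(1) ginv_carrier_subset by blast

text \<open>The elements over whose invariant hull one can average. \<open>abelian_part\<close> will
  consist of such elements, so an infinite hull without finite feet meets it trivially.\<close>

definition locally_finite :: "'a set"
  where "locally_finite = {x \<in> carrier G. finite (span x)}"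

text \<open>The hull of a product lies in the product of the two hulls, which is finite and
  invariant.\<close>

lemma subgroup_locally_finite: "subgroup locally_finite G"
proof (rule subgroupI)
  have "span \<one> \<subseteq> {\<one>}" by (rule span_least[OF ginv_trivial]) simp
  then have "finite (span \<one>)" by (rule finite_subset) simp
  then have "\<one> \<in> locally_finite" by (simp add: locally_finite_def)
  then show "locally_finite \<noteq> {}" by blast
  fix a assume a: "a \<in> locally_finite"
  then have ac: "a \<in> carrier G" "finite (span a)" by (auto simp: locally_finite_def)
  have "span (inv a) \<subseteq> span a"
    by (rule span_least[OF ginv_span[OF ac(1)]]) (use ginvD(6)[OF ginv_span] span_self ac in blast)
  then show "inv a \<in> locally_finite" using ac finite_subset by (auto simp: locally_finite_def)
  fix b assume b: "b \<in> locally_finite"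
  then have bc: "b \<in> carrier G" "finite (span b)" by (auto simp: locally_finite_def)
  have "ginv (span a <#> span b)"
  proof (rule ginvI)
    show "subgroup (span a <#> span b) G"
      by (rule mult_norm_subgroup[OF ginv_normal ginvD(1)]) (use ginv_span ac bc in auto)
    fix g x assume g: "g \<in> \<A>" and "x \<in> span a <#> span b"
    then obtain u v where uv: "u \<in> span a" "v \<in> span b" "x = u \<otimes> v" by (auto simp: set_mult_def)
    then have "g x = g u \<otimes> g v" using act_mult[OF g] ginvD(3)[OF ginv_span] ac bc by blast
    then show "g x \<in> span a <#> span b"
      using uv ginvD(2)[OF ginv_span g] ac bc by (auto simp: set_mult_def)
  qed
  then have "span (a \<otimes> b) \<subseteq> span a <#> span b"
    by (rule span_least) (use span_self ac bc in \<open>auto simp: set_mult_def\<close>)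
  moreover have "finite (span a <#> span b)" using ac bc by (auto simp: set_mult_def)
  ultimately show "a \<otimes> b \<in> locally_finite" using ac bc finite_subset by (auto simp: locally_finite_def)
qed (auto simp: locally_finite_def)

lemma generate_feet_locally_finite:
  assumes "\<And>M. M \<in> F \<Longrightarrow> G_foot G \<A> M \<and> finite M"
  shows "generate G (\<Union>F) \<subseteq> locally_finite"
proof (rule generate_subgroup_incl[OF _ subgroup_locally_finite])
  show "\<Union>F \<subseteq> locally_finite"
  proof
    fix x assume "x \<in> \<Union>F"
    then obtain M where M: "M \<in> F" "x \<in> M" by blast
    then have gM: "ginv M" using assms footD(1) by blast
    then show "x \<in> locally_finite"
      using finite_subset[OF span_least[OF gM M(2)]] assms M ginvD(3)[OF gM M(2)] by (auto simp: locally_finite_def)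
  qed
qed

lemma abelian_feet_commute:
  assumes "abelian_finite_G_foot G \<A> F" "abelian_finite_G_foot G \<A> F'" "x \<in> F" "y \<in> F'"
  shows "x \<otimes> y = y \<otimes> x"
proof (cases "F = F'")
  case True
  then show ?thesis using assms comm_group_iff_commute[of F] footD(1) ginvD(1)
    unfolding abelian_finite_G_foot_def by blast
next
  case False
  then show ?thesis using assms feet_commute unfolding abelian_finite_G_foot_def by blast
qed

lemma MAG_carrier: "\<Union>{M. abelian_finite_G_foot G \<A> M} \<subseteq> carrier G"
  by (rule feet_union_carrier) (auto simp: abelian_finite_G_foot_def)

lemma comm_group_MAG: "comm_group (G\<lparr>carrier := MAG G \<A>\<rparr>)"
  unfolding MAG_def by (rule generate_comm_group[OF MAG_carrier]) (use abelian_feet_commute in blast)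

lemma ginv_MAG: "ginv (MAG G \<A>)"
  unfolding MAG_def by (rule ginv_generate_Union) (auto simp: abelian_finite_G_foot_def footD)

lemma MAG_locally_finite: "MAG G \<A> \<subseteq> locally_finite"
  unfolding MAG_def by (rule generate_feet_locally_finite) (auto simp: abelian_finite_G_foot_def)

lemma foot_subset_MAG: "abelian_finite_G_foot G \<A> F \<Longrightarrow> F \<subseteq> MAG G \<A>"
  unfolding MAG_def using generate.incl[of _ "\<Union>{M. abelian_finite_G_foot G \<A> M}" G] by blast

lemma ginv_in_subgroup:
  assumes N: "ginv N" and M: "M \<subseteq> N"
  shows "G_invariant_subgroup (G\<lparr>carrier := N\<rparr>) \<A> M \<longleftrightarrow> ginv M"
  unfolding G_invariant_subgroup_def
  using subgroup_incl[OF _ ginvD(1)[OF N] M] incl_subgroup[OF ginvD(1)[OF N], of M] by blast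

lemma G_group_subgroup:
  assumes N: "ginv N"
  shows "G_group (G\<lparr>carrier := N\<rparr>) \<A>"
proof -
  note n = ginvD[OF N]
  have sub: "N \<subseteq> carrier G" using n by blast
  interpret N: group "G\<lparr>carrier := N\<rparr>" by (rule subgroup.subgroup_is_group[OF n(1) is_group])
  show ?thesis
  proof (unfold_locales, goal_cases)
    case 1 then show ?case using countable_subset[OF sub countable_carrier] by simp
  next
    case (2 g) then show ?case using n act_mult by (auto intro!: homI)
  next
    case (3 g) then show ?case using act_inv[of g] sub by simp blast
  next
    case (4 g h) then show ?case using act_comp[of g h] sub by simp blast
  next
    case 5 then show ?case using act_one sub by simp blast
  next
    case (6 a)
    then have "a \<in> carrier G" "a \<in> N" using n by auto
    moreover have "inv\<^bsub>G\<lparr>carrier := N\<rparr>\<^esub> a = inv a" using m_inv_consistent[OF n(1)] 6 by simp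
    ultimately show ?case using act_inner[of a] sub by simp blast
  qed
qed

end

section \<open>Averaging in irreducible unitary representations\<close>

context complex_inner_product_space
begin

lemma cinner_eqI:
  assumes "x \<in> carrier H" "x' \<in> carrier H" "\<And>y. y \<in> carrier H \<Longrightarrow> cinner H x y = cinner H x' y"
  shows "x = x'"
proof -
  have "sq (x \<ominus> x') = 0" using assms by (simp add: sq_def cinner_minus_left)
  then have "x \<ominus> x' = \<zero>" using assms by simp
  then show ?thesis using assms by (metis a_minus_def a_inv_closed minus_equality minus_minus r_neg)
qed

lemma group_unitary_group: "group (unitary_group H)"
proof -
  let ?B = "BijGroup (carrier H)"
  have "subgroup (unitaries H) ?B"
  proof (rule group.subgroupI[OF group_BijGroup])
    show "unitaries H \<subseteq> carrier ?B" by (auto simp: unitaries_def BijGroup_def)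
    have "(\<lambda>x\<in>carrier H. x) \<in> unitaries H" by (auto simp: unitaries_def id_Bij)
    then show "unitaries H \<noteq> {}" by blast
    fix U assume U: "U \<in> unitaries H"
    then have B: "U \<in> Bij (carrier H)" by (simp add: unitaries_def)
    define V' where "V' = restrict (inv_into (carrier H) U) (carrier H)"
    have bij: "bij_betw U (carrier H) (carrier H)" using B by (simp add: Bij_def)
    have inj: "x = y" if "x \<in> carrier H" "y \<in> carrier H" "U x = U y" for x y
      using bij that by (auto simp: bij_betw_def inj_on_def)
    have V1: "V' x \<in> carrier H" and V2: "U (V' x) = x" if "x \<in> carrier H" for x
      using bij that by (auto simp: bij_betw_def inv_into_into f_inv_into_f V'_def)
    have U1: "U (x \<oplus> y) = U x \<oplus> U y" "U (c \<odot> x) = c \<odot> U x" "cinner H (U x) (U y) = cinner H x y"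
      if "x \<in> carrier H" "y \<in> carrier H" for x y c
      using U that by (auto simp: unitaries_def)
    have "V' \<in> unitaries H" unfolding unitaries_def
    proof (intro CollectI conjI ballI allI)
      show "V' \<in> Bij (carrier H)" unfolding V'_def by (rule restrict_inv_into_Bij[OF B])
      fix x y assume x: "x \<in> carrier H" and y: "y \<in> carrier H"
      show "V' (x \<oplus> y) = V' x \<oplus> V' y"
        by (rule inj) (simp_all add: V1 V2 U1 x y)
      show "cinner H (V' x) (V' y) = cinner H x y"
        using U1(3)[OF V1[OF x] V1[OF y]] by (simp add: V2 x y)
    next
      fix c x assume x: "x \<in> carrier H"
      show "V' (c \<odot> x) = c \<odot> V' x"
        by (rule inj) (simp_all add: V1 V2 U1(2)[OF V1[OF x] x] x)
    qed
    then show "inv\<^bsub>?B\<^esub> U \<in> unitaries H" using inv_BijGroup[OF B] by (simp add: V'_def)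
    fix V assume V: "V \<in> unitaries H"
    then have B': "V \<in> Bij (carrier H)" by (simp add: unitaries_def)
    have c: "V x \<in> carrier H" if "x \<in> carrier H" for x using Bij_imp_funcset[OF B'] that by auto
    have "compose (carrier H) U V \<in> unitaries H"
      using U V c compose_Bij[OF B B'] by (auto simp: unitaries_def compose_def)
    then show "U \<otimes>\<^bsub>?B\<^esub> V \<in> unitaries H" using B B' by (simp add: BijGroup_def)
  qed
  then show ?thesis
    unfolding unitary_group_def using group_BijGroup by (rule subgroup.subgroup_is_group)
qed

end

context group
begin

context
  fixes H :: "'h hilbert" and \<sigma>
  assumes ur: "unitary_rep G H \<sigma>"
begin

interpretation H: complex_hilbert_space H
  using ur by (simp add: unitary_rep_def)

lemma rep_unitary: "x \<in> carrier G \<Longrightarrow> \<sigma> x \<in> unitaries H"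
  using ur by (auto simp: unitary_rep_def hom_def unitary_group_simps)

lemma rep_group_hom: "group_hom G (unitary_group H) \<sigma>"
  using ur H.group_unitary_group is_group
  by (simp add: group_hom_def group_hom_axioms_def unitary_rep_def)

lemma rep_closed [simp]: "x \<in> carrier G \<Longrightarrow> v \<in> carrier H \<Longrightarrow> \<sigma> x v \<in> carrier H"
  using Bij_imp_funcset[of "\<sigma> x" "carrier H"] rep_unitary[of x] by (auto simp: unitaries_def)

lemma rep_mult:
  assumes "x \<in> carrier G" "y \<in> carrier G" "v \<in> carrier H"
  shows "\<sigma> (x \<otimes> y) v = \<sigma> x (\<sigma> y v)"
proof -
  have "\<sigma> (x \<otimes> y) = compose (carrier H) (\<sigma> x) (\<sigma> y)"
    using group_hom.hom_mult[OF rep_group_hom assms(1,2)] rep_unitary assms by (simp add: unitary_group_simps)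
  then show ?thesis using assms by (simp add: compose_def)
qed

lemma rep_one: "v \<in> carrier H \<Longrightarrow> \<sigma> \<one> v = v"
  using group_hom.hom_one[OF rep_group_hom] by (simp add: unitary_group_simps)

lemma rep_linear:
  assumes "x \<in> carrier G" "v \<in> carrier H" "w \<in> carrier H"
  shows "\<sigma> x (v \<oplus>\<^bsub>H\<^esub> w) = \<sigma> x v \<oplus>\<^bsub>H\<^esub> \<sigma> x w" "\<sigma> x (c \<odot>\<^bsub>H\<^esub> v) = c \<odot>\<^bsub>H\<^esub> \<sigma> x v"
  using rep_unitary[OF assms(1)] assms by (auto simp: unitaries_def)

lemma rep_adjoint:
  assumes "x \<in> carrier G" "v \<in> carrier H" "w \<in> carrier H"
  shows "cinner H (\<sigma> x v) w = cinner H v (\<sigma> (inv x) w)"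
proof -
  have "cinner H (\<sigma> x v) (\<sigma> x (\<sigma> (inv x) w)) = cinner H v (\<sigma> (inv x) w)"
    using rep_unitary[OF assms(1)] assms by (simp add: unitaries_def)
  then show ?thesis using rep_mult[of x "inv x" w] rep_one assms by simp
qed

definition rep_sum :: "'h \<Rightarrow> (complex \<times> 'a) list \<Rightarrow> 'h"
  where "rep_sum v a = foldr (\<lambda>p w. fst p \<odot>\<^bsub>H\<^esub> \<sigma> (snd p) v \<oplus>\<^bsub>H\<^esub> w) a \<zero>\<^bsub>H\<^esub>"

lemma rep_sum_simps [simp]:
  "rep_sum v [] = \<zero>\<^bsub>H\<^esub>" "rep_sum v (p # a) = fst p \<odot>\<^bsub>H\<^esub> \<sigma> (snd p) v \<oplus>\<^bsub>H\<^esub> rep_sum v a"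
  by (simp_all add: rep_sum_def)

lemma rep_sum_closed [simp]: "v \<in> carrier H \<Longrightarrow> a \<in> combs \<Longrightarrow> rep_sum v a \<in> carrier H"
  by (induction a) auto

lemma cinner_rep_sum_left:
  assumes "v \<in> carrier H" "w \<in> carrier H" "a \<in> combs"
  shows "cinner H (rep_sum v a) w = (\<Sum>p\<leftarrow>a. fst p * cinner H (\<sigma> (snd p) v) w)"
  using assms(3) by (induction a) (use assms in \<open>auto simp: H.cinner_simps\<close>)

lemma cinner_rep_sum_right:
  assumes "v \<in> carrier H" "w \<in> carrier H" "a \<in> combs"
  shows "cinner H w (rep_sum v a) = (\<Sum>p\<leftarrow>a. cnj (fst p) * cinner H w (\<sigma> (snd p) v))"
  using assms(3) by (induction a) (use assms in \<open>auto simp: H.cinner_simps\<close>)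

lemma posdef_matrix_coefficient:
  assumes v: "v \<in> carrier H"
  shows "posdef (\<lambda>x. if x \<in> carrier G then cinner H (\<sigma> x v) v else 0)"
  unfolding posdef_def
proof (intro conjI ballI allI impI)
  let ?f = "\<lambda>x. if x \<in> carrier G then cinner H (\<sigma> x v) v else 0"
  fix a assume a: "a \<in> combs"
  have "cinner H (\<sigma> y v) (\<sigma> z v) = ?f (inv z \<otimes> y)" if "y \<in> carrier G" "z \<in> carrier G" for y z
    using rep_adjoint[of "inv z" "\<sigma> y v" v] that v rep_mult by simp
  moreover have "cinner H (rep_sum v a) (rep_sum v a)
      = (\<Sum>p\<leftarrow>a. \<Sum>q\<leftarrow>a. fst p * cnj (fst q) * cinner H (\<sigma> (snd p) v) (\<sigma> (snd q) v))"
    unfolding cinner_rep_sum_left[OF v rep_sum_closed[OF v a] a]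
    using combsD[OF a] v a
    by (intro arg_cong[where f = sum_list] map_cong refl)
      (simp add: cinner_rep_sum_right sum_list_const_mult mult.assoc)
  ultimately have "form ?f a a = cinner H (rep_sum v a) (rep_sum v a)"
    unfolding form_def using combsD[OF a] by (simp cong: map_cong)
  then show "Im (form ?f a a) = 0" "0 \<le> Re (form ?f a a)"
    using H.sq_nonneg[of "rep_sum v a"] v a by (simp_all add: H.sq_def)
qed auto

text \<open>By normality of \<open>M\<close> the fixed vectors form a closed subspace invariant
  under the whole group. It is not the whole space, because \<open>m0\<close> acts
  nontrivially.\<close>

lemma no_fixed_vectors:
  assumes irr: "irreducible_unitary_rep G H \<sigma>" and M: "M \<lhd> G"
    and m0: "m0 \<in> M" "\<sigma> m0 \<noteq> \<one>\<^bsub>unitary_group H\<^esub>"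
    and v: "v \<in> carrier H" "\<And>m. m \<in> M \<Longrightarrow> \<sigma> m v = v"
  shows "v = \<zero>\<^bsub>H\<^esub>"
proof -
  interpret M: normal M G by fact
  interpret T: Metric_space "carrier H" "hdist H" by (rule H.Metric_space_hdist)
  define W where "W = {v \<in> carrier H. \<forall>m\<in>M. \<sigma> m v = v}"
  have Mc: "m \<in> M \<Longrightarrow> m \<in> carrier G" for m by (rule M.mem_carrier)
  have zero: "\<sigma> m \<zero>\<^bsub>H\<^esub> = \<zero>\<^bsub>H\<^esub>" if "m \<in> carrier G" for m
  proof -
    have "\<sigma> m \<zero>\<^bsub>H\<^esub> \<oplus>\<^bsub>H\<^esub> \<sigma> m \<zero>\<^bsub>H\<^esub> = \<sigma> m \<zero>\<^bsub>H\<^esub>" using rep_linear(1)[of m "\<zero>\<^bsub>H\<^esub>" "\<zero>\<^bsub>H\<^esub>"] that by simp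
    then show ?thesis using that by (metis H.add.l_cancel_one H.zero_closed rep_closed)
  qed
  have "submodule W (ring_of_type_algebra :: complex ring) H"
  proof (rule H.submoduleI)
    fix a assume a: "a \<in> W"
    have ac: "a \<in> carrier H" using a by (simp add: W_def)
    have "\<sigma> m (\<ominus>\<^bsub>H\<^esub> a) = \<ominus>\<^bsub>H\<^esub> a" if m: "m \<in> M" for m
    proof -
      have "\<sigma> m (\<ominus>\<^bsub>H\<^esub> a) \<oplus>\<^bsub>H\<^esub> \<sigma> m a = \<zero>\<^bsub>H\<^esub>"
        using rep_linear(1)[OF Mc[OF m], of "\<ominus>\<^bsub>H\<^esub> a" a] ac zero Mc m by (simp add: H.l_neg)
      moreover have "\<sigma> m a = a" using a m by (simp add: W_def)
      ultimately have "\<sigma> m (\<ominus>\<^bsub>H\<^esub> a) \<oplus>\<^bsub>H\<^esub> a = \<zero>\<^bsub>H\<^esub>" by simp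
      from H.minus_equality[OF this ac rep_closed[OF Mc[OF m] H.a_inv_closed[OF ac]]]
      show ?thesis by (rule sym)
    qed
    then show "\<ominus>\<^bsub>H\<^esub> a \<in> W" using ac by (simp add: W_def)
  qed (auto simp: W_def zero Mc rep_linear)
  moreover have "closedin T.mtopology W"
    unfolding T.metric_closedin_iff_sequentially_closed
  proof (intro conjI allI impI)
    fix s l assume h: "range s \<subseteq> W \<and> limitin T.mtopology s l sequentially"
    have l: "l \<in> carrier H" using h T.limitin_mspace by blast
    have sW: "s n \<in> W" for n using h by blast
    then have sc: "s n \<in> carrier H" for n by (simp add: W_def)
    \<comment> \<open>Being fixed is tested by inner products after \<open>m\<close> has been moved
      to the other argument, so continuity of the inner product in its first argument is
      enough.\<close>
    have "\<sigma> m l = l" if m: "m \<in> M" for m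
    proof (rule H.cinner_eqI)
      fix y assume y: "y \<in> carrier H"
      have "(\<lambda>n. cinner H (s n) (\<sigma> (inv m) y)) \<longlonglongrightarrow> cinner H l (\<sigma> (inv m) y)"
        using h sc y Mc[OF m] by (intro H.cinner_tendsto) auto
      moreover have "cinner H (s n) (\<sigma> (inv m) y) = cinner H (s n) y" for n
        using rep_adjoint[OF Mc[OF m] sc y, of n] sW[of n] m by (simp add: W_def)
      moreover have "(\<lambda>n. cinner H (s n) y) \<longlonglongrightarrow> cinner H l y"
        using h sc y by (intro H.cinner_tendsto) auto
      ultimately have "cinner H l (\<sigma> (inv m) y) = cinner H l y"
        by (metis (no_types, lifting) LIMSEQ_unique ext)
      then show "cinner H (\<sigma> m l) y = cinner H l y" using rep_adjoint Mc[OF m] l y by simp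
    qed (use l Mc m in auto)
    then show "l \<in> W" using l by (simp add: W_def)
  qed (auto simp: W_def)
  moreover have "\<sigma> k ` W \<subseteq> W" if k: "k \<in> carrier G" for k
  proof
    fix w assume "w \<in> \<sigma> k ` W"
    then obtain v where v: "v \<in> W" "w = \<sigma> k v" by blast
    have vc: "v \<in> carrier H" using v by (simp add: W_def)
    have "\<sigma> m (\<sigma> k v) = \<sigma> k v" if m: "m \<in> M" for m
    proof -
      have im: "inv k \<otimes> m \<otimes> k \<in> M" using M.inv_op_closed1 k m by blast
      have "m \<otimes> k = k \<otimes> (inv k \<otimes> m \<otimes> k)" using k Mc[OF m] by (simp add: m_assoc[symmetric])
      then have "\<sigma> m (\<sigma> k v) = \<sigma> k (\<sigma> (inv k \<otimes> m \<otimes> k) v)"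
        using rep_mult[OF Mc[OF m] k vc] rep_mult[OF k Mc[OF im] vc] by simp
      then show ?thesis using v im by (simp add: W_def)
    qed
    then show "w \<in> W" using v vc k by (simp add: W_def)
  qed
  ultimately have "W = {\<zero>\<^bsub>H\<^esub>} \<or> W = carrier H"
    using irr unfolding irreducible_unitary_rep_def by blast
  moreover have "W \<noteq> carrier H"
  proof
    assume "W = carrier H"
    then have "\<sigma> m0 v = v" if "v \<in> carrier H" for v using that m0 unfolding W_def by blast
    moreover have "\<sigma> m0 \<in> extensional (carrier H)"
      using rep_unitary[OF Mc[OF m0(1)]] by (auto simp: unitaries_def Bij_def)
    ultimately have "\<sigma> m0 = (\<lambda>x\<in>carrier H. x)" by (intro extensionalityI[of _ "carrier H"]) auto
    then show False using m0 by (simp add: unitary_group_simps)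
  qed
  moreover have "v \<in> W" using v by (simp add: W_def)
  ultimately show ?thesis by blast
qed

text \<open>The sum of \<open>\<sigma> m v\<close> over \<open>m\<close> in \<open>M\<close> is a vector fixed by \<open>M\<close>.\<close>

lemma matrix_coefficient_sum_zero:
  assumes irr: "irreducible_unitary_rep G H \<sigma>" and M: "M \<lhd> G" "finite M"
    and m0: "m0 \<in> M" "\<sigma> m0 \<noteq> \<one>\<^bsub>unitary_group H\<^esub>"
    and v: "v \<in> carrier H" and w: "w \<in> carrier H"
  shows "(\<Sum>m\<in>M. cinner H (\<sigma> m v) w) = 0"
proof -
  interpret M: normal M G by fact
  have Mc: "m \<in> M \<Longrightarrow> m \<in> carrier G" for m by (rule M.mem_carrier)
  obtain xs where xs: "distinct xs" "set xs = M" using finite_distinct_list[OF M(2)] by blast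
  define s where "s = rep_sum v (map (\<lambda>m. (1, m)) xs)"
  have comb: "map (\<lambda>m. (1, m)) xs \<in> combs" using xs Mc by (auto simp: combs_def)
  have sc: "s \<in> carrier H" using comb v by (simp add: s_def)
  have sum: "cinner H s y = (\<Sum>m\<in>M. cinner H (\<sigma> m v) y)" if "y \<in> carrier H" for y
    using cinner_rep_sum_left[OF v that comb] xs
    by (simp add: s_def o_def sum_list_distinct_conv_sum_set)
  have "\<sigma> m s = s" if m: "m \<in> M" for m
  proof (rule H.cinner_eqI)
    fix y assume y: "y \<in> carrier H"
    have "cinner H (\<sigma> m s) y = (\<Sum>m'\<in>M. cinner H (\<sigma> m' v) (\<sigma> (inv m) y))"
      using rep_adjoint[OF Mc[OF m] sc y] sum[of "\<sigma> (inv m) y"] y Mc[OF m] by simp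
    also have "\<dots> = (\<Sum>m'\<in>M. cinner H (\<sigma> (m \<otimes> m') v) y)"
      using rep_adjoint[OF Mc[OF m] _ y] rep_mult[OF Mc[OF m]] Mc v by (intro sum.cong) auto
    also have "\<dots> = (\<Sum>m'\<in>M. cinner H (\<sigma> m' v) y)"
      by (rule sum.reindex_bij_witness[where i = "\<lambda>m'. inv m \<otimes> m'" and j = "\<lambda>m'. m \<otimes> m'"])
        (use m Mc in \<open>auto simp: m_assoc[symmetric]\<close>)
    finally show "cinner H (\<sigma> m s) y = cinner H s y" using sum[OF y] by simp
  qed (use sc Mc m in auto)
  then have "s = \<zero>\<^bsub>H\<^esub>" by (rule no_fixed_vectors[OF irr M(1) m0 sc])
  then show ?thesis using sum[OF w] w by simp
qed

end

end

section \<open>From irreducible representations to characters\<close>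

context G_group
begin

text \<open>Irreducibility under the whole group excludes vectors fixed by a finite subgroup
  \<open>span x\<close>, which is normal there. Hence a matrix coefficient restricted to
  \<open>A\<close> sums to 0 over each of its cosets in \<open>A\<close>. There are countably many
  such hulls, and a character of \<open>A\<close> that is nontrivial on all of them is
  faithful.\<close>

theorem irrep_imp_character:
  fixes H :: "'h hilbert"
  assumes A: "ginv A" "comm_group (G\<lparr>carrier := A\<rparr>)" "A \<subseteq> locally_finite"
    and irr: "irreducible_unitary_rep G H \<sigma>" and faithful: "G_faithful \<A> G (unitary_group H) \<sigma>"
  shows "has_G_faithful_character \<A> (G\<lparr>carrier := A\<rparr>)"
proof -
  have ur: "unitary_rep G H \<sigma>" using irr by (simp add: irreducible_unitary_rep_def)
  interpret H: complex_hilbert_space H using ur by (simp add: unitary_rep_def)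
  interpret N: comm_group "G\<lparr>carrier := A\<rparr>" by fact
  interpret GN: G_group "G\<lparr>carrier := A\<rparr>" \<A> by (rule G_group_subgroup[OF A(1)])
  note Ad = ginvD(1,3-6)[OF A(1)]
  have urN: "unitary_rep (G\<lparr>carrier := A\<rparr>) H \<sigma>"
    using ur Ad(2) by (auto simp: unitary_rep_def hom_def Pi_def)
  obtain v where v: "v \<in> carrier H" "v \<noteq> \<zero>\<^bsub>H\<^esub>"
  proof -
    have "carrier H \<noteq> {\<zero>\<^bsub>H\<^esub>}" using irr by (simp add: irreducible_unitary_rep_def)
    then show ?thesis using that H.zero_closed by blast
  qed
  define \<xi> where "\<xi> = of_real (1 / sqrt (H.sq v)) \<odot>\<^bsub>H\<^esub> v"
  have \<xi>: "\<xi> \<in> carrier H" using v by (simp add: \<xi>_def)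
  have sqv: "0 < H.sq v" using H.sq_nonneg[OF v(1)] H.sq_eq_0[OF v(1)] v(2) by linarith
  have sq\<xi>: "H.sq \<xi> = 1" using v sqv
    by (simp add: \<xi>_def H.sq_smult power_divide del: of_real_divide)
  define \<phi>0 where "\<phi>0 = (\<lambda>x. if x \<in> carrier (G\<lparr>carrier := A\<rparr>) then cinner H (\<sigma> x \<xi>) \<xi> else 0)"
  have pd: "N.posdef \<phi>0" unfolding \<phi>0_def by (rule N.posdef_matrix_coefficient[OF urN \<xi>])
  have one: "\<phi>0 \<one> = 1" using Ad(3) rep_one[OF ur \<xi>] H.cinner_self[OF \<xi>] sq\<xi> by (simp add: \<phi>0_def)
  have M: "span x \<lhd> G\<lparr>carrier := A\<rparr>" "N.dispersed \<phi>0 (span x)" if x: "x \<in> A" "x \<noteq> \<one>" for x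
  proof -
    have xc: "x \<in> carrier G" using x Ad by blast
    have gx: "ginv (span x)" by (rule ginv_span[OF xc])
    have sub: "span x \<subseteq> A" by (rule span_least[OF A(1) x(1)])
    have nt: "span x \<noteq> {\<one>}" using span_self[OF xc] x(2) by auto
    have fin: "finite (span x)" using A(3) x by (auto simp: locally_finite_def)
    show n: "span x \<lhd> G\<lparr>carrier := A\<rparr>"
      using ginv_in_subgroup[OF A(1) sub] gx by (intro GN.ginv_normal) simp
    obtain m0 where m0: "m0 \<in> span x" "\<sigma> m0 \<noteq> \<one>\<^bsub>unitary_group H\<^esub>"
      using faithful gx nt unfolding G_faithful_iff[OF rep_group_hom[OF ur]] by blast
    show "N.dispersed \<phi>0 (span x)"
    proof (rule N.dispersed_finite[OF n fin _ pd])
      fix y assume "y \<in> carrier (G\<lparr>carrier := A\<rparr>)"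
      then have y: "y \<in> A" "y \<in> carrier G" using Ad by auto
      have "\<phi>0 (y \<otimes> m) = cinner H (\<sigma> m \<xi>) (\<sigma> (inv y) \<xi>)" if m: "m \<in> span x" for m
      proof -
        have mc: "m \<in> A" "m \<in> carrier G" using m sub Ad by auto
        then show ?thesis using y Ad rep_mult[OF ur y(2) mc(2) \<xi>] rep_adjoint[OF ur y(2) _ \<xi>] rep_closed[OF ur mc(2) \<xi>]
          by (simp add: \<phi>0_def)
      qed
      then have "(\<Sum>m\<in>span x. \<phi>0 (y \<otimes> m)) = (\<Sum>m\<in>span x. cinner H (\<sigma> m \<xi>) (\<sigma> (inv y) \<xi>))" by simp
      also have "\<dots> = 0"
        using y by (intro matrix_coefficient_sum_zero[OF ur irr ginv_normal[OF gx] fin m0 \<xi>] rep_closed[OF ur _ \<xi>]) simp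
      finally show "(\<Sum>m\<in>span x. \<phi>0 (y \<otimes>\<^bsub>G\<lparr>carrier := A\<rparr>\<^esub> m)) = 0" by simp
    qed
  qed
  define F where "F = span ` (A - {\<one>})"
  have F: "countable F" "\<And>M. M \<in> F \<Longrightarrow> subgroup M (G\<lparr>carrier := A\<rparr>)" "\<And>M. M \<in> F \<Longrightarrow> N.dispersed \<phi>0 M"
    using GN.countable_carrier M normal_imp_subgroup by (auto simp: F_def)
  have one': "\<phi>0 \<one>\<^bsub>G\<lparr>carrier := A\<rparr>\<^esub> = 1" using one by simp
  have l0: "[(1, \<one>)] \<in> N.combs" "0 < Re (lf [(1, \<one>)] \<phi>0)" using Ad(3) one by auto
  obtain q where q: "q \<in> N.state_cone \<phi>0" "q \<one>\<^bsub>G\<lparr>carrier := A\<rparr>\<^esub> = 1" "N.pure \<phi>0 q"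
    "\<And>M. M \<in> F \<Longrightarrow> \<exists>x\<in>M. q x \<noteq> 1"
    by (rule N.pure_state_exists[OF pd one' GN.countable_carrier l0 F]) (assumption, assumption, rule that)
  have hom: "q \<in> hom (G\<lparr>carrier := A\<rparr>) circle_group" by (rule N.pure_state_character[OF pd q(1-3)])
  have "G_faithful \<A> (G\<lparr>carrier := A\<rparr>) circle_group q"
    unfolding GN.G_faithful_iff[OF group_hom.intro[OF N.is_group group_circle_group group_hom_axioms.intro[OF hom]]]
  proof (intro allI impI, elim conjE)
    fix M assume "GN.ginv M" and M1: "M \<noteq> {\<one>\<^bsub>G\<lparr>carrier := A\<rparr>\<^esub>}"
    then have gM: "ginv M" "M \<subseteq> A"
      using GN.ginv_carrier_subset[of M] ginv_in_subgroup[OF A(1), of M] by auto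
    obtain x where x: "x \<in> M" "x \<noteq> \<one>" using M1 ginvD(4)[OF gM(1)] by auto
    then have "span x \<in> F" using gM by (auto simp: F_def)
    then obtain y where "y \<in> span x" "q y \<noteq> 1" using q(4) by blast
    then show "\<exists>x\<in>M. q x \<noteq> \<one>\<^bsub>circle_group\<^esub>" using span_least[OF gM(1) x(1)] by auto
  qed
  then show ?thesis using hom unfolding has_G_faithful_character_def unitary_character_def by blast
qed

subsection \<open>Extending a faithful character of the abelian part\<close>

definition nonabelian_feet :: "'a set set"
  where "nonabelian_feet = {F. G_foot G \<A> F \<and> finite F \<and> \<not> comm_group (G\<lparr>carrier := F\<rparr>)}"

text \<open>The centre of \<open>F\<close> is invariant and different from \<open>F\<close>, so it
  is trivial by minimality.\<close>

lemma nonabelian_foot_center: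
  assumes F: "F \<in> nonabelian_feet" and x: "x \<in> F" "\<And>y. y \<in> F \<Longrightarrow> x \<otimes> y = y \<otimes> x"
  shows "x = \<one>"
proof -
  have gF: "ginv F" using F footD by (auto simp: nonabelian_feet_def)
  note Fd = ginvD(1,3-6)[OF gF] and F_act = ginvD(2)[OF gF]
  define Z where "Z = {x \<in> F. \<forall>y\<in>F. x \<otimes> y = y \<otimes> x}"
  have "ginv Z"
  proof (rule ginvI)
    show "subgroup Z G"
    proof (rule subgroupI)
      fix a assume a: "a \<in> Z"
      have "inv a \<otimes> y = y \<otimes> inv a" if y: "y \<in> F" for y
      proof -
        have c: "a \<in> carrier G" "y \<in> carrier G" "inv y \<in> F" using a y Fd by (auto simp: Z_def)
        have "inv (a \<otimes> inv y) = inv (inv y \<otimes> a)" using a c(3) by (simp add: Z_def)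
        then show ?thesis using c(1,2) by (simp add: inv_mult_group)
      qed
      then show "inv a \<in> Z" using a Fd by (simp add: Z_def)
      fix b assume b: "b \<in> Z"
      have "a \<otimes> b \<otimes> y = y \<otimes> (a \<otimes> b)" if y: "y \<in> F" for y
      proof -
        have c: "a \<in> carrier G" "b \<in> carrier G" "y \<in> carrier G" using a b y Fd by (auto simp: Z_def)
        have "a \<otimes> b \<otimes> y = a \<otimes> (b \<otimes> y)" using c by (simp add: m_assoc)
        also have "\<dots> = a \<otimes> (y \<otimes> b)" using b y by (simp add: Z_def)
        also have "\<dots> = a \<otimes> y \<otimes> b" using c by (simp add: m_assoc)
        also have "\<dots> = y \<otimes> a \<otimes> b" using a y by (simp add: Z_def)
        finally show ?thesis using c by (simp add: m_assoc)
      qed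
      moreover have "a \<otimes> b \<in> F" using a b Fd(4) unfolding Z_def by blast
      ultimately show "a \<otimes> b \<in> Z" unfolding Z_def by blast
    next
      show "Z \<subseteq> carrier G" using ginv_carrier_subset[OF gF] by (auto simp: Z_def)
      have "\<one> \<otimes> y = y \<otimes> \<one>" if "y \<in> F" for y using Fd(2)[OF that] by simp
      then have "\<one> \<in> Z" using Fd(3) by (simp add: Z_def)
      then show "Z \<noteq> {}" by blast
    qed
    fix g a assume g: "g \<in> \<A>" and a: "a \<in> Z"
    have "g a \<otimes> y = y \<otimes> g a" if y: "y \<in> F" for y
    proof -
      have "g ` F = F" using gF g by (simp add: G_invariant_subgroup_def)
      then obtain y' where y': "y' \<in> F" "y = g y'" using y by blast
      have c: "a \<in> carrier G" "y' \<in> carrier G" "a \<otimes> y' = y' \<otimes> a" using a y' Fd by (auto simp: Z_def)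
      then have "g (a \<otimes> y') = g (y' \<otimes> a)" by simp
      then show ?thesis using act_mult[OF g] c(1,2) y' by simp
    qed
    then show "g a \<in> Z" using a F_act[OF g] by (simp add: Z_def)
  qed
  moreover have "Z \<subseteq> F" by (auto simp: Z_def)
  moreover have "Z \<noteq> F"
  proof
    assume "Z = F"
    then have "comm_group (G\<lparr>carrier := F\<rparr>)" unfolding comm_group_iff_commute[OF Fd(1)] Z_def by blast
    then show False using F by (simp add: nonabelian_feet_def)
  qed
  ultimately have "Z = {\<one>}" using footD(3)[of F Z] F by (auto simp: nonabelian_feet_def)
  moreover have "x \<in> Z" using x by (simp add: Z_def)
  ultimately show ?thesis by blast
qed

text \<open>One non-central element of each nonabelian finite foot, together with \<open>MAG\<close>, generates an
  abelian group. A character of it that is nontrivial at all chosen elements replaces an infinite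
  tensor product of irreducible representations of the nonabelian feet.\<close>

definition chosen :: "'a set \<Rightarrow> 'a"
  where "chosen F = (SOME x. x \<in> F \<and> x \<noteq> \<one>)"

definition abelian_part :: "'a set set \<Rightarrow> 'a set"
  where "abelian_part J = generate G (MAG G \<A> \<union> chosen ` J)"

lemma chosen:
  assumes "F \<in> nonabelian_feet" shows "chosen F \<in> F" "chosen F \<noteq> \<one>" "chosen F \<in> carrier G"
proof -
  have f: "G_foot G \<A> F" using assms by (simp add: nonabelian_feet_def)
  have "\<exists>x. x \<in> F \<and> x \<noteq> \<one>" using footD(2)[OF f] ginvD(4)[OF footD(1)[OF f]] by blast
  then have "chosen F \<in> F \<and> chosen F \<noteq> \<one>" unfolding chosen_def by (rule someI_ex)
  then show "chosen F \<in> F" "chosen F \<noteq> \<one>" "chosen F \<in> carrier G" using ginvD(3)[OF footD(1)[OF f]] by auto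
qed

text \<open>A nonabelian foot differs from every abelian one, and distinct feet commute
  elementwise.\<close>

lemma MAG_commute_foot:
  assumes F: "F \<in> nonabelian_feet" and x: "x \<in> MAG G \<A>" and y: "y \<in> F"
  shows "x \<otimes> y = y \<otimes> x"
proof (rule generate_commute)
  show "x \<in> generate G (\<Union>{M. abelian_finite_G_foot G \<A> M})" using x by (simp add: MAG_def)
  show "y \<in> generate G F" using y by (rule generate.incl)
  have f: "G_foot G \<A> F" "\<not> abelian_finite_G_foot G \<A> F"
    using F by (auto simp: nonabelian_feet_def abelian_finite_G_foot_def)
  fix u v assume u: "u \<in> \<Union>{M. abelian_finite_G_foot G \<A> M}" and v: "v \<in> F"
  then obtain M where "abelian_finite_G_foot G \<A> M" "u \<in> M" by blast
  then show "u \<otimes> v = v \<otimes> u"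
    using feet_commute[OF _ f(1) _ _ v] f(2) unfolding abelian_finite_G_foot_def by blast
qed (use MAG_carrier F footD ginv_carrier_subset in \<open>auto simp: nonabelian_feet_def\<close>)

lemma MAG_closed: "MAG G \<A> \<subseteq> carrier G"
  by (rule ginv_carrier_subset[OF ginv_MAG])

lemma abelian_part_generators:
  assumes "J \<subseteq> nonabelian_feet" shows "MAG G \<A> \<union> chosen ` J \<subseteq> carrier G"
  using MAG_closed chosen(3) assms by blast

lemma abelian_part_commute_foot:
  assumes J: "J \<subseteq> nonabelian_feet" and F: "F \<in> nonabelian_feet" "F \<notin> J"
    and x: "x \<in> abelian_part J" and y: "y \<in> F"
  shows "x \<otimes> y = y \<otimes> x"
proof (rule generate_commute[OF abelian_part_generators[OF J]])
  show "x \<in> generate G (MAG G \<A> \<union> chosen ` J)" using x by (simp add: abelian_part_def)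
  show "y \<in> generate G F" using y by (rule generate.incl)
  fix u v assume u: "u \<in> MAG G \<A> \<union> chosen ` J" and v: "v \<in> F"
  from u show "u \<otimes> v = v \<otimes> u"
  proof
    assume "u \<in> chosen ` J"
    then obtain F' where F': "F' \<in> J" "u = chosen F'" by blast
    then have "F' \<in> nonabelian_feet" "F' \<noteq> F" using J F by auto
    then show ?thesis using feet_commute[of F' F u v] chosen(1)[of F'] F F' v
      by (auto simp: nonabelian_feet_def)
  qed (use MAG_commute_foot[OF F(1)] v in blast)
qed (use F footD ginv_carrier_subset in \<open>auto simp: nonabelian_feet_def\<close>)

text \<open>All of \<open>abelian_part J\<close> commutes with \<open>F\<close>, whose centre is
  trivial.\<close>

lemma chosen_not_in_abelian_part:
  assumes "J \<subseteq> nonabelian_feet" "F \<in> nonabelian_feet" "F \<notin> J"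
  shows "chosen F \<notin> abelian_part J"
  using nonabelian_foot_center[OF assms(2) chosen(1)[OF assms(2)]] chosen(2)[OF assms(2)]
    abelian_part_commute_foot[OF assms] by blast

lemma comm_group_abelian_part:
  assumes J: "J \<subseteq> nonabelian_feet"
  shows "comm_group (G\<lparr>carrier := abelian_part J\<rparr>)"
  unfolding abelian_part_def
proof (rule generate_comm_group[OF abelian_part_generators[OF J]])
  have 1: "u \<otimes> v = v \<otimes> u" if "u \<in> MAG G \<A>" "v \<in> chosen ` J" for u v
    using that J chosen(1) MAG_commute_foot by blast
  have 2: "u \<otimes> v = v \<otimes> u" if uv: "u \<in> chosen ` J" "v \<in> chosen ` J" for u v
  proof -
    obtain F F' where f: "F \<in> J" "u = chosen F" "F' \<in> J" "v = chosen F'" using uv by blast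
    then show ?thesis using feet_commute[of F F' u v] chosen(1)[of F] chosen(1)[of F'] J
      by (cases "F = F'") (auto simp: nonabelian_feet_def subset_iff)
  qed
  have 3: "u \<otimes> v = v \<otimes> u" if "u \<in> MAG G \<A>" "v \<in> MAG G \<A>" for u v
    using comm_group_MAG that unfolding comm_group_iff_commute[OF ginvD(1)[OF ginv_MAG]] by blast
  fix u v assume "u \<in> MAG G \<A> \<union> chosen ` J" "v \<in> MAG G \<A> \<union> chosen ` J"
  then consider "u \<in> MAG G \<A>" "v \<in> MAG G \<A>" | "u \<in> MAG G \<A>" "v \<in> chosen ` J"
    | "u \<in> chosen ` J" "v \<in> MAG G \<A>" | "u \<in> chosen ` J" "v \<in> chosen ` J" by blast
  then show "u \<otimes> v = v \<otimes> u" using 1 2 3 by cases metis+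
qed

lemma subgroup_abelian_part: "J \<subseteq> nonabelian_feet \<Longrightarrow> subgroup (abelian_part J) G"
  unfolding abelian_part_def by (rule generate_is_subgroup[OF abelian_part_generators])

lemma abelian_part_mono: "J \<subseteq> J' \<Longrightarrow> abelian_part J \<subseteq> abelian_part J'"
  unfolding abelian_part_def by (rule mono_generate) blast

lemma MAG_subset_abelian_part: "MAG G \<A> \<subseteq> abelian_part J"
  unfolding abelian_part_def by (intro subsetI generate.incl) blast

lemma chosen_in_abelian_part: "F \<in> J \<Longrightarrow> chosen F \<in> abelian_part J"
  unfolding abelian_part_def by (rule generate.incl) blast

lemma abelian_part_locally_finite:
  assumes "J \<subseteq> nonabelian_feet" shows "abelian_part J \<subseteq> locally_finite"
  unfolding abelian_part_def
proof (rule generate_subgroup_incl[OF _ subgroup_locally_finite])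
  have "chosen F \<in> locally_finite" if F: "F \<in> J" for F
  proof -
    have "F \<in> nonabelian_feet" using F assms by blast
    moreover have "generate G (\<Union>{F}) \<subseteq> locally_finite"
      by (rule generate_feet_locally_finite) (use calculation in \<open>auto simp: nonabelian_feet_def\<close>)
    ultimately show ?thesis using chosen(1) generate.incl[of _ F G] by auto
  qed
  then show "MAG G \<A> \<union> chosen ` J \<subseteq> locally_finite" using MAG_locally_finite by blast
qed

text \<open>Induction on \<open>J\<close>: restrict the character found for \<open>J\<close> to
  \<open>abelian_part J\<close>, which keeps its values at the elements already chosen, and extend
  it again with a value different from 1 at the next one.\<close>

lemma extend_to_abelian_part:
  assumes \<theta>: "\<theta> \<in> hom (G\<lparr>carrier := MAG G \<A>\<rparr>) circle_group"
    and J: "finite J" "J \<subseteq> nonabelian_feet"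
  shows "\<exists>\<psi>\<in>hom (G\<lparr>carrier := abelian_part nonabelian_feet\<rparr>) circle_group.
    (\<forall>x\<in>MAG G \<A>. \<psi> x = \<theta> x) \<and> (\<forall>F\<in>J. \<psi> (chosen F) \<noteq> 1)"
proof -
  define N where "N = G\<lparr>carrier := abelian_part nonabelian_feet\<rparr>"
  interpret N: comm_group N unfolding N_def by (rule comm_group_abelian_part) simp
  have countN: "countable (carrier N)"
    using countable_subset[OF subgroup.subset[OF subgroup_abelian_part] countable_carrier] by (simp add: N_def)
  have sub: "subgroup B N" if "subgroup B G" "B \<subseteq> abelian_part nonabelian_feet" for B
    unfolding N_def by (rule subgroup_incl[OF that(1) subgroup_abelian_part that(2)]) simp
  have res: "N\<lparr>carrier := B\<rparr> = G\<lparr>carrier := B\<rparr>" for B by (simp add: N_def)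
  show ?thesis using J unfolding N_def[symmetric]
  proof (induction J rule: finite_induct)
    case empty
    show ?case
    \<comment> \<open>\<open>extend_character\<close> asks for an element outside the
      subgroup.\<close>
    proof (cases "carrier N = MAG G \<A>")
      case True
      then show ?thesis using \<theta> by (intro bexI[of _ \<theta>]) (auto simp: N_def)
    next
      case False
      then obtain c where c: "c \<in> carrier N" "c \<notin> MAG G \<A>"
        using MAG_subset_abelian_part by (auto simp: N_def)
      have \<theta>': "\<theta> \<in> hom (N\<lparr>carrier := MAG G \<A>\<rparr>) circle_group" using \<theta> by (simp add: res)
      obtain \<psi> where "\<psi> \<in> hom N circle_group" "\<And>x. x \<in> MAG G \<A> \<Longrightarrow> \<psi> x = \<theta> x"
        using N.extend_character[OF countN sub[OF ginvD(1)[OF ginv_MAG] MAG_subset_abelian_part] \<theta>' c] by blast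
      then show ?thesis by auto
    qed
  next
    case (insert F J)
    then have J: "J \<subseteq> nonabelian_feet" and F: "F \<in> nonabelian_feet" by auto
    obtain \<psi> where \<psi>: "\<psi> \<in> hom N circle_group" "\<forall>x\<in>MAG G \<A>. \<psi> x = \<theta> x" "\<forall>F\<in>J. \<psi> (chosen F) \<noteq> 1"
      using insert.IH[OF J] by blast
    have le: "abelian_part J \<subseteq> abelian_part nonabelian_feet" by (rule abelian_part_mono[OF J])
    have "\<psi> \<in> hom (N\<lparr>carrier := abelian_part J\<rparr>) circle_group"
      using \<psi>(1) le by (auto simp: hom_def N_def Pi_def subset_iff)
    moreover have "chosen F \<in> carrier N" using chosen_in_abelian_part[OF F] by (simp add: N_def)
    moreover have "chosen F \<notin> abelian_part J" using chosen_not_in_abelian_part J F insert.hyps by blast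
    ultimately obtain \<psi>' where \<psi>': "\<psi>' \<in> hom N circle_group" "\<And>x. x \<in> abelian_part J \<Longrightarrow> \<psi>' x = \<psi> x"
      "\<psi>' (chosen F) \<noteq> 1"
      using N.extend_character[OF countN sub[OF subgroup_abelian_part[OF J] le]] by metis
    have "\<forall>x\<in>MAG G \<A>. \<psi>' x = \<theta> x" using \<psi>'(2) \<psi>(2) MAG_subset_abelian_part by fastforce
    moreover have "\<forall>F'\<in>insert F J. \<psi>' (chosen F') \<noteq> 1"
      using \<psi>'(2,3) \<psi>(3) chosen_in_abelian_part by fastforce
    ultimately show ?case using \<psi>'(1) by blast
  qed
qed

lemma closed_hom:
  "closed {f :: 'a \<Rightarrow> complex. \<forall>x\<in>A. \<forall>y\<in>A. f (x \<otimes> y) = f x * f y}"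
proof -
  have ev: "continuous_on UNIV (\<lambda>f :: 'a \<Rightarrow> complex. f x)" for x
    by (rule continuous_on_product_coordinates)
  have "closed (\<Inter>x\<in>A. \<Inter>y\<in>A. {f :: 'a \<Rightarrow> complex. f (x \<otimes> y) = f x * f y})"
    by (intro closed_INT ballI closed_Collect_eq continuous_intros ev)
  moreover have "(\<Inter>x\<in>A. \<Inter>y\<in>A. {f :: 'a \<Rightarrow> complex. f (x \<otimes> y) = f x * f y}) =
      {f. \<forall>x\<in>A. \<forall>y\<in>A. f (x \<otimes> y) = f x * f y}" by auto
  ultimately show ?thesis by simp
qed

lemma closed_eval_in: "finite C \<Longrightarrow> closed {f :: 'a \<Rightarrow> complex. f x \<in> C}"
proof -
  assume "finite C"
  then have "closed (\<Union>c\<in>C. {f :: 'a \<Rightarrow> complex. f x = c})" by (intro closed_UN ballI closed_eval_eq)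
  moreover have "(\<Union>c\<in>C. {f :: 'a \<Rightarrow> complex. f x = c}) = {f. f x \<in> C}" by auto
  ultimately show ?thesis by simp
qed

lemma hom_pow:
  assumes B: "subgroup B G" and \<psi>: "\<psi> \<in> hom (G\<lparr>carrier := B\<rparr>) circle_group" and x: "x \<in> B"
  shows "\<psi> (x [^] (n::nat)) = \<psi> x ^ n"
proof (induction n)
  case (Suc n)
  have "x [^] n \<in> B"
    by (induction n) (auto intro: subgroup.one_closed[OF B] subgroup.m_closed[OF B] x)
  then show ?case using Suc character_mult[OF \<psi> _ x] by simp
qed (simp add: character_one[OF B \<psi>])

lemma character_finite_order:
  assumes B: "subgroup B G" and \<psi>: "\<psi> \<in> hom (G\<lparr>carrier := B\<rparr>) circle_group"
    and M: "subgroup M G" "finite M" and x: "x \<in> B" "x \<in> M"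
  shows "\<psi> x ^ card M = 1"
proof -
  interpret M: group "G\<lparr>carrier := M\<rparr>" by (rule subgroup.subgroup_is_group[OF M(1) is_group])
  have "x [^]\<^bsub>G\<lparr>carrier := M\<rparr>\<^esub> Coset.order (G\<lparr>carrier := M\<rparr>) = \<one>"
    using M.pow_order_eq_1[of x] x M by simp
  then have "x [^] card M = \<one>" by (simp add: Coset.order_def nat_pow_consistent[symmetric])
  then show ?thesis using hom_pow[OF B \<psi> x(1), of "card M"] character_one[OF B \<psi>] by simp
qed

text \<open>\<open>chosen F\<close> has finite order, so a character takes one of finitely many
  values there, and being different from 1 means lying in a finite, hence closed, set. Compactness
  then reduces all nonabelian feet to finitely many.\<close>

lemma faithful_abelian_part_character:
  assumes \<theta>: "\<theta> \<in> hom (G\<lparr>carrier := MAG G \<A>\<rparr>) circle_group"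
  obtains \<psi> where "\<psi> \<in> hom (G\<lparr>carrier := abelian_part nonabelian_feet\<rparr>) circle_group"
    "\<And>x. x \<in> MAG G \<A> \<Longrightarrow> \<psi> x = \<theta> x" "\<And>F. F \<in> nonabelian_feet \<Longrightarrow> \<psi> (chosen F) \<noteq> 1"
proof -
  define B where "B = abelian_part nonabelian_feet"
  have sB: "subgroup B G" unfolding B_def by (rule subgroup_abelian_part) simp
  define K where "K = {f :: 'a \<Rightarrow> complex. \<forall>x. cmod (f x) \<le> 1} \<inter>
    ({f. \<forall>x\<in>B. \<forall>y\<in>B. f (x \<otimes> y) = f x * f y} \<inter> (\<Inter>x\<in>MAG G \<A>. {f. f x = \<theta> x}) \<inter> {f. f \<one> = 1})"
  have "compact K" unfolding K_def
    by (intro compact_Int_closed compact_unit_bounded_functions closed_Int closed_hom closed_INT ballI closed_eval_eq)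
  define Z where "Z = (\<lambda>F. {f :: 'a \<Rightarrow> complex. f (chosen F) \<in> {z. z ^ card F = 1} - {1}})"
  have cZ: "closed (Z F)" if F: "F \<in> nonabelian_feet" for F
    unfolding Z_def
  proof (rule closed_eval_in)
    have "card F > 0" using F chosen(1)[OF F] by (auto simp: nonabelian_feet_def card_gt_0_iff)
    then show "finite ({z::complex. z ^ card F = 1} - {1})"
      using finite_roots_unity[of "card F"] by simp
  qed
  have "K \<inter> (\<Inter>F\<in>nonabelian_feet. Z F) \<noteq> {}"
  proof (rule compact_imp_fip_image[OF \<open>compact K\<close> cZ])
    fix J assume J: "finite J" "J \<subseteq> nonabelian_feet"
    obtain \<psi> where \<psi>: "\<psi> \<in> hom (G\<lparr>carrier := B\<rparr>) circle_group" "\<forall>x\<in>MAG G \<A>. \<psi> x = \<theta> x"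
      "\<forall>F\<in>J. \<psi> (chosen F) \<noteq> 1" using extend_to_abelian_part[OF \<theta> J] unfolding B_def by blast
    define f where "f = (\<lambda>x. if x \<in> B then \<psi> x else 0)"
    have "f \<in> K" using \<psi> character_norm[OF \<psi>(1)] character_mult[OF \<psi>(1)] character_one[OF sB \<psi>(1)]
        subgroup.m_closed[OF sB] subgroup.one_closed[OF sB] MAG_subset_abelian_part[of nonabelian_feet]
      by (auto simp: K_def f_def B_def[symmetric])
    moreover have "f \<in> Z F" if F: "F \<in> J" for F
    proof -
      have FN: "F \<in> nonabelian_feet" using F J by blast
      then have "chosen F \<in> B" using chosen_in_abelian_part by (simp add: B_def)
      moreover have "subgroup F G" "finite F" using FN footD(1) ginvD(1) by (auto simp: nonabelian_feet_def)
      ultimately show ?thesis using \<psi>(3) F character_finite_order[OF sB \<psi>(1), of F "chosen F"] chosen(1)[OF FN]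
        by (simp add: Z_def f_def)
    qed
    ultimately show "K \<inter> (\<Inter>F\<in>J. Z F) \<noteq> {}" by blast
  qed
  then obtain f where f: "f \<in> K" "\<And>F. F \<in> nonabelian_feet \<Longrightarrow> f \<in> Z F" by blast
  \<comment> \<open>Membership in \<open>K\<close> gives \<open>cmod (f x) \<le> 1\<close>;
    multiplicativity at \<open>x\<close> and \<open>inv x\<close> forces equality.\<close>
  have "cmod (f x) = 1" if x: "x \<in> B" for x
  proof -
    have xi: "inv x \<in> B" "x \<in> carrier G" using subgroup.m_inv_closed[OF sB x] subgroup.mem_carrier[OF sB x] .
    have "f x * f (inv x) = f (x \<otimes> inv x)" using f(1) x xi(1) unfolding K_def by simp
    also have "\<dots> = 1" using f(1) xi by (simp add: K_def)
    finally have "cmod (f x) * cmod (f (inv x)) = 1" by (metis norm_mult norm_one)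
    moreover have "cmod (f x) \<le> 1" "cmod (f (inv x)) \<le> 1" using f(1) by (auto simp: K_def)
    ultimately show ?thesis by (metis mult_left_le norm_ge_zero order_antisym)
  qed
  then have "f \<in> hom (G\<lparr>carrier := B\<rparr>) circle_group" using f(1) by (auto intro!: homI simp: K_def)
  then show ?thesis using that[of f] f unfolding B_def K_def Z_def by auto
qed

text \<open>It suffices to be nontrivial on one invariant subgroup inside each hull
  \<open>span x\<close>, which makes countably many conditions. A hull that contains a finite foot
  is handled by averaging over the foot. Any other hull is infinite and meets the locally finite
  group \<open>abelian_part\<close> trivially, so \<open>dispersed_infinite\<close> applies to
  it.\<close>

theorem character_imp_pure_state:
  assumes \<theta>: "\<theta> \<in> hom (G\<lparr>carrier := MAG G \<A>\<rparr>) circle_group"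
    and faithful: "G_faithful \<A> (G\<lparr>carrier := MAG G \<A>\<rparr>) circle_group \<theta>"
  obtains \<phi>0 q where "posdef \<phi>0" "q \<in> state_cone \<phi>0" "q \<one> = 1" "pure \<phi>0 q"
    "\<And>M. ginv M \<Longrightarrow> M \<noteq> {\<one>} \<Longrightarrow> \<exists>x\<in>M. q x \<noteq> 1"
proof -
  define B where "B = abelian_part nonabelian_feet"
  have sB: "subgroup B G" unfolding B_def by (rule subgroup_abelian_part) simp
  obtain \<psi> where \<psi>: "\<psi> \<in> hom (G\<lparr>carrier := B\<rparr>) circle_group"
    "\<And>x. x \<in> MAG G \<A> \<Longrightarrow> \<psi> x = \<theta> x" "\<And>F. F \<in> nonabelian_feet \<Longrightarrow> \<psi> (chosen F) \<noteq> 1"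
    using faithful_abelian_part_character[OF \<theta>] unfolding B_def by blast
  define \<phi>0 where "\<phi>0 = induced B \<psi>"
  have pd: "posdef \<phi>0" unfolding \<phi>0_def by (rule posdef_induced[OF sB \<psi>(1)])
  have one: "\<phi>0 \<one> = 1"
    using character_one[OF sB \<psi>(1)] subgroup.one_closed[OF sB] by (simp add: \<phi>0_def induced_def)
  interpret GN: G_group "G\<lparr>carrier := MAG G \<A>\<rparr>" \<A> by (rule G_group_subgroup[OF ginv_MAG])
  have hom: "group_hom (G\<lparr>carrier := MAG G \<A>\<rparr>) circle_group \<theta>"
    by (rule group_hom.intro[OF GN.is_group group_circle_group group_hom_axioms.intro[OF \<theta>]])
  have foot: "dispersed \<phi>0 F" if F: "G_foot G \<A> F" "finite F" for F
  proof -
    have gF: "ginv F" using footD(1) F by blast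
    have "\<exists>c. c \<in> F \<and> c \<in> B \<and> \<psi> c \<noteq> 1"
    proof (cases "comm_group (G\<lparr>carrier := F\<rparr>)")
      case True
      then have "abelian_finite_G_foot G \<A> F" using F by (simp add: abelian_finite_G_foot_def)
      then have sub: "F \<subseteq> MAG G \<A>" by (rule foot_subset_MAG)
      then have "GN.ginv F" using ginv_in_subgroup[OF ginv_MAG sub] gF by simp
      then obtain c where "c \<in> F" "\<theta> c \<noteq> 1"
        using faithful footD(2)[OF F(1)] unfolding GN.G_faithful_iff[OF hom] by auto
      then show ?thesis using sub \<psi>(2) MAG_subset_abelian_part[of nonabelian_feet] unfolding B_def by force
    next
      case False
      then have "F \<in> nonabelian_feet" using F by (simp add: nonabelian_feet_def)
      then show ?thesis using \<psi>(3) chosen(1) chosen_in_abelian_part unfolding B_def by blast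
    qed
    then obtain c where c: "c \<in> F" "c \<in> B" "\<psi> c \<noteq> 1" by blast
    show ?thesis
      by (rule dispersed_finite[OF ginv_normal[OF gF] F(2) _ pd])
        (unfold \<phi>0_def, rule induced_sum_zero[OF sB \<psi>(1) ginvD(1)[OF gF] c])
  qed
  have "\<exists>M. ginv M \<and> M \<subseteq> span x \<and> dispersed \<phi>0 M" if x: "x \<in> carrier G" "x \<noteq> \<one>" for x
  proof (cases "\<exists>F. G_foot G \<A> F \<and> finite F \<and> F \<subseteq> span x")
    case True
    then show ?thesis using foot footD(1) by blast
  next
    case False
    have gx: "ginv (span x)" by (rule ginv_span[OF x(1)])
    have nt: "span x \<noteq> {\<one>}" using span_self[OF x(1)] x(2) by auto
    \<comment> \<open>A nontrivial finite invariant subgroup contains a finite foot, which is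
      excluded in this case.\<close>
    have small: "N = {\<one>}" if N: "ginv N" "finite N" "N \<subseteq> span x" for N
    proof (rule ccontr)
      assume "N \<noteq> {\<one>}"
      then obtain F where "G_foot G \<A> F" "finite F" "F \<subseteq> N"
        using finite_ginv_contains_foot[OF N(2,1)] by blast
      then show False using False N(3) by blast
    qed
    have "infinite (span x)" using small[OF gx] nt by blast
    moreover have "span x \<inter> B = {\<one>}"
    proof -
      have "y = \<one>" if y: "y \<in> span x" "y \<in> B" for y
      proof -
        have yf: "y \<in> carrier G" "finite (span y)"
          using y(2) abelian_part_locally_finite[of nonabelian_feet] by (auto simp: B_def locally_finite_def)
        then show ?thesis
          using small[OF ginv_span[OF yf(1)] yf(2) span_least[OF gx y(1)]] span_self[OF yf(1)] by blast
      qed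
      then show ?thesis using ginvD(4)[OF gx] subgroup.one_closed[OF sB] by blast
    qed
    ultimately have "dispersed \<phi>0 (span x)"
      by (intro dispersed_infinite[OF ginv_normal[OF gx] _ sB _ _ pd]) (auto simp: \<phi>0_def induced_def)
    then show ?thesis using gx by blast
  qed
  then obtain S where S: "\<And>x. x \<in> carrier G - {\<one>} \<Longrightarrow> ginv (S x) \<and> S x \<subseteq> span x \<and> dispersed \<phi>0 (S x)"
    by (metis DiffE singletonI)
  define F where "F = S ` (carrier G - {\<one>})"
  have F: "countable F" "\<And>M. M \<in> F \<Longrightarrow> subgroup M G" "\<And>M. M \<in> F \<Longrightarrow> dispersed \<phi>0 M"
    using countable_carrier S ginvD(1) by (auto simp: F_def)
  have l0: "[(1, \<one>)] \<in> combs" "0 < Re (lf [(1, \<one>)] \<phi>0)" using one by auto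
  obtain q where q: "q \<in> state_cone \<phi>0" "q \<one> = 1" "pure \<phi>0 q" "\<And>M. M \<in> F \<Longrightarrow> \<exists>x\<in>M. q x \<noteq> 1"
    by (rule pure_state_exists[OF pd one countable_carrier l0 F]) (assumption, assumption, rule that)
  have "\<exists>x\<in>M. q x \<noteq> 1" if M: "ginv M" "M \<noteq> {\<one>}" for M
  proof -
    obtain x where x: "x \<in> M" "x \<noteq> \<one>" using M ginvD(4) by blast
    then have xc: "x \<in> carrier G - {\<one>}" using ginvD(3)[OF M(1)] by blast
    then obtain y where "y \<in> S x" "q y \<noteq> 1" using q(4) by (auto simp: F_def)
    then show ?thesis using S[OF xc] span_least[OF M(1) x(1)] by blast
  qed
  then show ?thesis using that[OF pd q(1-3)] by blast
qed

theorem irrep_iff_character: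
  assumes u: "inj (u :: real \<Rightarrow> 'h)"
  shows "has_G_faithful_irrep TYPE('h) \<A> G \<longleftrightarrow> has_G_faithful_character \<A> (G\<lparr>carrier := MAG G \<A>\<rparr>)"
proof
  assume "has_G_faithful_irrep TYPE('h) \<A> G"
  then show "has_G_faithful_character \<A> (G\<lparr>carrier := MAG G \<A>\<rparr>)"
    unfolding has_G_faithful_irrep_def
    using irrep_imp_character[OF ginv_MAG comm_group_MAG MAG_locally_finite] by blast
next
  assume "has_G_faithful_character \<A> (G\<lparr>carrier := MAG G \<A>\<rparr>)"
  then obtain \<theta> where "\<theta> \<in> hom (G\<lparr>carrier := MAG G \<A>\<rparr>) circle_group"
    "G_faithful \<A> (G\<lparr>carrier := MAG G \<A>\<rparr>) circle_group \<theta>"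
    unfolding has_G_faithful_character_def unitary_character_def by blast
  then obtain \<phi>0 q where q: "posdef \<phi>0" "q \<in> state_cone \<phi>0" "q \<one> = 1" "pure \<phi>0 q"
    "\<And>M. ginv M \<Longrightarrow> M \<noteq> {\<one>} \<Longrightarrow> \<exists>x\<in>M. q x \<noteq> 1"
    using character_imp_pure_state by blast
  obtain H :: "'h hilbert" and \<sigma> where H: "irreducible_unitary_rep G H \<sigma>"
    "\<And>x. x \<in> carrier G \<Longrightarrow> \<sigma> x = \<one>\<^bsub>unitary_group H\<^esub> \<Longrightarrow> q x = 1"
    using pure_state_irreducible_rep[OF u countable_carrier q(1-4)] by blast
  have ur: "unitary_rep G H \<sigma>" using H(1) by (simp add: irreducible_unitary_rep_def)
  have "G_faithful \<A> G (unitary_group H) \<sigma>"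
    unfolding G_faithful_iff[OF rep_group_hom[OF ur]]
  proof (intro allI impI, elim conjE)
    fix M assume M: "ginv M" "M \<noteq> {\<one>}"
    then obtain x where "x \<in> M" "q x \<noteq> 1" using q(5) by blast
    then show "\<exists>x\<in>M. \<sigma> x \<noteq> \<one>\<^bsub>unitary_group H\<^esub>" using H(2) ginvD(3)[OF M(1)] by blast
  qed
  then show "has_G_faithful_irrep TYPE('h) \<A> G" using H(1) unfolding has_G_faithful_irrep_def by blast
qed

text \<open>The pure state obtained from a faithful character of \<open>MAG\<close> is itself a
  character when the group is abelian. The result is meant for \<open>MA\<close>.\<close>

theorem abelian_character_iff:
  assumes comm: "comm_group G"
  shows "has_G_faithful_character \<A> G \<longleftrightarrow> has_G_faithful_character \<A> (G\<lparr>carrier := MAG G \<A>\<rparr>)"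
proof
  interpret C: comm_group G by fact
  interpret GN: G_group "G\<lparr>carrier := MAG G \<A>\<rparr>" \<A> by (rule G_group_subgroup[OF ginv_MAG])
  have gh: "group_hom (G\<lparr>carrier := MAG G \<A>\<rparr>) circle_group f"
    if "f \<in> hom (G\<lparr>carrier := MAG G \<A>\<rparr>) circle_group" for f
    by (rule group_hom.intro[OF GN.is_group group_circle_group group_hom_axioms.intro[OF that]])
  have gh': "group_hom G circle_group f" if "f \<in> hom G circle_group" for f
    by (rule group_hom.intro[OF is_group group_circle_group group_hom_axioms.intro[OF that]])
  {
    assume "has_G_faithful_character \<A> G"
    then obtain \<theta> where \<theta>: "\<theta> \<in> hom G circle_group" "G_faithful \<A> G circle_group \<theta>"
      unfolding has_G_faithful_character_def unitary_character_def by blast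
    have \<theta>': "\<theta> \<in> hom (G\<lparr>carrier := MAG G \<A>\<rparr>) circle_group"
      using \<theta>(1) MAG_closed by (auto simp: hom_def Pi_def subset_iff)
    moreover have "G_faithful \<A> (G\<lparr>carrier := MAG G \<A>\<rparr>) circle_group \<theta>"
      unfolding GN.G_faithful_iff[OF gh[OF \<theta>']]
    proof (intro allI impI, elim conjE)
      fix M assume M: "GN.ginv M" "M \<noteq> {\<one>\<^bsub>G\<lparr>carrier := MAG G \<A>\<rparr>\<^esub>}"
      then have "ginv M" using GN.ginv_carrier_subset[of M] ginv_in_subgroup[OF ginv_MAG, of M] by auto
      then show "\<exists>x\<in>M. \<theta> x \<noteq> \<one>\<^bsub>circle_group\<^esub>"
        using \<theta>(2) M(2) unfolding G_faithful_iff[OF gh'[OF \<theta>(1)]] by simp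
    qed
    ultimately show "has_G_faithful_character \<A> (G\<lparr>carrier := MAG G \<A>\<rparr>)"
      unfolding has_G_faithful_character_def unitary_character_def by blast
  next
    assume "has_G_faithful_character \<A> (G\<lparr>carrier := MAG G \<A>\<rparr>)"
    then obtain \<theta> where "\<theta> \<in> hom (G\<lparr>carrier := MAG G \<A>\<rparr>) circle_group"
      "G_faithful \<A> (G\<lparr>carrier := MAG G \<A>\<rparr>) circle_group \<theta>"
      unfolding has_G_faithful_character_def unitary_character_def by blast
    then obtain \<phi>0 q where q: "posdef \<phi>0" "q \<in> state_cone \<phi>0" "q \<one> = 1" "pure \<phi>0 q"
      "\<And>M. ginv M \<Longrightarrow> M \<noteq> {\<one>} \<Longrightarrow> \<exists>x\<in>M. q x \<noteq> 1"
      using character_imp_pure_state by blast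
    have hq: "q \<in> hom G circle_group" by (rule C.pure_state_character[OF q(1-4)])
    have "G_faithful \<A> G circle_group q"
      unfolding G_faithful_iff[OF gh'[OF hq]] using q(5) by simp
    then show "has_G_faithful_character \<A> G"
      using hq unfolding has_G_faithful_character_def unitary_character_def by blast
  }
qed

end

subsection \<open>Cyclic and faithful direct sums\<close>

context comm_group
begin

text \<open>The value 0 outside \<open>B\<close> makes each character of \<open>B\<close> a single
  function, so that characters can be counted.\<close>

definition dual :: "'a set \<Rightarrow> ('a \<Rightarrow> complex) set"
  where "dual B = {\<psi> \<in> hom (G\<lparr>carrier := B\<rparr>) circle_group. \<forall>x. x \<notin> B \<longrightarrow> \<psi> x = 0}"

lemma dual_restrict:
  assumes "subgroup B G" "\<psi> \<in> hom (G\<lparr>carrier := B\<rparr>) circle_group"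
  shows "(\<lambda>x. if x \<in> B then \<psi> x else 0) \<in> dual B"
  using assms(2) subgroup.m_closed[OF assms(1)] by (auto simp: dual_def hom_def Pi_def)

lemma dual_pow_card:
  assumes B: "subgroup B G" "finite B" and \<psi>: "\<psi> \<in> dual B" and x: "x \<in> B"
  shows "\<psi> x ^ card B = 1"
proof -
  have h: "\<psi> \<in> hom (G\<lparr>carrier := B\<rparr>) circle_group" using \<psi> by (simp add: dual_def)
  have pow: "x [^] (n::nat) \<in> B" for n
    by (induction n) (auto intro: subgroup.one_closed[OF B(1)] subgroup.m_closed[OF B(1)] x)
  have hp: "\<psi> (x [^] (n::nat)) = \<psi> x ^ n" for n
    by (induction n) (simp_all add: character_one[OF B(1) h] character_mult[OF h pow x])
  interpret M: group "G\<lparr>carrier := B\<rparr>" by (rule subgroup.subgroup_is_group[OF B(1) is_group])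
  have "x [^]\<^bsub>G\<lparr>carrier := B\<rparr>\<^esub> Coset.order (G\<lparr>carrier := B\<rparr>) = \<one>"
    using M.pow_order_eq_1[of x] x B by simp
  then have "x [^] card B = \<one>" by (simp add: Coset.order_def nat_pow_consistent[symmetric])
  then show ?thesis using hp[of "card B"] character_one[OF B(1) h] by simp
qed

lemma finite_dual:
  assumes B: "subgroup B G" "finite B" shows "finite (dual B)"
proof -
  have "card B > 0" using B subgroup.one_closed[OF B(1)] by (auto simp: card_gt_0_iff)
  then have "finite {z::complex. z ^ card B = 1}" using finite_roots_unity[of "card B"] by simp
  then have "finite {f. \<forall>x. (x \<in> B \<longrightarrow> f x \<in> {z::complex. z ^ card B = 1}) \<and> (x \<notin> B \<longrightarrow> f x = 0)}"
    by (rule finite_set_of_finite_funs[OF B(2)])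
  then show ?thesis by (rule finite_subset[rotated]) (use dual_pow_card[OF B] in \<open>auto simp: dual_def\<close>)
qed

lemma dual_mult:
  assumes "subgroup B G" "\<psi> \<in> dual B" "\<theta> \<in> dual B" shows "(\<lambda>x. \<psi> x * \<theta> x) \<in> dual B"
  using assms subgroup.m_closed[OF assms(1)] by (auto simp: dual_def hom_def Pi_def norm_mult)

lemma dual_cnj:
  assumes "subgroup B G" "\<psi> \<in> dual B" shows "(\<lambda>x. cnj (\<psi> x)) \<in> dual B"
  using assms subgroup.m_closed[OF assms(1)] by (auto simp: dual_def hom_def Pi_def)

lemma dual_mult_cnj:
  assumes "\<psi> \<in> dual B" "x \<in> B" shows "\<psi> x * cnj (\<psi> x) = 1"
proof -
  have "cmod (\<psi> x) = 1" using assms by (auto simp: dual_def hom_def Pi_def)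
  then show ?thesis using complex_norm_square[of "\<psi> x"] by simp
qed

text \<open>The trivial character of the trivial subgroup extends with a value different from 1 at
  \<open>b\<close>.\<close>

lemma dual_separates:
  assumes B: "subgroup B G" "finite B" and b: "b \<in> B" "b \<noteq> \<one>"
  obtains \<psi> where "\<psi> \<in> dual B" "\<psi> b \<noteq> 1"
proof -
  interpret N: group "G\<lparr>carrier := B\<rparr>" by (rule subgroup.subgroup_is_group[OF B(1) is_group])
  interpret N: comm_group "G\<lparr>carrier := B\<rparr>"
    by (rule N.group_comm_groupI) (use subgroup.mem_carrier[OF B(1)] m_comm in auto)
  have h: "(\<lambda>_. 1) \<in> hom (G\<lparr>carrier := B, carrier := {\<one>\<^bsub>G\<lparr>carrier := B\<rparr>\<^esub>}\<rparr>) circle_group"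
    by (auto simp: hom_def)
  have b': "b \<in> carrier (G\<lparr>carrier := B\<rparr>)" "b \<notin> {\<one>\<^bsub>G\<lparr>carrier := B\<rparr>\<^esub>}" using b by auto
  obtain \<psi> where "\<psi> \<in> hom (G\<lparr>carrier := B\<rparr>) circle_group" "\<psi> b \<noteq> 1"
    by (rule N.extend_character[OF _ N.triv_subgroup h b']) (use B(2) in \<open>auto intro: countable_finite\<close>)
  then show ?thesis using that[OF dual_restrict[OF B(1)]] b(1) by auto
qed

text \<open>Double counting of the values \<open>\<psi> b\<close> by orthogonality of characters.\<close>

lemma card_dual:
  assumes B: "subgroup B G" "finite B" shows "card (dual B) = card B"
proof -
  note B1 = subgroup.one_closed[OF B(1)] and Bm = subgroup.m_closed[OF B(1)]
    and Bi = subgroup.m_inv_closed[OF B(1)] and Bc = subgroup.mem_carrier[OF B(1)]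
  define \<epsilon> where "\<epsilon> = (\<lambda>x. if x \<in> B then 1 else 0 :: complex)"
  have \<epsilon>: "\<epsilon> \<in> dual B" unfolding \<epsilon>_def by (rule dual_restrict[OF B(1)]) (auto simp: hom_def)
  \<comment> \<open>Multiplication by a character \<open>\<theta>\<close> with
    \<open>\<theta> b \<noteq> 1\<close> permutes the dual and multiplies the sum by
    \<open>\<theta> b\<close>.\<close>
  have col: "(\<Sum>\<psi>\<in>dual B. \<psi> b) = 0" if b: "b \<in> B" "b \<noteq> \<one>" for b
  proof -
    obtain \<theta> where \<theta>: "\<theta> \<in> dual B" "\<theta> b \<noteq> 1" using dual_separates[OF B b] by blast
    have off: "\<psi> x = 0" if "\<psi> \<in> dual B" "x \<notin> B" for \<psi> x using that by (auto simp: dual_def)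
    have e: "\<theta> x * (cnj (\<theta> x) * \<psi> x) = \<psi> x" "cnj (\<theta> x) * (\<theta> x * \<psi> x) = \<psi> x"
      if \<psi>: "\<psi> \<in> dual B" for \<psi> x
    proof -
      have "\<theta> x * (cnj (\<theta> x) * \<psi> x) = (\<theta> x * cnj (\<theta> x)) * \<psi> x"
        "cnj (\<theta> x) * (\<theta> x * \<psi> x) = (\<theta> x * cnj (\<theta> x)) * \<psi> x" by (simp_all only: mult_ac)
      moreover have "(\<theta> x * cnj (\<theta> x)) * \<psi> x = \<psi> x"
        using dual_mult_cnj[OF \<theta>(1), of x] off[OF \<psi>, of x] by (cases "x \<in> B") simp_all
      ultimately show "\<theta> x * (cnj (\<theta> x) * \<psi> x) = \<psi> x" "cnj (\<theta> x) * (\<theta> x * \<psi> x) = \<psi> x"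
        by simp_all
    qed
    have "(\<Sum>\<psi>\<in>dual B. \<psi> b) = (\<Sum>\<psi>\<in>dual B. \<theta> b * \<psi> b)"
      by (rule sum.reindex_bij_witness[where i = "\<lambda>\<psi> x. \<theta> x * \<psi> x" and j = "\<lambda>\<psi> x. cnj (\<theta> x) * \<psi> x"])
        (auto simp: e dual_mult[OF B(1)] dual_cnj[OF B(1)] \<theta>)
    then have "(1 - \<theta> b) * (\<Sum>\<psi>\<in>dual B. \<psi> b) = 0" by (simp add: sum_distrib_left[symmetric] left_diff_distrib)
    then show ?thesis using \<theta>(2) by simp
  qed
  \<comment> \<open>Translation by an element \<open>c\<close> with
    \<open>\<psi> c \<noteq> 1\<close> permutes \<open>B\<close> and multiplies the sum by
    \<open>\<psi> c\<close>.\<close>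
  have row: "(\<Sum>b\<in>B. \<psi> b) = 0" if \<psi>: "\<psi> \<in> dual B" "\<psi> \<noteq> \<epsilon>" for \<psi>
  proof -
    obtain c where c: "c \<in> B" "\<psi> c \<noteq> 1" using \<psi> by (auto simp: \<epsilon>_def dual_def fun_eq_iff split: if_splits)
    have h: "\<psi> \<in> hom (G\<lparr>carrier := B\<rparr>) circle_group" using \<psi> by (simp add: dual_def)
    have "(\<Sum>b\<in>B. \<psi> b) = (\<Sum>b\<in>B. \<psi> (c \<otimes> b))"
      by (rule sum.reindex_bij_witness[where i = "\<lambda>b. c \<otimes> b" and j = "\<lambda>b. inv c \<otimes> b"])
        (use c Bc Bm Bi in \<open>auto simp: m_assoc[symmetric]\<close>)
    also have "\<dots> = \<psi> c * (\<Sum>b\<in>B. \<psi> b)" using character_mult[OF h c(1)] by (simp add: sum_distrib_left)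
    finally have "(1 - \<psi> c) * (\<Sum>b\<in>B. \<psi> b) = 0" by (simp add: left_diff_distrib)
    then show ?thesis using c(2) by simp
  qed
  have "(\<Sum>b\<in>B. \<Sum>\<psi>\<in>dual B. \<psi> b) = (\<Sum>b\<in>B. if b = \<one> then of_nat (card (dual B)) else 0)"
  proof (intro sum.cong refl)
    fix b assume b: "b \<in> B"
    have "(\<Sum>\<psi>\<in>dual B. \<psi> \<one>) = (\<Sum>\<psi>\<in>dual B. 1)"
      using character_one[OF B(1)] by (intro sum.cong) (auto simp: dual_def)
    then show "(\<Sum>\<psi>\<in>dual B. \<psi> b) = (if b = \<one> then of_nat (card (dual B)) else 0)"
      using col[OF b] by simp
  qed
  also have "\<dots> = of_nat (card (dual B))" using B(2) B1 by simp
  finally have 1: "(\<Sum>b\<in>B. \<Sum>\<psi>\<in>dual B. \<psi> b) = of_nat (card (dual B))" .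
  have "(\<Sum>\<psi>\<in>dual B. \<Sum>b\<in>B. \<psi> b) = (\<Sum>\<psi>\<in>dual B. if \<psi> = \<epsilon> then of_nat (card B) else 0)"
    using row by (intro sum.cong) (auto simp: \<epsilon>_def)
  also have "\<dots> = of_nat (card B)" using finite_dual[OF B] \<epsilon> by simp
  finally have "(\<Sum>\<psi>\<in>dual B. \<Sum>b\<in>B. \<psi> b) = of_nat (card B)" .
  then have "(of_nat (card (dual B)) :: complex) = of_nat (card B)" using 1 sum.swap[of "\<lambda>b \<psi>. \<psi> b" "dual B" B] by simp
  then show ?thesis by simp
qed

end

section \<open>Equivariant homomorphisms and products with one foot\<close>

locale comm_G_group = G_group G \<A> + comm_group G for G (structure) and \<A>
begin

text \<open>Equivariant homomorphisms, extensional so that \<open>card\<close> counts each of them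
  once.\<close>

definition Hm :: "'a set \<Rightarrow> 'a set \<Rightarrow> ('a \<Rightarrow> 'a) set"
  where "Hm S T = {h \<in> extensional S. (\<forall>x\<in>S. h x \<in> T) \<and>
    (\<forall>x\<in>S. \<forall>y\<in>S. h (x \<otimes> y) = h x \<otimes> h y) \<and> (\<forall>g\<in>\<A>. \<forall>x\<in>S. h (g x) = g (h x))}"

lemma HmD:
  assumes "h \<in> Hm S T"
  shows "h \<in> extensional S" "\<And>x. x \<in> S \<Longrightarrow> h x \<in> T"
    "\<And>x y. x \<in> S \<Longrightarrow> y \<in> S \<Longrightarrow> h (x \<otimes> y) = h x \<otimes> h y"
    "\<And>g x. g \<in> \<A> \<Longrightarrow> x \<in> S \<Longrightarrow> h (g x) = g (h x)"
  using assms by (auto simp: Hm_def)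

lemma Hm_one:
  assumes "h \<in> Hm S T" "ginv S" "ginv T" shows "h \<one> = \<one>"
proof -
  have "h \<one> \<otimes> h \<one> = h \<one>" using HmD(3)[OF assms(1), of \<one> \<one>] ginvD(4)[OF assms(2)] by simp
  moreover have "h \<one> \<in> carrier G" using HmD(2)[OF assms(1)] ginvD(3,4) assms(2,3) by blast
  ultimately show ?thesis by simp
qed

lemma Hm_inv:
  assumes "h \<in> Hm S T" "ginv S" "ginv T" "x \<in> S" shows "h (inv x) = inv (h x)"
proof -
  have x: "inv x \<in> S" "x \<in> carrier G" using ginvD(3,6)[OF assms(2)] assms(4) by auto
  then have c: "h x \<in> carrier G" "h (inv x) \<in> carrier G"
    using HmD(2)[OF assms(1)] ginvD(3)[OF assms(3)] assms(4) by auto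
  have "h (inv x) \<otimes> h x = \<one>" using HmD(3)[OF assms(1) x(1) assms(4)] Hm_one[OF assms(1-3)] x by simp
  then show ?thesis using c inv_equality by metis
qed

lemma ginv_subsetI:
  assumes S: "ginv S" and "P \<one>" "\<And>x y. x \<in> S \<Longrightarrow> y \<in> S \<Longrightarrow> P x \<Longrightarrow> P y \<Longrightarrow> P (x \<otimes> y)"
    "\<And>x. x \<in> S \<Longrightarrow> P x \<Longrightarrow> P (inv x)" "\<And>g x. g \<in> \<A> \<Longrightarrow> x \<in> S \<Longrightarrow> P x \<Longrightarrow> P (g x)"
  shows "ginv {x \<in> S. P x}"
proof (rule ginvI)
  show "subgroup {x \<in> S. P x} G"
    by (rule subgroupI) (use assms ginvD(3-6)[OF S] in auto)
qed (use assms ginvD(2)[OF S] in auto)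

lemma ginv_equalizer:
  assumes "h \<in> Hm S T" "h' \<in> Hm S T" "ginv S" "ginv T"
  shows "ginv {x \<in> S. h x = h' x}"
  by (rule ginv_subsetI[OF assms(3)])
    (simp_all add: Hm_one[OF assms(1,3,4)] Hm_one[OF assms(2-4)] HmD(3,4)[OF assms(1)] HmD(3,4)[OF assms(2)]
      Hm_inv[OF assms(1,3,4)] Hm_inv[OF assms(2-4)])

lemma Hm_eqI:
  assumes "h \<in> Hm S T" "h' \<in> Hm S T" "\<And>x. x \<in> S \<Longrightarrow> h x = h' x" shows "h = h'"
  using assms(3) HmD(1)[OF assms(1)] HmD(1)[OF assms(2)] by (rule extensionalityI[rotated 2])

lemma ginv_set_mult:
  assumes S: "ginv S" and T: "ginv T" shows "ginv (S <#> T)"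
proof (rule ginvI)
  show "subgroup (S <#> T) G" by (rule mult_norm_subgroup[OF ginv_normal[OF S] ginvD(1)[OF T]])
  fix g x assume g: "g \<in> \<A>" and "x \<in> S <#> T"
  then obtain u v where uv: "u \<in> S" "v \<in> T" "x = u \<otimes> v" by (auto simp: set_mult_def)
  then have "g x = g u \<otimes> g v" using act_mult[OF g] ginvD(3)[OF S] ginvD(3)[OF T] by simp
  then show "g x \<in> S <#> T" using uv ginvD(2)[OF S g] ginvD(2)[OF T g] by (auto simp: set_mult_def)
qed

definition cyclic :: "'a set \<Rightarrow> bool"
  where "cyclic S \<longleftrightarrow> (\<exists>x\<in>S. span x = S)"

text \<open>Faithfulness in the form of \<open>G_faithful_iff\<close>, for subgroups of a fixed
  ambient group.\<close>

definition faithful_on :: "'a set \<Rightarrow> ('a \<Rightarrow> complex) \<Rightarrow> bool"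
  where "faithful_on S \<psi> \<longleftrightarrow> \<psi> \<in> hom (G\<lparr>carrier := S\<rparr>) circle_group \<and>
    (\<forall>M. ginv M \<and> M \<subseteq> S \<and> M \<noteq> {\<one>} \<longrightarrow> (\<exists>x\<in>M. \<psi> x \<noteq> 1))"

context
  fixes S B
  assumes S: "ginv S" and B: "ginv B" and SB: "S \<inter> B = {\<one>}"
begin

lemma SB_unique:
  assumes "s \<in> S" "b \<in> B" "s' \<in> S" "b' \<in> B" "s \<otimes> b = s' \<otimes> b'"
  shows "s = s'" "b = b'"
proof -
  have c: "s \<in> carrier G" "b \<in> carrier G" "s' \<in> carrier G" "b' \<in> carrier G"
    using assms ginvD(3)[OF S] ginvD(3)[OF B] by auto
  have "inv s' \<otimes> s = inv s' \<otimes> (s \<otimes> b) \<otimes> inv b" using c by (simp add: m_assoc)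
  also have "\<dots> = b' \<otimes> inv b" unfolding assms(5) using c by (simp add: m_assoc[symmetric])
  finally have e: "inv s' \<otimes> s = b' \<otimes> inv b" .
  have "inv s' \<otimes> s \<in> S" "b' \<otimes> inv b \<in> B"
    using assms ginvD(5,6)[OF S] ginvD(5,6)[OF B] by auto
  then have "inv s' \<otimes> s \<in> S \<inter> B" using e by simp
  then have "inv s' \<otimes> s = \<one>" unfolding SB by simp
  then have "s' \<otimes> (inv s' \<otimes> s) = s'" using c by simp
  then show "s = s'" using c by (simp add: m_assoc[symmetric])
  then show "b = b'" using assms(5) c by simp
qed

lemma SB_incl: "s \<in> S \<Longrightarrow> s \<in> S <#> B" "b \<in> B \<Longrightarrow> b \<in> S <#> B"
proof -
  show "s \<in> S <#> B" if "s \<in> S"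
  proof -
    have "s = s \<otimes> \<one>" using ginvD(3)[OF S that] by simp
    then show ?thesis using that ginvD(4)[OF B] unfolding set_mult_def by blast
  qed
  show "b \<in> S <#> B" if "b \<in> B"
  proof -
    have "b = \<one> \<otimes> b" using ginvD(3)[OF B that] by simp
    then show ?thesis using that ginvD(4)[OF S] unfolding set_mult_def by blast
  qed
qed

lemma SB_least: "ginv T \<Longrightarrow> S \<subseteq> T \<Longrightarrow> B \<subseteq> T \<Longrightarrow> S <#> B \<subseteq> T"
  unfolding set_mult_def using ginvD(5) by blast

definition prS :: "'a \<Rightarrow> 'a" where "prS y = (THE s. s \<in> S \<and> (\<exists>b\<in>B. y = s \<otimes> b))"
definition prB :: "'a \<Rightarrow> 'a" where "prB y = (THE b. b \<in> B \<and> (\<exists>s\<in>S. y = s \<otimes> b))"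

lemma pr_simps [simp]:
  assumes "s \<in> S" "b \<in> B" shows "prS (s \<otimes> b) = s" "prB (s \<otimes> b) = b"
  unfolding prS_def prB_def using assms SB_unique[OF assms] by (auto intro!: the_equality)

lemma pr_cases:
  assumes "y \<in> S <#> B" obtains s b where "s \<in> S" "b \<in> B" "y = s \<otimes> b"
  using assms by (auto simp: set_mult_def)

lemma pr_closed: "y \<in> S <#> B \<Longrightarrow> prS y \<in> S" "y \<in> S <#> B \<Longrightarrow> prB y \<in> B" "y \<in> S <#> B \<Longrightarrow> y = prS y \<otimes> prB y"
  by (auto elim!: pr_cases)

lemma pr_incl: "s \<in> S \<Longrightarrow> prS s = s" "s \<in> S \<Longrightarrow> prB s = \<one>" "b \<in> B \<Longrightarrow> prS b = \<one>" "b \<in> B \<Longrightarrow> prB b = b"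
  using pr_simps[of s \<one>] pr_simps[of \<one> b] ginvD(3,4)[OF S] ginvD(3,4)[OF B] by auto

lemma SB_mult:
  assumes "s \<in> S" "b \<in> B" "s' \<in> S" "b' \<in> B"
  shows "(s \<otimes> b) \<otimes> (s' \<otimes> b') = (s \<otimes> s') \<otimes> (b \<otimes> b')"
  using assms ginvD(3)[OF S] ginvD(3)[OF B] by (simp add: m_ac)

lemma pr_mult:
  assumes "y \<in> S <#> B" "z \<in> S <#> B"
  shows "prS (y \<otimes> z) = prS y \<otimes> prS z" "prB (y \<otimes> z) = prB y \<otimes> prB z"
proof -
  obtain s b where y: "s \<in> S" "b \<in> B" "y = s \<otimes> b" using assms(1) by (rule pr_cases)
  obtain s' b' where z: "s' \<in> S" "b' \<in> B" "z = s' \<otimes> b'" using assms(2) by (rule pr_cases)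
  have "y \<otimes> z = (s \<otimes> s') \<otimes> (b \<otimes> b')" unfolding y(3) z(3) by (rule SB_mult[OF y(1,2) z(1,2)])
  then show "prS (y \<otimes> z) = prS y \<otimes> prS z" "prB (y \<otimes> z) = prB y \<otimes> prB z"
    using y z ginvD(5)[OF S y(1) z(1)] ginvD(5)[OF B y(2) z(2)] by simp_all
qed

lemma pr_act:
  assumes "y \<in> S <#> B" "g \<in> \<A>"
  shows "prS (g y) = g (prS y)" "prB (g y) = g (prB y)"
proof -
  obtain s b where y: "s \<in> S" "b \<in> B" "y = s \<otimes> b" using assms(1) by (rule pr_cases)
  have "g y = g s \<otimes> g b" using y act_mult[OF assms(2)] ginvD(3)[OF S] ginvD(3)[OF B] by simp
  then show "prS (g y) = g (prS y)" "prB (g y) = g (prB y)"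
    using y ginvD(2)[OF S assms(2)] ginvD(2)[OF B assms(2)] by simp_all
qed

text \<open>Restriction to the two factors is bijective: a pair \<open>(h, k)\<close> comes from
  \<open>h (prS y) \<otimes> k (prB y)\<close>, which is multiplicative in \<open>y\<close> because
  the group is abelian.\<close>

lemma card_Hm_from_product:
  assumes T: "ginv T"
  shows "card (Hm (S <#> B) T) = card (Hm S T) * card (Hm B T)"
proof -
  have "bij_betw (\<lambda>h. (restrict h S, restrict h B)) (Hm (S <#> B) T) (Hm S T \<times> Hm B T)"
  proof (rule bij_betw_byWitness[where f' = "\<lambda>(h, k). \<lambda>y\<in>S <#> B. h (prS y) \<otimes> k (prB y)"])
    show "\<forall>h\<in>Hm (S <#> B) T. (case (restrict h S, restrict h B) of (h, k) \<Rightarrow> \<lambda>y\<in>S <#> B. h (prS y) \<otimes> k (prB y)) = h"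
    proof
      fix h assume h: "h \<in> Hm (S <#> B) T"
      have "h y = h (prS y) \<otimes> h (prB y)" if y: "y \<in> S <#> B" for y
        using HmD(3)[OF h, of "prS y" "prB y"] pr_closed[OF y] SB_incl by simp
      then show "(case (restrict h S, restrict h B) of (h, k) \<Rightarrow> \<lambda>y\<in>S <#> B. h (prS y) \<otimes> k (prB y)) = h"
        using HmD(1)[OF h] by (auto simp: pr_closed intro!: extensionalityI[where A = "S <#> B"])
    qed
    show "\<forall>hk\<in>Hm S T \<times> Hm B T. (\<lambda>h. (restrict h S, restrict h B))
        (case hk of (h, k) \<Rightarrow> \<lambda>y\<in>S <#> B. h (prS y) \<otimes> k (prB y)) = hk"
    proof
      fix hk assume "hk \<in> Hm S T \<times> Hm B T"
      then obtain h k where hk: "hk = (h, k)" and h: "h \<in> Hm S T" and k: "k \<in> Hm B T" by auto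
      have "h s \<in> carrier G" if "s \<in> S" for s using HmD(2)[OF h that] ginvD(3)[OF T] by blast
      moreover have "k b \<in> carrier G" if "b \<in> B" for b using HmD(2)[OF k that] ginvD(3)[OF T] by blast
      ultimately have e: "h (prS s) \<otimes> k (prB s) = h s" "h (prS b) \<otimes> k (prB b) = k b"
        if "s \<in> S" "b \<in> B" for s b
        using that Hm_one[OF h S T] Hm_one[OF k B T] pr_incl by simp_all
      have "restrict (\<lambda>y\<in>S <#> B. h (prS y) \<otimes> k (prB y)) S = h"
        by (rule extensionalityI[OF restrict_extensional HmD(1)[OF h]])
          (use e(1) SB_incl(1) ginvD(4)[OF B] in auto)
      moreover have "restrict (\<lambda>y\<in>S <#> B. h (prS y) \<otimes> k (prB y)) B = k"
        by (rule extensionalityI[OF restrict_extensional HmD(1)[OF k]])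
          (use e(2) SB_incl(2) ginvD(4)[OF S] in auto)
      ultimately have "restrict (\<lambda>y\<in>S <#> B. h (prS y) \<otimes> k (prB y)) S = h"
        "restrict (\<lambda>y\<in>S <#> B. h (prS y) \<otimes> k (prB y)) B = k" by auto
      then show "(\<lambda>h. (restrict h S, restrict h B))
        (case hk of (h, k) \<Rightarrow> \<lambda>y\<in>S <#> B. h (prS y) \<otimes> k (prB y)) = hk" using hk by simp
    qed
    show "(\<lambda>h. (restrict h S, restrict h B)) ` Hm (S <#> B) T \<subseteq> Hm S T \<times> Hm B T"
    proof
      fix p assume "p \<in> (\<lambda>h. (restrict h S, restrict h B)) ` Hm (S <#> B) T"
      then obtain h where h: "h \<in> Hm (S <#> B) T" "p = (restrict h S, restrict h B)" by blast
      have "restrict h S \<in> Hm S T" "restrict h B \<in> Hm B T"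
        using HmD(2-4)[OF h(1)] SB_incl ginvD(2,5)[OF S] ginvD(2,5)[OF B] by (auto simp: Hm_def)
      then show "p \<in> Hm S T \<times> Hm B T" using h by simp
    qed
    show "(\<lambda>(h, k). \<lambda>y\<in>S <#> B. h (prS y) \<otimes> k (prB y)) ` (Hm S T \<times> Hm B T) \<subseteq> Hm (S <#> B) T"
    proof
      fix f assume "f \<in> (\<lambda>(h, k). \<lambda>y\<in>S <#> B. h (prS y) \<otimes> k (prB y)) ` (Hm S T \<times> Hm B T)"
      then obtain h k where h: "h \<in> Hm S T" and k: "k \<in> Hm B T"
        and f: "f = (\<lambda>y\<in>S <#> B. h (prS y) \<otimes> k (prB y))" by auto
      note P = ginvD(2,5)[OF ginv_set_mult[OF S B]]
      have hT: "h s \<in> T" "h s \<in> carrier G" if "s \<in> S" for s using HmD(2)[OF h that] ginvD(3)[OF T] by auto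
      have kT: "k b \<in> T" "k b \<in> carrier G" if "b \<in> B" for b using HmD(2)[OF k that] ginvD(3)[OF T] by auto
      show "f \<in> Hm (S <#> B) T" unfolding Hm_def
      proof (intro CollectI conjI ballI)
        show "f \<in> extensional (S <#> B)" by (simp add: f)
        fix y assume y: "y \<in> S <#> B"
        show "f y \<in> T" using y pr_closed[OF y] hT kT ginvD(5)[OF T] by (simp add: f)
        fix z assume z: "z \<in> S <#> B"
        show "f (y \<otimes> z) = f y \<otimes> f z"
          using y z P(2)[OF y z] pr_closed[OF y] pr_closed[OF z] hT kT
          by (simp add: f pr_mult HmD(3)[OF h] HmD(3)[OF k] m_ac)
      next
        fix g y assume g: "g \<in> \<A>" and y: "y \<in> S <#> B"
        show "f (g y) = g (f y)"
          using y P(1)[OF g y] pr_closed[OF y] hT kT act_mult[OF g]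
          by (simp add: f pr_act[OF y g] HmD(4)[OF h g] HmD(4)[OF k g])
      qed
    qed
  qed
  from bij_betw_same_card[OF this] show ?thesis by (simp add: card_cartesian_product)
qed

text \<open>Composition with the two projections is bijective, with pointwise multiplication as
  inverse.\<close>

lemma card_Hm_into_product:
  assumes T: "ginv T"
  shows "card (Hm T (S <#> B)) = card (Hm T S) * card (Hm T B)"
proof -
  have "bij_betw (\<lambda>h. (\<lambda>t\<in>T. prS (h t), \<lambda>t\<in>T. prB (h t))) (Hm T (S <#> B)) (Hm T S \<times> Hm T B)"
  proof (rule bij_betw_byWitness[where f' = "\<lambda>(h, k). \<lambda>t\<in>T. h t \<otimes> k t"])
    show "\<forall>h\<in>Hm T (S <#> B). (case (\<lambda>t\<in>T. prS (h t), \<lambda>t\<in>T. prB (h t)) of (h, k) \<Rightarrow> \<lambda>t\<in>T. h t \<otimes> k t) = h"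
    proof
      fix h assume h: "h \<in> Hm T (S <#> B)"
      have "prS (h t) \<otimes> prB (h t) = h t" if "t \<in> T" for t using pr_closed(3)[OF HmD(2)[OF h that]] by simp
      then show "(case (\<lambda>t\<in>T. prS (h t), \<lambda>t\<in>T. prB (h t)) of (h, k) \<Rightarrow> \<lambda>t\<in>T. h t \<otimes> k t) = h"
        using HmD(1)[OF h] by (auto intro!: extensionalityI[where A = T])
    qed
    show "\<forall>hk\<in>Hm T S \<times> Hm T B. (\<lambda>h. (\<lambda>t\<in>T. prS (h t), \<lambda>t\<in>T. prB (h t)))
        (case hk of (h, k) \<Rightarrow> \<lambda>t\<in>T. h t \<otimes> k t) = hk"
    proof
      fix hk assume "hk \<in> Hm T S \<times> Hm T B"
      then obtain h k where hk: "hk = (h, k)" and h: "h \<in> Hm T S" and k: "k \<in> Hm T B" by auto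
      have "(\<lambda>t\<in>T. prS ((\<lambda>t\<in>T. h t \<otimes> k t) t)) = h" "(\<lambda>t\<in>T. prB ((\<lambda>t\<in>T. h t \<otimes> k t) t)) = k"
        using HmD(1,2)[OF h] HmD(1,2)[OF k] by (auto intro!: extensionalityI[where A = T])
      then show "(\<lambda>h. (\<lambda>t\<in>T. prS (h t), \<lambda>t\<in>T. prB (h t)))
        (case hk of (h, k) \<Rightarrow> \<lambda>t\<in>T. h t \<otimes> k t) = hk" using hk by simp
    qed
    show "(\<lambda>h. (\<lambda>t\<in>T. prS (h t), \<lambda>t\<in>T. prB (h t))) ` Hm T (S <#> B) \<subseteq> Hm T S \<times> Hm T B"
    proof
      fix p assume "p \<in> (\<lambda>h. (\<lambda>t\<in>T. prS (h t), \<lambda>t\<in>T. prB (h t))) ` Hm T (S <#> B)"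
      then obtain h where h: "h \<in> Hm T (S <#> B)" "p = (\<lambda>t\<in>T. prS (h t), \<lambda>t\<in>T. prB (h t))" by blast
      have "(\<lambda>t\<in>T. prS (h t)) \<in> Hm T S" "(\<lambda>t\<in>T. prB (h t)) \<in> Hm T B"
        using HmD(2-4)[OF h(1)] ginvD(2,5)[OF T] by (auto simp: Hm_def pr_closed pr_mult pr_act)
      then show "p \<in> Hm T S \<times> Hm T B" using h by simp
    qed
    show "(\<lambda>(h, k). \<lambda>t\<in>T. h t \<otimes> k t) ` (Hm T S \<times> Hm T B) \<subseteq> Hm T (S <#> B)"
    proof
      fix f assume "f \<in> (\<lambda>(h, k). \<lambda>t\<in>T. h t \<otimes> k t) ` (Hm T S \<times> Hm T B)"
      then obtain h k where h: "h \<in> Hm T S" and k: "k \<in> Hm T B" and f: "f = (\<lambda>t\<in>T. h t \<otimes> k t)" by auto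
      have hS: "h t \<in> S" "h t \<in> carrier G" if "t \<in> T" for t using HmD(2)[OF h that] ginvD(3)[OF S] by auto
      have kB: "k t \<in> B" "k t \<in> carrier G" if "t \<in> T" for t using HmD(2)[OF k that] ginvD(3)[OF B] by auto
      show "f \<in> Hm T (S <#> B)" unfolding Hm_def
      proof (intro CollectI conjI ballI)
        show "f \<in> extensional T" by (simp add: f)
        fix y assume y: "y \<in> T"
        show "f y \<in> S <#> B" using hS[OF y] kB[OF y] y by (auto simp: f set_mult_def)
        fix z assume z: "z \<in> T"
        show "f (y \<otimes> z) = f y \<otimes> f z"
          using ginvD(5)[OF T y z] y z hS[OF y] kB[OF y] hS[OF z] kB[OF z]
          by (simp add: f HmD(3)[OF h] HmD(3)[OF k] m_ac)
      next
        fix g y assume g: "g \<in> \<A>" and y: "y \<in> T"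
        show "f (g y) = g (f y)"
          using ginvD(2)[OF T g y] y hS[OF y] kB[OF y] act_mult[OF g]
          by (simp add: f HmD(4)[OF h g] HmD(4)[OF k g])
      qed
    qed
  qed
  from bij_betw_same_card[OF this] show ?thesis by (simp add: card_cartesian_product)
qed

context
  assumes foot: "G_foot G \<A> B" and fin: "finite B"
begin

text \<open>If \<open>span (x \<otimes> b)\<close> meets \<open>B\<close> trivially then it is the graph of a homomorphism \<open>S \<rightarrow> B\<close>
  sending \<open>x\<close> to \<open>b\<close>.\<close>

lemma span_mult_iff:
  assumes x: "x \<in> S" "span x = S" and b: "b \<in> B"
  shows "span (x \<otimes> b) = S <#> B \<longleftrightarrow> \<not> (\<exists>h\<in>Hm S B. h x = b)"
proof -
  note Sd = ginvD(3-6)[OF S] and Bd = ginvD(3-6)[OF B]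
  define T where "T = span (x \<otimes> b)"
  have c: "x \<in> carrier G" "b \<in> carrier G" using x b Sd(1) Bd(1) by auto
  have T: "ginv T" "x \<otimes> b \<in> T" unfolding T_def using ginv_span span_self c by auto
  note Td = ginvD(3-6)[OF T(1)]
  have TSB: "T \<subseteq> S <#> B" unfolding T_def
    by (rule span_least[OF ginv_set_mult[OF S B]]) (use x b in \<open>auto simp: set_mult_def\<close>)
  have 1: False if h: "h \<in> Hm S B" "h x = b" and eq: "T = S <#> B" for h
  proof -
    \<comment> \<open>The graph of \<open>h\<close> is an invariant subgroup containing
      \<open>x \<otimes> b\<close>, hence all of \<open>T\<close>, but it meets \<open>B\<close>
      only in \<open>\<one>\<close>.\<close>
    define \<Gamma> where "\<Gamma> = {y \<in> S <#> B. h (prS y) = prB y}"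
    have "ginv \<Gamma>" unfolding \<Gamma>_def
    proof (rule ginvI)
      note P = ginvD(3-6)[OF ginv_set_mult[OF S B]]
      show "subgroup {y \<in> S <#> B. h (prS y) = prB y} G"
      proof (rule subgroupI)
        have "\<one> \<in> {y \<in> S <#> B. h (prS y) = prB y}"
          using P(2) pr_incl(1)[of \<one>] pr_incl(4)[of \<one>] Sd(2) Bd(2) Hm_one[OF h(1) S B] by simp
        then show "{y \<in> S <#> B. h (prS y) = prB y} \<noteq> {}" by blast
        fix y assume "y \<in> {y \<in> S <#> B. h (prS y) = prB y}"
        then have y: "y \<in> S <#> B" "h (prS y) = prB y" by auto
        obtain s b where sb: "s \<in> S" "b \<in> B" "y = s \<otimes> b" using y(1) by (rule pr_cases)
        have "inv y = inv s \<otimes> inv b" using sb Sd(1) Bd(1) by (simp add: inv_mult)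
        then show "inv y \<in> {y \<in> S <#> B. h (prS y) = prB y}"
          using sb y P(4)[OF y(1)] Sd(4) Bd(4) Hm_inv[OF h(1) S B sb(1)] by simp
        fix z assume "z \<in> {y \<in> S <#> B. h (prS y) = prB y}"
        then have z: "z \<in> S <#> B" "h (prS z) = prB z" by auto
        show "y \<otimes> z \<in> {y \<in> S <#> B. h (prS y) = prB y}"
          using y z P(3)[OF y(1) z(1)] pr_closed(1)[OF y(1)] pr_closed(1)[OF z(1)]
          by (simp add: pr_mult HmD(3)[OF h(1)])
      qed (use P(1) in auto)
      fix g y assume g: "g \<in> \<A>" and "y \<in> {y \<in> S <#> B. h (prS y) = prB y}"
      then have y: "y \<in> S <#> B" "h (prS y) = prB y" by auto
      show "g y \<in> {y \<in> S <#> B. h (prS y) = prB y}"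
        using y ginvD(2)[OF ginv_set_mult[OF S B] g y(1)] pr_closed(1)[OF y(1)]
        by (simp add: pr_act[OF y(1) g] HmD(4)[OF h(1) g])
    qed
    moreover have "x \<otimes> b \<in> \<Gamma>" using x b h by (auto simp: \<Gamma>_def set_mult_def)
    ultimately have sub: "S <#> B \<subseteq> \<Gamma>" using span_least eq unfolding T_def by metis
    have "b0 = \<one>" if b0: "b0 \<in> B" for b0
    proof -
      have "b0 \<in> \<Gamma>" using sub SB_incl(2)[OF b0] by blast
      then show ?thesis using pr_incl(3,4)[OF b0] Hm_one[OF h(1) S B] by (simp add: \<Gamma>_def)
    qed
    then have "B = {\<one>}" using Bd(2) by blast
    then show False using footD(2)[OF foot] by simp
  qed
  have 2: "\<exists>h\<in>Hm S B. h x = b" if ne: "T \<noteq> S <#> B"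
  proof -
    \<comment> \<open>If \<open>T\<close> contained \<open>B\<close>, it would contain
      \<open>x\<close>, hence \<open>S\<close>, hence the whole product. By minimality of
      \<open>B\<close> the intersection is therefore trivial.\<close>
    have "\<not> B \<subseteq> T"
    proof
      assume BT: "B \<subseteq> T"
      then have "(x \<otimes> b) \<otimes> inv b \<in> T" using b T(2) Td(3,4) by blast
      then have "x \<in> T" using c by (simp add: m_assoc)
      then have "S \<subseteq> T" using span_least[OF T(1)] x(2) by blast
      then show False using SB_least[OF T(1) _ BT] TSB ne by blast
    qed
    then have BT: "B \<inter> T = {\<one>}" using foot_Int[OF foot T(1)] by blast
    have uniq: "b1 = b2" if "s \<in> S" "b1 \<in> B" "s \<otimes> b1 \<in> T" "b2 \<in> B" "s \<otimes> b2 \<in> T" for s b1 b2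
    proof -
      have cc: "s \<in> carrier G" "b1 \<in> carrier G" "b2 \<in> carrier G" using that Sd(1) Bd(1) by auto
      have "inv (s \<otimes> b1) \<otimes> (s \<otimes> b2) \<in> T" using that Td(3,4) by blast
      moreover have "inv (s \<otimes> b1) \<otimes> (s \<otimes> b2) = inv b1 \<otimes> b2"
        using cc by (simp add: inv_mult_group m_assoc) (simp add: m_assoc[symmetric])
      moreover have "inv b1 \<otimes> b2 \<in> B" using that Bd(3,4) by blast
      ultimately have "inv b1 \<otimes> b2 = \<one>" using BT by auto
      then have "b1 \<otimes> (inv b1 \<otimes> b2) = b1" using cc by simp
      then show ?thesis using cc by (simp add: m_assoc[symmetric])
    qed
    \<comment> \<open>The projection of \<open>T\<close> to \<open>S\<close> is invariant and
      contains the generator \<open>x\<close>, so every element of \<open>S\<close> has a partner in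
      \<open>B\<close>.\<close>
    define R where "R = {s \<in> S. \<exists>b'\<in>B. s \<otimes> b' \<in> T}"
    have "ginv R" unfolding R_def
    proof (rule ginv_subsetI[OF S])
      show "\<exists>b'\<in>B. \<one> \<otimes> b' \<in> T" using Bd(2) Td(2) by (intro bexI[of _ \<one>]) auto
    next
      fix u v assume u: "u \<in> S" "\<exists>b'\<in>B. u \<otimes> b' \<in> T" and v: "v \<in> S" "\<exists>b'\<in>B. v \<otimes> b' \<in> T"
      then obtain b1 b2 where bb: "b1 \<in> B" "u \<otimes> b1 \<in> T" "b2 \<in> B" "v \<otimes> b2 \<in> T" by blast
      have "(u \<otimes> v) \<otimes> (b1 \<otimes> b2) \<in> T" using Td(3)[OF bb(2,4)] SB_mult[OF u(1) bb(1) v(1) bb(3)] by simp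
      then show "\<exists>b'\<in>B. u \<otimes> v \<otimes> b' \<in> T" using Bd(3)[OF bb(1,3)] by blast
    next
      fix u assume u: "u \<in> S" "\<exists>b'\<in>B. u \<otimes> b' \<in> T"
      then obtain b1 where bb: "b1 \<in> B" "u \<otimes> b1 \<in> T" by blast
      have "inv u \<otimes> inv b1 \<in> T" using Td(4)[OF bb(2)] inv_mult u bb Sd(1) Bd(1) by simp
      then show "\<exists>b'\<in>B. inv u \<otimes> b' \<in> T" using Bd(4)[OF bb(1)] by blast
    next
      fix g u assume g: "g \<in> \<A>" and u: "u \<in> S" "\<exists>b'\<in>B. u \<otimes> b' \<in> T"
      then obtain b1 where bb: "b1 \<in> B" "u \<otimes> b1 \<in> T" by blast
      have "g u \<otimes> g b1 \<in> T" using ginvD(2)[OF T(1) g bb(2)] act_mult[OF g] u bb Sd(1) Bd(1) by simp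
      then show "\<exists>b'\<in>B. g u \<otimes> b' \<in> T" using ginvD(2)[OF B g bb(1)] by blast
    qed
    moreover have "x \<in> R" using x b T(2) by (auto simp: R_def)
    ultimately have "S \<subseteq> R" using span_least x(2) by metis
    then have ex: "\<exists>b'. b' \<in> B \<and> s \<otimes> b' \<in> T" if "s \<in> S" for s using that by (auto simp: R_def)
    define h where "h = (\<lambda>s\<in>S. SOME b'. b' \<in> B \<and> s \<otimes> b' \<in> T)"
    have hs: "h s \<in> B" "s \<otimes> h s \<in> T" if "s \<in> S" for s
      using someI_ex[OF ex[OF that]] that by (auto simp: h_def)
    have hu: "h s = b'" if "s \<in> S" "b' \<in> B" "s \<otimes> b' \<in> T" for s b'
      using uniq[OF that(1) hs[OF that(1)] that(2,3)] .
    have "h \<in> Hm S B" unfolding Hm_def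
    proof (intro CollectI conjI ballI)
      show "h \<in> extensional S" by (simp add: h_def)
      fix u assume u: "u \<in> S"
      show "h u \<in> B" using hs[OF u] by simp
      fix v assume v: "v \<in> S"
      have "(u \<otimes> v) \<otimes> (h u \<otimes> h v) \<in> T"
        using Td(3)[OF hs(2)[OF u] hs(2)[OF v]] SB_mult[OF u hs(1)[OF u] v hs(1)[OF v]] by simp
      then show "h (u \<otimes> v) = h u \<otimes> h v" by (intro hu Sd(3) Bd(3) hs u v)
    next
      fix g u assume g: "g \<in> \<A>" and u: "u \<in> S"
      have "g u \<otimes> g (h u) \<in> T"
        using ginvD(2)[OF T(1) g hs(2)[OF u]] act_mult[OF g] u hs(1)[OF u] Sd(1) Bd(1) by simp
      then show "h (g u) = g (h u)" by (intro hu ginvD(2)[OF S g] ginvD(2)[OF B g] hs u)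
    qed
    moreover have "h x = b" using hu[OF x(1) b T(2)] .
    ultimately show ?thesis by blast
  qed
  show ?thesis using 1 2 unfolding T_def by blast
qed

lemma inj_on_eval_generator:
  assumes "x \<in> S" "span x = S" shows "inj_on (\<lambda>h. h x) (Hm S B)"
proof (rule inj_onI)
  fix h h' assume h: "h \<in> Hm S B" "h' \<in> Hm S B" "h x = h' x"
  have "span x \<subseteq> {y \<in> S. h y = h' y}"
    by (rule span_least[OF ginv_equalizer[OF h(1,2) S B]]) (use assms h in simp)
  then show "h = h'" using assms by (intro Hm_eqI[OF h(1,2)]) auto
qed

text \<open>For a generator \<open>x\<close> of \<open>S\<close> the elements \<open>b\<close> that
  fail are the values \<open>h x\<close>, and \<open>h\<close> is determined by \<open>h x\<close>.
  So a suitable \<open>b\<close> exists exactly when there are fewer homomorphisms than elements of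
  \<open>B\<close>, a condition independent of \<open>x\<close>.\<close>

lemma cyclic_product_iff: "cyclic (S <#> B) \<longleftrightarrow> cyclic S \<and> card (Hm S B) < card B"
proof -
  have main: "(\<exists>b\<in>B. span (x \<otimes> b) = S <#> B) \<longleftrightarrow> card (Hm S B) < card B"
    if x: "x \<in> S" "span x = S" for x
  proof -
    let ?I = "(\<lambda>h. h x) ` Hm S B"
    have sub: "?I \<subseteq> B" using HmD(2) x(1) by blast
    have "(\<exists>b\<in>B. span (x \<otimes> b) = S <#> B) \<longleftrightarrow> (\<exists>b\<in>B. b \<notin> ?I)"
    proof (intro bex_cong refl)
      fix b assume "b \<in> B"
      then show "span (x \<otimes> b) = S <#> B \<longleftrightarrow> b \<notin> ?I" by (subst span_mult_iff[OF x]) auto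
    qed
    also have "\<dots> \<longleftrightarrow> ?I \<noteq> B" using sub by blast
    also have "\<dots> \<longleftrightarrow> card ?I < card B"
      using sub fin card_mono[OF fin sub] card_subset_eq[OF fin sub] by (metis le_neq_implies_less less_irrefl)
    also have "card ?I = card (Hm S B)" by (rule card_image[OF inj_on_eval_generator[OF x]])
    finally show ?thesis .
  qed
  have P: "ginv (S <#> B)" by (rule ginv_set_mult[OF S B])
  show ?thesis
  proof
    assume "cyclic (S <#> B)"
    then obtain y where y: "y \<in> S <#> B" "span y = S <#> B" by (auto simp: cyclic_def)
    \<comment> \<open>The component in \<open>S\<close> of a generator of the product generates
      \<open>S\<close>.\<close>
    obtain x b where xb: "x \<in> S" "b \<in> B" "y = x \<otimes> b" using y(1) by (rule pr_cases)
    have xc: "x \<in> carrier G" using ginvD(3)[OF S xb(1)] .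
    have sx: "span x \<subseteq> S" by (rule span_least[OF S xb(1)])
    have "span y \<subseteq> span x <#> B"
      by (rule span_least[OF ginv_set_mult[OF ginv_span[OF xc] B]])
        (use xb span_self[OF xc] in \<open>auto simp: set_mult_def\<close>)
    then have "S <#> B \<subseteq> span x <#> B" using y(2) by simp
    moreover have "s \<in> span x" if s: "s \<in> S" "S <#> B \<subseteq> span x <#> B" for s
    proof -
      have "s \<in> span x <#> B" using s SB_incl(1) by blast
      then obtain s' b' where sb: "s' \<in> span x" "b' \<in> B" "s = s' \<otimes> b'" by (auto simp: set_mult_def)
      then have "prS s = s'" using sx by auto
      then show ?thesis using pr_incl(1)[OF s(1)] sb by simp
    qed
    ultimately have "span x = S" using sx by blast
    then show "cyclic S \<and> card (Hm S B) < card B"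
      using main[OF xb(1)] xb y by (auto simp: cyclic_def)
  next
    assume h: "cyclic S \<and> card (Hm S B) < card B"
    then obtain x where x: "x \<in> S" "span x = S" by (auto simp: cyclic_def)
    then obtain b where "b \<in> B" "span (x \<otimes> b) = S <#> B" using main h by blast
    moreover from this have "x \<otimes> b \<in> S <#> B" using x unfolding set_mult_def by blast
    ultimately show "cyclic (S <#> B)" unfolding cyclic_def by blast
  qed
qed

text \<open>A nontrivial invariant subgroup on which \<open>\<omega>\<close> is trivial meets \<open>S\<close> trivially, so it is the
  graph of a homomorphism \<open>B \<rightarrow> S\<close>.\<close>

lemma faithful_product_iff:
  assumes \<omega>: "\<omega> \<in> hom (G\<lparr>carrier := S <#> B\<rparr>) circle_group" and fS: "faithful_on S \<omega>"
  shows "faithful_on (S <#> B) \<omega> \<longleftrightarrow> \<not> (\<exists>h\<in>Hm B S. \<forall>b\<in>B. \<omega> (h b) * \<omega> b = 1)"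
proof -
  note Sd = ginvD(3-6)[OF S] and Bd = ginvD(3-6)[OF B]
  have mult: "\<omega> (s \<otimes> b) = \<omega> s * \<omega> b" if "s \<in> S" "b \<in> B" for s b
    using character_mult[OF \<omega>] SB_incl that by simp
  have 1: False if h: "h \<in> Hm B S" "\<forall>b\<in>B. \<omega> (h b) * \<omega> b = 1" and f: "faithful_on (S <#> B) \<omega>" for h
  proof -
    \<comment> \<open>The values \<open>h b \<otimes> b\<close> form a nontrivial invariant subgroup
      on which \<open>\<omega>\<close> is trivial.\<close>
    define M where "M = (\<lambda>b. h b \<otimes> b) ` B"
    have hS: "h b \<in> S" "h b \<in> carrier G" "b \<in> carrier G" if "b \<in> B" for b
      using HmD(2)[OF h(1) that] Sd(1) Bd(1) that by auto
    have "ginv M"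
    proof (rule ginvI)
      show "subgroup M G"
      proof (rule subgroupI)
        show "M \<subseteq> carrier G" "M \<noteq> {}" using hS Bd(2) by (auto simp: M_def)
        fix y assume "y \<in> M"
        then obtain b where b: "b \<in> B" "y = h b \<otimes> b" by (auto simp: M_def)
        have "inv y = h (inv b) \<otimes> inv b" using b hS[OF b(1)] Hm_inv[OF h(1) B S] by (simp add: inv_mult)
        then show "inv y \<in> M" using Bd(4)[OF b(1)] by (simp add: M_def)
        fix z assume "z \<in> M"
        then obtain c where c: "c \<in> B" "z = h c \<otimes> c" by (auto simp: M_def)
        have "y \<otimes> z = h (b \<otimes> c) \<otimes> (b \<otimes> c)"
          using b c hS[OF b(1)] hS[OF c(1)] HmD(3)[OF h(1) b(1) c(1)] by (simp add: m_ac)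
        then show "y \<otimes> z \<in> M" using Bd(3)[OF b(1) c(1)] by (simp add: M_def)
      qed
      fix g y assume g: "g \<in> \<A>" and "y \<in> M"
      then obtain b where b: "b \<in> B" "y = h b \<otimes> b" by (auto simp: M_def)
      have "g y = h (g b) \<otimes> g b" using b hS[OF b(1)] act_mult[OF g] HmD(4)[OF h(1) g b(1)] by simp
      then show "g y \<in> M" using ginvD(2)[OF B g b(1)] by (simp add: M_def)
    qed
    moreover have "M \<subseteq> S <#> B" using hS by (auto simp: M_def set_mult_def)
    moreover have "M \<noteq> {\<one>}"
    proof
      assume M1: "M = {\<one>}"
      have "b = \<one>" if b: "b \<in> B" for b
      proof -
        have "h b \<otimes> b = \<one> \<otimes> \<one>" using M1 b by (auto simp: M_def)
        then show ?thesis using SB_unique(2)[OF hS(1)[OF b] b Sd(2) Bd(2)] by blast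
      qed
      then have "B = {\<one>}" using Bd(2) by blast
      then show False using footD(2)[OF foot] by simp
    qed
    ultimately obtain y where "y \<in> M" "\<omega> y \<noteq> 1" using f unfolding faithful_on_def by blast
    then show False using h(2) mult hS by (auto simp: M_def)
  qed
  have 2: "\<exists>h\<in>Hm B S. \<forall>b\<in>B. \<omega> (h b) * \<omega> b = 1" if nf: "\<not> faithful_on (S <#> B) \<omega>"
  proof -
    obtain C where C: "ginv C" "C \<subseteq> S <#> B" "C \<noteq> {\<one>}" "\<And>y. y \<in> C \<Longrightarrow> \<omega> y = 1"
      using nf \<omega> unfolding faithful_on_def by blast
    note Cd = ginvD(3-6)[OF C(1)]
    have CS: "C \<inter> S = {\<one>}"
    proof (rule ccontr)
      assume "C \<inter> S \<noteq> {\<one>}"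
      then have "\<exists>x\<in>C \<inter> S. \<omega> x \<noteq> 1" using fS ginv_Int[OF C(1) S] unfolding faithful_on_def by blast
      then show False using C(4) by blast
    qed
    have uniq: "s1 = s2" if "b \<in> B" "s1 \<in> S" "s1 \<otimes> b \<in> C" "s2 \<in> S" "s2 \<otimes> b \<in> C" for b s1 s2
    proof -
      have cc: "b \<in> carrier G" "s1 \<in> carrier G" "s2 \<in> carrier G" using that Sd(1) Bd(1) by auto
      have "(s1 \<otimes> b) \<otimes> inv (s2 \<otimes> b) \<in> C" using that Cd(3,4) by blast
      moreover have "(s1 \<otimes> b) \<otimes> inv (s2 \<otimes> b) = s1 \<otimes> inv s2"
        using cc by (simp add: inv_mult_group m_assoc) (simp add: m_assoc[symmetric])
      moreover have "s1 \<otimes> inv s2 \<in> S" using that Sd(3,4) by blast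
      ultimately have "s1 \<otimes> inv s2 = \<one>" using CS by auto
      then have "s1 \<otimes> inv s2 \<otimes> s2 = s2" using cc by simp
      then show ?thesis using cc by (simp add: m_assoc)
    qed
    \<comment> \<open>The projection of \<open>C\<close> to \<open>B\<close> is nontrivial because
      \<open>C\<close> meets \<open>S\<close> trivially, so it is all of \<open>B\<close> by
      minimality of the foot.\<close>
    define R where "R = {b \<in> B. \<exists>s\<in>S. s \<otimes> b \<in> C}"
    have "ginv R" unfolding R_def
    proof (rule ginv_subsetI[OF B])
      show "\<exists>s\<in>S. s \<otimes> \<one> \<in> C" using Sd(2) Cd(2) by (intro bexI[of _ \<one>]) auto
    next
      fix u v assume u: "u \<in> B" "\<exists>s\<in>S. s \<otimes> u \<in> C" and v: "v \<in> B" "\<exists>s\<in>S. s \<otimes> v \<in> C"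
      then obtain s1 s2 where ss: "s1 \<in> S" "s1 \<otimes> u \<in> C" "s2 \<in> S" "s2 \<otimes> v \<in> C" by blast
      have "(s1 \<otimes> s2) \<otimes> (u \<otimes> v) \<in> C" using Cd(3)[OF ss(2,4)] SB_mult[OF ss(1) u(1) ss(3) v(1)] by simp
      then show "\<exists>s\<in>S. s \<otimes> (u \<otimes> v) \<in> C" using Sd(3)[OF ss(1,3)] by blast
    next
      fix u assume u: "u \<in> B" "\<exists>s\<in>S. s \<otimes> u \<in> C"
      then obtain s1 where ss: "s1 \<in> S" "s1 \<otimes> u \<in> C" by blast
      have "inv s1 \<otimes> inv u \<in> C" using Cd(4)[OF ss(2)] inv_mult u ss Sd(1) Bd(1) by simp
      then show "\<exists>s\<in>S. s \<otimes> inv u \<in> C" using Sd(4)[OF ss(1)] by blast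
    next
      fix g u assume g: "g \<in> \<A>" and u: "u \<in> B" "\<exists>s\<in>S. s \<otimes> u \<in> C"
      then obtain s1 where ss: "s1 \<in> S" "s1 \<otimes> u \<in> C" by blast
      have "g s1 \<otimes> g u \<in> C" using ginvD(2)[OF C(1) g ss(2)] act_mult[OF g] u ss Sd(1) Bd(1) by simp
      then show "\<exists>s\<in>S. s \<otimes> g u \<in> C" using ginvD(2)[OF S g ss(1)] by blast
    qed
    moreover have "R \<subseteq> B" by (auto simp: R_def)
    moreover have "R \<noteq> {\<one>}"
    proof
      assume R1: "R = {\<one>}"
      have "y = \<one>" if y: "y \<in> C" for y
      proof -
        obtain s b where sb: "s \<in> S" "b \<in> B" "y = s \<otimes> b" using pr_cases C(2) y by blast
        then have "b \<in> R" using y by (auto simp: R_def)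
        then have "y = s" using R1 sb Sd(1) by simp
        then show ?thesis using CS y sb by blast
      qed
      then show False using C(3) Cd(2) by blast
    qed
    ultimately have "R = B" using footD(3)[OF foot] by blast
    then have ex: "\<exists>s. s \<in> S \<and> s \<otimes> b \<in> C" if "b \<in> B" for b using that by (auto simp: R_def)
    define h where "h = (\<lambda>b\<in>B. SOME s. s \<in> S \<and> s \<otimes> b \<in> C)"
    have hs: "h b \<in> S" "h b \<otimes> b \<in> C" if "b \<in> B" for b
      using someI_ex[OF ex[OF that]] that by (auto simp: h_def)
    have hu: "h b = s" if "b \<in> B" "s \<in> S" "s \<otimes> b \<in> C" for s b
      using uniq[OF that(1) hs[OF that(1)] that(2,3)] .
    have "h \<in> Hm B S" unfolding Hm_def
    proof (intro CollectI conjI ballI)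
      show "h \<in> extensional B" by (simp add: h_def)
      fix u assume u: "u \<in> B"
      show "h u \<in> S" using hs[OF u] by simp
      fix v assume v: "v \<in> B"
      have "(h u \<otimes> h v) \<otimes> (u \<otimes> v) \<in> C"
        using Cd(3)[OF hs(2)[OF u] hs(2)[OF v]] SB_mult[OF hs(1)[OF u] u hs(1)[OF v] v] by simp
      then show "h (u \<otimes> v) = h u \<otimes> h v" by (intro hu Sd(3) Bd(3) hs u v)
    next
      fix g u assume g: "g \<in> \<A>" and u: "u \<in> B"
      have "g (h u) \<otimes> g u \<in> C"
        using ginvD(2)[OF C(1) g hs(2)[OF u]] act_mult[OF g] u hs(1)[OF u] Sd(1) Bd(1) by simp
      then show "h (g u) = g (h u)" by (intro hu ginvD(2)[OF S g] ginvD(2)[OF B g] hs u)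
    qed
    moreover have "\<omega> (h b) * \<omega> b = 1" if b: "b \<in> B" for b
      using mult[OF hs(1)[OF b] b] C(4)[OF hs(2)[OF b]] by simp
    ultimately show ?thesis by blast
  qed
  show ?thesis using 1 2 by blast
qed

lemma faithful_on_subset:
  assumes "faithful_on T \<omega>" "U \<subseteq> T" shows "faithful_on U \<omega>"
proof -
  have "\<omega> \<in> hom (G\<lparr>carrier := U\<rparr>) circle_group"
    using assms by (auto simp: faithful_on_def hom_def Pi_def subset_iff)
  then show ?thesis using assms unfolding faithful_on_def by blast
qed

lemma faithful_on_cong:
  assumes "ginv T" "faithful_on T \<omega>" "\<And>x. x \<in> T \<Longrightarrow> \<omega>' x = \<omega> x" shows "faithful_on T \<omega>'"
proof -
  have "\<omega>' \<in> hom (G\<lparr>carrier := T\<rparr>) circle_group"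
    using assms(2,3) ginvD(5)[OF assms(1)] by (auto simp: faithful_on_def hom_def Pi_def)
  then show ?thesis using assms(2,3) unfolding faithful_on_def by (metis subset_iff)
qed

text \<open>A character of \<open>B\<close> fails to complete a given faithful
  \<open>\<theta>\<close> exactly when it is some \<open>bad h\<close>, the conjugate of
  \<open>\<theta>\<close> composed with \<open>h\<close>. Distinct \<open>h\<close> give distinct
  characters, and \<open>B\<close> has as many characters as elements. The criterion is thus that of
  \<open>cyclic_product_iff\<close> with the direction of the homomorphisms reversed.\<close>

lemma faithful_exists_product_iff:
  "(\<exists>\<omega>. faithful_on (S <#> B) \<omega>) \<longleftrightarrow> (\<exists>\<theta>. faithful_on S \<theta>) \<and> card (Hm B S) < card B"
proof -
  note Sd = ginvD(3-6)[OF S] and Bd = ginvD(3-6)[OF B]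
  have P: "ginv (S <#> B)" by (rule ginv_set_mult[OF S B])
  have main: "(\<exists>\<omega>. faithful_on (S <#> B) \<omega> \<and> (\<forall>s\<in>S. \<omega> s = \<theta> s)) \<longleftrightarrow> card (Hm B S) < card B"
    if \<theta>: "faithful_on S \<theta>" for \<theta>
  proof -
    have h\<theta>: "\<theta> \<in> hom (G\<lparr>carrier := S\<rparr>) circle_group" using \<theta> by (simp add: faithful_on_def)
    define bad where "bad = (\<lambda>h b. if b \<in> B then cnj (\<theta> (h b)) else 0)"
    have n: "\<theta> s * cnj (\<theta> s) = 1" "\<theta> s \<noteq> 0" if "s \<in> S" for s
      using character_norm[OF h\<theta> that] complex_norm_square[of "\<theta> s"] by auto
    have sub: "bad ` Hm B S \<subseteq> dual B"
    proof
      fix f assume "f \<in> bad ` Hm B S"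
      then obtain h where h: "h \<in> Hm B S" "f = bad h" by blast
      have "(\<lambda>b. cnj (\<theta> (h b))) \<in> hom (G\<lparr>carrier := B\<rparr>) circle_group"
        using HmD(2,3)[OF h(1)] character_mult[OF h\<theta>] character_norm[OF h\<theta>] by (intro homI) auto
      then show "f \<in> dual B" unfolding h bad_def by (rule dual_restrict[OF ginvD(1)[OF B]])
    qed
    have inj: "inj_on bad (Hm B S)"
    proof (rule inj_onI)
      fix h h' assume h: "h \<in> Hm B S" "h' \<in> Hm B S" "bad h = bad h'"
      have eq: "\<theta> (h b) = \<theta> (h' b)" if "b \<in> B" for b
        using fun_cong[OF h(3), of b] that by (simp add: bad_def)
      \<comment> \<open>If \<open>bad h = bad h'\<close>, then \<open>\<theta>\<close> is trivial on
        this invariant subgroup of \<open>S\<close>, which must therefore be trivial.\<close>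
      define M where "M = (\<lambda>b. h b \<otimes> inv (h' b)) ` B"
      have hS: "h b \<in> S" "h' b \<in> S" "h b \<in> carrier G" "h' b \<in> carrier G" if "b \<in> B" for b
        using HmD(2)[OF h(1) that] HmD(2)[OF h(2) that] Sd(1) by auto
      have "ginv M"
      proof (rule ginvI)
        show "subgroup M G"
        proof (rule subgroupI)
          show "M \<subseteq> carrier G" "M \<noteq> {}" using hS Bd(2) by (auto simp: M_def)
          fix y assume "y \<in> M"
          then obtain b where b: "b \<in> B" "y = h b \<otimes> inv (h' b)" by (auto simp: M_def)
          have "inv y = h (inv b) \<otimes> inv (h' (inv b))"
            using b hS[OF b(1)] Hm_inv[OF h(1) B S] Hm_inv[OF h(2) B S] by (simp add: inv_mult)
          then show "inv y \<in> M" using Bd(4)[OF b(1)] by (simp add: M_def)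
          fix z assume "z \<in> M"
          then obtain c where c: "c \<in> B" "z = h c \<otimes> inv (h' c)" by (auto simp: M_def)
          have "y \<otimes> z = h (b \<otimes> c) \<otimes> inv (h' (b \<otimes> c))"
            using b c hS[OF b(1)] hS[OF c(1)] HmD(3)[OF h(1) b(1) c(1)] HmD(3)[OF h(2) b(1) c(1)]
            by (simp add: m_ac inv_mult)
          then show "y \<otimes> z \<in> M" using Bd(3)[OF b(1) c(1)] by (simp add: M_def)
        qed
        fix g y assume g: "g \<in> \<A>" and "y \<in> M"
        then obtain b where b: "b \<in> B" "y = h b \<otimes> inv (h' b)" by (auto simp: M_def)
        have "g y = h (g b) \<otimes> inv (h' (g b))"
          using b hS[OF b(1)] act_mult[OF g] act_inverse[OF g] HmD(4)[OF h(1) g b(1)] HmD(4)[OF h(2) g b(1)] by simp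
        then show "g y \<in> M" using ginvD(2)[OF B g b(1)] by (simp add: M_def)
      qed
      moreover have "M \<subseteq> S" using hS Sd(3,4) by (auto simp: M_def)
      moreover have "\<theta> y = 1" if "y \<in> M" for y
      proof -
        obtain b where b: "b \<in> B" "y = h b \<otimes> inv (h' b)" using \<open>y \<in> M\<close> by (auto simp: M_def)
        have "\<theta> y = \<theta> (h b) * cnj (\<theta> (h' b))"
          using character_mult[OF h\<theta>] character_inv[OF ginvD(1)[OF S] h\<theta>] hS[OF b(1)] Sd(4) b(2) by simp
        then show ?thesis using eq[OF b(1)] n(1) hS[OF b(1)] by simp
      qed
      ultimately have "M = {\<one>}" using \<theta> unfolding faithful_on_def by blast
      then have "h b = h' b" if b: "b \<in> B" for b
      proof -
        have "h b \<otimes> inv (h' b) = \<one>" using \<open>M = {\<one>}\<close> b by (auto simp: M_def)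
        then have "h b \<otimes> inv (h' b) \<otimes> h' b = h' b" using hS[OF b] by simp
        then show ?thesis using hS[OF b] by (simp add: m_assoc)
      qed
      then show "h = h'" by (rule Hm_eqI[OF h(1,2)])
    qed
    have bad_iff: "bad h = \<psi> \<longleftrightarrow> (\<forall>b\<in>B. \<theta> (h b) * \<psi> b = 1)" if h: "h \<in> Hm B S" and \<psi>: "\<psi> \<in> dual B" for h \<psi>
    proof -
      have "\<psi> b = cnj (\<theta> (h b)) \<longleftrightarrow> \<theta> (h b) * \<psi> b = 1" if "b \<in> B" for b
        using n[OF HmD(2)[OF h that]] by (metis mult_left_cancel)
      moreover have "\<psi> b = 0" if "b \<notin> B" for b using \<psi> that by (simp add: dual_def)
      ultimately show ?thesis by (auto simp: bad_def fun_eq_iff)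
    qed
    have "(\<exists>\<omega>. faithful_on (S <#> B) \<omega> \<and> (\<forall>s\<in>S. \<omega> s = \<theta> s)) \<longleftrightarrow> (\<exists>\<psi>\<in>dual B. \<psi> \<notin> bad ` Hm B S)"
    proof
      assume "\<exists>\<omega>. faithful_on (S <#> B) \<omega> \<and> (\<forall>s\<in>S. \<omega> s = \<theta> s)"
      then obtain \<omega> where \<omega>: "faithful_on (S <#> B) \<omega>" "\<forall>s\<in>S. \<omega> s = \<theta> s" by blast
      have h\<omega>: "\<omega> \<in> hom (G\<lparr>carrier := S <#> B\<rparr>) circle_group" using \<omega> by (simp add: faithful_on_def)
      have "\<omega> \<in> hom (G\<lparr>carrier := B\<rparr>) circle_group" using h\<omega> SB_incl(2) by (auto simp: hom_def Pi_def)
      then have \<psi>: "(\<lambda>b. if b \<in> B then \<omega> b else 0) \<in> dual B" by (rule dual_restrict[OF ginvD(1)[OF B]])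
      have "faithful_on S \<omega>" using faithful_on_cong[OF S \<theta>] \<omega>(2) by blast
      then have nobad: "\<not> (\<exists>h\<in>Hm B S. \<forall>b\<in>B. \<omega> (h b) * \<omega> b = 1)"
        using faithful_product_iff[OF h\<omega>] \<omega>(1) by blast
      have "(\<lambda>b. if b \<in> B then \<omega> b else 0) \<notin> bad ` Hm B S"
      proof
        assume "(\<lambda>b. if b \<in> B then \<omega> b else 0) \<in> bad ` Hm B S"
        then obtain h where h': "(\<lambda>b. if b \<in> B then \<omega> b else 0) = bad h" and h: "h \<in> Hm B S" by (rule imageE)
        have "\<forall>b\<in>B. \<theta> (h b) * \<omega> b = 1" using bad_iff[OF h(1) \<psi>] h' by simp
        then have "\<forall>b\<in>B. \<omega> (h b) * \<omega> b = 1" using \<omega>(2) HmD(2)[OF h(1)] by simp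
        then show False using nobad h(1) by blast
      qed
      then show "\<exists>\<psi>\<in>dual B. \<psi> \<notin> bad ` Hm B S" using \<psi> by blast
    next
      assume "\<exists>\<psi>\<in>dual B. \<psi> \<notin> bad ` Hm B S"
      then obtain \<psi> where \<psi>: "\<psi> \<in> dual B" "\<psi> \<notin> bad ` Hm B S" by blast
      have h\<psi>: "\<psi> \<in> hom (G\<lparr>carrier := B\<rparr>) circle_group" using \<psi> by (simp add: dual_def)
      define \<omega> where "\<omega> = (\<lambda>y. \<theta> (prS y) * \<psi> (prB y))"
      have h\<omega>: "\<omega> \<in> hom (G\<lparr>carrier := S <#> B\<rparr>) circle_group"
        using pr_closed(1,2) character_mult[OF h\<theta>] character_mult[OF h\<psi>] character_norm[OF h\<theta>] character_norm[OF h\<psi>]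
        by (intro homI) (auto simp: \<omega>_def norm_mult pr_mult)
      have \<omega>S: "\<omega> s = \<theta> s" if "s \<in> S" for s
        using that pr_incl character_one[OF ginvD(1)[OF B] h\<psi>] by (simp add: \<omega>_def)
      have \<omega>B: "\<omega> b = \<psi> b" if "b \<in> B" for b
        using that pr_incl character_one[OF ginvD(1)[OF S] h\<theta>] by (simp add: \<omega>_def)
      have "faithful_on S \<omega>" using faithful_on_cong[OF S \<theta>] \<omega>S by blast
      moreover have "\<not> (\<exists>h\<in>Hm B S. \<forall>b\<in>B. \<omega> (h b) * \<omega> b = 1)"
      proof
        assume "\<exists>h\<in>Hm B S. \<forall>b\<in>B. \<omega> (h b) * \<omega> b = 1"
        then obtain h where h: "h \<in> Hm B S" "\<forall>b\<in>B. \<omega> (h b) * \<omega> b = 1" by blast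
        then have "\<forall>b\<in>B. \<theta> (h b) * \<psi> b = 1" using \<omega>S \<omega>B HmD(2)[OF h(1)] by simp
        then have "bad h = \<psi>" using bad_iff[OF h(1) \<psi>(1)] by blast
        then show False using \<psi>(2) h(1) by blast
      qed
      ultimately have "faithful_on (S <#> B) \<omega>" using faithful_product_iff[OF h\<omega>] by blast
      then show "\<exists>\<omega>. faithful_on (S <#> B) \<omega> \<and> (\<forall>s\<in>S. \<omega> s = \<theta> s)" using \<omega>S by blast
    qed
    also have "\<dots> \<longleftrightarrow> bad ` Hm B S \<noteq> dual B" using sub by blast
    also have "\<dots> \<longleftrightarrow> card (bad ` Hm B S) < card (dual B)"
      using finite_dual[OF ginvD(1)[OF B] fin] sub card_mono card_subset_eq
      by (metis le_neq_implies_less less_irrefl)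
    also have "card (bad ` Hm B S) = card (Hm B S)" by (rule card_image[OF inj])
    also have "card (dual B) = card B" by (rule card_dual[OF ginvD(1)[OF B] fin])
    finally show ?thesis .
  qed
  show ?thesis
  proof
    assume "\<exists>\<omega>. faithful_on (S <#> B) \<omega>"
    then obtain \<omega> where \<omega>: "faithful_on (S <#> B) \<omega>" by blast
    have "faithful_on S \<omega>" using faithful_on_subset[OF \<omega>] SB_incl(1) by blast
    then show "(\<exists>\<theta>. faithful_on S \<theta>) \<and> card (Hm B S) < card B" using main[of \<omega>] \<omega> by blast
  next
    assume "(\<exists>\<theta>. faithful_on S \<theta>) \<and> card (Hm B S) < card B"
    then show "\<exists>\<omega>. faithful_on (S <#> B) \<omega>" using main by blast
  qed
qed

end

end

end

section \<open>Symmetry of homomorphism counts between feet\<close>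

context comm_G_group
begin

lemma Hm_trivial: "ginv S \<Longrightarrow> ginv T \<Longrightarrow> (\<lambda>x\<in>S. \<one>) \<in> Hm S T"
  using ginvD(2,4,5) by (auto simp: Hm_def act_unit)

text \<open>Schur's lemma: kernel and image are invariant subgroups of feet.\<close>

lemma Hm_foot_bij:
  assumes F: "G_foot G \<A> F" and F': "G_foot G \<A> F'" and h: "h \<in> Hm F F'" and nt: "\<exists>x\<in>F. h x \<noteq> \<one>"
  shows "bij_betw h F F'"
proof -
  have g: "ginv F" "ginv F'" using footD(1) F F' by auto
  note d = ginvD(3-6)[OF g(1)] and d' = ginvD(3-6)[OF g(2)]
  have "ginv {x \<in> F. h x = (\<lambda>x\<in>F. \<one>) x}" by (rule ginv_equalizer[OF h Hm_trivial[OF g] g])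
  then have "{x \<in> F. h x = (\<lambda>x\<in>F. \<one>) x} = F \<or> {x \<in> F. h x = (\<lambda>x\<in>F. \<one>) x} = {\<one>}"
    by (rule footD(3)[OF F]) auto
  moreover have "{x \<in> F. h x = (\<lambda>x\<in>F. \<one>) x} \<noteq> F"
  proof
    assume eq: "{x \<in> F. h x = (\<lambda>x\<in>F. \<one>) x} = F"
    obtain x where x: "x \<in> F" "h x \<noteq> \<one>" using nt by blast
    then have "x \<in> {x \<in> F. h x = (\<lambda>x\<in>F. \<one>) x}" by (simp only: eq)
    then show False using x by simp
  qed
  ultimately have kerF: "{x \<in> F. h x = (\<lambda>x\<in>F. \<one>) x} = {\<one>}" by blast
  have ker: "x = \<one>" if "x \<in> F" "h x = \<one>" for x
  proof -
    have "x \<in> {x \<in> F. h x = (\<lambda>x\<in>F. \<one>) x}" using that by simp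
    then show ?thesis unfolding kerF by simp
  qed
  have "inj_on h F"
  proof (rule inj_onI)
    fix x y assume xy: "x \<in> F" "y \<in> F" "h x = h y"
    have c: "x \<in> carrier G" "y \<in> carrier G" "h y \<in> carrier G" using xy d(1) d'(1) HmD(2)[OF h] by auto
    have "h (x \<otimes> inv y) = \<one>"
      using HmD(3)[OF h xy(1) d(4)[OF xy(2)]] Hm_inv[OF h g xy(2)] xy(3) c by simp
    then have "x \<otimes> inv y = \<one>" using ker d(3)[OF xy(1) d(4)[OF xy(2)]] by blast
    then have "x \<otimes> inv y \<otimes> y = y" using c by simp
    then show "x = y" using c by (simp add: m_assoc)
  qed
  moreover have "h ` F = F'"
  proof -
    have "ginv (h ` F)"
    proof (rule ginvI)
      show "subgroup (h ` F) G"
      proof (rule subgroupI)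
        show "h ` F \<subseteq> carrier G" "h ` F \<noteq> {}" using HmD(2)[OF h] d'(1) d(2) by auto
        fix y assume "y \<in> h ` F"
        then obtain x where x: "x \<in> F" "y = h x" by blast
        have "inv y = h (inv x)" using Hm_inv[OF h g x(1)] x(2) by simp
        then show "inv y \<in> h ` F" using d(4)[OF x(1)] by blast
        fix z assume "z \<in> h ` F"
        then obtain w where w: "w \<in> F" "z = h w" by blast
        have "y \<otimes> z = h (x \<otimes> w)" using HmD(3)[OF h x(1) w(1)] x w by simp
        then show "y \<otimes> z \<in> h ` F" using d(3)[OF x(1) w(1)] by blast
      qed
      fix k y assume k: "k \<in> \<A>" and "y \<in> h ` F"
      then obtain x where x: "x \<in> F" "y = h x" by blast
      have "k y = h (k x)" using HmD(4)[OF h k x(1)] x by simp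
      then show "k y \<in> h ` F" using ginvD(2)[OF g(1) k x(1)] by blast
    qed
    moreover have "h ` F \<subseteq> F'" using HmD(2)[OF h] by blast
    moreover have "h ` F \<noteq> {\<one>}" using nt by blast
    ultimately show ?thesis using footD(3)[OF F'] by blast
  qed
  ultimately show ?thesis by (simp add: bij_betw_def)
qed

lemma Hm_comp:
  assumes "h \<in> Hm S T" "k \<in> Hm T U" "ginv S" shows "(\<lambda>x\<in>S. k (h x)) \<in> Hm S U"
  using HmD(2-4)[OF assms(1)] HmD(2-4)[OF assms(2)] ginvD(2,5)[OF assms(3)] by (simp add: Hm_def)

text \<open>With \<open>k\<close> the inverse of \<open>h\<close>, the map
  \<open>f \<mapsto> k \<circ> f \<circ> k\<close> is a bijection between the two sets.\<close>

lemma card_Hm_iso: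
  assumes F: "ginv F" and F': "ginv F'" and h: "h \<in> Hm F F'" and bij: "bij_betw h F F'"
  shows "card (Hm F F') = card (Hm F' F)"
proof -
  note d = ginvD(3-6)[OF F] and d' = ginvD(3-6)[OF F']
  define k where "k = (\<lambda>y\<in>F'. inv_into F h y)"
  have kF: "k y \<in> F" "h (k y) = y" if "y \<in> F'" for y
    using bij that by (auto simp: k_def bij_betw_def inv_into_into f_inv_into_f)
  have kh: "k (h x) = x" if "x \<in> F" for x
    using bij that by (auto simp: k_def bij_betw_def inv_into_f_f)
  have inj: "x = y" if "x \<in> F" "y \<in> F" "h x = h y" for x y using kh that by metis
  have k: "k \<in> Hm F' F" unfolding Hm_def
  proof (intro CollectI conjI ballI)
    show "k \<in> extensional F'" by (simp add: k_def)
    fix x assume x: "x \<in> F'"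
    show "k x \<in> F" using kF[OF x] by simp
    fix y assume y: "y \<in> F'"
    show "k (x \<otimes> y) = k x \<otimes> k y"
      by (rule inj) (use kF[OF x] kF[OF y] kF[OF d'(3)[OF x y]] d(3) HmD(3)[OF h] in auto)
  next
    fix g x assume g: "g \<in> \<A>" and x: "x \<in> F'"
    show "k (g x) = g (k x)"
      by (rule inj) (use kF[OF x] kF[OF ginvD(2)[OF F' g x]] ginvD(2)[OF F g] HmD(4)[OF h g] in auto)
  qed
  have "bij_betw (\<lambda>f. \<lambda>y\<in>F'. k (f (k y))) (Hm F F') (Hm F' F)"
  proof (rule bij_betw_byWitness[where f' = "\<lambda>f. \<lambda>x\<in>F. h (f (h x))"])
    show "\<forall>f\<in>Hm F F'. (\<lambda>x\<in>F. h ((\<lambda>y\<in>F'. k (f (k y))) (h x))) = f"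
    proof
      fix f assume f: "f \<in> Hm F F'"
      show "(\<lambda>x\<in>F. h ((\<lambda>y\<in>F'. k (f (k y))) (h x))) = f"
        by (rule extensionalityI[OF restrict_extensional HmD(1)[OF f]])
          (use HmD(2)[OF h] HmD(2)[OF f] kF kh in simp)
    qed
    show "\<forall>f\<in>Hm F' F. (\<lambda>y\<in>F'. k ((\<lambda>x\<in>F. h (f (h x))) (k y))) = f"
    proof
      fix f assume f: "f \<in> Hm F' F"
      show "(\<lambda>y\<in>F'. k ((\<lambda>x\<in>F. h (f (h x))) (k y))) = f"
        by (rule extensionalityI[OF restrict_extensional HmD(1)[OF f]])
          (use HmD(2)[OF f] kF kh in simp)
    qed
    show "(\<lambda>f. \<lambda>y\<in>F'. k (f (k y))) ` Hm F F' \<subseteq> Hm F' F"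
    proof
      fix e assume "e \<in> (\<lambda>f. \<lambda>y\<in>F'. k (f (k y))) ` Hm F F'"
      then obtain f where f: "f \<in> Hm F F'" "e = (\<lambda>y\<in>F'. k (f (k y)))" by blast
      have "(\<lambda>y\<in>F'. k ((\<lambda>y\<in>F'. f (k y)) y)) \<in> Hm F' F" by (rule Hm_comp[OF Hm_comp[OF k f(1) F'] k F'])
      moreover have "(\<lambda>y\<in>F'. k ((\<lambda>y\<in>F'. f (k y)) y)) = e" unfolding f by (rule restrict_ext) simp
      ultimately show "e \<in> Hm F' F" by simp
    qed
    show "(\<lambda>f. \<lambda>x\<in>F. h (f (h x))) ` Hm F' F \<subseteq> Hm F F'"
    proof
      fix e assume "e \<in> (\<lambda>f. \<lambda>x\<in>F. h (f (h x))) ` Hm F' F"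
      then obtain f where f: "f \<in> Hm F' F" "e = (\<lambda>x\<in>F. h (f (h x)))" by blast
      have "(\<lambda>x\<in>F. h ((\<lambda>x\<in>F. f (h x)) x)) \<in> Hm F F'" by (rule Hm_comp[OF Hm_comp[OF h f(1) F] h F])
      moreover have "(\<lambda>x\<in>F. h ((\<lambda>x\<in>F. f (h x)) x)) = e" unfolding f by (rule restrict_ext) simp
      ultimately show "e \<in> Hm F F'" by simp
    qed
  qed
  then show ?thesis by (rule bij_betw_same_card)
qed

text \<open>If a nontrivial homomorphism exists in one of the two directions, the feet are
  isomorphic; otherwise each side has only the trivial one.\<close>

lemma card_Hm_feet:
  assumes F: "G_foot G \<A> F" and F': "G_foot G \<A> F'"
  shows "card (Hm F F') = card (Hm F' F)"
proof -
  have g: "ginv F" "ginv F'" using footD(1) F F' by auto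
  have triv: "Hm S T = {\<lambda>x\<in>S. \<one>}"
    if ST: "ginv S" "ginv T" "\<And>h x. h \<in> Hm S T \<Longrightarrow> x \<in> S \<Longrightarrow> h x = \<one>" for S T
  proof -
    have "h = (\<lambda>x\<in>S. \<one>)" if h: "h \<in> Hm S T" for h
      by (rule Hm_eqI[OF h Hm_trivial[OF ST(1,2)]]) (simp add: ST(3)[OF h])
    then show ?thesis using Hm_trivial[OF ST(1,2)] by blast
  qed
  consider h where "h \<in> Hm F F'" "\<exists>x\<in>F. h x \<noteq> \<one>" | h where "h \<in> Hm F' F" "\<exists>x\<in>F'. h x \<noteq> \<one>"
    | "\<And>h x. h \<in> Hm F F' \<Longrightarrow> x \<in> F \<Longrightarrow> h x = \<one>" "\<And>h x. h \<in> Hm F' F \<Longrightarrow> x \<in> F' \<Longrightarrow> h x = \<one>" by blast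
  then show ?thesis
  proof cases
    case 1 then show ?thesis using card_Hm_iso[OF g _ Hm_foot_bij[OF F F']] by blast
  next
    case 2 then show ?thesis using card_Hm_iso[OF g(2,1) _ Hm_foot_bij[OF F' F]] by metis
  next
    case 3
    have "Hm F F' = {\<lambda>x\<in>F. \<one>}" by (rule triv[OF g]) (rule 3(1))
    moreover have "Hm F' F = {\<lambda>x\<in>F'. \<one>}" by (rule triv[OF g(2,1)]) (rule 3(2))
    ultimately show ?thesis by simp
  qed
qed

section \<open>Finite partial sums and the whole direct sum\<close>

context
  fixes I :: "'i set" and B :: "'i \<Rightarrow> 'a set"
  assumes feet: "\<And>i. i \<in> I \<Longrightarrow> G_foot G \<A> (B i)" and fin: "\<And>i. i \<in> I \<Longrightarrow> finite (B i)"
    and indep: "\<And>i. i \<in> I \<Longrightarrow> B i \<inter> generate G (\<Union>j\<in>I - {i}. B j) = {\<one>}"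
    and gen: "carrier G = generate G (\<Union>i\<in>I. B i)"
begin

abbreviation part :: "'i set \<Rightarrow> 'a set" where "part E \<equiv> MAG_part G B E"

lemma ginv_part: "E \<subseteq> I \<Longrightarrow> ginv (part E)"
  unfolding MAG_part_def by (rule ginv_generate_Union) (use feet footD(1) in blast)

lemma part_mono: "E \<subseteq> E' \<Longrightarrow> part E \<subseteq> part E'"
  unfolding MAG_part_def by (rule mono_generate) blast

lemma foot_subset_part: "i \<in> E \<Longrightarrow> B i \<subseteq> part E"
  unfolding MAG_part_def by (intro subsetI generate.incl) blast

lemma part_Int:
  assumes "E \<subseteq> I" "i \<in> I" "i \<notin> E" shows "part E \<inter> B i = {\<one>}"
proof -
  have "part E \<subseteq> generate G (\<Union>j\<in>I - {i}. B j)"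
    unfolding MAG_part_def by (rule mono_generate) (use assms in blast)
  moreover have "\<one> \<in> part E" "\<one> \<in> B i" using ginvD(4) ginv_part[OF assms(1)] footD(1)[OF feet[OF assms(2)]] by auto
  ultimately show ?thesis using indep[OF assms(2)] by blast
qed

lemma part_insert:
  assumes "E \<subseteq> I" "i \<in> I" "i \<notin> E"
  shows "part (insert i E) = part E <#> B i"
proof
  have gB: "ginv (B i)" using footD(1) feet assms by blast
  note gE = ginv_part[OF assms(1)]
  note int = part_Int[OF assms]
  have "(\<Union>j\<in>insert i E. B j) \<subseteq> part E <#> B i"
    using SB_incl[OF gE gB int] foot_subset_part by blast
  then show "part (insert i E) \<subseteq> part E <#> B i"
    unfolding MAG_part_def[of _ _ "insert i E"]
    by (rule generate_subgroup_incl[OF _ ginvD(1)[OF ginv_set_mult[OF gE gB]]])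
  show "part E <#> B i \<subseteq> part (insert i E)"
    by (rule SB_least[OF gE gB int ginv_part]) (use assms part_mono foot_subset_part in blast)+
qed

text \<open>The statements have to be proved together: adding the foot \<open>B i\<close> compares
  \<open>Hm (part E) (B i)\<close> with \<open>Hm (B i) (part E)\<close>, so equality of these
  counts must be carried for all feet, and it multiplies over the factors. Finiteness is recorded
  for the compactness argument that follows.\<close>

lemma part_properties:
  assumes "finite E" "E \<subseteq> I"
  shows "finite (part E) \<and> (cyclic (part E) \<longleftrightarrow> (\<exists>\<theta>. faithful_on (part E) \<theta>)) \<and>
    (\<forall>i\<in>I. card (Hm (part E) (B i)) = card (Hm (B i) (part E)))"
  using assms
proof (induction E rule: finite_induct)
  case empty
  have P: "part {} = {\<one>}" by (simp add: MAG_part_def generate_empty)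
  have "span \<one> = {\<one>}"
    using span_least[OF ginv_trivial, of \<one>] span_self[of \<one>] by auto
  then have c: "cyclic (part {})" by (simp add: cyclic_def P)
  have f: "faithful_on (part {}) (\<lambda>_. 1)" using ginvD(4) by (auto simp: faithful_on_def P hom_def)
  have h: "Hm {\<one>} T = {\<lambda>x\<in>{\<one>}. \<one>}" "Hm T {\<one>} = {\<lambda>x\<in>T. \<one>}" if T: "ginv T" for T
  proof -
    have "h = (\<lambda>x\<in>{\<one>}. \<one>)" if "h \<in> Hm {\<one>} T" for h
      by (rule Hm_eqI[OF that Hm_trivial[OF ginv_trivial T]]) (use Hm_one[OF that ginv_trivial T] in auto)
    then show "Hm {\<one>} T = {\<lambda>x\<in>{\<one>}. \<one>}" using Hm_trivial[OF ginv_trivial T] by blast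
    have "h = (\<lambda>x\<in>T. \<one>)" if "h \<in> Hm T {\<one>}" for h
      by (rule Hm_eqI[OF that Hm_trivial[OF T ginv_trivial]]) (use HmD(2)[OF that] in auto)
    then show "Hm T {\<one>} = {\<lambda>x\<in>T. \<one>}" using Hm_trivial[OF T ginv_trivial] by blast
  qed
  have "card (Hm {\<one>} (B i)) = card (Hm (B i) {\<one>})" if "i \<in> I" for i
    using h[OF footD(1)[OF feet[OF that]]] by simp
  then show ?case using c f P by auto
next
  case (insert i E)
  then have E: "E \<subseteq> I" "i \<in> I" "i \<notin> E" by auto
  note gE = ginv_part[OF E(1)] and gB = footD(1)[OF feet[OF E(2)]] and int = part_Int[OF E]
  have IH: "finite (part E)" "cyclic (part E) \<longleftrightarrow> (\<exists>\<theta>. faithful_on (part E) \<theta>)"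
    "\<And>j. j \<in> I \<Longrightarrow> card (Hm (part E) (B j)) = card (Hm (B j) (part E))"
    using insert.IH[OF E(1)] by auto
  have "finite (part (insert i E))"
    unfolding part_insert[OF E] set_mult_def using IH(1) fin[OF E(2)] by simp
  moreover have "cyclic (part (insert i E)) \<longleftrightarrow> (\<exists>\<theta>. faithful_on (part (insert i E)) \<theta>)"
    unfolding part_insert[OF E] cyclic_product_iff[OF gE gB int feet[OF E(2)] fin[OF E(2)]]
      faithful_exists_product_iff[OF gE gB int feet[OF E(2)] fin[OF E(2)]] IH(2) IH(3)[OF E(2)] ..
  moreover have "card (Hm (part (insert i E)) (B j)) = card (Hm (B j) (part (insert i E)))" if j: "j \<in> I" for j
    unfolding part_insert[OF E] card_Hm_from_product[OF gE gB int footD(1)[OF feet[OF j]]]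
      card_Hm_into_product[OF gE gB int footD(1)[OF feet[OF j]]]
    using IH(3)[OF j] card_Hm_feet[OF feet[OF E(2)] feet[OF j]] by simp
  ultimately show ?case by blast
qed

lemma exists_finite_part:
  assumes "x \<in> carrier G" obtains E where "finite E" "E \<subseteq> I" "x \<in> part E"
proof -
  have "\<exists>E. finite E \<and> E \<subseteq> I \<and> x \<in> part E" if "x \<in> generate G (\<Union>i\<in>I. B i)"
    using that
  proof (induction rule: generate.induct)
    case one
    then show ?case using ginvD(4)[OF ginv_part[of "{}"]] by blast
  next
    case (incl h)
    then obtain i where "i \<in> I" "h \<in> B i" by blast
    then show ?case using foot_subset_part[of i "{i}"] by (intro exI[of _ "{i}"]) auto
  next
    case (inv h)
    then obtain i where i: "i \<in> I" "h \<in> B i" by blast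
    then have "inv h \<in> part {i}" using foot_subset_part[of i "{i}"] ginvD(6)[OF ginv_part[of "{i}"]] by blast
    then show ?case using i by (intro exI[of _ "{i}"]) auto
  next
    case (eng h1 h2)
    then obtain E1 E2 where E: "finite E1" "E1 \<subseteq> I" "h1 \<in> part E1" "finite E2" "E2 \<subseteq> I" "h2 \<in> part E2" by blast
    then have "h1 \<in> part (E1 \<union> E2)" "h2 \<in> part (E1 \<union> E2)"
      using part_mono[of E1 "E1 \<union> E2"] part_mono[of E2 "E1 \<union> E2"] by auto
    then have "h1 \<otimes> h2 \<in> part (E1 \<union> E2)" using ginvD(5)[OF ginv_part[of "E1 \<union> E2"]] E by blast
    then show ?case using E by (intro exI[of _ "E1 \<union> E2"]) auto
  qed
  then show ?thesis using assms gen that by blast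
qed

text \<open>A finite partial sum has finitely many characters, so faithfulness on it is a closed
  condition and compactness yields a function satisfying all of these conditions. It is faithful on
  the whole sum, because a nontrivial invariant subgroup meets some finite partial sum
  nontrivially.\<close>

theorem cyclic_parts_iff_faithful:
  "(\<forall>E. finite E \<and> E \<subseteq> I \<longrightarrow> cyclic (part E)) \<longleftrightarrow> (\<exists>\<theta>. faithful_on (carrier G) \<theta>)"
proof
  assume "\<exists>\<theta>. faithful_on (carrier G) \<theta>"
  then obtain \<theta> where \<theta>: "faithful_on (carrier G) \<theta>" by blast
  show "\<forall>E. finite E \<and> E \<subseteq> I \<longrightarrow> cyclic (part E)"
  proof (intro allI impI, elim conjE)
    fix E assume E: "finite E" "E \<subseteq> I"
    have sub: "part E \<subseteq> carrier G" by (rule ginv_carrier_subset[OF ginv_part[OF E(2)]])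
    have "\<theta> \<in> hom (G\<lparr>carrier := part E\<rparr>) circle_group"
      using \<theta> sub by (auto simp: faithful_on_def hom_def Pi_def subset_iff)
    then have "faithful_on (part E) \<theta>" using \<theta> sub unfolding faithful_on_def by blast
    then show "cyclic (part E)" using part_properties[OF E] by blast
  qed
next
  assume cyc: "\<forall>E. finite E \<and> E \<subseteq> I \<longrightarrow> cyclic (part E)"
  define D where "D = (\<lambda>E. {\<psi> \<in> dual (part E). faithful_on (part E) \<psi>})"
  define cut where "cut = (\<lambda>E (f :: 'a \<Rightarrow> complex) x. if x \<in> part E then f x else 0)"
  define Z where "Z = (\<lambda>E. {f. cut E f \<in> D E})"
  define K where "K = {f :: 'a \<Rightarrow> complex. \<forall>x. cmod (f x) \<le> 1}"
  define \<E> where "\<E> = {E. finite E \<and> E \<subseteq> I}"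
  have cZ: "closed (Z E)" if E: "E \<in> \<E>" for E
  proof -
    have "finite (D E)" using finite_dual[OF ginvD(1)[OF ginv_part]] part_properties[of E] E
      by (auto simp: D_def \<E>_def)
    then have "closed (\<Union>\<psi>\<in>D E. \<Inter>x\<in>part E. {f :: 'a \<Rightarrow> complex. f x = \<psi> x})"
      by (intro closed_UN closed_INT ballI closed_eval_eq)
    moreover have "Z E = (\<Union>\<psi>\<in>D E. \<Inter>x\<in>part E. {f. f x = \<psi> x})"
    proof (intro equalityI subsetI)
      fix f assume "f \<in> Z E"
      then have "cut E f \<in> D E" by (simp add: Z_def)
      moreover have "f \<in> (\<Inter>x\<in>part E. {g. g x = cut E f x})" by (auto simp: cut_def)
      ultimately show "f \<in> (\<Union>\<psi>\<in>D E. \<Inter>x\<in>part E. {f. f x = \<psi> x})" by blast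
    next
      fix f assume "f \<in> (\<Union>\<psi>\<in>D E. \<Inter>x\<in>part E. {f. f x = \<psi> x})"
      then obtain \<psi> where \<psi>: "\<psi> \<in> D E" "\<And>x. x \<in> part E \<Longrightarrow> f x = \<psi> x" by blast
      then have "cut E f = \<psi>" by (auto simp: cut_def D_def dual_def fun_eq_iff)
      then show "f \<in> Z E" using \<psi>(1) by (simp add: Z_def)
    qed
    ultimately show ?thesis by simp
  qed
  have comp: "compact K" unfolding K_def by (rule compact_unit_bounded_functions)
  have "K \<inter> (\<Inter>E\<in>\<E>. Z E) \<noteq> {}"
  proof (rule compact_imp_fip_image[OF comp cZ])
    fix \<J> assume J: "finite \<J>" "\<J> \<subseteq> \<E>"
    \<comment> \<open>A faithful character for the finite union \<open>U\<close> restricts to a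
      faithful one for every member of the family.\<close>
    define U where "U = \<Union>\<J>"
    have U: "finite U" "U \<subseteq> I" using J by (auto simp: U_def \<E>_def)
    obtain \<theta> where \<theta>: "faithful_on (part U) \<theta>" using cyc part_properties[OF U] U by blast
    have h\<theta>: "\<theta> \<in> hom (G\<lparr>carrier := part U\<rparr>) circle_group" using \<theta> by (simp add: faithful_on_def)
    have "cut U \<theta> \<in> K" using character_norm[OF h\<theta>] by (simp add: K_def cut_def)
    moreover have "cut U \<theta> \<in> Z E" if E: "E \<in> \<J>" for E
    proof -
      have EI: "E \<subseteq> I" "E \<subseteq> U" using E J by (auto simp: \<E>_def U_def)
      have sub: "part E \<subseteq> part U" by (rule part_mono[OF EI(2)])
      have e: "cut E (cut U \<theta>) = cut E \<theta>" using sub by (auto simp: cut_def fun_eq_iff)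
      have h: "\<theta> \<in> hom (G\<lparr>carrier := part E\<rparr>) circle_group"
        using h\<theta> sub by (auto simp: hom_def Pi_def subset_iff)
      have d: "cut E \<theta> \<in> dual (part E)"
        unfolding cut_def by (rule dual_restrict[OF ginvD(1)[OF ginv_part[OF EI(1)]] h])
      have "\<exists>x\<in>M. cut E \<theta> x \<noteq> 1" if M: "ginv M" "M \<subseteq> part E" "M \<noteq> {\<one>}" for M
      proof -
        obtain x where "x \<in> M" "\<theta> x \<noteq> 1" using \<theta> M sub unfolding faithful_on_def by blast
        then show ?thesis using M(2) by (auto simp: cut_def)
      qed
      then have "faithful_on (part E) (cut E \<theta>)" using d by (simp add: faithful_on_def dual_def)
      then show ?thesis using d e by (simp add: Z_def D_def)
    qed
    ultimately show "K \<inter> (\<Inter>E\<in>\<J>. Z E) \<noteq> {}" by blast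
  qed
  then obtain f where f: "\<And>E. E \<in> \<E> \<Longrightarrow> f \<in> Z E" by blast
  have fE: "faithful_on (part E) (cut E f)" if "finite E" "E \<subseteq> I" for E
    using f[of E] that by (simp add: \<E>_def Z_def D_def)
  have "f \<in> hom (G\<lparr>carrier := carrier G\<rparr>) circle_group"
  proof (rule homI)
    fix x assume x: "x \<in> carrier (G\<lparr>carrier := carrier G\<rparr>)"
    then obtain E where E: "finite E" "E \<subseteq> I" "x \<in> part E" using exists_finite_part[of x] by auto
    then have "cmod (cut E f x) = 1" using character_norm fE[OF E(1,2)] unfolding faithful_on_def by blast
    then show "f x \<in> carrier circle_group" using E by (simp add: cut_def)
    fix y assume y: "y \<in> carrier (G\<lparr>carrier := carrier G\<rparr>)"
    then obtain E' where E': "finite E'" "E' \<subseteq> I" "y \<in> part E'" using exists_finite_part[of y] by auto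
    have u: "finite (E \<union> E')" "E \<union> E' \<subseteq> I" "x \<in> part (E \<union> E')" "y \<in> part (E \<union> E')"
      using E E' part_mono[of E "E \<union> E'"] part_mono[of E' "E \<union> E'"] by auto
    have "cut (E \<union> E') f (x \<otimes> y) = cut (E \<union> E') f x * cut (E \<union> E') f y"
      using character_mult[OF _ u(3,4)] fE[OF u(1,2)] unfolding faithful_on_def by blast
    then show "f (x \<otimes>\<^bsub>G\<lparr>carrier := carrier G\<rparr>\<^esub> y) = f x \<otimes>\<^bsub>circle_group\<^esub> f y"
      using u(3,4) ginvD(5)[OF ginv_part[OF u(2)] u(3,4)] by (simp add: cut_def)
  qed
  moreover have "\<exists>x\<in>M. f x \<noteq> 1" if M: "ginv M" "M \<noteq> {\<one>}" for M
  proof -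
    obtain x where x: "x \<in> M" "x \<noteq> \<one>" using M ginvD(4) by blast
    then have "x \<in> carrier G" using ginvD(3)[OF M(1)] by blast
    then obtain E where E: "finite E" "E \<subseteq> I" "x \<in> part E" by (rule exists_finite_part)
    have "ginv (M \<inter> part E)" by (rule ginv_Int[OF M(1) ginv_part[OF E(2)]])
    moreover have "M \<inter> part E \<noteq> {\<one>}" using x E by blast
    ultimately obtain y where "y \<in> M \<inter> part E" "cut E f y \<noteq> 1"
      using fE[OF E(1,2)] unfolding faithful_on_def by blast
    then show ?thesis by (auto simp: cut_def)
  qed
  ultimately show "\<exists>\<theta>. faithful_on (carrier G) \<theta>" unfolding faithful_on_def by blast
qed

end

end

subsection \<open>Passage to invariant subgroups\<close>

context G_group
begin

lemma foot_in_subgroup: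
  assumes N: "ginv N" and M: "M \<subseteq> N"
  shows "G_foot (G\<lparr>carrier := N\<rparr>) \<A> M \<longleftrightarrow> G_foot G \<A> M"
proof -
  have "G_invariant_subgroup (G\<lparr>carrier := N\<rparr>) \<A> L \<longleftrightarrow> ginv L" if "L \<subseteq> M" for L
    using ginv_in_subgroup[OF N] that M by blast
  then show ?thesis unfolding G_foot_def by auto
qed

text \<open>Minimality of a foot only looks inside the foot, and the feet that generate
  \<open>MAG\<close> all lie in \<open>N\<close>.\<close>

lemma MAG_of_subgroup:
  assumes N: "ginv N" and le: "MAG G \<A> \<subseteq> N"
  shows "MAG (G\<lparr>carrier := N\<rparr>) \<A> = MAG G \<A>"
proof -
  interpret N: G_group "G\<lparr>carrier := N\<rparr>" \<A> by (rule G_group_subgroup[OF N])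
  have "abelian_finite_G_foot (G\<lparr>carrier := N\<rparr>) \<A> M \<longleftrightarrow> abelian_finite_G_foot G \<A> M" for M
  proof (cases "M \<subseteq> N")
    case True
    then show ?thesis using foot_in_subgroup[OF N True] by (simp add: abelian_finite_G_foot_def)
  next
    case False
    then have "\<not> abelian_finite_G_foot G \<A> M" using foot_subset_MAG le by blast
    moreover have "\<not> abelian_finite_G_foot (G\<lparr>carrier := N\<rparr>) \<A> M"
      using False N.footD(1) N.ginv_carrier_subset by (auto simp: abelian_finite_G_foot_def)
    ultimately show ?thesis by blast
  qed
  then have eq: "{M. abelian_finite_G_foot (G\<lparr>carrier := N\<rparr>) \<A> M} = {M. abelian_finite_G_foot G \<A> M}" by blast
  have "\<Union>{M. abelian_finite_G_foot G \<A> M} \<subseteq> N" using foot_subset_MAG le by blast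
  from generate_consistent[OF this ginvD(1)[OF N]] show ?thesis unfolding MAG_def eq by simp
qed

lemma ginv_MSG: "ginv (MSG G \<A>)"
  unfolding MSG_def by (rule ginv_generate_Union) (auto simp: footD)

lemma MAG_subset_MSG: "MAG G \<A> \<subseteq> MSG G \<A>"
  unfolding MAG_def MSG_def by (rule mono_generate) (auto simp: abelian_finite_G_foot_def)

lemma irrep_subgroup_iff:
  assumes u: "inj (u :: real \<Rightarrow> 'h)" and N: "ginv N" "MAG G \<A> \<subseteq> N"
  shows "has_G_faithful_irrep TYPE('h) \<A> (G\<lparr>carrier := N\<rparr>) \<longleftrightarrow>
    has_G_faithful_character \<A> (G\<lparr>carrier := MAG G \<A>\<rparr>)"
proof -
  interpret N: G_group "G\<lparr>carrier := N\<rparr>" \<A> by (rule G_group_subgroup[OF N(1)])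
  show ?thesis using N.irrep_iff_character[OF u] by (simp add: MAG_of_subgroup[OF N])
qed

lemma character_subgroup_iff:
  assumes N: "ginv N" "MAG G \<A> \<subseteq> N" and comm: "comm_group (G\<lparr>carrier := N\<rparr>)"
  shows "has_G_faithful_character \<A> (G\<lparr>carrier := N\<rparr>) \<longleftrightarrow>
    has_G_faithful_character \<A> (G\<lparr>carrier := MAG G \<A>\<rparr>)"
proof -
  interpret N: G_group "G\<lparr>carrier := N\<rparr>" \<A> by (rule G_group_subgroup[OF N(1)])
  show ?thesis using N.abelian_character_iff[OF comm] by (simp add: MAG_of_subgroup[OF N])
qed

theorem character_iff_cyclic:
  assumes dec: "MAG_decomposition G \<A> I B"
  shows "has_G_faithful_character \<A> (G\<lparr>carrier := MAG G \<A>\<rparr>) \<longleftrightarrow>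
    (\<forall>E. finite E \<and> E \<subseteq> I \<longrightarrow>
      (\<exists>x\<in>MAG_part G B E. generate G ((\<lambda>g. g x) ` \<A>) = MAG_part G B E))"
proof -
  let ?A = "MAG G \<A>" and ?N = "G\<lparr>carrier := MAG G \<A>\<rparr>"
  interpret N: G_group ?N \<A> by (rule G_group_subgroup[OF ginv_MAG])
  interpret NC: comm_group ?N by (rule comm_group_MAG)
  interpret N: comm_G_group ?N \<A> ..
  have B: "abelian_finite_G_foot G \<A> (B i)" if "i \<in> I" for i
    using dec that by (simp add: MAG_decomposition_def)
  have sub: "B i \<subseteq> ?A" if "i \<in> I" for i by (rule foot_subset_MAG[OF B[OF that]])
  have cons: "generate ?N Y = generate G Y" if "Y \<subseteq> ?A" for Y
    using generate_consistent[OF that ginvD(1)[OF ginv_MAG]] by simp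
  have feet: "G_foot ?N \<A> (B i)" "finite (B i)" if "i \<in> I" for i
    using B[OF that] foot_in_subgroup[OF ginv_MAG sub[OF that]] by (auto simp: abelian_finite_G_foot_def)
  have indep: "B i \<inter> generate ?N (\<Union>j\<in>I - {i}. B j) = {\<one>\<^bsub>?N\<^esub>}" if "i \<in> I" for i
  proof -
    have "(\<Union>j\<in>I - {i}. B j) \<subseteq> ?A" using sub by blast
    from cons[OF this] show ?thesis using dec that
      unfolding MAG_decomposition_def internal_direct_sum_def by auto
  qed
  have gen: "carrier ?N = generate ?N (\<Union>i\<in>I. B i)"
  proof -
    have "(\<Union>i\<in>I. B i) \<subseteq> ?A" using sub by blast
    from cons[OF this] show ?thesis using dec
      unfolding MAG_decomposition_def internal_direct_sum_def by auto
  qed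
  have "has_G_faithful_character \<A> ?N \<longleftrightarrow> (\<exists>\<theta>. N.faithful_on (carrier ?N) \<theta>)"
  proof -
    have "\<theta> \<in> hom ?N circle_group \<and> G_faithful \<A> ?N circle_group \<theta> \<longleftrightarrow> N.faithful_on (carrier ?N) \<theta>" for \<theta>
    proof (cases "\<theta> \<in> hom ?N circle_group")
      case True
      have "group_hom ?N circle_group \<theta>"
        by (rule group_hom.intro[OF N.is_group group_circle_group group_hom_axioms.intro[OF True]])
      then have "G_faithful \<A> ?N circle_group \<theta> \<longleftrightarrow> (\<forall>M. N.ginv M \<and> M \<noteq> {\<one>\<^bsub>?N\<^esub>} \<longrightarrow> (\<exists>x\<in>M. \<theta> x \<noteq> 1))"
        by (simp add: N.G_faithful_iff)
      moreover have "?N\<lparr>carrier := carrier ?N\<rparr> = ?N" by simp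
      ultimately show ?thesis using True N.ginv_carrier_subset unfolding N.faithful_on_def by metis
    qed (simp add: N.faithful_on_def)
    then show ?thesis unfolding has_G_faithful_character_def unitary_character_def by blast
  qed
  also have "\<dots> \<longleftrightarrow> (\<forall>E. finite E \<and> E \<subseteq> I \<longrightarrow> N.cyclic (MAG_part ?N B E))"
    using N.cyclic_parts_iff_faithful[OF feet indep gen] by simp
  also have "\<dots> \<longleftrightarrow> (\<forall>E. finite E \<and> E \<subseteq> I \<longrightarrow>
      (\<exists>x\<in>MAG_part G B E. generate G ((\<lambda>g. g x) ` \<A>) = MAG_part G B E))"
  proof (intro all_cong1 imp_cong refl)
    fix E assume "finite E \<and> E \<subseteq> I"
    then have "(\<Union>i\<in>E. B i) \<subseteq> ?A" using sub by blast
    then have p: "MAG_part ?N B E = MAG_part G B E" "MAG_part G B E \<subseteq> ?A"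
      using cons generate_subgroup_incl[OF _ ginvD(1)[OF ginv_MAG]] by (auto simp: MAG_part_def)
    have "N.span x = generate G ((\<lambda>g. g x) ` \<A>)" if "x \<in> MAG_part G B E" for x
    proof -
      have "(\<lambda>g. g x) ` \<A> \<subseteq> ?A" using that p(2) ginvD(2)[OF ginv_MAG] by blast
      then show ?thesis by (simp add: N.span_def cons)
    qed
    then show "N.cyclic (MAG_part ?N B E) \<longleftrightarrow>
        (\<exists>x\<in>MAG_part G B E. generate G ((\<lambda>g. g x) ` \<A>) = MAG_part G B E)"
      by (simp add: N.cyclic_def p(1))
  qed
  finally show ?thesis .
qed

text \<open>Serves the chain condition in Zorn's lemma: finitely many feet of the union of a chain
  already lie in one member.\<close>

lemma generate_finite_support:
  assumes "x \<in> generate G (\<Union>F)"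
  shows "\<exists>F'. finite F' \<and> F' \<subseteq> F \<and> x \<in> generate G (\<Union>F')"
  using assms
proof (induction rule: generate.induct)
  case one
  then show ?case using generate.one by (intro exI[of _ "{}"]) auto
next
  case (incl h)
  then obtain M where "M \<in> F" "h \<in> M" by blast
  then show ?case using generate.incl[of h M G] by (intro exI[of _ "{M}"]) auto
next
  case (inv h)
  then obtain M where "M \<in> F" "h \<in> M" by blast
  then show ?case using generate.inv[of h M G] by (intro exI[of _ "{M}"]) auto
next
  case (eng h1 h2)
  then obtain F1 F2 where F: "finite F1" "F1 \<subseteq> F" "h1 \<in> generate G (\<Union>F1)"
    "finite F2" "F2 \<subseteq> F" "h2 \<in> generate G (\<Union>F2)" by blast
  have "h1 \<in> generate G (\<Union>(F1 \<union> F2))" "h2 \<in> generate G (\<Union>(F1 \<union> F2))"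
    using F(3,6) mono_generate[of "\<Union>F1" "\<Union>(F1 \<union> F2)"] mono_generate[of "\<Union>F2" "\<Union>(F1 \<union> F2)"] by auto
  then have "h1 \<otimes> h2 \<in> generate G (\<Union>(F1 \<union> F2))" by (rule generate.eng)
  then show ?case using F by (intro exI[of _ "F1 \<union> F2"]) auto
qed

text \<open>Zorn's lemma for independent families of feet. A foot not contained in the sum of a
  maximal family would meet this sum trivially and could be added.\<close>

lemma MAG_decomposition_exists: "\<exists>\<B> :: 'a set set. MAG_decomposition G \<A> \<B> (\<lambda>B. B)"
proof -
  define Ind where "Ind = {\<B>. (\<forall>B\<in>\<B>. abelian_finite_G_foot G \<A> B) \<and>
    (\<forall>B\<in>\<B>. B \<inter> generate G (\<Union>(\<B> - {B})) = {\<one>})}"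
  have one: "\<one> \<in> B" if "abelian_finite_G_foot G \<A> B" for B
    using that footD(1) ginvD(4) by (auto simp: abelian_finite_G_foot_def)
  have "\<exists>\<B>\<in>Ind. \<forall>Y\<in>Ind. \<B> \<subseteq> Y \<longrightarrow> Y = \<B>"
  proof (rule subset_Zorn')
    fix C assume C: "subset.chain Ind C"
    have CI: "C \<subseteq> Ind" using C by (simp add: subset_chain_def)
    show "\<Union>C \<in> Ind" unfolding Ind_def
    proof (intro CollectI conjI ballI)
      fix B assume "B \<in> \<Union>C"
      then obtain Y0 where Y0: "Y0 \<in> C" "B \<in> Y0" by blast
      then show f: "abelian_finite_G_foot G \<A> B" using CI by (auto simp: Ind_def)
      have "x = \<one>" if x: "x \<in> B" "x \<in> generate G (\<Union>(\<Union>C - {B}))" for x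
      proof -
        obtain F' where F': "finite F'" "F' \<subseteq> \<Union>C - {B}" "x \<in> generate G (\<Union>F')"
          using generate_finite_support[OF x(2)] by blast
        have "finite (insert B F')" "insert B F' \<subseteq> \<Union>C" using F' \<open>B \<in> \<Union>C\<close> by auto
        then obtain Y where Y: "Y \<in> C" "insert B F' \<subseteq> Y"
          using finite_subset_Union_chain[OF _ _ _ C] Y0 by blast
        have "x \<in> generate G (\<Union>(Y - {B}))" using F'(2,3) Y(2) mono_generate[of "\<Union>F'" "\<Union>(Y - {B})"] by blast
        moreover have "Y \<in> Ind" using Y CI by blast
        ultimately show ?thesis using x(1) Y(2) by (auto simp: Ind_def)
      qed
      then show "B \<inter> generate G (\<Union>(\<Union>C - {B})) = {\<one>}" using one[OF f] generate.one by blast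
    qed
  qed
  then obtain \<B> where \<B>: "\<B> \<in> Ind" "\<And>Y. Y \<in> Ind \<Longrightarrow> \<B> \<subseteq> Y \<Longrightarrow> Y = \<B>" by blast
  have feet: "\<And>B. B \<in> \<B> \<Longrightarrow> abelian_finite_G_foot G \<A> B" using \<B>(1) by (simp add: Ind_def)
  have ind: "\<And>B. B \<in> \<B> \<Longrightarrow> B \<inter> generate G (\<Union>(\<B> - {B})) = {\<one>}" using \<B>(1) by (simp add: Ind_def)
  define S where "S = generate G (\<Union>\<B>)"
  have ginvF: "ginv B" if "abelian_finite_G_foot G \<A> B" for B
    using that footD(1) by (simp add: abelian_finite_G_foot_def)
  have gS: "ginv S" unfolding S_def by (rule ginv_generate_Union) (use feet ginvF in blast)
  have "F \<subseteq> S" if F: "abelian_finite_G_foot G \<A> F" for F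
  proof (rule ccontr)
    assume "\<not> F \<subseteq> S"
    then have FS: "F \<inter> S = {\<one>}" using foot_Int[OF _ gS] F by (auto simp: abelian_finite_G_foot_def)
    have FB: "F \<notin> \<B>" using \<open>\<not> F \<subseteq> S\<close> generate.incl[of _ "\<Union>\<B>" G] unfolding S_def by blast
    have "insert F \<B> \<in> Ind" unfolding Ind_def
    proof (intro CollectI conjI ballI)
      fix B assume B: "B \<in> insert F \<B>"
      then show f: "abelian_finite_G_foot G \<A> B" using F feet by blast
      show "B \<inter> generate G (\<Union>(insert F \<B> - {B})) = {\<one>}"
      proof (cases "B = F")
        case True
        then have "insert F \<B> - {B} = \<B>" using FB by blast
        then show ?thesis using FS True by (simp add: S_def)
      next
        case False
        then have BB: "B \<in> \<B>" using B by blast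
        \<comment> \<open>If an element \<open>x\<close> of \<open>B\<close> is
          \<open>r \<otimes> f\<close> with \<open>r\<close> in \<open>R\<close> and
          \<open>f\<close> in \<open>F\<close>, then \<open>f\<close> lies in \<open>S\<close> and
          is \<open>\<one>\<close>, so \<open>x\<close> lies in the sum of the other
          members.\<close>
        define R where "R = generate G (\<Union>(\<B> - {B}))"
        have gR: "ginv R" unfolding R_def by (rule ginv_generate_Union) (use feet ginvF in blast)
        have RS: "R \<subseteq> S" unfolding R_def S_def by (rule mono_generate) blast
        have "subgroup (R <#> F) G"
          by (rule mult_norm_subgroup[OF ginv_normal[OF gR] ginvD(1)[OF ginvF[OF F]]])
        moreover have "\<Union>(insert F \<B> - {B}) \<subseteq> R <#> F"
        proof
          fix x assume "x \<in> \<Union>(insert F \<B> - {B})"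
          then consider "x \<in> F" | "x \<in> \<Union>(\<B> - {B})" by blast
          then show "x \<in> R <#> F"
          proof cases
            case 1
            then have "x = \<one> \<otimes> x" using ginvD(3)[OF ginvF[OF F]] by simp
            then show ?thesis using 1 ginvD(4)[OF gR] unfolding set_mult_def by blast
          next
            case 2
            then have xR: "x \<in> R" unfolding R_def by (rule generate.incl)
            then have "x = x \<otimes> \<one>" using ginvD(3)[OF gR] by simp
            then show ?thesis using xR one[OF F] unfolding set_mult_def by blast
          qed
        qed
        ultimately have le: "generate G (\<Union>(insert F \<B> - {B})) \<subseteq> R <#> F" by (intro generate_subgroup_incl)
        have "x = \<one>" if x: "x \<in> B" "x \<in> generate G (\<Union>(insert F \<B> - {B}))" for x
        proof -
          obtain r f where rf: "r \<in> R" "f \<in> F" "x = r \<otimes> f" using le x(2) by (auto simp: set_mult_def)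
          have c: "r \<in> carrier G" "f \<in> carrier G" using rf ginvD(3)[OF gR] ginvD(3)[OF ginvF[OF F]] by auto
          have "x \<in> S" using x(1) BB unfolding S_def by (intro generate.incl) blast
          moreover have "inv r \<in> S" using rf(1) RS ginvD(6)[OF gS] by blast
          ultimately have "inv r \<otimes> x \<in> S" using ginvD(5)[OF gS] by blast
          moreover have "inv r \<otimes> x = f" using rf(3) c by (simp add: m_assoc[symmetric])
          ultimately have "f = \<one>" using rf(2) FS by blast
          then have "x \<in> R" using rf c by simp
          then show ?thesis using x(1) ind[OF BB] unfolding R_def by blast
        qed
        then show ?thesis using one[OF f] generate.one by blast
      qed
    qed
    then show False using \<B>(2)[of "insert F \<B>"] FB by blast
  qed
  then have "MAG G \<A> \<subseteq> S" unfolding MAG_def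
    by (intro generate_subgroup_incl ginvD(1)[OF gS]) blast
  moreover have "S \<subseteq> MAG G \<A>" unfolding S_def MAG_def by (rule mono_generate) (use feet in blast)
  ultimately have "MAG G \<A> = S" by blast
  then have "MAG_decomposition G \<A> \<B> (\<lambda>B. B)"
    unfolding MAG_decomposition_def internal_direct_sum_def
  proof (intro conjI ballI impI)
    fix B assume "B \<in> \<B>"
    then show "abelian_finite_G_foot G \<A> B" by (rule feet)
  next
    fix B assume "B \<in> \<B>"
    then show "subgroup B G" by (intro ginvD(1) ginvF feet)
  next
    fix B C x y assume "B \<in> \<B>" "C \<in> \<B>" "B \<noteq> C" "x \<in> B" "y \<in> C"
    then show "x \<otimes> y = y \<otimes> x" by (intro abelian_feet_commute[OF feet feet])
  next
    fix B assume "B \<in> \<B>"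
    then show "B \<inter> generate G (\<Union>C\<in>\<B> - {B}. C) = {\<one>}" using ind by simp
  next
    show "MAG G \<A> = generate G (\<Union>B\<in>\<B>. B)" using \<open>MAG G \<A> = S\<close> by (simp add: S_def)
  qed
  then show ?thesis by blast
qed

end

section \<open>Ordinary feet as feet for the inner automorphisms\<close>

lemma (in group) inner_G_group:
  assumes "countable (carrier G)" shows "G_group G (inner_automorphisms G)"
proof (unfold_locales, goal_cases)
  case 1 then show ?case by (rule assms)
next
  case (2 g)
  then obtain a where a: "a \<in> carrier G" "g = (\<lambda>x\<in>carrier G. a \<otimes> x \<otimes> inv a)" by (auto simp: inner_automorphisms_def)
  then show ?case by (intro homI) (auto simp: m_assoc inv_solve_left)
next
  case (3 g)
  then obtain a where a: "a \<in> carrier G" "g = (\<lambda>x\<in>carrier G. a \<otimes> x \<otimes> inv a)" by (auto simp: inner_automorphisms_def)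
  have "inv a \<otimes> (a \<otimes> x \<otimes> inv a) \<otimes> inv (inv a) = x \<and> a \<otimes> (inv a \<otimes> x \<otimes> inv (inv a)) \<otimes> inv a = x"
    if "x \<in> carrier G" for x
    using that a(1) by (simp add: m_assoc) (simp add: m_assoc[symmetric])
  moreover have "(\<lambda>x\<in>carrier G. inv a \<otimes> x \<otimes> inv (inv a)) \<in> inner_automorphisms G"
    unfolding inner_automorphisms_def using a(1) by (intro imageI inv_closed)
  ultimately show ?case using a
    by (intro bexI[of _ "\<lambda>x\<in>carrier G. inv a \<otimes> x \<otimes> inv (inv a)"]) auto
next
  case (4 g h)
  then obtain a b where a: "a \<in> carrier G" "g = (\<lambda>x\<in>carrier G. a \<otimes> x \<otimes> inv a)"
    and b: "b \<in> carrier G" "h = (\<lambda>x\<in>carrier G. b \<otimes> x \<otimes> inv b)" by (auto simp: inner_automorphisms_def)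
  have "(\<lambda>x\<in>carrier G. (a \<otimes> b) \<otimes> x \<otimes> inv (a \<otimes> b)) \<in> inner_automorphisms G"
    unfolding inner_automorphisms_def using a(1) b(1) by (intro imageI m_closed)
  then show ?case
    by (rule bexI[rotated]) (use a b in \<open>auto simp: inv_mult_group m_assoc\<close>)
next
  case 5
  have "(\<lambda>x\<in>carrier G. \<one> \<otimes> x \<otimes> inv \<one>) \<in> inner_automorphisms G"
    unfolding inner_automorphisms_def by (intro imageI one_closed)
  then show ?case by (rule bexI[rotated]) auto
next
  case (6 a)
  then have "(\<lambda>x\<in>carrier G. a \<otimes> x \<otimes> inv a) \<in> inner_automorphisms G"
    unfolding inner_automorphisms_def by (rule imageI)
  then show ?case by (rule bexI[rotated]) auto
qed

lemma (in group) normal_iff_inner_invariant: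
  assumes "countable (carrier G)"
  shows "M \<lhd> G \<longleftrightarrow> G_invariant_subgroup G (inner_automorphisms G) M"
proof -
  interpret I: G_group G "inner_automorphisms G" by (rule inner_G_group[OF assms])
  show ?thesis
  proof
    assume M: "M \<lhd> G"
    then interpret M: normal M G .
    show "I.ginv M"
      by (rule I.ginvI[OF M.subgroup_axioms])
        (use M.inv_op_closed2 M.mem_carrier in \<open>auto simp: inner_automorphisms_def\<close>)
  qed (rule I.ginv_normal)
qed

text \<open>Normality is invariance under inner automorphisms, so \<open>MA\<close> is an instance
  of \<open>MAG\<close> and inherits the results on it, such as commutativity.\<close>

lemma (in group) feet_inner:
  assumes "countable (carrier G)"
  shows "foot G M \<longleftrightarrow> G_foot G (inner_automorphisms G) M"
    "MA G = MAG G (inner_automorphisms G)"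
proof -
  show f: "foot G M \<longleftrightarrow> G_foot G (inner_automorphisms G) M" for M
    by (simp add: foot_def G_foot_def normal_iff_inner_invariant[OF assms])
  show "MA G = MAG G (inner_automorphisms G)"
    by (simp add: MA_def MAG_def abelian_finite_G_foot_def f)
qed

context G_group
begin

text \<open>Automorphisms preserve normality, and the inverse brings a normal subgroup below the
  image back below \<open>M\<close>. So \<open>\<A>\<close> permutes the ordinary feet, which makes
  \<open>MS\<close> and \<open>MA\<close> invariant.\<close>

lemma image_foot:
  assumes g: "g \<in> \<A>" and M: "foot G M" shows "foot G (g ` M)"
proof -
  obtain g' where g': "g' \<in> \<A>" "\<And>x. x \<in> carrier G \<Longrightarrow> g' (g x) = x" "\<And>x. x \<in> carrier G \<Longrightarrow> g (g' x) = x"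
    using act_inv[OF g] by blast
  have nor: "k ` N \<lhd> G" if k: "k \<in> \<A>" and N: "N \<lhd> G" for k N
  proof -
    interpret N: normal N G by fact
    obtain k' where k': "k' \<in> \<A>" "\<And>x. x \<in> carrier G \<Longrightarrow> k (k' x) = x" using act_inv[OF k] by blast
    show ?thesis unfolding normal_inv_iff
    proof (intro conjI ballI)
      show "subgroup (k ` N) G" by (rule group_hom.subgroup_img_is_subgroup[OF act_group_hom[OF k] N.subgroup_axioms])
      fix a y assume a: "a \<in> carrier G" and "y \<in> k ` N"
      then obtain n where n: "n \<in> N" "y = k n" by blast
      have c: "k' a \<in> carrier G" "n \<in> carrier G" using a n act_closed[OF k'(1)] by auto
      have "k (k' a \<otimes> n \<otimes> inv (k' a)) = a \<otimes> y \<otimes> inv a"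
        using c n a k'(2) by (simp add: act_mult[OF k] act_inverse[OF k])
      moreover have "k' a \<otimes> n \<otimes> inv (k' a) \<in> N" using N.inv_op_closed2 c n by blast
      ultimately show "a \<otimes> y \<otimes> inv a \<in> k ` N" by (metis image_eqI)
    qed
  qed
  have Mn: "M \<lhd> G" "M \<noteq> {\<one>}" "\<And>N. N \<lhd> G \<Longrightarrow> N \<subseteq> M \<Longrightarrow> N = M \<or> N = {\<one>}" using M by (auto simp: foot_def)
  have Mc: "M \<subseteq> carrier G" using subgroup.subset[OF normal_imp_subgroup[OF Mn(1)]] .
  have gg: "g' ` g ` M = M" using g'(2) Mc by (auto simp: image_image subset_iff)
  show ?thesis unfolding foot_def
  proof (intro conjI allI impI nor[OF g Mn(1)])
    show "g ` M \<noteq> {\<one>}"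
    proof
      assume "g ` M = {\<one>}"
      then have "M = {\<one>}" using gg act_unit[OF g'(1)] by auto
      then show False using Mn by blast
    qed
    fix N assume N: "N \<lhd> G \<and> N \<subseteq> g ` M"
    then have "N \<lhd> G" by blast
    then have Nc: "N \<subseteq> carrier G" by (rule subgroup.subset[OF normal_imp_subgroup])
    have gN: "g ` g' ` N = N" using g'(3) Nc by (auto simp: image_image subset_iff)
    have "g' ` N \<subseteq> M" using N gg by blast
    then have "g' ` N = M \<or> g' ` N = {\<one>}" using Mn(3) nor[OF g'(1)] N by blast
    then show "N = g ` M \<or> N = {\<one>}" using gN act_unit[OF g] by auto
  qed
qed

lemma foot_carrier: "foot G M \<Longrightarrow> M \<subseteq> carrier G"
  unfolding foot_def by (elim conjE) (rule subgroup.subset[OF normal_imp_subgroup])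

lemma image_comm_group:
  assumes g: "g \<in> \<A>" and M: "foot G M" "comm_group (G\<lparr>carrier := M\<rparr>)"
  shows "comm_group (G\<lparr>carrier := g ` M\<rparr>)"
proof -
  have s: "subgroup M G" "subgroup (g ` M) G"
    using M(1) image_foot[OF g M(1)] normal_imp_subgroup by (auto simp: foot_def)
  have "g x \<otimes> g y = g y \<otimes> g x" if "x \<in> M" "y \<in> M" for x y
  proof -
    have "g (x \<otimes> y) = g (y \<otimes> x)" using M(2) that unfolding comm_group_iff_commute[OF s(1)] by simp
    then show ?thesis using act_mult[OF g] that foot_carrier[OF M(1)] by (simp add: subset_iff)
  qed
  then show ?thesis unfolding comm_group_iff_commute[OF s(2)] by blast
qed

lemma ginv_MS: "ginv (MS G)"
  unfolding MS_def
  by (rule ginv_generate) (use foot_carrier image_foot in blast)+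

lemma ginv_MA: "ginv (MA G)"
  unfolding MA_def
proof (rule ginv_generate)
  fix g x assume g: "g \<in> \<A>" and "x \<in> \<Union>{M. foot G M \<and> finite M \<and> comm_group (G\<lparr>carrier := M\<rparr>)}"
  then obtain M where M: "foot G M" "finite M" "comm_group (G\<lparr>carrier := M\<rparr>)" "x \<in> M" by blast
  have "foot G (g ` M)" "finite (g ` M)" "comm_group (G\<lparr>carrier := g ` M\<rparr>)"
    using image_foot[OF g M(1)] image_comm_group[OF g M(1,3)] M(2) by auto
  then show "g x \<in> \<Union>{M. foot G M \<and> finite M \<and> comm_group (G\<lparr>carrier := M\<rparr>)}" using M(4) by blast
qed (use foot_carrier in blast)

lemma MA_subset_MS: "MA G \<subseteq> MS G"
  unfolding MA_def MS_def by (rule mono_generate) blast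

lemma comm_group_MA: "comm_group (G\<lparr>carrier := MA G\<rparr>)"
  using G_group.comm_group_MAG[OF inner_G_group[OF countable_carrier]] feet_inner(2)[OF countable_carrier] by simp

text \<open>A finite abelian foot \<open>F\<close> for \<open>\<A>\<close> contains an ordinary foot
  \<open>M\<close>. By minimality \<open>F\<close> is the hull of any nontrivial element of
  \<open>M\<close>, and the invariant subgroup \<open>MA\<close> contains this hull with
  \<open>M\<close>.\<close>

lemma MAG_subset_MA: "MAG G \<A> \<subseteq> MA G"
proof -
  interpret I: G_group G "inner_automorphisms G" by (rule inner_G_group[OF countable_carrier])
  have "F \<subseteq> MA G" if F: "abelian_finite_G_foot G \<A> F" for F
  proof -
    have f: "G_foot G \<A> F" "finite F" "comm_group (G\<lparr>carrier := F\<rparr>)"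
      using F by (auto simp: abelian_finite_G_foot_def)
    have gF: "ginv F" by (rule footD(1)[OF f(1)])
    have "I.ginv F" using normal_iff_inner_invariant[OF countable_carrier] ginv_normal[OF gF] by blast
    then obtain M where "G_foot G (inner_automorphisms G) M" and M': "finite M" "M \<subseteq> F"
      using I.finite_ginv_contains_foot[OF f(2) _ footD(2)[OF f(1)]] by blast
    then have M: "foot G M" using feet_inner(1)[OF countable_carrier] by blast
    have sM: "subgroup M G" using M normal_imp_subgroup by (auto simp: foot_def)
    have cM: "comm_group (G\<lparr>carrier := M\<rparr>)"
      using f(3) M'(2) unfolding comm_group_iff_commute[OF sM] comm_group_iff_commute[OF ginvD(1)[OF gF]] by blast
    obtain x where x: "x \<in> M" "x \<noteq> \<one>"
      using M subgroup.one_closed[OF sM] unfolding foot_def by blast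
    have xF: "x \<in> F" "x \<in> carrier G" using x M' ginvD(3)[OF gF] by auto
    have "span x \<noteq> {\<one>}" using span_self[OF xF(2)] x(2) by blast
    then have "span x = F" using footD(3)[OF f(1) ginv_span[OF xF(2)] span_least[OF gF xF(1)]] by blast
    moreover have "M \<subseteq> MA G"
      unfolding MA_def by (intro subsetI generate.incl) (use M M'(1) cM in blast)
    ultimately show ?thesis using span_least[OF ginv_MA] x(1) by blast
  qed
  then show ?thesis unfolding MAG_def by (intro generate_subgroup_incl ginvD(1)[OF ginv_MA]) blast
qed

end

lemma G_group_of_automorphisms:
  assumes "group \<Gamma>" "countable (carrier \<Gamma>)" "subgroup G (AutoGroup \<Gamma>)" "inner_automorphisms \<Gamma> \<subseteq> G"
  shows "G_group \<Gamma> G"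
proof -
  interpret group \<Gamma> by fact
  interpret I: G_group \<Gamma> "inner_automorphisms \<Gamma>" by (rule inner_G_group[OF assms(2)])
  have GA: "G \<subseteq> auto \<Gamma>" using subgroup.subset[OF assms(3)] by (simp add: AutoGroup_def)
  have bij: "g \<in> Bij (carrier \<Gamma>)" "g \<in> hom \<Gamma> \<Gamma>" if "g \<in> G" for g using GA that by (auto simp: auto_def)
  interpret AG: group "AutoGroup \<Gamma>" by (rule AutoGroup)
  have Bmul: "g \<otimes>\<^bsub>AutoGroup \<Gamma>\<^esub> h = compose (carrier \<Gamma>) g h" if "g \<in> G" "h \<in> G" for g h
    using bij that by (simp add: AutoGroup_def BijGroup_def)
  show ?thesis
  proof (unfold_locales, goal_cases)
    case 1 then show ?case by (rule assms(2))
  next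
    case (2 g) then show ?case using bij by blast
  next
    case (3 g)
    define g' where "g' = inv\<^bsub>AutoGroup \<Gamma>\<^esub> g"
    have g': "g' \<in> G" unfolding g'_def by (rule subgroup.m_inv_closed[OF assms(3) 3])
    have "g \<in> carrier (AutoGroup \<Gamma>)" using GA 3 by (auto simp: AutoGroup_def)
    then have "compose (carrier \<Gamma>) g' g = (\<lambda>x\<in>carrier \<Gamma>. x)" "compose (carrier \<Gamma>) g g' = (\<lambda>x\<in>carrier \<Gamma>. x)"
      using AG.l_inv[of g] AG.r_inv[of g] Bmul[OF g' 3] Bmul[OF 3 g']
      by (auto simp: g'_def AutoGroup_def BijGroup_def)
    then have "g' (g x) = x \<and> g (g' x) = x" if "x \<in> carrier \<Gamma>" for x
      using that by (metis compose_eq restrict_apply')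
    then show ?case using g' by blast
  next
    case (4 g h)
    have "compose (carrier \<Gamma>) g h \<in> G" using subgroup.m_closed[OF assms(3) 4] Bmul[OF 4] by simp
    then show ?case by (intro bexI[of _ "compose (carrier \<Gamma>) g h"]) (auto simp: compose_eq)
  next
    case 5 then show ?case using I.act_one assms(4) by blast
  next
    case (6 a) then show ?case using I.act_inner assms(4) by blast
  qed
qed

text \<open>All conditions are compared with the existence of a faithful character of
  \<open>MAG\<close>. By \<open>large_universe\<close> the type \<open>'h\<close> has at least the
  cardinality of the continuum, which leaves room for the GNS space of a countable group.\<close>

theorem theorem19:
  fixes \<Gamma> :: "('a, 'c) monoid_scheme" and G :: "('a \<Rightarrow> 'a) set"
  assumes "group \<Gamma>" and "countable (carrier \<Gamma>)"
    and "subgroup G (AutoGroup \<Gamma>)" and "inner_automorphisms \<Gamma> \<subseteq> G"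
    and large_universe: "\<exists>u :: real \<Rightarrow> 'h. inj u"
  shows
    "(\<exists>\<B> :: 'a set set. MAG_decomposition \<Gamma> G \<B> (\<lambda>B. B)) \<and>
     (\<forall>(I :: 'i set) B. MAG_decomposition \<Gamma> G I B \<longrightarrow>
        (has_G_faithful_irrep TYPE('h) G \<Gamma>
           \<longleftrightarrow> has_G_faithful_character G (\<Gamma>\<lparr>carrier := MA \<Gamma>\<rparr>)) \<and>
        (has_G_faithful_irrep TYPE('h) G \<Gamma>
           \<longleftrightarrow> has_G_faithful_character G (\<Gamma>\<lparr>carrier := MAG \<Gamma> G\<rparr>)) \<and>
        (has_G_faithful_irrep TYPE('h) G \<Gamma>
           \<longleftrightarrow> has_G_faithful_irrep TYPE('h) G (\<Gamma>\<lparr>carrier := MS \<Gamma>\<rparr>)) \<and>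
        (has_G_faithful_irrep TYPE('h) G \<Gamma>
           \<longleftrightarrow> has_G_faithful_irrep TYPE('h) G (\<Gamma>\<lparr>carrier := MSG \<Gamma> G\<rparr>)) \<and>
        (has_G_faithful_irrep TYPE('h) G \<Gamma>
           \<longleftrightarrow> (\<forall>E. finite E \<and> E \<subseteq> I \<longrightarrow>
                 (\<exists>x \<in> MAG_part \<Gamma> B E. generate \<Gamma> ((\<lambda>g. g x) ` G) = MAG_part \<Gamma> B E)))) \<and>
     (MAG \<Gamma> G = {\<one>\<^bsub>\<Gamma>\<^esub>} \<longrightarrow> has_G_faithful_irrep TYPE('h) G \<Gamma>) \<and>
     (MSG \<Gamma> G = {\<one>\<^bsub>\<Gamma>\<^esub>} \<longrightarrow> has_G_faithful_irrep TYPE('h) G \<Gamma>)"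
proof -
  interpret G_group \<Gamma> G by (rule G_group_of_automorphisms[OF assms(1-4)])
  obtain u :: "real \<Rightarrow> 'h" where u: "inj u" using large_universe by blast
  have MAG1: "MAG \<Gamma> G = {\<one>\<^bsub>\<Gamma>\<^esub>} \<Longrightarrow> has_G_faithful_irrep TYPE('h) G \<Gamma>"
  proof -
    assume "MAG \<Gamma> G = {\<one>\<^bsub>\<Gamma>\<^esub>}"
    moreover have "has_G_faithful_character G (\<Gamma>\<lparr>carrier := {\<one>\<^bsub>\<Gamma>\<^esub>}\<rparr>)"
      unfolding has_G_faithful_character_def unitary_character_def
    proof (intro exI[of _ "\<lambda>_. 1"] conjI)
      show "(\<lambda>_. 1) \<in> hom (\<Gamma>\<lparr>carrier := {\<one>\<^bsub>\<Gamma>\<^esub>}\<rparr>) circle_group"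
        by (rule homI) (simp_all add: circle_group_def)
      show "G_faithful G (\<Gamma>\<lparr>carrier := {\<one>\<^bsub>\<Gamma>\<^esub>}\<rparr>) circle_group (\<lambda>_. 1)"
        using act_one by (auto simp: G_faithful_def kernel_def circle_group_def)
    qed
    ultimately show ?thesis using irrep_iff_character[OF u] by simp
  qed
  have "MAG \<Gamma> G = {\<one>\<^bsub>\<Gamma>\<^esub>}" if "MSG \<Gamma> G = {\<one>\<^bsub>\<Gamma>\<^esub>}"
    using MAG_subset_MSG ginvD(4)[OF ginv_MAG] that by blast
  moreover have MSG: "has_G_faithful_irrep TYPE('h) G (\<Gamma>\<lparr>carrier := MSG \<Gamma> G\<rparr>)
      \<longleftrightarrow> has_G_faithful_character G (\<Gamma>\<lparr>carrier := MAG \<Gamma> G\<rparr>)"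
    by (rule irrep_subgroup_iff[OF u ginv_MSG MAG_subset_MSG])
  moreover have MS: "has_G_faithful_irrep TYPE('h) G (\<Gamma>\<lparr>carrier := MS \<Gamma>\<rparr>)
      \<longleftrightarrow> has_G_faithful_character G (\<Gamma>\<lparr>carrier := MAG \<Gamma> G\<rparr>)"
    by (rule irrep_subgroup_iff[OF u ginv_MS subset_trans[OF MAG_subset_MA MA_subset_MS]])
  moreover have MA: "has_G_faithful_character G (\<Gamma>\<lparr>carrier := MA \<Gamma>\<rparr>)
      \<longleftrightarrow> has_G_faithful_character G (\<Gamma>\<lparr>carrier := MAG \<Gamma> G\<rparr>)"
    by (rule character_subgroup_iff[OF ginv_MA MAG_subset_MA comm_group_MA])
  ultimately show ?thesis
    using MAG1 MAG_decomposition_exists by (simp add: irrep_iff_character[OF u] character_iff_cyclic)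
qed

end
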